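(* Let the standing assumptions and the objects $S_V$, $(K_n^V)_{n\in\mathbb N}$, $H_V$ be as in the context, and let $T>0$. For every $z\in S_V$ there exists a solution $Y=(Y_t)_{t\in[0,T]}$ (in the sense defined in the context, on the time interval $[0,T]$) of $$dY_t=\bigl(AY_t-\nabla V(Y_t)+B(Y_t)\bigr)\,dt+dW_t,\qquad Y_0=z,$$ on some filtered probability space $(\Omega',\mathcal F',P')$, and this solution is unique in law. Furthermore, with $\sigma_{H\setminus K_n^V}:=\inf\{t>0: Y_t\in H\setminus K_n^V\}$ ($\inf\emptyset=\infty$), $$P'\Bigl[\lim_{n\to\infty}\sigma_{H\setminus K_n^V}=\infty\Bigr]=1,$$ and if $z\in S_V\cap H_V$, then $$\int_0^T|\nabla V(Y_s)|^2\,ds<\infty\qquad P'\text{-a.s.}$$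
   Context: Let $H$ be a separable real Hilbert space with inner product $\langle\cdot,\cdot\rangle$ and norm $|\cdot|$. Standing assumptions. (1) $A:D(A)\subset H\to H$ is self-adjoint, $A\le-\omega I$ for some $\omega>0$, and $A^{-1}$ is trace class. $\gamma$ is the centered Gaussian measure on $H$ with covariance $Q=-\frac12A^{-1}$, and $(e_k)_{k\in\mathbb N}$ is an orthonormal basis of $H$ consisting of eigenvectors of $A$. $\mathcal FC_b^k(H)$ is the set of functions $\varphi(x)=\phi(\langle x,e_1\rangle,\dots,\langle x,e_n\rangle)$, $n\in\mathbb N$, $\phi\in C_b^k(\mathbb R^n)$. (2) $V:H\to(-\infty,+\infty]$ is convex, proper, lower semicontinuous and lower bounded. $D_V$ is the set of $x\in\{V<\infty\}$ at which $V$ is Gâteaux differentiable, with Gâteaux derivative $\nabla V(x)\in H$ ($\lim_{s\to0}\frac{V(x+sh)-V(x)}{s}=\langle\nabla V(x),h\rangle$ for all $h\in H$); $\nabla V$ is extended by $0$ to $H\setminus D_V$. $\nu(dx)=\frac1Ze^{-V(x)}\gamma(dx)$, $Z=\int_He^{-V}d\gamma$. (3) $\gamma(D_V)=1$ and for some $\varepsilon>0$, $\int_H(|V|^{2+\varepsilon}+|\nabla V|^2)\,d\gamma<\infty$. Moreover one of the following holds: (3a) $\int_H\|D^2V(x)\|_{\mathcal L(H)}\,\nu(dx)<\infty$, in the sense that there are $u_n\in\mathcal FC_b^2(H)$ with $V=\lim u_n$ in $L^2(H,\nu)$ and $D^2V:=\lim D^2u_n$ in $L^2(H,\nu;\mathcal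 L(H))$; or (3b) there is a separable Banach space $E\subset H$, continuously and densely embedded, with $E\subset D_V$, $\gamma(E)=1$, such that on $E$ the function $V$ is twice Gâteaux differentiable and for all $x\in E$ its second Gâteaux derivative $V_E''(x)\in \mathcal L(E,E')$ extends by continuity to an element of $\mathcal L(H,E')$ with $\|V_E''(x)\|_{\mathcal L(H,E')}\le\Psi(|x|_E)$ for some convex $\Psi:[0,\infty)\to[0,\infty)$; and for $\gamma$-a.e. $z\in E$ there is a (probabilistically) weak solution $X^V(t)$, $t\in[0,T]$, of the SDE below with $B=0$ and initial condition $z$ such that $\mathbb E\int_0^T\Psi(|X^V(s)|_E)\,ds<\infty$. (4) $B:H\to H$ is Borel measurable and bounded. Solution. A solution of $dX_t=(AX_t-\nabla V(X_t)+B(X_t))dt+dW_t$, $X_0=z$, consists of a filtered probability space $(\Omega,\mathcal F,(\mathcal F_t)_{t\ge0},P)$ with normal filtration, an $H$-cylindrical $(\mathcal F_t)$-Brownian motion $W$ on it, and a continuous $(\mathcal F_t)$-adapted $H$-valued process $X$ such that: (i) $X_s\in D_V$ for $dt\otimes P$-a.e. $(s,\omega)$ and $\int_0^T|\langle\nabla V(X_s),h\rangle|\,ds<\infty$ with probability one for every $T>0$, $h\in D(A)$; (ii) for every $h\in D(A)$, $t\ge0$, with probability one, $\langle X_t,h\rangle=\langle z,h\rangle+\int_0^t\bigl(\langle X_s,Ah\rangle+\langle B(X_s)-\nabla V(X_s),h\rangle\bigr)ds+\langle W_t,h\rangle$. Dirichlet form notions. $W^{1,2}(H,\nu)$ is the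 completion of $\mathcal FC_b^1(H)$ in the norm $(\int_H(|\varphi|^2+|D\varphi|^2)d\nu)^{1/2}$; $\mathcal E_\nu(u,v)=\int_H\langle Du,Dv\rangle d\nu$ on $D(\mathcal E_\nu)=W^{1,2}(H,\nu)$. An increasing sequence $(F_n)$ of closed subsets of $H$ is an $\mathcal E_\nu$-nest if $\bigcup_n\{u\in D(\mathcal E_\nu):u=0\ \nu\text{-a.e. on }H\setminus F_n\}$ is dense in $W^{1,2}(H,\nu)$; it is regular if $\nu(U\cap F_n)>0$ whenever $U$ is open and $U\cap F_n\ne\emptyset$. A set is $\mathcal E_\nu$-exceptional if it is contained in the complement $H\setminus\bigcup_nF_n$ of an $\mathcal E_\nu$-nest; Borel $\mathcal E_\nu$-exceptional sets are $\nu$-null. The objects $K_n^V$, $S_V$, $H_V$ (existence of the first two has been established beforehand; they are fixed). $(K_n^V)_n$ is a regular $\mathcal E_\nu$-nest consisting of compact sets such that $V|_{K_n^V}$ is real valued, continuous and bounded for each $n$. $S_V\subset H$ is a Borel set with $H\setminus S_V$ $\mathcal E_\nu$-exceptional (so $\gamma(S_V)=\nu(S_V)=1$) for which there is a conservative Markov process $(\Omega,\mathcal F,(\mathcal F_t)_{t\ge0},(X_t)_{t\ge0},(P_z)_{z\in S_V})$ with continuous paths in $H$ and invariant measure $\nu$, such that for every $z\in S_V$, $P_z$-a.s.: $X_t\in S_V$ for all $t\ge0$; $\int_H\mathbb E_{P_z}[\int_0^t|\nabla V(X_s)|^2ds]\,\nu(dz)<\infty$ and $\mathbb E_{P_z}[\int_0^t1_{H\setminus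 D_V}(X_s)ds]=0$ for all $t\ge0$; $\langle e_k,X_t\rangle=\langle e_k,z\rangle+\int_0^t(\langle Ae_k,X_s\rangle-\langle e_k,\nabla V(X_s)\rangle)ds+W_t^k$ for all $t\ge0,k\in\mathbb N$, with independent real Brownian motions $W^k$ (so under $P_z$, $X$ is a solution of the SDE with $B=0$ and initial condition $z$); and $P_z[\lim_n\sigma^X_{H\setminus K_n^V}=\infty]=1$, where $\sigma^X_{H\setminus K_n^V}=\inf\{t>0:X_t\in H\setminus K_n^V\}$. Finally $H_V:=\{z: \mathbb E_{P_z}[\int_0^T|\nabla V(X_s)|^2ds]<\infty\}$, which satisfies $\nu(H_V)=\gamma(H_V)=1$. *)

theory Defs
  imports "HOL-Probability.Probability"
begin

text \<open>
  The separable real Hilbert space \<open>H\<close> is a type of class \<open>{real_inner, polish_space}\<close>.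
  Unbounded operators are functions together with an explicit domain; their values
  outside the domain are irrelevant.
\<close>


section \<open>The operator and the Gaussian reference measure\<close>

text \<open>The second conjunct says that the graphs of \<open>A\<^sup>*\<close> and \<open>A\<close> coincide.\<close>

definition self_adjoint_on :: "'a::real_inner set \<Rightarrow> ('a \<Rightarrow> 'a) \<Rightarrow> bool" where
  "self_adjoint_on D A \<longleftrightarrow>
     subspace D \<and> closure D = UNIV \<and>
     (\<forall>x\<in>D. \<forall>y\<in>D. \<forall>c. A (x + c *\<^sub>R y) = A x + c *\<^sub>R A y) \<and>
     {(y, w). \<forall>x\<in>D. A x \<bullet> y = x \<bullet> w} = (\<lambda>y. (y, A y)) ` D"

text \<open>On a Hilbert space the nuclear operators are exactly the trace class operators.\<close>

definition trace_class :: "('a::{real_inner, complete_space} \<Rightarrow> 'a) \<Rightarrow> bool" where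
  "trace_class R \<longleftrightarrow> bounded_linear R \<and>
     (\<exists>a b :: nat \<Rightarrow> 'a. summable (\<lambda>k. norm (a k) * norm (b k)) \<and>
        (\<forall>x. (\<lambda>k. (a k \<bullet> x) *\<^sub>R b k) sums R x))"

definition eigenbasis :: "'a::real_inner set \<Rightarrow> ('a \<Rightarrow> 'a) \<Rightarrow> (nat \<Rightarrow> 'a) \<Rightarrow> bool" where
  "eigenbasis D A e \<longleftrightarrow>
     (\<forall>i j. e i \<bullet> e j = (if i = j then 1 else 0)) \<and>
     closure (span (range e)) = UNIV \<and>
     (\<forall>k. e k \<in> D \<and> (\<exists>l. A (e k) = l *\<^sub>R e k))"

definition covariance_op :: "'a::real_inner set \<Rightarrow> ('a \<Rightarrow> 'a) \<Rightarrow> 'a \<Rightarrow> 'a" where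
  "covariance_op D A x = - ((1/2) *\<^sub>R inv_into D A x)"

text \<open>The second disjunct is the degenerate Gaussian law, of variance 0.\<close>

definition centered_normal_law :: "real measure \<Rightarrow> bool" where
  "centered_normal_law \<mu> \<longleftrightarrow>
     (\<exists>\<sigma>>0. \<mu> = density lborel (\<lambda>x. ennreal (normal_density 0 \<sigma> x))) \<or> \<mu> = return borel 0"

definition centered_gaussian ::
    "('a::{real_inner, polish_space} \<Rightarrow> 'a) \<Rightarrow> 'a measure \<Rightarrow> bool" where
  "centered_gaussian Q \<gamma> \<longleftrightarrow>
     prob_space \<gamma> \<and> sets \<gamma> = sets borel \<and>
     (\<forall>h. centered_normal_law (distr \<gamma> borel (\<lambda>x. x \<bullet> h))) \<and>
     (\<forall>h k. integrable \<gamma> (\<lambda>x. (x \<bullet> h) * (x \<bullet> k)) \<and>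
            (LINT x|\<gamma>. (x \<bullet> h) * (x \<bullet> k)) = Q h \<bullet> k)"


section \<open>The potential\<close>

definition convex_potential :: "('a::real_inner \<Rightarrow> ereal) \<Rightarrow> bool" where
  "convex_potential V \<longleftrightarrow>
     (\<forall>x y. \<forall>t\<in>{0..1}.
        V ((1 - t) *\<^sub>R x + t *\<^sub>R y) \<le> ereal (1 - t) * V x + ereal t * V y) \<and>
     (\<exists>x. V x < \<infinity>) \<and>
     (\<forall>x. V x \<le> Liminf (at x) V) \<and>
     (\<exists>c::real. \<forall>x. ereal c \<le> V x)"

text \<open>
  The difference quotient is taken in the extended reals; if it converges to a real number
  then \<open>V (x + s h)\<close> is finite for all small \<open>s\<close>.
\<close>

definition has_gateaux_gradient :: "('a::real_inner \<Rightarrow> ereal) \<Rightarrow> 'a \<Rightarrow> 'a \<Rightarrow> bool" where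
  "has_gateaux_gradient V x g \<longleftrightarrow>
     (\<forall>h. ((\<lambda>s::real. (V (x + s *\<^sub>R h) - V x) / ereal s) \<longlongrightarrow> ereal (g \<bullet> h)) (at 0))"

definition diff_dom :: "('a::real_inner \<Rightarrow> ereal) \<Rightarrow> 'a set" where
  "diff_dom V = {x. V x < \<infinity> \<and> (\<exists>g. has_gateaux_gradient V x g)}"

definition gradV :: "('a::real_inner \<Rightarrow> ereal) \<Rightarrow> 'a \<Rightarrow> 'a" where
  "gradV V x = (if x \<in> diff_dom V then THE g. has_gateaux_gradient V x g else 0)"

definition exp_neg :: "('a \<Rightarrow> ereal) \<Rightarrow> 'a \<Rightarrow> ennreal" where
  "exp_neg V x = (if V x = \<infinity> then 0 else ennreal (exp (- real_of_ereal (V x))))"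

definition gibbs :: "'a measure \<Rightarrow> ('a \<Rightarrow> ereal) \<Rightarrow> 'a measure" where
  "gibbs \<gamma> V = density \<gamma> (\<lambda>x. exp_neg V x / (\<integral>\<^sup>+y. exp_neg V y \<partial>\<gamma>))"

text \<open>
  The function \<open>real_of_ereal\<close> sends \<open>\<infinity>\<close> to 0, which is harmless below: the set where
  \<open>V = \<infinity>\<close> is disjoint from \<open>diff_dom V\<close>, hence a null set.
\<close>

definition potential_integrable ::
    "'a::{real_inner, polish_space} measure \<Rightarrow> ('a \<Rightarrow> ereal) \<Rightarrow> bool" where
  "potential_integrable \<gamma> V \<longleftrightarrow>
     emeasure \<gamma> (diff_dom V) = 1 \<and>
     (\<exists>\<epsilon>>0. (\<integral>\<^sup>+x. ennreal (\<bar>real_of_ereal (V x)\<bar> powr (2 + \<epsilon>) + (norm (gradV V x))\<^sup>2) \<partial>\<gamma>) < \<infinity>)"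


section \<open>Cylindrical functions, Sobolev space and nests\<close>

text \<open>
  \<open>Cb n k \<phi>\<close> expresses \<open>\<phi> \<in> C\<^sub>b\<^sup>k(\<real>\<^sup>n)\<close>. A function on \<open>\<real>\<^sup>n\<close> is represented as a function
  on real sequences which depends on the first \<open>n\<close> entries only; for such functions
  continuity for the product topology is continuity on \<open>\<real>\<^sup>n\<close>. The function \<open>\<psi>\<close> is the
  \<open>i\<close>-th partial derivative.
\<close>

fun Cb :: "nat \<Rightarrow> nat \<Rightarrow> ((nat \<Rightarrow> real) \<Rightarrow> real) \<Rightarrow> bool" where
  "Cb n 0 \<phi> \<longleftrightarrow>
     (\<forall>\<xi> \<eta>. (\<forall>i<n. \<xi> i = \<eta> i) \<longrightarrow> \<phi> \<xi> = \<phi> \<eta>) \<and>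
     continuous_on UNIV \<phi> \<and> bounded (range \<phi>)"
| "Cb n (Suc k) \<phi> \<longleftrightarrow> Cb n 0 \<phi> \<and>
     (\<forall>i<n. \<exists>\<psi>. Cb n k \<psi> \<and>
        (\<forall>\<xi>. ((\<lambda>s. \<phi> (\<xi>(i := s))) has_real_derivative \<psi> \<xi>) (at (\<xi> i))))"

definition FCb :: "(nat \<Rightarrow> 'a::real_inner) \<Rightarrow> nat \<Rightarrow> ('a \<Rightarrow> real) set" where
  "FCb e k = {u. \<exists>n \<phi>. Cb n k \<phi> \<and> u = (\<lambda>x. \<phi> (\<lambda>i. x \<bullet> e i))}"

definition grad :: "('a::real_inner \<Rightarrow> real) \<Rightarrow> 'a \<Rightarrow> 'a" where
  "grad u x = (THE g. GDERIV u x :> g)"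

definition hess :: "('a::real_inner \<Rightarrow> real) \<Rightarrow> 'a \<Rightarrow> 'a \<Rightarrow>\<^sub>L 'a" where
  "hess u x = (THE L. (grad u has_derivative blinfun_apply L) (at x))"

definition L2_dist_sq ::
    "'a measure \<Rightarrow> ('a \<Rightarrow> 'b::real_normed_vector) \<Rightarrow> ('a \<Rightarrow> 'b) \<Rightarrow> ennreal" where
  "L2_dist_sq \<nu> f g = (\<integral>\<^sup>+x. ennreal ((norm (f x - g x))\<^sup>2) \<partial>\<nu>)"

text \<open>
  The completion of \<open>FC\<^sub>b\<^sup>1\<close> for the Sobolev norm, realised as the closure of the pairs
  \<open>(\<phi>, D\<phi>)\<close> in \<open>L\<^sup>2(\<nu>) \<times> L\<^sup>2(\<nu>; H)\<close>; an element is a pair \<open>(u, Du)\<close>.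
\<close>

definition W12 :: "(nat \<Rightarrow> 'a::{real_inner, polish_space}) \<Rightarrow> 'a measure
    \<Rightarrow> (('a \<Rightarrow> real) \<times> ('a \<Rightarrow> 'a)) set" where
  "W12 e \<nu> = {(u, g). u \<in> borel_measurable \<nu> \<and> g \<in> borel_measurable \<nu> \<and>
     (\<exists>\<phi>. (\<forall>n::nat. \<phi> n \<in> FCb e 1) \<and>
        (\<lambda>n. L2_dist_sq \<nu> (\<phi> n) u + L2_dist_sq \<nu> (grad (\<phi> n)) g) \<longlonglongrightarrow> 0)}"

definition nest :: "(nat \<Rightarrow> 'a::{real_inner, polish_space}) \<Rightarrow> 'a measure
    \<Rightarrow> (nat \<Rightarrow> 'a set) \<Rightarrow> bool" where
  "nest e \<nu> F \<longleftrightarrow> incseq F \<and> (\<forall>n. closed (F n)) \<and>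
     (\<forall>(u, g)\<in>W12 e \<nu>. \<forall>\<epsilon>>0. \<exists>(v, h)\<in>W12 e \<nu>.
        (\<exists>n. AE x in \<nu>. x \<notin> F n \<longrightarrow> v x = 0) \<and>
        L2_dist_sq \<nu> v u + L2_dist_sq \<nu> h g < \<epsilon>)"

definition regular_nest :: "(nat \<Rightarrow> 'a::{real_inner, polish_space}) \<Rightarrow> 'a measure
    \<Rightarrow> (nat \<Rightarrow> 'a set) \<Rightarrow> bool" where
  "regular_nest e \<nu> F \<longleftrightarrow> nest e \<nu> F \<and>
     (\<forall>n U. open U \<and> U \<inter> F n \<noteq> {} \<longrightarrow> emeasure \<nu> (U \<inter> F n) > 0)"

definition exceptional :: "(nat \<Rightarrow> 'a::{real_inner, polish_space}) \<Rightarrow> 'a measure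
    \<Rightarrow> 'a set \<Rightarrow> bool" where
  "exceptional e \<nu> N \<longleftrightarrow> (\<exists>F. nest e \<nu> F \<and> N \<subseteq> - (\<Union>n. F n))"


section \<open>Stochastic processes\<close>

text \<open>The time set \<open>I\<close> is \<open>{0..}\<close> or \<open>{0..T}\<close>.\<close>

definition filtration_on :: "real set \<Rightarrow> 'w measure \<Rightarrow> (real \<Rightarrow> 'w measure) \<Rightarrow> bool" where
  "filtration_on I M F \<longleftrightarrow>
     (\<forall>t\<in>I. subalgebra M (F t)) \<and> (\<forall>s\<in>I. \<forall>t\<in>I. s \<le> t \<longrightarrow> sets (F s) \<subseteq> sets (F t))"

definition normal_filtration :: "real set \<Rightarrow> 'w measure \<Rightarrow> (real \<Rightarrow> 'w measure) \<Rightarrow> bool" where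
  "normal_filtration I M F \<longleftrightarrow> filtration_on I M F \<and>
     null_sets M \<subseteq> sets (F 0) \<and>
     (\<forall>t\<in>I. (\<exists>s\<in>I. t < s) \<longrightarrow> sets (F t) = (\<Inter>s\<in>{s\<in>I. t < s}. sets (F s)))"

definition brownian_motion ::
    "real set \<Rightarrow> 'w measure \<Rightarrow> (real \<Rightarrow> 'w measure) \<Rightarrow> (real \<Rightarrow> 'w \<Rightarrow> real) \<Rightarrow> bool" where
  "brownian_motion I M F \<beta> \<longleftrightarrow>
     (\<forall>t\<in>I. \<beta> t \<in> borel_measurable (F t)) \<and>
     (AE \<omega> in M. \<beta> 0 \<omega> = 0) \<and>
     (AE \<omega> in M. continuous_on I (\<lambda>t. \<beta> t \<omega>)) \<and>
     (\<forall>s\<in>I. \<forall>t\<in>I. s < t \<longrightarrow>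
        distributed M lborel (\<lambda>\<omega>. \<beta> t \<omega> - \<beta> s \<omega>) (normal_density 0 (sqrt (t - s))) \<and>
        prob_space.indep_set M (sets (F s))
          (sets (vimage_algebra (space M) (\<lambda>\<omega>. \<beta> t \<omega> - \<beta> s \<omega>) borel)))"

text \<open>\<open>W t h\<close> is the real random variable \<open>\<langle>W\<^sub>t, h\<rangle>\<close>.\<close>

definition cylindrical_bm :: "real set \<Rightarrow> 'w measure \<Rightarrow> (real \<Rightarrow> 'w measure)
    \<Rightarrow> (real \<Rightarrow> 'a::real_inner \<Rightarrow> 'w \<Rightarrow> real) \<Rightarrow> bool" where
  "cylindrical_bm I M F W \<longleftrightarrow>
     (\<forall>h. norm h = 1 \<longrightarrow> brownian_motion I M F (\<lambda>t. W t h)) \<and>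
     (\<forall>t\<in>I. \<forall>h k a b. AE \<omega> in M. W t (a *\<^sub>R h + b *\<^sub>R k) \<omega> = a * W t h \<omega> + b * W t k \<omega>)"

text \<open>
  A solution on \<open>[0, T]\<close> of \<open>dX = (A X - \<nabla>V(X) + B(X)) dt + dW\<close>, \<open>X\<^sub>0 = z\<close>, where \<open>D\<close>
  is the domain of \<open>A\<close>.
\<close>

definition solution :: "real \<Rightarrow> 'a::{real_inner, polish_space} set \<Rightarrow> ('a \<Rightarrow> 'a) \<Rightarrow> ('a \<Rightarrow> ereal)
    \<Rightarrow> ('a \<Rightarrow> 'a) \<Rightarrow> 'a \<Rightarrow> 'w measure \<Rightarrow> (real \<Rightarrow> 'w measure) \<Rightarrow> (real \<Rightarrow> 'a \<Rightarrow> 'w \<Rightarrow> real)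
    \<Rightarrow> (real \<Rightarrow> 'w \<Rightarrow> 'a) \<Rightarrow> bool" where
  "solution T D A V B z M F W X \<longleftrightarrow>
     prob_space M \<and> normal_filtration {0..T} M F \<and> cylindrical_bm {0..T} M F W \<and>
     (\<forall>t\<in>{0..T}. X t \<in> borel_measurable (F t)) \<and>
     (\<forall>\<omega>\<in>space M. continuous_on {0..T} (\<lambda>t. X t \<omega>)) \<and>
     (AE \<omega> in M. X 0 \<omega> = z) \<and>
     (AE p in lborel \<Otimes>\<^sub>M M. fst p \<in> {0..T} \<longrightarrow> X (fst p) (snd p) \<in> diff_dom V) \<and>
     (\<forall>h\<in>D. AE \<omega> in M. (\<integral>\<^sup>+s\<in>{0..T}. ennreal \<bar>gradV V (X s \<omega>) \<bullet> h\<bar> \<partial>lborel) < \<infinity>) \<and>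
     (\<forall>h\<in>D. \<forall>t\<in>{0..T}. AE \<omega> in M.
        X t \<omega> \<bullet> h = z \<bullet> h
          + (LINT s:{0..t}|lborel. X s \<omega> \<bullet> A h + (B (X s \<omega>) - gradV V (X s \<omega>)) \<bullet> h)
          + W t h \<omega>)"

text \<open>
  The Borel sets of \<open>C([0,T]; H)\<close> are the traces of the product \<open>\<sigma>\<close>-algebra, so two
  continuous processes have the same law on \<open>C([0,T]; H)\<close> iff they have the same law
  on the product space.
\<close>

definition path_law :: "real \<Rightarrow> 'w measure \<Rightarrow> (real \<Rightarrow> 'w \<Rightarrow> 'a::topological_space)
    \<Rightarrow> (real \<Rightarrow> 'a) measure" where
  "path_law T M X =
     distr M (\<Pi>\<^sub>M t\<in>{0..T}. borel) (\<lambda>\<omega>. restrict (\<lambda>t. X t \<omega>) {0..T})"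

definition hitting_time :: "real set \<Rightarrow> 'a set \<Rightarrow> (real \<Rightarrow> 'a) \<Rightarrow> ereal" where
  "hitting_time I C x = Inf (ereal ` {t \<in> I. 0 < t \<and> x t \<in> C})"


section \<open>The two alternative regularity conditions on the second derivative\<close>

definition D2V_integrable :: "(nat \<Rightarrow> 'a::{real_inner, polish_space}) \<Rightarrow> 'a measure
    \<Rightarrow> ('a \<Rightarrow> ereal) \<Rightarrow> bool" where
  "D2V_integrable e \<nu> V \<longleftrightarrow>
     (\<exists>(u :: nat \<Rightarrow> 'a \<Rightarrow> real) (D2V :: 'a \<Rightarrow> 'a \<Rightarrow>\<^sub>L 'a).
        (\<forall>n. u n \<in> FCb e 2) \<and>
        (\<lambda>n. L2_dist_sq \<nu> (u n) (\<lambda>x. real_of_ereal (V x))) \<longlonglongrightarrow> 0 \<and>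
        D2V \<in> borel_measurable \<nu> \<and>
        (\<lambda>n. L2_dist_sq \<nu> (hess (u n)) D2V) \<longlonglongrightarrow> 0 \<and>
        (\<integral>\<^sup>+x. ennreal (norm (D2V x)) \<partial>\<nu>) < \<infinity>)"

definition has_gateaux_derivative :: "('b::real_normed_vector \<Rightarrow> 'c::real_normed_vector)
    \<Rightarrow> 'b \<Rightarrow> ('b \<Rightarrow>\<^sub>L 'c) \<Rightarrow> bool" where
  "has_gateaux_derivative f x L \<longleftrightarrow>
     (\<forall>h. ((\<lambda>s::real. (f (x + s *\<^sub>R h) - f x) /\<^sub>R s) \<longlongrightarrow> blinfun_apply L h) (at 0))"

text \<open>
  The Banach space \<open>E \<subset> H\<close> is a type together with its embedding \<open>j\<close> into \<open>H\<close>. The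
  norm \<open>|x|\<^sub>E\<close> is infinite for \<open>x \<notin> E\<close>, so finiteness of the expectation of
  \<open>\<integral> \<Psi>(|X\<^sub>s|\<^sub>E) ds\<close> includes that \<open>X\<^sub>s \<in> E\<close> for almost every \<open>(s, \<omega>)\<close>. The type
  argument is the type of the sample points of the weak solutions.
\<close>

definition E_regular :: "'v itself \<Rightarrow> ('e::{banach, second_countable_topology}
      \<Rightarrow> 'a::{real_inner, polish_space})
    \<Rightarrow> real \<Rightarrow> 'a set \<Rightarrow> ('a \<Rightarrow> 'a) \<Rightarrow> 'a measure \<Rightarrow> ('a \<Rightarrow> ereal) \<Rightarrow> bool" where
  "E_regular (_ :: 'v itself) j T D A \<gamma> V \<longleftrightarrow>
     bounded_linear j \<and> inj j \<and> closure (range j) = UNIV \<and>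
     range j \<subseteq> diff_dom V \<and> emeasure \<gamma> (range j) = 1 \<and>
     (\<exists>(V1 :: 'e \<Rightarrow> 'e \<Rightarrow>\<^sub>L real) (V2 :: 'e \<Rightarrow> 'e \<Rightarrow>\<^sub>L 'e \<Rightarrow>\<^sub>L real) (\<Psi> :: real \<Rightarrow> real).
        convex_on {0..} \<Psi> \<and> (\<forall>r\<ge>0. 0 \<le> \<Psi> r) \<and>
        (\<forall>x. has_gateaux_derivative (\<lambda>y. real_of_ereal (V (j y))) x (V1 x) \<and>
             has_gateaux_derivative V1 x (V2 x) \<and>
             (\<exists>L :: 'a \<Rightarrow>\<^sub>L 'e \<Rightarrow>\<^sub>L real.
                (\<forall>h. blinfun_apply L (j h) = blinfun_apply (V2 x) h) \<and>
                norm L \<le> \<Psi> (norm x))) \<and>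
        (AE z in \<gamma>. z \<in> range j \<longrightarrow>
           (\<exists>(M :: 'v measure) F W X.
              solution T D A V (\<lambda>_. 0) z M F W X \<and>
              (AE p in lborel \<Otimes>\<^sub>M M. fst p \<in> {0..T} \<longrightarrow> X (fst p) (snd p) \<in> range j) \<and>
              (\<integral>\<^sup>+\<omega>. (\<integral>\<^sup>+s\<in>{0..T}. ennreal (\<Psi> (norm (inv j (X s \<omega>)))) \<partial>lborel) \<partial>M) < \<infinity>)))"


section \<open>The Markov process associated with the equation without perturbation\<close>

definition compact_nest :: "(nat \<Rightarrow> 'a::{real_inner, polish_space}) \<Rightarrow> 'a measure
    \<Rightarrow> ('a \<Rightarrow> ereal) \<Rightarrow> (nat \<Rightarrow> 'a set) \<Rightarrow> bool" where
  "compact_nest e \<nu> V K \<longleftrightarrow> regular_nest e \<nu> K \<and>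
     (\<forall>n. compact (K n) \<and> (\<forall>x\<in>K n. \<bar>V x\<bar> \<noteq> \<infinity>) \<and> continuous_on (K n) V \<and>
          bounded ((\<lambda>x. real_of_ereal (V x)) ` K n))"

text \<open>
  \<open>N\<close> carries the \<open>\<sigma>\<close>-algebra common to all \<open>P z\<close>; its measure is irrelevant. The process
  is conservative because it takes values in \<open>H\<close> for all times.
\<close>

definition markov_process :: "'a::{real_inner, polish_space} set \<Rightarrow> 'w measure
    \<Rightarrow> (real \<Rightarrow> 'w measure) \<Rightarrow> (real \<Rightarrow> 'w \<Rightarrow> 'a) \<Rightarrow> ('a \<Rightarrow> 'w measure) \<Rightarrow> bool" where
  "markov_process S N F X P \<longleftrightarrow>
     filtration_on {0..} N F \<and>
     (\<forall>t\<ge>0. X t \<in> borel_measurable (F t)) \<and>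
     (\<forall>\<omega>\<in>space N. continuous_on {0..} (\<lambda>t. X t \<omega>)) \<and>
     (\<forall>z\<in>S. prob_space (P z) \<and> sets (P z) = sets N \<and>
        (AE \<omega> in P z. X 0 \<omega> = z) \<and>
        (AE \<omega> in P z. \<forall>t\<ge>0. X t \<omega> \<in> S)) \<and>
     (\<forall>\<Gamma>\<in>sigma_sets (space N) {X t -` C \<inter> space N | t C. 0 \<le> t \<and> C \<in> sets borel}.
        (\<lambda>z. emeasure (P z) \<Gamma>) \<in> borel_measurable (restrict_space borel S)) \<and>
     (\<forall>z\<in>S. \<forall>s\<ge>0. \<forall>t\<ge>0. \<forall>C\<in>sets borel.
        AE \<omega> in P z. real_cond_exp (P z) (F s) (indicator (X (s + t) -` C \<inter> space N)) \<omega>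
          = measure (P (X s \<omega>)) (X t -` C \<inter> space N))"

definition invariant_measure :: "'a::{real_inner, polish_space} set \<Rightarrow> 'w measure
    \<Rightarrow> (real \<Rightarrow> 'w \<Rightarrow> 'a) \<Rightarrow> ('a \<Rightarrow> 'w measure) \<Rightarrow> 'a measure \<Rightarrow> bool" where
  "invariant_measure S N X P \<nu> \<longleftrightarrow>
     (\<forall>t\<ge>0. \<forall>C\<in>sets borel.
        (\<integral>\<^sup>+z\<in>S. emeasure (P z) (X t -` C \<inter> space N) \<partial>\<nu>) = emeasure \<nu> C)"

definition energy :: "('a::{real_inner, polish_space} \<Rightarrow> ereal) \<Rightarrow> (real \<Rightarrow> 'w \<Rightarrow> 'a)
    \<Rightarrow> ('a \<Rightarrow> 'w measure) \<Rightarrow> real \<Rightarrow> 'a \<Rightarrow> ennreal" where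
  "energy V X P t z =
     (\<integral>\<^sup>+\<omega>. (\<integral>\<^sup>+s\<in>{0..t}. ennreal ((norm (gradV V (X s \<omega>)))\<^sup>2) \<partial>lborel) \<partial>P z)"

text \<open>The Brownian motions are allowed to depend on the starting point.\<close>

definition solves_componentwise :: "('a::{real_inner, polish_space} \<Rightarrow> 'a) \<Rightarrow> (nat \<Rightarrow> 'a)
    \<Rightarrow> ('a \<Rightarrow> ereal) \<Rightarrow> (real \<Rightarrow> 'w measure) \<Rightarrow> (real \<Rightarrow> 'w \<Rightarrow> 'a) \<Rightarrow> 'w measure \<Rightarrow> 'a \<Rightarrow> bool" where
  "solves_componentwise A e V F X M z \<longleftrightarrow>
     (\<exists>W :: nat \<Rightarrow> real \<Rightarrow> 'w \<Rightarrow> real.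
        (\<forall>k. brownian_motion {0..} M F (W k)) \<and>
        prob_space.indep_vars M (\<lambda>_. \<Pi>\<^sub>M t\<in>{0..}. borel)
          (\<lambda>k \<omega>. restrict (\<lambda>t. W k t \<omega>) {0..}) UNIV \<and>
        (AE \<omega> in M. \<forall>t\<ge>0. \<forall>k.
           set_integrable lborel {0..t} (\<lambda>s. A (e k) \<bullet> X s \<omega> - e k \<bullet> gradV V (X s \<omega>)) \<and>
           e k \<bullet> X t \<omega> = e k \<bullet> z
             + (LINT s:{0..t}|lborel. A (e k) \<bullet> X s \<omega> - e k \<bullet> gradV V (X s \<omega>))
             + W k t \<omega>))"

text \<open>
  The integrability condition for all \<open>h\<close> in the domain \<open>D\<close> of \<open>A\<close> is the one required of a
  solution of the equation with \<open>B = 0\<close>.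
\<close>

definition associated_process :: "'a::{real_inner, polish_space} set \<Rightarrow> ('a \<Rightarrow> 'a) \<Rightarrow> (nat \<Rightarrow> 'a)
    \<Rightarrow> 'a measure \<Rightarrow> ('a \<Rightarrow> ereal) \<Rightarrow> (nat \<Rightarrow> 'a set) \<Rightarrow> 'a set \<Rightarrow> 'w measure
    \<Rightarrow> (real \<Rightarrow> 'w measure) \<Rightarrow> (real \<Rightarrow> 'w \<Rightarrow> 'a) \<Rightarrow> ('a \<Rightarrow> 'w measure) \<Rightarrow> bool" where
  "associated_process D A e \<nu> V K S N F X P \<longleftrightarrow>
     S \<in> sets borel \<and> exceptional e \<nu> (- S) \<and>
     markov_process S N F X P \<and> invariant_measure S N X P \<nu> \<and>
     (\<forall>t\<ge>0. (\<integral>\<^sup>+z\<in>S. energy V X P t z \<partial>\<nu>) < \<infinity>) \<and>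
     (\<forall>z\<in>S.
        (\<forall>t\<ge>0. (\<integral>\<^sup>+\<omega>. (\<integral>\<^sup>+s\<in>{0..t}. indicator (- diff_dom V) (X s \<omega>) \<partial>lborel) \<partial>P z) = 0) \<and>
        solves_componentwise A e V F X (P z) z \<and>
        (\<forall>h\<in>D. \<forall>t\<ge>0. AE \<omega> in P z.
           (\<integral>\<^sup>+s\<in>{0..t}. ennreal \<bar>gradV V (X s \<omega>) \<bullet> h\<bar> \<partial>lborel) < \<infinity>) \<and>
        (AE \<omega> in P z. (\<lambda>n. hitting_time {0..} (- K n) (\<lambda>t. X t \<omega>)) \<longlonglongrightarrow> \<infinity>))"

definition HV :: "('a::{real_inner, polish_space} \<Rightarrow> ereal) \<Rightarrow> 'a set \<Rightarrow> (real \<Rightarrow> 'w \<Rightarrow> 'a)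
    \<Rightarrow> ('a \<Rightarrow> 'w measure) \<Rightarrow> real \<Rightarrow> 'a set" where
  "HV V S X P T = {z\<in>S. energy V X P T z < \<infinity>}"

end

theory Submission
  imports Defs
begin

text \<open>
  If \<open>V\<close> is Gateaux differentiable at one point, then by Baire's theorem \<open>V\<close> is bounded on some ball, so
  \<open>\<nabla>V\<close> is coercive relative to the centre of that ball and \<open>\<integral>|\<nabla>V(X)|ds\<close> is finite along every path for
  which all \<open>\<integral>|\<langle>\<nabla>V(X),e\<^sub>k\<rangle>|ds\<close> are. Hence the equation with \<open>B = 0\<close> has pathwise at most one solution, by
  monotonicity of \<open>\<nabla>V\<close>: a path is an injective Borel function of its noise. The bounded drift \<open>B(Y)\<close> is
  added and removed by a change of measure whose density is a limit of exponential densities of finitely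
  valued dyadic step processes, so no stochastic integral is needed. For existence, \<open>B\<close> is added to the
  given process. For uniqueness, \<open>B\<close> is removed from two solutions, with the same step approximation of
  \<open>B\<close> for both; their noises then have the same law, hence so do the paths since they are injective
  functions of the noise, and the two densities are the same function of the path.
\<close>

section \<open>Integrals and laws\<close>

text \<open>Brownian motion enters through exponential moments: \<open>bm_system\<close> prescribes
  the mean of \<open>exp (\<Sum>k<n. v k * (w k t om - w k s om))\<close> on every event of
  \<open>F s\<close>. Such identities pass to limits, transform explicitly under step densities and
  survive augmentation of the filtration. The step densities are compared through their square
  roots, because the geometric mean of two of them is again such a density up to an explicit factor.
  Computations take place at the dyadic times T j / 2^N; continuity of paths supplies the other
  times.

  In place of a strong solution, uniqueness compares laws: two laws carried by a set on which the
  noise map is injective coincide if their images do. Inner regularity on the graph reduces this to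
  compact sets, so the inverse of the noise map never appears.

  Existence has to bridge gaps in the given process. Its coordinate noises are separately Brownian
  for the filtration and independent of one another, but their joint independence of the past has to
  be derived; the filtration has to be made normal; and the noise has to be defined in every
  direction h, not just along the eigenvectors.\<close>

lemma nn_integral_tendsto_of_L2_bounded:
 fixes f :: "nat \<Rightarrow> 'w \<Rightarrow> real"
 assumes M: "prob_space M"
  and f[measurable]: "\<And>n. f n \<in> borel_measurable M" and g[measurable]: "g \<in> borel_measurable M"
  and nonneg: "\<And>n om. 0 \<le> f n om"
  and L2: "\<And>n. (\<integral>\<^sup>+om. ennreal ((f n om)\<^sup>2) \<partial>M) \<le> ennreal K"
  and lim: "AE om in M. (\<lambda>n. f n om) \<longlonglongrightarrow> g om"
 shows "(\<lambda>n. \<integral>\<^sup>+om. ennreal (f n om) \<partial>M) \<longlonglongrightarrow> (\<integral>\<^sup>+om. ennreal (g om) \<partial>M)"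
proof -
 interpret prob_space M by fact
 define J where "J = (\<integral>\<^sup>+om. ennreal (g om) \<partial>M)"
 define I where "I n = (\<integral>\<^sup>+om. ennreal (f n om) \<partial>M)" for n
 have gl: "AE om in M. liminf (\<lambda>n. ennreal (f n om)) = ennreal (g om)"
  using lim
 proof eventually_elim
  case (elim om)
  then have "(\<lambda>n. ennreal (f n om)) \<longlonglongrightarrow> ennreal (g om)" by (rule tendsto_ennrealI)
  then show ?case by (intro lim_imp_Liminf) auto
 qed
 have "J = (\<integral>\<^sup>+om. liminf (\<lambda>n. ennreal (f n om)) \<partial>M)"
  unfolding J_def by (rule nn_integral_cong_AE) (use gl in auto)
 also have "... \<le> liminf I"
  unfolding I_def by (rule nn_integral_liminf) auto
 finally have lo: "J \<le> liminf I" .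
 have up: "limsup I \<le> J + ennreal e" if "e > 0" for e
 proof -
  \<comment> \<open>Truncation level: x \<le> min x c + x^2 / c for x \<ge> 0, so cutting
    \<open>f n\<close> at \<open>c\<close> loses at most K / c \<le> e in the integral, uniformly in
    n. The truncated functions converge by dominated convergence; the lower bound is Fatou's
    lemma.\<close>
  define c where "c = max 1 (\<bar>K\<bar> / e)"
  have c: "c > 0" "K / c \<le> e" using that
   by (auto simp: c_def field_simps max_def)
  have 1: "I n \<le> (\<integral>\<^sup>+om. ennreal (min (f n om) c) \<partial>M) + ennreal e" for n
  proof -
   have "f n om \<le> min (f n om) c + (f n om)\<^sup>2 / c" for om
    using c nonneg[of n om] zero_le_power2[of "f n om - c"] by (auto simp: min_def field_simps power2_eq_square intro: add_increasing mult_right_mono)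
   then have "I n \<le> (\<integral>\<^sup>+om. ennreal (min (f n om) c) + ennreal (1/c) * ennreal ((f n om)\<^sup>2) \<partial>M)"
    unfolding I_def using c nonneg
    by (intro nn_integral_mono) (auto simp: ennreal_plus[symmetric] ennreal_mult[symmetric] simp del: ennreal_plus intro!: ennreal_leI)
   also have "... = (\<integral>\<^sup>+om. ennreal (min (f n om) c) \<partial>M) + ennreal (1/c) * (\<integral>\<^sup>+om. ennreal ((f n om)\<^sup>2) \<partial>M)"
    by (subst nn_integral_add) (auto simp: nn_integral_cmult)
   also have "... \<le> (\<integral>\<^sup>+om. ennreal (min (f n om) c) \<partial>M) + ennreal (1/c) * ennreal K"
    by (intro add_left_mono mult_left_mono L2) auto
   also have "ennreal (1/c) * ennreal K \<le> ennreal e"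
   proof (cases "K \<ge> 0")
    case True then show ?thesis using c by (auto simp: ennreal_mult[symmetric] intro!: ennreal_leI)
   next
    case False then show ?thesis by (simp add: ennreal_neg)
   qed
   finally show ?thesis by (simp add: add_left_mono)
  qed
  have "(\<lambda>n. \<integral>\<^sup>+om. ennreal (min (f n om) c) \<partial>M) \<longlonglongrightarrow> (\<integral>\<^sup>+om. ennreal (min (g om) c) \<partial>M)"
  proof (rule nn_integral_dominated_convergence[where w="\<lambda>_. ennreal c"])
   show "AE om in M. (\<lambda>n. ennreal (min (f n om) c)) \<longlonglongrightarrow> ennreal (min (g om) c)"
    using lim by eventually_elim (intro tendsto_ennrealI tendsto_min tendsto_const)
  qed (auto simp: emeasure_space_1 intro!: ennreal_leI)
  then have 2: "(\<lambda>n. (\<integral>\<^sup>+om. ennreal (min (f n om) c) \<partial>M) + ennreal e) \<longlonglongrightarrow> (\<integral>\<^sup>+om. ennreal (min (g om) c) \<partial>M) + ennreal e"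
   by (intro tendsto_add tendsto_const)
  have "limsup I \<le> limsup (\<lambda>n. (\<integral>\<^sup>+om. ennreal (min (f n om) c) \<partial>M) + ennreal e)"
   by (intro Limsup_mono always_eventually allI 1)
  also have "... = (\<integral>\<^sup>+om. ennreal (min (g om) c) \<partial>M) + ennreal e"
   using 2 by (intro lim_imp_Limsup) auto
  also have "... \<le> J + ennreal e"
   unfolding J_def by (intro add_right_mono nn_integral_mono) (auto intro!: ennreal_leI)
  finally show ?thesis .
 qed
 have "limsup I \<le> J" by (rule ennreal_le_epsilon) (use up in auto)
 moreover have "liminf I \<le> limsup I" by (intro Liminf_le_Limsup) auto
 ultimately have "liminf I = J \<and> limsup I = J" using lo by (metis order.antisym order.trans)
 then show ?thesis unfolding I_def[symmetric] J_def[symmetric]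
  by (subst tendsto_iff_Liminf_eq_Limsup) auto
qed

text \<open>The hypothesis \<open>base\<close> says that \<open>Z\<close> has the constant
  conditional expectation \<open>c\<close> given \<open>G\<close>. Monotone approximation carries
  this from indicators to all nonnegative factors known to \<open>G\<close>.\<close>

lemma nn_integral_subalgebra_mult:
 fixes Z :: "'w \<Rightarrow> ennreal"
 assumes sub: "subalgebra M G" and Z[measurable]: "Z \<in> borel_measurable M"
  and base: "\<And>A. A \<in> sets G \<Longrightarrow> (\<integral>\<^sup>+om. indicator A om * Z om \<partial>M) = emeasure M A * c"
  and xi: "xi \<in> borel_measurable G"
 shows "(\<integral>\<^sup>+om. xi om * Z om \<partial>M) = (\<integral>\<^sup>+om. xi om \<partial>M) * (c::ennreal)"
 using xi
proof (induction rule: borel_measurable_induct)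
 case (cong f g)
 have "space M = space G" using sub by (simp add: subalgebra_def)
 then have e: "(\<integral>\<^sup>+om. f om * Z om \<partial>M) = (\<integral>\<^sup>+om. g om * Z om \<partial>M)" "(\<integral>\<^sup>+om. f om \<partial>M) = (\<integral>\<^sup>+om. g om \<partial>M)"
  using cong(3) by (auto intro: nn_integral_cong)
 show ?case unfolding e by (rule cong)
next
 case (set A)
 then have "A \<in> sets M" using sub by (auto simp: subalgebra_def)
 then show ?case using base[OF set] by simp
next
 case (mult u k)
 have [measurable]: "u \<in> borel_measurable M" using mult measurable_from_subalg[OF sub] by blast
 show ?case using mult by (simp add: nn_integral_cmult mult.assoc)
next
 case (add u v)
 have [measurable]: "u \<in> borel_measurable M" "v \<in> borel_measurable M" using add measurable_from_subalg[OF sub] by blast+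
 show ?case using add by (simp add: nn_integral_add distrib_right)
next
 case (seq U)
 have [measurable]: "U i \<in> borel_measurable M" for i using seq measurable_from_subalg[OF sub] by blast
 have inc: "incseq (\<lambda>i om. U i om * Z om)"
  using seq(3) by (auto simp: incseq_def le_fun_def intro!: mult_right_mono)
 have "(\<integral>\<^sup>+om. (SUP i. U i) om * Z om \<partial>M) = (\<integral>\<^sup>+om. (SUP i. U i om * Z om) \<partial>M)"
  by (auto intro!: nn_integral_cong simp: SUP_apply SUP_mult_right_ennreal image_comp)
 also have "... = (SUP i. \<integral>\<^sup>+om. U i om * Z om \<partial>M)"
  by (rule nn_integral_monotone_convergence_SUP[OF inc]) auto
 also have "... = (SUP i. (\<integral>\<^sup>+om. U i om \<partial>M)) * c" using seq by (simp add: SUP_mult_right_ennreal image_comp)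
 also have "(SUP i. (\<integral>\<^sup>+om. U i om \<partial>M)) = (\<integral>\<^sup>+om. (SUP i. U i om) \<partial>M)"
  by (rule nn_integral_monotone_convergence_SUP[symmetric]) (use seq in auto)
 finally show ?case by (simp add: SUP_apply image_comp)
qed

text \<open>Inner regularity of the law of (x, \<Psi> x) on the graph yields a compact part of the
  graph over \<open>C\<close> for one measure and over the complement of \<open>C\<close> for the
  other. Their second projections are compact, hence Borel, and injectivity makes them disjoint. The
  common image law therefore separates \<open>C\<close> from its complement up to an arbitrarily
  small error.\<close>

lemma prob_eqI_of_injective_image:
 fixes L1 L2 :: "'x::polish_space measure" and \<Psi> :: "'x \<Rightarrow> 'y::polish_space"
 assumes L: "prob_space L1" "prob_space L2" "sets L1 = sets borel" "sets L2 = sets borel"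
  and \<Psi>[measurable]: "\<Psi> \<in> borel_measurable borel"
  and G[measurable]: "G \<in> sets borel" and inj: "inj_on \<Psi> G"
  and full: "AE x in L1. x \<in> G" "AE x in L2. x \<in> G"
  and eq: "distr L1 borel \<Psi> = distr L2 borel \<Psi>"
 shows "L1 = L2"
proof -
 have main: "emeasure La C \<le> emeasure Lb C + ennreal (2 * eps)"
  if L: "prob_space La" "prob_space Lb" "sets La = sets borel" "sets Lb = sets borel"
  and full: "AE x in La. x \<in> G" "AE x in Lb. x \<in> G"
  and eq: "distr La borel \<Psi> = distr Lb borel \<Psi>"
  and C[measurable]: "C \<in> sets borel" and eps: "eps > 0" for La Lb :: "'x measure" and C and eps :: real
 proof -
  interpret a: prob_space La by fact
  interpret b: prob_space Lb by fact
  note [measurable_cong] = L(3,4)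
  let ?gr = "\<lambda>x. (x, \<Psi> x)"
  have gr[measurable]: "?gr \<in> borel_measurable borel" by (simp add: borel_prod[symmetric])
  have spc: "space La = UNIV" "space Lb = UNIV" using sets_eq_imp_space_eq[OF L(3)] sets_eq_imp_space_eq[OF L(4)] by simp_all
  have ex: "\<exists>K. compact K \<and> K \<subseteq> {p. fst p \<in> D \<inter> G \<and> snd p = \<Psi> (fst p)}
    \<and> emeasure Lc D \<le> emeasure (distr Lc borel ?gr) K + ennreal eps"
   if D[measurable]: "D \<in> sets borel" and Lc: "prob_space Lc" "sets Lc = sets borel" "AE x in Lc. x \<in> G" for D and Lc :: "'x measure"
  proof -
   interpret c: prob_space Lc by fact
   note [measurable_cong] = Lc(2)
   define E where "E = {p::'x\<times>'y. fst p \<in> D \<inter> G \<and> snd p = \<Psi> (fst p)}"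
   have E[measurable]: "E \<in> sets borel"
   proof -
    have "{p \<in> space (borel \<Otimes>\<^sub>M borel). fst p \<in> D \<inter> G \<and> dist (snd p) (\<Psi> (fst p)) = 0} \<in> sets (borel \<Otimes>\<^sub>M borel)"
     by measurable
    then show ?thesis unfolding borel_prod by (simp add: E_def)
   qed
   have gm: "?gr \<in> measurable Lc borel" using gr by (simp add: measurable_cong_sets[OF Lc(2) refl])
   interpret d: prob_space "distr Lc borel ?gr" by (rule c.prob_space_distr) (fact gm)
   have spLc: "space Lc = UNIV" using sets_eq_imp_space_eq[OF Lc(2)] by simp
   have "emeasure (distr Lc borel ?gr) E = emeasure Lc (D \<inter> G)"
   proof -
    have "?gr -` E \<inter> space Lc = D \<inter> G" unfolding spLc E_def by fastforce
    then show ?thesis by (simp only: emeasure_distr[OF gm E])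
   qed
   also have "... = emeasure Lc D"
    by (rule emeasure_eq_AE) (use Lc D G in auto)
   finally have e: "emeasure (distr Lc borel ?gr) E = emeasure Lc D" .
   have reg: "emeasure (distr Lc borel ?gr) E = (SUP K \<in> {K. K \<subseteq> E \<and> compact K}. emeasure (distr Lc borel ?gr) K)"
    by (rule inner_regular) (use E in \<open>auto simp: d.emeasure_space_1\<close>)
   show ?thesis
   proof (rule ccontr)
    assume "\<not> ?thesis"
    then have *: "emeasure (distr Lc borel ?gr) K + ennreal eps \<le> emeasure Lc D" if "K \<subseteq> E" "compact K" for K
     using that unfolding E_def[symmetric] by (meson linear)
    have "(SUP K \<in> {K. K \<subseteq> E \<and> compact K}. emeasure (distr Lc borel ?gr) K) + ennreal eps \<le> emeasure Lc D"
     by (subst ennreal_SUP_add_left[symmetric]) (auto intro!: SUP_least * exI[of _ "{}"])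
    then have "emeasure Lc D + ennreal eps \<le> emeasure Lc D" using reg e by simp
    then have "ennreal (measure Lc D + eps) \<le> ennreal (measure Lc D)"
     using eps by (simp add: c.emeasure_eq_measure)
    then show False using eps by (simp add: ennreal_le_iff)
   qed
  qed
  obtain K1 where K1: "compact K1" "K1 \<subseteq> {p. fst p \<in> C \<inter> G \<and> snd p = \<Psi> (fst p)}"
   "emeasure La C \<le> emeasure (distr La borel ?gr) K1 + ennreal eps" using ex[OF C L(1,3) full(1)] by auto
  have nC: "- C \<in> sets borel" by auto
  obtain K2 where K2: "compact K2" "K2 \<subseteq> {p. fst p \<in> - C \<inter> G \<and> snd p = \<Psi> (fst p)}"
   "emeasure Lb (- C) \<le> emeasure (distr Lb borel ?gr) K2 + ennreal eps" using ex[OF nC L(2,4) full(2)] by auto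
  let ?S1 = "snd ` K1" and ?S2 = "snd ` K2"
  have [measurable]: "?S1 \<in> sets borel" "?S2 \<in> sets borel"
   using K1 K2 by (auto intro!: borel_closed compact_imp_closed compact_continuous_image continuous_intros)
  have disj: "?S1 \<inter> ?S2 = {}"
  proof (rule ccontr)
   assume "?S1 \<inter> ?S2 \<noteq> {}"
   then obtain p q where "p \<in> K1" "q \<in> K2" "snd p = snd q" by blast
   then have "fst p \<in> C \<inter> G" "fst q \<in> -C \<inter> G" "\<Psi> (fst p) = \<Psi> (fst q)" using K1 K2 by force+
   then show False using inj by (auto dest: inj_onD)
  qed
  have kk[measurable]: "K1 \<in> sets borel" "K2 \<in> sets borel" using K1 K2 by (auto intro: borel_closed compact_imp_closed)
  have P1[measurable]: "\<Psi> -` ?S1 \<in> sets borel" "\<Psi> -` ?S2 \<in> sets borel" by (auto intro!: measurable_sets_borel[OF \<Psi>])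
  have bm: "emeasure Lb (- C) \<le> emeasure Lb (- C \<inter> \<Psi> -` ?S2) + ennreal eps"
  proof -
   have "emeasure (distr Lb borel ?gr) K2 \<le> emeasure Lb (- C \<inter> \<Psi> -` ?S2)"
   proof -
    have "?gr -` K2 \<inter> space Lb \<subseteq> - C \<inter> \<Psi> -` ?S2" using K2(2) by force
    moreover have "- C \<inter> \<Psi> -` ?S2 \<in> sets Lb" using P1 by (auto simp: L)
    ultimately show ?thesis using gr by (simp only: emeasure_distr[OF _ kk(2)] measurable_cong_sets[OF L(4) refl] emeasure_mono)
   qed
   then show ?thesis using K2(3) by (meson add_right_mono order_trans)
  qed
  have am: "emeasure La C \<le> emeasure La (C \<inter> \<Psi> -` ?S1) + ennreal eps"
  proof -
   have "emeasure (distr La borel ?gr) K1 \<le> emeasure La (C \<inter> \<Psi> -` ?S1)"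
   proof -
    have "?gr -` K1 \<inter> space La \<subseteq> C \<inter> \<Psi> -` ?S1" using K1(2) by force
    moreover have "C \<inter> \<Psi> -` ?S1 \<in> sets La" using P1 by (auto simp: L)
    ultimately show ?thesis using gr by (simp only: emeasure_distr[OF _ kk(1)] measurable_cong_sets[OF L(3) refl] emeasure_mono)
   qed
   then show ?thesis using K1(3) by (meson add_right_mono order_trans)
  qed
  have "emeasure La (C \<inter> \<Psi> -` ?S1) \<le> emeasure La (\<Psi> -` ?S1)" by (intro emeasure_mono) (auto simp: L)
  also have "... = emeasure (distr La borel \<Psi>) ?S1" by (subst emeasure_distr) (auto simp: spc)
  also have "... = emeasure (distr Lb borel \<Psi>) ?S1" using eq by simp
  also have "... = emeasure Lb (\<Psi> -` ?S1)" by (subst emeasure_distr) (auto simp: spc)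
  \<comment> \<open>Since \<open>?S1\<close> misses \<open>?S2\<close>, whatever the preimage of
    \<open>?S1\<close> contains outside \<open>C\<close> lies in the small part of the complement
    that \<open>K2\<close> fails to cover.\<close>
  also have "... \<le> emeasure Lb (C \<union> (- C - \<Psi> -` ?S2))" using disj by (intro emeasure_mono) (auto simp: L)
  also have "... \<le> emeasure Lb C + emeasure Lb (- C - \<Psi> -` ?S2)" by (intro emeasure_subadditive) (auto simp: L)
  also have "emeasure Lb (- C - \<Psi> -` ?S2) \<le> ennreal eps"
  proof -
   have "measure Lb (- C) = measure Lb (- C \<inter> \<Psi> -` ?S2) + measure Lb (- C - \<Psi> -` ?S2)"
    by (subst b.finite_measure_Union[symmetric]) (auto simp: L intro!: arg_cong[where f="measure Lb"])
   moreover have "measure Lb (- C) \<le> measure Lb (- C \<inter> \<Psi> -` ?S2) + eps"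
    using bm eps by (simp add: b.emeasure_eq_measure ennreal_plus[symmetric] del: ennreal_plus)
   ultimately show ?thesis by (simp add: b.emeasure_eq_measure ennreal_leI)
  qed
  finally have "emeasure La (C \<inter> \<Psi> -` ?S1) \<le> emeasure Lb C + ennreal eps" by (simp add: add_left_mono)
  then have "emeasure La C \<le> emeasure Lb C + ennreal eps + ennreal eps" using am by (meson add_right_mono order_trans)
  then show ?thesis using eps by (simp add: add.assoc ennreal_plus[symmetric] del: ennreal_plus)
 qed
 have le: "emeasure La C \<le> emeasure Lb C"
  if "prob_space La" "prob_space Lb" "sets La = sets borel" "sets Lb = sets borel"
  and "AE x in La. x \<in> G" "AE x in Lb. x \<in> G"
  and "distr La borel \<Psi> = distr Lb borel \<Psi>"
  and "C \<in> sets borel" for La Lb :: "'x measure" and C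
 proof (rule ennreal_le_epsilon)
  fix e :: real assume "0 < e"
  with main[OF that, of "e/2"] show "emeasure La C \<le> emeasure Lb C + ennreal e" by simp
 qed
 show ?thesis
 proof (rule measure_eqI)
  show "sets L1 = sets L2" using L by simp
  fix C assume "C \<in> sets L1"
  then have C: "C \<in> sets borel" using L by simp
  show "emeasure L1 C = emeasure L2 C"
   using le[OF L full eq C] le[OF L(2,1,4,3) full(2,1) eq[symmetric] C] by (rule antisym)
 qed
qed

section \<open>Laws determined by their exponential moments\<close>

lemma exp_moment_power_series:
 fixes z :: complex
 assumes "real_distribution \<mu>" and fin: "\<And>th. (\<integral>\<^sup>+x. ennreal (exp (th * x)) \<partial>\<mu>) < \<infinity>"
 shows "(\<lambda>n. of_real ((\<integral>x. x ^ n \<partial>\<mu>) / fact n) * z ^ n) sums (\<integral>x. exp (z * of_real x) \<partial>\<mu>)"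
proof -
 interpret real_distribution \<mu> by fact
 have int_exp: "integrable \<mu> (\<lambda>x. exp (th * x))" for th :: real
  using fin[of th] by (intro integrableI_nonneg) auto
 have dom: "integrable \<mu> (\<lambda>x. exp (r * \<bar>x\<bar>))" for r :: real
 proof (rule Bochner_Integration.integrable_bound)
  show "integrable \<mu> (\<lambda>x. exp (r * x) + exp ((-r) * x))" by (intro Bochner_Integration.integrable_add int_exp)
  show "AE x in \<mu>. norm (exp (r * \<bar>x\<bar>)) \<le> norm (exp (r * x) + exp ((-r) * x))"
  proof (intro AE_I2)
   fix x
   have "exp (r * \<bar>x\<bar>) \<le> exp (r * x) + exp ((-r) * x)" by (cases "x < 0") auto
   then show "norm (exp (r * \<bar>x\<bar>)) \<le> norm (exp (r * x) + exp ((-r) * x))"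
    unfolding real_norm_def abs_exp_cancel by linarith
  qed
 qed auto
 have intp: "integrable \<mu> (\<lambda>x. x ^ n)" for n
 proof (rule Bochner_Integration.integrable_bound)
  show "integrable \<mu> (\<lambda>x. fact n * exp (1 * \<bar>x\<bar>))" by (intro integrable_mult_right dom)
  have "\<bar>x\<bar> ^ n \<le> fact n * exp \<bar>x\<bar>" for x :: real
  proof -
   have "(\<lambda>k. \<bar>x\<bar> ^ k / fact k) sums exp \<bar>x\<bar>" using exp_converges[of "\<bar>x\<bar>"] by (simp add: field_simps scaleR_conv_of_real)
   then have "(\<Sum>k\<in>{n}. \<bar>x\<bar> ^ k / fact k) \<le> exp \<bar>x\<bar>"
    using sum_le_suminf[of "\<lambda>k. \<bar>x\<bar> ^ k / fact k" "{n}"] by (simp add: sums_iff)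
   then show ?thesis by (simp add: field_simps)
  qed
  then show "AE x in \<mu>. norm (x ^ n) \<le> norm (fact n * exp (1 * \<bar>x\<bar>))"
   by (auto simp: power_abs abs_mult)
 qed auto
 let ?s = "\<lambda>N x. \<Sum>n<N. (z * of_real x) ^ n / fact n"
 have conv: "(\<lambda>n. (z * of_real x) ^ n / fact n) sums exp (z * of_real x)" for x
  using exp_converges[of "z * of_real x"] by (simp add: field_simps scaleR_conv_of_real)
 have bnd: "cmod (?s N x) \<le> exp (cmod z * \<bar>x\<bar>)" for N x
 proof -
  have s: "(\<lambda>k. (cmod z * \<bar>x\<bar>) ^ k / fact k) sums exp (cmod z * \<bar>x\<bar>)"
   using exp_converges[of "cmod z * \<bar>x\<bar>"] by (simp add: field_simps scaleR_conv_of_real)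
  have "cmod (?s N x) \<le> (\<Sum>n<N. (cmod z * \<bar>x\<bar>) ^ n / fact n)"
   by (rule order_trans[OF norm_sum]) (auto simp: norm_mult norm_divide norm_power intro!: sum_mono)
  also have "... \<le> exp (cmod z * \<bar>x\<bar>)"
   using sum_le_suminf[of "\<lambda>k. (cmod z * \<bar>x\<bar>) ^ k / fact k" "{..<N}"] s by (simp add: sums_iff)
  finally show ?thesis .
 qed
 have "(\<lambda>N. \<integral>x. ?s N x \<partial>\<mu>) \<longlonglongrightarrow> (\<integral>x. exp (z * of_real x) \<partial>\<mu>)"
 proof (rule integral_dominated_convergence[where w="\<lambda>x. exp (cmod z * \<bar>x\<bar>)"])
  show "AE x in \<mu>. (\<lambda>N. ?s N x) \<longlonglongrightarrow> exp (z * of_real x)" using conv by (auto simp: sums_def)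
  show "AE x in \<mu>. cmod (?s N x) \<le> exp (cmod z * \<bar>x\<bar>)" for N using bnd by auto
 qed (auto simp: dom)
 moreover have "(\<integral>x. ?s N x \<partial>\<mu>) = (\<Sum>n<N. of_real ((\<integral>x. x ^ n \<partial>\<mu>) / fact n) * z ^ n)" for N
 proof -
  have i: "integrable \<mu> (\<lambda>x. (z * of_real x) ^ n / fact n)" for n
  proof -
   have "integrable \<mu> (\<lambda>x. (z ^ n / fact n) * complex_of_real (x ^ n))" by (intro integrable_mult_right integrable_of_real intp)
   then show ?thesis by (simp add: power_mult_distrib field_simps)
  qed
  have "(\<integral>x. (z * of_real x) ^ n / fact n \<partial>\<mu>) = of_real ((\<integral>x. x ^ n \<partial>\<mu>) / fact n) * z ^ n" for n
  proof -
   have "(\<integral>x. (z * of_real x) ^ n / fact n \<partial>\<mu>) = (\<integral>x. (z ^ n / fact n) * complex_of_real (x ^ n) \<partial>\<mu>)"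
    by (intro Bochner_Integration.integral_cong) (auto simp: power_mult_distrib field_simps)
   then show ?thesis by (simp only: integral_mult_right_zero integral_complex_of_real) (simp add: field_simps)
  qed
  then show ?thesis by (subst Bochner_Integration.integral_sum) (auto intro: i)
 qed
 ultimately show ?thesis by (simp add: sums_def)
qed

text \<open>Letting x tend to 0 reads off the constant coefficient of a vanishing series; dividing
  by x shifts the series, and the argument repeats.\<close>

lemma power_series_eq_zero:
 fixes a :: "nat \<Rightarrow> real"
 assumes "\<And>x. (\<lambda>n. a n * x ^ n) sums 0"
 shows "a n = 0"
proof -
 have z: "a n = 0" if "\<And>x. x \<noteq> 0 \<Longrightarrow> (\<lambda>k. a (k + n) * x ^ k) sums 0" for n
 proof -
  have "((\<lambda>_. 0) \<longlongrightarrow> a (0 + n)) (at (0::real))"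
   by (rule powser_limit_0_strong[of 1 "\<lambda>k. a (k + n)"]) (use that in auto)
  then show ?thesis by (simp add: tendsto_const_iff)
 qed
 have P: "x \<noteq> 0 \<Longrightarrow> (\<lambda>k. a (k + n) * x ^ k) sums 0" for n x
 proof (induction n arbitrary: x)
  case 0 then show ?case using assms by simp
 next
  case (Suc n)
  have an: "a n = 0" by (rule z) (use Suc.IH in auto)
  have "(\<lambda>k. a (Suc k + n) * x ^ Suc k) sums 0"
   using Suc.IH[OF Suc.prems] by (subst sums_Suc_iff) (simp add: an)
  then have "(\<lambda>k. (1/x) * (a (Suc k + n) * x ^ Suc k)) sums ((1/x) * 0)" by (rule sums_mult)
  then show ?case using Suc.prems by (simp add: field_simps)
 qed
 show ?thesis by (rule z) (use P in auto)
qed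

text \<open>The Laplace transform is entire with the moments as Taylor coefficients. Agreement on
  the real axis forces equal moments, and the same series at imaginary arguments then gives equal
  characteristic functions.\<close>

lemma real_distribution_eqI_exp_moments:
 assumes "real_distribution \<mu>1" "real_distribution \<mu>2"
  and fin: "\<And>th. (\<integral>\<^sup>+x. ennreal (exp (th * x)) \<partial>\<mu>1) < \<infinity>"
  and eq: "\<And>th. (\<integral>\<^sup>+x. ennreal (exp (th * x)) \<partial>\<mu>1) = (\<integral>\<^sup>+x. ennreal (exp (th * x)) \<partial>\<mu>2)"
 shows "\<mu>1 = \<mu>2"
proof -
 interpret a: real_distribution \<mu>1 by fact
 interpret b: real_distribution \<mu>2 by fact
 have fin2: "(\<integral>\<^sup>+x. ennreal (exp (th * x)) \<partial>\<mu>2) < \<infinity>" for th using fin eq by metis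
 let ?m1 = "\<lambda>n. (\<integral>x. x ^ n \<partial>\<mu>1) / fact n" and ?m2 = "\<lambda>n. (\<integral>x. x ^ n \<partial>\<mu>2) / fact n"
 note S1 = exp_moment_power_series[OF assms(1) fin] and S2 = exp_moment_power_series[OF assms(2) fin2]
 have real_eq: "(\<integral>x. exp (of_real th * of_real x) \<partial>\<mu>1) = (\<integral>x. exp (of_real th * complex_of_real x) \<partial>\<mu>2)" for th :: real
 proof -
  have "(\<integral>x. exp (th * x) \<partial>\<mu>1) = (\<integral>x. exp (th * x) \<partial>\<mu>2)"
   using eq[of th] by (simp add: integral_eq_nn_integral)
  then have "(\<integral>x. complex_of_real (exp (th * x)) \<partial>\<mu>1) = (\<integral>x. complex_of_real (exp (th * x)) \<partial>\<mu>2)"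
   by (simp only: integral_complex_of_real)
  then show ?thesis by (simp only: exp_of_real[symmetric] of_real_mult)
 qed
 have "(\<lambda>n. (?m1 n - ?m2 n) * th ^ n) sums 0" for th :: real
 proof -
  have "(\<lambda>n. of_real (?m1 n) * complex_of_real th ^ n - of_real (?m2 n) * complex_of_real th ^ n) sums 0"
   using sums_diff[OF S1[of "of_real th"] S2[of "of_real th"]] real_eq[of th] by simp
  then have "(\<lambda>n. complex_of_real ((?m1 n - ?m2 n) * th ^ n)) sums of_real 0" by (simp add: left_diff_distrib)
  then show ?thesis by (simp only: sums_of_real_iff)
 qed
 then have m: "?m1 n = ?m2 n" for n using power_series_eq_zero[of "\<lambda>n. ?m1 n - ?m2 n" n] by simp
 have "char \<mu>1 = char \<mu>2"
 proof
  fix t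
  have "(\<integral>x. exp (\<i> * of_real t * of_real x) \<partial>\<mu>1) = (\<integral>x. exp (\<i> * of_real t * complex_of_real x) \<partial>\<mu>2)"
   using S1[of "\<i> * of_real t"] S2[of "\<i> * of_real t"] by (simp only: m sums_unique2)
  then show "char \<mu>1 t = char \<mu>2 t" by (simp add: char_def mult.assoc)
 qed
 then show ?thesis by (intro Levy_uniqueness assms)
qed

section \<open>Gaussian increments independent of the past\<close>

lemma nn_integral_exp_normal:
 assumes "sg > 0"
 shows "(\<integral>\<^sup>+x. ennreal (exp (th * x)) \<partial>density lborel (\<lambda>x. ennreal (normal_density 0 sg x))) = ennreal (exp (th\<^sup>2 * sg\<^sup>2 / 2))"
proof -
 \<comment> \<open>Completing the square: the exponential factor shifts the mean by th sg^2.\<close>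
 have e: "normal_density 0 sg x * exp (th * x) = exp (th\<^sup>2 * sg\<^sup>2 / 2) * normal_density (th * sg\<^sup>2) sg x" for x
 proof -
  have "- x\<^sup>2 / (2 * sg\<^sup>2) + th * x = th\<^sup>2 * sg\<^sup>2 / 2 + (- (x - th * sg\<^sup>2)\<^sup>2 / (2 * sg\<^sup>2))"
   using assms by (simp add: field_simps power2_eq_square)
  then have "exp (- x\<^sup>2 / (2 * sg\<^sup>2)) * exp (th * x) = exp (th\<^sup>2 * sg\<^sup>2 / 2) * exp (- (x - th * sg\<^sup>2)\<^sup>2 / (2 * sg\<^sup>2))"
   by (simp only: exp_add[symmetric])
  then show ?thesis by (simp add: normal_density_def field_simps)
 qed
 have "(\<integral>\<^sup>+x. ennreal (exp (th * x)) \<partial>density lborel (\<lambda>x. ennreal (normal_density 0 sg x)))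
   = (\<integral>\<^sup>+x. ennreal (exp (th\<^sup>2 * sg\<^sup>2 / 2)) * ennreal (normal_density (th * sg\<^sup>2) sg x) \<partial>lborel)"
  by (subst nn_integral_density) (auto intro!: nn_integral_cong simp: ennreal_mult[symmetric] e)
 also have "... = ennreal (exp (th\<^sup>2 * sg\<^sup>2 / 2)) * (\<integral>\<^sup>+x. ennreal (normal_density (th * sg\<^sup>2) sg x) \<partial>lborel)"
  by (rule nn_integral_cmult) auto
 also have "(\<integral>\<^sup>+x. ennreal (normal_density (th * sg\<^sup>2) sg x) \<partial>lborel) = 1"
  using prob_space.emeasure_space_1[OF prob_space_normal_density[OF assms, of "th * sg\<^sup>2"]]
  by (simp add: emeasure_density)
 finally show ?thesis by simp
qed

text \<open>Independence of \<open>G\<close> amounts to the law of \<open>De\<close> being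
  unaffected by conditioning on any event of \<open>G\<close> with positive probability; events of
  probability 0 factorise trivially.\<close>

lemma indep_normal_of_conditional_law:
 fixes De :: "'w \<Rightarrow> real"
 assumes M: "prob_space M" and sub: "subalgebra M G" and De[measurable]: "De \<in> borel_measurable M"
  and sg: "sg > 0"
  and law: "\<And>A. A \<in> sets G \<Longrightarrow> measure M A > 0 \<Longrightarrow>
   distr (uniform_measure M A) borel De = density lborel (\<lambda>x. ennreal (normal_density 0 sg x))"
 shows "distributed M lborel De (normal_density 0 sg)"
  and "prob_space.indep_set M (sets G) (sets (vimage_algebra (space M) De borel))"
proof -
 interpret prob_space M by fact
 let ?N = "density lborel (\<lambda>x. ennreal (normal_density 0 sg x))"
 have spG: "space M \<in> sets G" using sub by (metis sets.top subalgebra_def)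
 have u: "uniform_measure M (space M) = M"
  by (intro measure_eqI) (auto simp: emeasure_uniform_measure emeasure_space_1 sets.Int_space_eq1 divide_ennreal_def)
 have d: "distr M borel De = ?N" using law[OF spG] by (simp add: prob_space u)
 then show "distributed M lborel De (normal_density 0 sg)"
  by (simp add: distributed_def distr_cong[OF refl sets_lborel refl])
 show "indep_set (sets G) (sets (vimage_algebra (space M) De borel))"
 proof (rule indep_setI)
  show "sets G \<subseteq> events" using sub by (simp add: subalgebra_def)
  show "sets (vimage_algebra (space M) De borel) \<subseteq> events" by (auto simp: sets_vimage_algebra2)
  fix A B assume A: "A \<in> sets G" and "B \<in> sets (vimage_algebra (space M) De borel)"
  then obtain C where C: "C \<in> sets borel" "B = De -` C \<inter> space M" by (auto simp: sets_vimage_algebra2)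
  have AM[measurable]: "A \<in> events" using A sub by (auto simp: subalgebra_def)
  have B: "B \<in> events" "prob B = measure ?N C" using C d[symmetric] by (simp_all add: measure_distr)
  show "prob (A \<inter> B) = prob A * prob B"
  proof (cases "prob A > 0")
   case False
   then have "prob A = 0" by (simp add: measure_nonneg order.antisym)
   moreover have "prob (A \<inter> B) \<le> prob A" using B by (intro finite_measure_mono) auto
   ultimately show ?thesis by (simp add: measure_le_0_iff)
  next
   case True
   have "measure ?N C = measure (uniform_measure M A) B"
    using C by (simp add: law[OF A True, symmetric] measure_distr)
   also have "... = prob (A \<inter> B) / prob A"
    using True B by (intro measure_uniform_measure) (auto simp: emeasure_eq_measure)
   finally show ?thesis using True B by (simp add: field_simps)
  qed
 qed
qed

lemma indep_normal_of_exp_moments: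
 fixes De :: "'w \<Rightarrow> real"
 assumes M: "prob_space M" and sub: "subalgebra M G" and De[measurable]: "De \<in> borel_measurable M"
  and v: "v > 0"
  and mgf: "\<And>A th. A \<in> sets G \<Longrightarrow>
   (\<integral>\<^sup>+om. indicator A om * ennreal (exp (th * De om)) \<partial>M) = emeasure M A * ennreal (exp (th\<^sup>2 * v / 2))"
 shows "distributed M lborel De (normal_density 0 (sqrt v))"
  and "prob_space.indep_set M (sets G) (sets (vimage_algebra (space M) De borel))"
proof -
 interpret prob_space M by fact
 have s: "sqrt v > 0" using v by simp
 have law: "distr (uniform_measure M A) borel De = density lborel (\<lambda>x. ennreal (normal_density 0 (sqrt v) x))"
  if A: "A \<in> sets G" "measure M A > 0" for A
 proof (rule real_distribution_eqI_exp_moments)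
  have [measurable]: "A \<in> events" using A sub by (auto simp: subalgebra_def)
  interpret U: prob_space "uniform_measure M A" by (rule prob_space_uniform_measure) (use A in \<open>auto simp: emeasure_eq_measure\<close>)
  show "real_distribution (distr (uniform_measure M A) borel De)" by (rule U.real_distribution_distr) simp
  interpret N: prob_space "density lborel (\<lambda>x. ennreal (normal_density 0 (sqrt v) x))" by (rule prob_space_normal_density[OF s])
  show "real_distribution (density lborel (\<lambda>x. ennreal (normal_density 0 (sqrt v) x)))" by unfold_locales auto
  have e: "(\<integral>\<^sup>+x. ennreal (exp (th * x)) \<partial>distr (uniform_measure M A) borel De) = ennreal (exp (th\<^sup>2 * v / 2))" for th
  proof -
   have "(\<integral>\<^sup>+x. ennreal (exp (th * x)) \<partial>distr (uniform_measure M A) borel De) = (\<integral>\<^sup>+om. ennreal (exp (th * De om)) * indicator A om \<partial>M) / emeasure M A"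
    by (simp add: nn_integral_distr nn_integral_uniform_measure)
   also have "... = emeasure M A * ennreal (exp (th\<^sup>2 * v / 2)) / emeasure M A"
    using mgf[OF A(1), of th] by (simp add: mult.commute)
   also have "... = ennreal (exp (th\<^sup>2 * v / 2))" using A(2) by (simp add: emeasure_eq_measure ennreal_mult[symmetric] divide_ennreal)
   finally show ?thesis .
  qed
  show "(\<integral>\<^sup>+x. ennreal (exp (th * x)) \<partial>distr (uniform_measure M A) borel De) < \<infinity>" for th by (simp add: e)
  show "(\<integral>\<^sup>+x. ennreal (exp (th * x)) \<partial>distr (uniform_measure M A) borel De)
    = (\<integral>\<^sup>+x. ennreal (exp (th * x)) \<partial>density lborel (\<lambda>x. ennreal (normal_density 0 (sqrt v) x)))" for th
   using v by (simp only: e nn_integral_exp_normal[OF s]) simp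
 qed
 show "distributed M lborel De (normal_density 0 (sqrt v))"
  by (rule indep_normal_of_conditional_law(1)[OF M sub De s law])
 show "indep_set (sets G) (sets (vimage_algebra (space M) De borel))"
  by (rule indep_normal_of_conditional_law(2)[OF M sub De s law])
qed

lemma char_normal_density:
 assumes sg: "sg > 0"
 shows "char (density lborel (\<lambda>x. ennreal (normal_density 0 sg x))) t = of_real (exp (- (t\<^sup>2 * sg\<^sup>2 / 2)))"
proof -
 interpret prob_space "std_normal_distribution" by (simp add: prob_space_normal_density)
 have "distributed std_normal_distribution lborel (\<lambda>x. x) std_normal_density"
  by (simp add: distributed_def distr_id2)
 then have "distributed std_normal_distribution lborel (\<lambda>x. 0 + sg * x) (normal_density (0 + sg * 0) (\<bar>sg\<bar> * 1))"
  by (intro normal_density_affine) (use sg in auto)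
 then have "density lborel (\<lambda>x. ennreal (normal_density 0 sg x)) = distr std_normal_distribution lborel (\<lambda>x. sg * x)"
  using sg by (simp add: distributed_def)
 then have "char (density lborel (\<lambda>x. ennreal (normal_density 0 sg x))) t = char std_normal_distribution (t * sg)"
  by (simp add: char_def integral_distr mult.assoc)
 then show ?thesis by (simp add: char_std_normal_distribution power_mult_distrib)
qed

text \<open>Counterpart of \<open>indep_normal_of_exp_moments\<close> for imaginary exponents. It
  serves \<open>bm_system_of_indep\<close>, where the Taylor remainder of the exponential is
  controlled by a cubic moment because the exponential has modulus 1.\<close>

lemma indep_normal_of_char:
 fixes De :: "'w \<Rightarrow> real"
 assumes M: "prob_space M" and sub: "subalgebra M G" and De[measurable]: "De \<in> borel_measurable M"
  and v: "v > 0"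
  and ch: "\<And>A th. A \<in> sets G \<Longrightarrow>
   (\<integral>om. indicator A om *\<^sub>R iexp (th * De om) \<partial>M) = of_real (measure M A * exp (- (th\<^sup>2 * v / 2)))"
 shows "distributed M lborel De (normal_density 0 (sqrt v))"
  and "prob_space.indep_set M (sets G) (sets (vimage_algebra (space M) De borel))"
proof -
 interpret prob_space M by fact
 have s: "sqrt v > 0" using v by simp
 have law: "distr (uniform_measure M A) borel De = density lborel (\<lambda>x. ennreal (normal_density 0 (sqrt v) x))"
  if A: "A \<in> sets G" "measure M A > 0" for A
 proof (rule Levy_uniqueness)
  have [measurable]: "A \<in> events" using A sub by (auto simp: subalgebra_def)
  interpret U: prob_space "uniform_measure M A" by (rule prob_space_uniform_measure) (use A in \<open>auto simp: emeasure_eq_measure\<close>)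
  show "real_distribution (distr (uniform_measure M A) borel De)" by (rule U.real_distribution_distr) simp
  interpret N: prob_space "density lborel (\<lambda>x. ennreal (normal_density 0 (sqrt v) x))" by (rule prob_space_normal_density[OF s])
  show "real_distribution (density lborel (\<lambda>x. ennreal (normal_density 0 (sqrt v) x)))" by unfold_locales auto
  show "char (distr (uniform_measure M A) borel De) = char (density lborel (\<lambda>x. ennreal (normal_density 0 (sqrt v) x)))"
  proof
   fix t
   have um: "uniform_measure M A = density M (\<lambda>om. ennreal (indicator A om / measure M A))"
    unfolding uniform_measure_def using A(2)
    by (intro density_cong) (auto simp: indicator_def emeasure_eq_measure divide_ennreal ennreal_1[symmetric] simp del: ennreal_1)
   have "char (distr (uniform_measure M A) borel De) t = (\<integral>om. iexp (t * De om) \<partial>uniform_measure M A)"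
    by (simp add: char_def integral_distr)
   also have "... = (\<integral>om. (indicator A om / measure M A) *\<^sub>R iexp (t * De om) \<partial>M)"
    unfolding um by (subst integral_density) auto
   also have "... = (\<integral>om. (1 / measure M A) *\<^sub>R (indicator A om *\<^sub>R iexp (t * De om)) \<partial>M)" by simp
   also have "... = (1 / measure M A) *\<^sub>R of_real (measure M A * exp (- (t\<^sup>2 * v / 2)))"
    by (subst integral_scaleR_right) (simp only: ch[OF A(1)])
   also have "... = char (density lborel (\<lambda>x. ennreal (normal_density 0 (sqrt v) x))) t"
    using A(2) v by (simp add: char_normal_density[OF s] scaleR_conv_of_real)
   finally show "char (distr (uniform_measure M A) borel De) t = char (density lborel (\<lambda>x. ennreal (normal_density 0 (sqrt v) x))) t" .
  qed
 qed
 show "distributed M lborel De (normal_density 0 (sqrt v))"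
  by (rule indep_normal_of_conditional_law(1)[OF M sub De s law])
 show "indep_set (sets G) (sets (vimage_algebra (space M) De borel))"
  by (rule indep_normal_of_conditional_law(2)[OF M sub De s law])
qed

section \<open>The potential and the monotone flow\<close>

definition basis_proj :: "(nat \<Rightarrow> 'a::real_inner) \<Rightarrow> nat \<Rightarrow> 'a \<Rightarrow> 'a" where
 "basis_proj e n x = (\<Sum>k<n. (x \<bullet> e k) *\<^sub>R e k)"

definition orthonormal_basis :: "(nat \<Rightarrow> 'a::real_inner) \<Rightarrow> bool" where
 "orthonormal_basis e \<longleftrightarrow> (\<forall>i j. e i \<bullet> e j = (if i = j then 1 else 0)) \<and> closure (span (range e)) = UNIV"

lemma eigenbasis_orthonormal: "eigenbasis D A e \<Longrightarrow> orthonormal_basis e"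
 by (simp add: eigenbasis_def orthonormal_basis_def)

lemma basis_proj_inner: "basis_proj e n x \<bullet> y = (\<Sum>k<n. (x \<bullet> e k) * (y \<bullet> e k))"
 unfolding basis_proj_def inner_sum_left by (intro sum.cong) (simp_all add: inner_commute)

lemma basis_proj_coeff:
 assumes "orthonormal_basis e"
 shows "basis_proj e n x \<bullet> e k = (if k < n then x \<bullet> e k else 0)"
proof -
 have "basis_proj e n x \<bullet> e k = (\<Sum>i<n. if i = k then x \<bullet> e k else 0)"
  unfolding basis_proj_inner using assms by (intro sum.cong) (auto simp: orthonormal_basis_def)
 then show ?thesis by simp
qed

lemma norm_basis_proj:
 assumes "orthonormal_basis e"
 shows "(norm (basis_proj e n x))\<^sup>2 = (\<Sum>k<n. (x \<bullet> e k)\<^sup>2)"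
proof -
 have "(norm (basis_proj e n x))\<^sup>2 = (\<Sum>k<n. (x \<bullet> e k) * (basis_proj e n x \<bullet> e k))"
  unfolding power2_norm_eq_inner by (rule basis_proj_inner)
 also have "... = (\<Sum>k<n. (x \<bullet> e k)\<^sup>2)"
  by (intro sum.cong) (simp_all add: basis_proj_coeff[OF assms] power2_eq_square)
 finally show ?thesis .
qed

lemma norm_basis_proj_le:
 assumes "orthonormal_basis e"
 shows "norm (basis_proj e n x) \<le> norm x"
proof -
 have "basis_proj e n x \<bullet> x = (norm (basis_proj e n x))\<^sup>2"
  unfolding norm_basis_proj[OF assms] basis_proj_inner by (simp add: power2_eq_square)
 then have "(norm (basis_proj e n x))\<^sup>2 \<le> norm (basis_proj e n x) * norm x"
  by (metis norm_cauchy_schwarz)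
 then show ?thesis by (cases "norm (basis_proj e n x) = 0") (auto simp: power2_eq_square)
qed

lemma basis_proj_diff: "basis_proj e n (x - y) = basis_proj e n x - basis_proj e n y"
 by (simp add: basis_proj_def inner_diff_left scaleR_diff_left sum_subtractf)

text \<open>The vectors that are eventually fixed by the projections form a subspace containing the
  basis, hence its dense span. Contractivity of the projections extends the convergence to the
  closure.\<close>

lemma basis_proj_tendsto:
 assumes "orthonormal_basis e"
 shows "(\<lambda>n. basis_proj e n x) \<longlonglongrightarrow> x"
proof (rule LIMSEQ_I)
 fix r :: real assume r: "0 < r"
 let ?S = "{y. \<exists>m. \<forall>n\<ge>m. basis_proj e n y = y}"
 have "subspace ?S"
 proof (rule subspaceI)
  show "0 \<in> ?S" by (simp add: basis_proj_def)
  fix u v assume "u \<in> ?S" "v \<in> ?S"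
  then obtain m m' where "\<forall>n\<ge>m. basis_proj e n u = u" "\<forall>n\<ge>m'. basis_proj e n v = v" by auto
  moreover have "basis_proj e n (u + v) = basis_proj e n u + basis_proj e n v" for n
   by (simp add: basis_proj_def inner_add_left scaleR_add_left sum.distrib)
  ultimately show "u + v \<in> ?S" by (auto intro!: exI[of _ "max m m'"])
 next
  fix c u assume "u \<in> ?S"
  moreover have "basis_proj e n (c *\<^sub>R u) = c *\<^sub>R basis_proj e n u" for n
   by (simp add: basis_proj_def scaleR_sum_right)
  ultimately show "c *\<^sub>R u \<in> ?S" by auto
 qed
 moreover have "e i \<in> ?S" for i
 proof -
  have "basis_proj e n (e i) = e i" if "n \<ge> Suc i" for n
  proof -
   have "basis_proj e n (e i) = (\<Sum>k<n. (if k = i then e i else 0))"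
    unfolding basis_proj_def using assms by (intro sum.cong) (auto simp: orthonormal_basis_def)
   then show ?thesis using that by simp
  qed
  then show ?thesis by blast
 qed
 ultimately have "span (range e) \<subseteq> ?S" by (intro span_minimal) auto
 moreover have "x \<in> closure (span (range e))" using assms by (simp add: orthonormal_basis_def)
 then obtain y where "y \<in> span (range e)" "dist y x < r/2"
  using r by (metis closure_approachable half_gt_zero)
 ultimately obtain m where m: "\<forall>n\<ge>m. basis_proj e n y = y" and y: "norm (x - y) < r/2"
  by (auto simp: dist_norm norm_minus_commute)
 have "norm (basis_proj e n x - x) < r" if "n \<ge> m" for n
 proof -
  have "basis_proj e n x - x = basis_proj e n (x - y) - (x - y)" using m that by (simp add: basis_proj_diff)
  then have "norm (basis_proj e n x - x) \<le> norm (basis_proj e n (x - y)) + norm (x - y)" by (metis norm_triangle_ineq4)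
  also have "... < r" using norm_basis_proj_le[OF assms, of n "x - y"] y by linarith
  finally show ?thesis .
 qed
 then show "\<exists>no. \<forall>n\<ge>no. norm (basis_proj e n x - x) < r" by blast
qed

lemma inner_basis_sums:
 assumes "orthonormal_basis e"
 shows "(\<lambda>n. \<Sum>k<n. (x \<bullet> e k) * (y \<bullet> e k)) \<longlonglongrightarrow> x \<bullet> y"
 using tendsto_inner[OF basis_proj_tendsto[OF assms, of x] tendsto_const[of y]] by (simp add: basis_proj_inner)

text \<open>Pointwise convergence of contractions is uniform on compact sets: a finite net of mesh
  r/3 suffices. Applied to the range of a path, this reduces the coercivity estimate to finitely
  many coordinates of the gradient.\<close>

lemma basis_proj_uniform_compact:
 assumes e: "orthonormal_basis e" and K: "compact K" and r: "0 < r"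
 shows "\<exists>n. \<forall>x\<in>K. norm (basis_proj e n x - x) < r"
proof -
 obtain F where F: "finite F" "F \<subseteq> K" "K \<subseteq> (\<Union>y\<in>F. ball y (r/3))"
  using compactE_image[OF K, of K "\<lambda>y. ball y (r/3)"] r by (metis UN_I centre_in_ball divide_pos_pos open_ball subsetI zero_less_numeral)
 have "\<forall>\<^sub>F n in sequentially. norm (basis_proj e n y - y) < r/3" for y
  using tendstoD[OF basis_proj_tendsto[OF e, of y], of "r/3"] r by (simp add: dist_norm)
 then have "\<forall>\<^sub>F n in sequentially. \<forall>y\<in>F. norm (basis_proj e n y - y) < r/3"
  using F(1) by (simp add: eventually_ball_finite)
 then obtain n where n: "\<forall>y\<in>F. norm (basis_proj e n y - y) < r/3" by (auto simp: eventually_sequentially)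
 have "norm (basis_proj e n x - x) < r" if xK: "x \<in> K" for x
 proof -
  obtain y where "y \<in> F" "x \<in> ball y (r/3)" using F(3) xK by blast
  then have y: "y \<in> F" "norm (x - y) < r/3" by (simp_all add: dist_norm norm_minus_commute)
  have eq: "basis_proj e n x - x = basis_proj e n (x - y) + (basis_proj e n y - y) - (x - y)" by (simp add: basis_proj_diff)
  then have "norm (basis_proj e n x - x) \<le> norm (basis_proj e n (x - y)) + norm (basis_proj e n y - y) + norm (x - y)"
   using norm_triangle_ineq4[of "basis_proj e n (x - y) + (basis_proj e n y - y)" "x - y"]
    norm_triangle_ineq[of "basis_proj e n (x - y)" "basis_proj e n y - y"] unfolding eq by linarith
  then show ?thesis using norm_basis_proj_le[OF e, of n "x - y"] y n by fastforce
 qed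
 then show ?thesis by blast
qed

text \<open>The pair \<open>(e k, A (e k))\<close> lies in the graph of the adjoint, which lets the
  eigenvalue be moved from \<open>A h\<close> onto the coefficient of \<open>h\<close>. This last
  conjunct later turns the coordinate equations into the equation tested with an arbitrary
  \<open>h\<close> in the domain.\<close>

lemma self_adjoint_eigen:
 assumes A: "self_adjoint_on D A" and e: "eigenbasis D A e" and neg: "\<And>x. x \<in> D \<Longrightarrow> A x \<bullet> x \<le> - om\<^sub>0 * (norm x)\<^sup>2"
 shows "\<exists>l. \<forall>k. l k \<le> - om\<^sub>0 \<and> A (e k) = l k *\<^sub>R e k \<and> (\<forall>h\<in>D. A h \<bullet> e k = l k * (h \<bullet> e k))"
proof -
 have "\<exists>l. \<forall>k. A (e k) = l k *\<^sub>R e k" using e by (intro choice) (auto simp: eigenbasis_def)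
 then obtain l where l: "\<And>k. A (e k) = l k *\<^sub>R e k" by blast
 have D: "e k \<in> D" for k using e by (simp add: eigenbasis_def)
 have n: "e k \<bullet> e k = 1" "norm (e k) = 1" for k using e by (auto simp: eigenbasis_def norm_eq_sqrt_inner)
 have "l k \<le> - om\<^sub>0" for k using neg[OF D, of k] by (simp add: l n)
 moreover have "A h \<bullet> e k = l k * (h \<bullet> e k)" if "h \<in> D" for h k
 proof -
  have "(e k, A (e k)) \<in> {(y, w). \<forall>x\<in>D. A x \<bullet> y = x \<bullet> w}"
   using A D by (auto simp: self_adjoint_on_def)
  then show ?thesis using that by (simp add: l)
 qed
 ultimately show ?thesis using l by blast
qed

section \<open>The convex potential and its gradient\<close>

lemma convex_potential_sublevel_closed:
 assumes "convex_potential V"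
 shows "closed {x. V x \<le> a}"
proof -
 have "open {x. a < V x}"
 proof (subst open_subopen, safe)
  fix x assume "a < V x"
  moreover have "V x \<le> Liminf (at x) V" using assms by (simp add: convex_potential_def)
  ultimately have "\<forall>\<^sub>F y in at x. a < V y" by (intro less_LiminfD) auto
  then obtain S where "open S" "x \<in> S" "\<forall>y\<in>S. y \<noteq> x \<longrightarrow> a < V y" by (auto simp: eventually_at_topological)
  then show "\<exists>T. open T \<and> x \<in> T \<and> T \<subseteq> {x. a < V x}" using \<open>a < V x\<close> by (intro exI[of _ S]) auto
 qed
 moreover have "{x. V x \<le> a} = - {x. a < V x}" by auto
 ultimately show ?thesis by (simp add: closed_def)
qed

lemma convex_potential_measurable:
 assumes "convex_potential V"
 shows "V \<in> borel_measurable borel"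
 by (intro borel_measurableI_le) (use convex_potential_sublevel_closed[OF assms] in auto)

lemma diff_dom_finite:
 assumes "convex_potential V" "x \<in> diff_dom V"
 obtains v where "V x = ereal v"
proof -
 obtain c where c: "\<forall>x. ereal c \<le> V x" using assms(1) unfolding convex_potential_def by blast
 show ?thesis
 proof (cases "V x")
  case MInf
  then show ?thesis using c[rule_format, of x] by simp
 qed (use assms(2) that in \<open>auto simp: diff_dom_def\<close>)
qed

lemma has_gateaux_gradient_unique:
 assumes "has_gateaux_gradient V x g" "has_gateaux_gradient V x g'"
 shows "g = g'"
proof -
 have "ereal (g \<bullet> h) = ereal (g' \<bullet> h)" for h
  using assms unfolding has_gateaux_gradient_def
  by (intro tendsto_unique[OF _ assms(1)[unfolded has_gateaux_gradient_def, rule_format] assms(2)[unfolded has_gateaux_gradient_def, rule_format]]) simp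
 then have "(g - g') \<bullet> (g - g') = 0" by (simp only: ereal.inject inner_diff_left)
 then show ?thesis by simp
qed

lemma has_gateaux_gradient_gradV:
 assumes "x \<in> diff_dom V"
 shows "has_gateaux_gradient V x (gradV V x)"
proof -
 obtain g where g: "has_gateaux_gradient V x g" using assms by (auto simp: diff_dom_def)
 then have "(THE g. has_gateaux_gradient V x g) = g" by (intro the_equality) (auto intro: has_gateaux_gradient_unique)
 then show ?thesis using g assms by (simp add: gradV_def)
qed

text \<open>Convexity bounds the difference quotients in the direction y - x by V y - V x for 0 < s
  < 1, and their right limit at 0 is the directional derivative. Where V y is infinite nothing has
  to be shown.\<close>

lemma gradV_subgradient:
 assumes V: "convex_potential V" and x: "x \<in> diff_dom V"
 shows "V x + ereal (gradV V x \<bullet> (y - x)) \<le> V y"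
proof -
 obtain v where v: "V x = ereal v" using diff_dom_finite[OF assms] .
 obtain c where c: "\<And>z. ereal c \<le> V z" using V by (auto simp: convex_potential_def)
 show ?thesis
 proof (cases "V y")
  case (real w)
  let ?g = "gradV V x"
  have lim: "((\<lambda>s::real. (V (x + s *\<^sub>R (y - x)) - V x) / ereal s) \<longlongrightarrow> ereal (?g \<bullet> (y - x))) (at_right 0)"
   using has_gateaux_gradient_gradV[OF x] unfolding has_gateaux_gradient_def
   by (blast intro: tendsto_mono at_le[OF subset_UNIV])
  have "ereal (?g \<bullet> (y - x)) \<le> ereal (w - v)"
  proof (rule tendsto_upperbound[OF lim])
   have "(V (x + s *\<^sub>R (y - x)) - V x) / ereal s \<le> ereal (w - v)" if "0 < s" "s < 1" for s :: real
   proof -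
    have "V ((1 - s) *\<^sub>R x + s *\<^sub>R y) \<le> ereal (1 - s) * V x + ereal s * V y"
     using V that by (simp add: convex_potential_def)
    moreover have "(1 - s) *\<^sub>R x + s *\<^sub>R y = x + s *\<^sub>R (y - x)" by (simp add: algebra_simps)
    ultimately have le: "V (x + s *\<^sub>R (y - x)) \<le> ereal ((1 - s) * v + s * w)" using v real by simp
    then obtain u where u: "V (x + s *\<^sub>R (y - x)) = ereal u"
     using c[of "x + s *\<^sub>R (y - x)"] by (cases "V (x + s *\<^sub>R (y - x))") auto
    have "u - v \<le> s * (w - v)" using le u by (simp add: algebra_simps)
    then show ?thesis using that u v by (simp add: field_simps)
   qed
   then show "\<forall>\<^sub>F s in at_right 0. (V (x + s *\<^sub>R (y - x)) - V x) / ereal s \<le> ereal (w - v)"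
    by (auto simp: eventually_at_right_field intro!: exI[of _ 1])
  qed simp
  then show ?thesis using v real by simp
 qed (use c[of y] in auto)
qed

lemma gradV_monotone:
 assumes V: "convex_potential V" and x: "x \<in> diff_dom V" and y: "y \<in> diff_dom V"
 shows "0 \<le> (gradV V x - gradV V y) \<bullet> (x - y)"
proof -
 obtain v where v: "V x = ereal v" using diff_dom_finite[OF V x] .
 obtain w where w: "V y = ereal w" using diff_dom_finite[OF V y] .
 have "v + gradV V x \<bullet> (y - x) \<le> w" "w + gradV V y \<bullet> (x - y) \<le> v"
  using gradV_subgradient[OF V x, of y] gradV_subgradient[OF V y, of x] v w by auto
 then show ?thesis by (simp add: algebra_simps)
qed

text \<open>Gateaux differentiability at a point makes the sublevel sets absorbing in every direction,
 so by Baire one of them has interior points.\<close>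

lemma diff_dom_bounded_on_ball:
 fixes V :: "'a::{real_inner, polish_space} \<Rightarrow> ereal"
 assumes V: "convex_potential V" and x: "x \<in> diff_dom V"
 shows "\<exists>u r K. 0 < r \<and> (\<forall>y\<in>ball u r. V y \<le> ereal K)"
proof -
 \<comment> \<open>Scale and level share one index. Along each \<open>h\<close> the quotients at s =
   1/(n+1) have a finite limit, so the values stay bounded and are eventually below n. Hence these
   countably many closed sets cover the space, as Baire's theorem requires.\<close>
 define C where "C n = {h. V (x + (1 / Suc n) *\<^sub>R h) \<le> ereal (real n)}" for n :: nat
 obtain v where v: "V x = ereal v" using diff_dom_finite[OF assms] .
 have cl: "closed (C n)" for n
 proof -
  have "C n = (\<lambda>h. x + (1 / Suc n) *\<^sub>R h) -` {y. V y \<le> ereal (real n)}" by (auto simp: C_def)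
  moreover have "closed ((\<lambda>h. x + (1 / Suc n) *\<^sub>R h) -` {y. V y \<le> ereal (real n)})"
   by (intro closed_vimage convex_potential_sublevel_closed[OF V] continuous_intros)
  ultimately show ?thesis by simp
 qed
 have "h \<in> (\<Union>n. C n)" for h
 proof -
  have lim: "((\<lambda>s::real. (V (x + s *\<^sub>R h) - V x) / ereal s) \<longlongrightarrow> ereal (gradV V x \<bullet> h)) (at 0)"
   using has_gateaux_gradient_gradV[OF x] by (simp add: has_gateaux_gradient_def)
  have "filterlim (\<lambda>n. 1 / real (Suc n)) (at 0) sequentially"
   using LIMSEQ_inverse_real_of_nat by (auto simp: filterlim_at inverse_eq_divide)
  from filterlim_compose[OF lim this]
  have lim': "(\<lambda>n. (V (x + (1 / Suc n) *\<^sub>R h) - V x) / ereal (1 / Suc n)) \<longlonglongrightarrow> ereal (gradV V x \<bullet> h)" .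
  have "\<forall>\<^sub>F n in sequentially. (V (x + (1 / Suc n) *\<^sub>R h) - V x) / ereal (1 / Suc n) < ereal (gradV V x \<bullet> h + 1)"
   by (rule order_tendstoD(2)[OF lim']) simp
  moreover have "\<forall>\<^sub>F n in sequentially. \<bar>gradV V x \<bullet> h + 1\<bar> + v \<le> real n"
   using filterlim_real_sequentially unfolding filterlim_at_top by blast
  ultimately have "\<forall>\<^sub>F n in sequentially. h \<in> C n"
  proof eventually_elim
   case (elim n)
   show ?case
   proof (cases "V (x + (1 / Suc n) *\<^sub>R h)")
    case (real w)
    have "(w - v) * Suc n < gradV V x \<bullet> h + 1" using elim(1) unfolding real v by (simp add: field_simps)
    then have "(w - v) \<le> \<bar>gradV V x \<bullet> h + 1\<bar>"
    proof (cases "w - v \<le> 0")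
     case False
     then have "w - v \<le> (w - v) * Suc n" by (simp add: mult_le_cancel_left1)
     then show ?thesis using \<open>(w - v) * Suc n < gradV V x \<bullet> h + 1\<close> by linarith
    qed linarith
    then have "w \<le> real n" using elim(2) by linarith
    then show ?thesis unfolding C_def mem_Collect_eq real by simp
   next
    case PInf
    then show ?thesis using elim(1) by (simp add: v)
   next
    case MInf
    then show ?thesis by (simp add: C_def)
   qed
  qed
  then show ?thesis by (auto simp: eventually_sequentially)
 qed
 then have U: "(\<Union>n. C n) = UNIV" by auto
 have "\<exists>n. interior (C n) \<noteq> {}"
 proof (rule ccontr)
  assume "\<not> ?thesis"
  then have emp: "interior (C n) = {}" for n by blast
  have io: "euclidean interior_of S = interior S" for S :: "'a set"
   unfolding interior_of_def interior_def by auto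
  have "Met_TC.mtopology interior_of \<Union>(range C) = {}"
  proof (rule Met_TC.metric_Baire_category_alt)
   show "Met_TC.mcomplete TYPE('a)" by (simp only: mcomplete_iff_complete complete_UNIV)
   show "countable (range C)" by (rule countable_image) simp
   fix S assume "S \<in> range C"
   then obtain n where "S = C n" by blast
   then show "closedin Met_TC.mtopology S \<and> Met_TC.mtopology interior_of S = {}"
    using cl[of n] emp[of n] by (simp only: mtopology_is_euclidean io closed_closedin[symmetric] simp_thms)
  qed
  then have "interior UNIV = ({} :: 'a set)" by (simp only: mtopology_is_euclidean io U)
  then show False by simp
 qed
 then obtain n h \<rho> where h: "0 < \<rho>" "ball h \<rho> \<subseteq> C n" by (metis all_not_in_conv mem_interior)
 have "V y \<le> ereal (real n)" if "y \<in> ball (x + (1 / Suc n) *\<^sub>R h) (\<rho> / Suc n)" for y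
 proof -
  define k where "k = real (Suc n) *\<^sub>R (y - x)"
  have y: "y = x + (1 / Suc n) *\<^sub>R k" by (simp add: k_def)
  have "dist (x + (1 / Suc n) *\<^sub>R h) y = dist h k / Suc n"
   by (simp add: y dist_norm scaleR_diff_right[symmetric] divide_inverse)
  then have "k \<in> ball h \<rho>" using that by (simp add: divide_less_cancel)
  then have "k \<in> C n" using h by blast
  then show ?thesis by (simp add: C_def y)
 qed
 then show ?thesis using h(1) by (intro exI[of _ "x + (1 / Suc n) *\<^sub>R h"] exI[of _ "\<rho> / Suc n"] exI[of _ "real n"]) auto
qed

text \<open>The subgradient inequality is evaluated at
  \<open>u + (r / 2) *\<^sub>R sgn (gradV V x)\<close>, a point of the ball on which
  \<open>V\<close> is bounded. The bound there and the global lower bound of \<open>V\<close> leave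
  half the radius times the norm of the gradient.\<close>

lemma gradV_coercive:
 fixes V :: "'a::{real_inner, polish_space} \<Rightarrow> ereal"
 assumes V: "convex_potential V" and ne: "diff_dom V \<noteq> {}"
 shows "\<exists>u r C. 0 < r \<and> (\<forall>x\<in>diff_dom V. r * norm (gradV V x) \<le> gradV V x \<bullet> (x - u) + C)"
proof -
 obtain u r K where r: "0 < r" and K: "\<And>y. y \<in> ball u r \<Longrightarrow> V y \<le> ereal K"
  using diff_dom_bounded_on_ball[OF V] ne by blast
 obtain c where c: "\<And>x. ereal c \<le> V x" using V by (auto simp: convex_potential_def)
 have "(r/2) * norm (gradV V x) \<le> gradV V x \<bullet> (x - u) + (K - c)" if x: "x \<in> diff_dom V" for x
 proof -
  let ?g = "gradV V x"
  define y where "y = u + (r / 2) *\<^sub>R sgn ?g"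
  have "norm ((r / 2) *\<^sub>R sgn ?g) \<le> r / 2" using r by (simp add: norm_sgn)
  then have "y \<in> ball u r" using r by (simp add: y_def dist_norm del: norm_scaleR)
  then have "V x + ereal (?g \<bullet> (y - x)) \<le> ereal K" using K gradV_subgradient[OF V x, of y] by (meson order_trans)
  moreover have "ereal c + ereal (?g \<bullet> (y - x)) \<le> V x + ereal (?g \<bullet> (y - x))" by (intro add_right_mono c)
  ultimately have "ereal c + ereal (?g \<bullet> (y - x)) \<le> ereal K" by (meson order_trans)
  then have "c + ?g \<bullet> (y - x) \<le> K" by simp
  moreover have "?g \<bullet> sgn ?g = norm ?g"
   by (cases "?g = 0") (simp_all add: sgn_div_norm dot_square_norm power2_eq_square)
  then have "?g \<bullet> (y - x) = (r / 2) * norm ?g - ?g \<bullet> (x - u)" by (simp add: y_def inner_add_right inner_diff_right)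
  ultimately show ?thesis by simp
 qed
 then show ?thesis using r by (intro exI[of _ u] exI[of _ "r/2"] exI[of _ "K - c"]) auto
qed

text \<open>Each component is a pointwise limit of Borel difference quotients along s = 1/(n+1). Off
  the domain of differentiability both the quotients and the gradient are set to 0.\<close>

lemma gradV_inner_measurable:
 fixes V :: "'a::{real_inner, polish_space} \<Rightarrow> ereal"
 assumes V: "convex_potential V" and D[measurable]: "diff_dom V \<in> sets borel"
 shows "(\<lambda>x. gradV V x \<bullet> h) \<in> borel_measurable borel"
proof -
 have Vm[measurable]: "V \<in> borel_measurable borel" by (rule convex_potential_measurable[OF V])
 show ?thesis
 proof (rule borel_measurable_LIMSEQ_metric)
  let ?f = "\<lambda>n x. if x \<in> diff_dom V then real_of_ereal ((V (x + (1 / Suc n) *\<^sub>R h) - V x) / ereal (1 / Suc n)) else 0"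
  show "?f n \<in> borel_measurable borel" for n by measurable
  fix x
  show "(\<lambda>n. ?f n x) \<longlonglongrightarrow> gradV V x \<bullet> h"
  proof (cases "x \<in> diff_dom V")
   case True
   have lim: "((\<lambda>s::real. (V (x + s *\<^sub>R h) - V x) / ereal s) \<longlongrightarrow> ereal (gradV V x \<bullet> h)) (at 0)"
    using has_gateaux_gradient_gradV[OF True] by (simp add: has_gateaux_gradient_def)
   have "filterlim (\<lambda>n. 1 / real (Suc n)) (at 0) sequentially"
    using LIMSEQ_inverse_real_of_nat by (auto simp: filterlim_at inverse_eq_divide)
   from lim_real_of_ereal[OF filterlim_compose[OF lim this]] show ?thesis using True by simp
  qed (simp add: gradV_def)
 qed
qed

lemma gradV_measurable:
 fixes V :: "'a::{real_inner, polish_space} \<Rightarrow> ereal" and e :: "nat \<Rightarrow> 'a"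
 assumes V: "convex_potential V" and D: "diff_dom V \<in> sets borel" and e: "orthonormal_basis e"
 shows "gradV V \<in> borel_measurable borel"
proof (rule borel_measurable_LIMSEQ_metric)
 note [measurable] = gradV_inner_measurable[OF V D]
 show "(\<lambda>x. basis_proj e n (gradV V x)) \<in> borel_measurable borel" for n
  unfolding basis_proj_def by measurable
 show "(\<lambda>n. basis_proj e n (gradV V x)) \<longlonglongrightarrow> gradV V x" for x by (rule basis_proj_tendsto[OF e])
qed

text \<open>The drift is tested against the finitely many directions that approximate the compact path
 relative to the centre of a ball on which the potential is bounded.\<close>

lemma path_gradV_integrable:
 fixes V :: "'a::{real_inner, polish_space} \<Rightarrow> ereal" and x :: "real \<Rightarrow> 'a" and e :: "nat \<Rightarrow> 'a"
 assumes V: "convex_potential V" and D[measurable]: "diff_dom V \<in> sets borel" and ne: "diff_dom V \<noteq> {}"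
  and e: "orthonormal_basis e"
  and x: "continuous_on UNIV x" and dom: "AE s in lborel. s \<in> {0..T} \<longrightarrow> x s \<in> diff_dom V"
  and fin: "\<And>k. (\<integral>\<^sup>+s\<in>{0..T}. ennreal \<bar>gradV V (x s) \<bullet> e k\<bar> \<partial>lborel) < \<infinity>"
 shows "set_integrable lborel {0..T} (\<lambda>s. norm (gradV V (x s)))"
proof -
 have [measurable]: "x \<in> borel_measurable borel" using x by (rule borel_measurable_continuous_onI)
 note [measurable] = gradV_measurable[OF V D e]
 obtain u r C where r: "0 < r" and coer: "\<And>y. y \<in> diff_dom V \<Longrightarrow> r * norm (gradV V y) \<le> gradV V y \<bullet> (y - u) + C"
  using gradV_coercive[OF V ne] by blast
 have comp: "compact ((\<lambda>s. x s - u) ` {0..T})"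
  by (intro compact_continuous_image continuous_intros continuous_on_subset[OF x]) auto
 \<comment> \<open>Beyond n coordinates the shifted path has norm below r/2, so its pairing with the
   gradient can be absorbed into the left side of the coercivity estimate, of which r/2 times the
   norm remains.\<close>
 obtain n where n: "\<forall>y\<in>(\<lambda>s. x s - u) ` {0..T}. norm (basis_proj e n y - y) < r/2"
  using basis_proj_uniform_compact[OF e comp, of "r/2"] r by auto
 obtain B where B: "\<And>s. s \<in> {0..T} \<Longrightarrow> norm (x s - u) \<le> B" using compact_imp_bounded[OF comp] unfolding bounded_iff by blast
 have int: "set_integrable lborel {0..T} (\<lambda>s. \<bar>gradV V (x s) \<bullet> e k\<bar>)" for k
  unfolding set_integrable_def
  by (rule integrableI_nonneg) (use fin[of k] in \<open>auto simp: ennreal_mult'' ennreal_indicator mult.commute\<close>)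
 have bnd: "norm (gradV V (x s)) \<le> (2 / r) * (B * (\<Sum>k<n. \<bar>gradV V (x s) \<bullet> e k\<bar>) + \<bar>C\<bar>)"
  if s: "s \<in> {0..T}" "x s \<in> diff_dom V" for s
 proof -
  let ?g = "gradV V (x s)" and ?y = "x s - u"
  have "norm (e k) = 1" for k using e by (auto simp: orthonormal_basis_def norm_eq_sqrt_inner)
  then have yk: "\<bar>?y \<bullet> e k\<bar> \<le> B" for k using Cauchy_Schwarz_ineq2[of ?y "e k"] B[OF s(1)] by simp
  have "?g \<bullet> ?y = basis_proj e n ?y \<bullet> ?g - (basis_proj e n ?y - ?y) \<bullet> ?g" by (simp only: inner_diff_left) (simp add: inner_commute[of ?g] inner_diff_left)
  also have "... \<le> basis_proj e n ?y \<bullet> ?g + r/2 * norm ?g"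
  proof -
   have "\<bar>(basis_proj e n ?y - ?y) \<bullet> ?g\<bar> \<le> norm (basis_proj e n ?y - ?y) * norm ?g" by (rule Cauchy_Schwarz_ineq2)
   also have "... \<le> r/2 * norm ?g" using n s(1) by (intro mult_right_mono) (auto intro: less_imp_le)
   finally show ?thesis by linarith
  qed
  also have "basis_proj e n ?y \<bullet> ?g \<le> (\<Sum>k<n. B * \<bar>?g \<bullet> e k\<bar>)"
   unfolding basis_proj_inner
  proof (rule sum_mono)
   fix k
   have "(?y \<bullet> e k) * (?g \<bullet> e k) \<le> \<bar>?y \<bullet> e k\<bar> * \<bar>?g \<bullet> e k\<bar>" by (metis abs_ge_self abs_mult)
   also have "... \<le> B * \<bar>?g \<bullet> e k\<bar>" using yk[of k] by (intro mult_right_mono) auto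
   finally show "(?y \<bullet> e k) * (?g \<bullet> e k) \<le> B * \<bar>?g \<bullet> e k\<bar>" .
  qed
  finally have "r * norm ?g \<le> B * (\<Sum>k<n. \<bar>?g \<bullet> e k\<bar>) + r/2 * norm ?g + C"
   using coer[OF s(2)] by (simp add: sum_distrib_left)
  then have "r/2 * norm ?g \<le> B * (\<Sum>k<n. \<bar>?g \<bullet> e k\<bar>) + \<bar>C\<bar>" by linarith
  then show ?thesis using r by (simp add: field_simps)
 qed
 have "set_integrable lborel {0..T} (\<lambda>s. (2 / r) * (B * (\<Sum>k<n. \<bar>gradV V (x s) \<bullet> e k\<bar>) + \<bar>C\<bar>))"
 proof -
  have ind: "integrable lborel (indicat_real {0..T})"
   by (rule integrable_real_indicator) (auto simp: emeasure_lborel_Icc_eq)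
  have "integrable lborel (\<lambda>s. (2 / r * B) * (\<Sum>k<n. indicat_real {0..T} s *\<^sub>R \<bar>gradV V (x s) \<bullet> e k\<bar>) + (2 / r * \<bar>C\<bar>) * indicat_real {0..T} s)"
   using int by (intro Bochner_Integration.integrable_add integrable_mult_right Bochner_Integration.integrable_sum)
    (auto simp: set_integrable_def intro: ind)
  then show ?thesis
   unfolding set_integrable_def
  proof (rule Bochner_Integration.integrable_cong[THEN iffD1, rotated -1])
   fix s
   show "2 / r * B * (\<Sum>k<n. indicat_real {0..T} s *\<^sub>R \<bar>gradV V (x s) \<bullet> e k\<bar>) + 2 / r * \<bar>C\<bar> * indicat_real {0..T} s
    = indicat_real {0..T} s *\<^sub>R (2 / r * (B * (\<Sum>k<n. \<bar>gradV V (x s) \<bullet> e k\<bar>) + \<bar>C\<bar>))"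
    by (cases "s \<in> {0..T}") (simp_all add: algebra_simps)
  qed simp
 qed
 then show ?thesis
  unfolding set_integrable_def
 proof (rule Bochner_Integration.integrable_bound)
  show "AE s in lborel. norm (indicat_real {0..T} s *\<^sub>R norm (gradV V (x s)))
    \<le> norm (indicat_real {0..T} s *\<^sub>R (2 / r * (B * (\<Sum>k<n. \<bar>gradV V (x s) \<bullet> e k\<bar>) + \<bar>C\<bar>)))"
   using dom
  proof eventually_elim
   case (elim s)
   show ?case
   proof (cases "s \<in> {0..T}")
    case True
    then show ?thesis using bnd[OF True] elim by (simp add: abs_if)
   qed simp
  qed
 qed measurable
qed

section \<open>The energy identity and uniqueness for monotone flows\<close>

lemma square_of_integral:
 fixes f :: "real \<Rightarrow> real"
 assumes f: "set_integrable lborel {0..T} f" and t: "t \<in> {0..T}"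
 shows "(LINT s:{0..t}|lborel. f s)\<^sup>2 = 2 * (LINT s:{0..t}|lborel. (LINT r:{0..s}|lborel. f r) * f s)"
  and "set_integrable lborel {0..t} (\<lambda>s. (LINT r:{0..s}|lborel. f r) * f s)"
proof -
 define F where "F = (\<lambda>s. indicat_real {0..t} s * f s)"
 have Fint: "integrable lborel F"
  using set_integrable_subset[OF f, of "{0..t}"] t by (simp add: F_def set_integrable_def)
 then have [measurable]: "F \<in> borel_measurable borel" by auto
 let ?I = "\<integral>s. F s \<partial>lborel"
 have prod_int: "integrable (lborel \<Otimes>\<^sub>M lborel) (\<lambda>(s, r). F s * F r)"
  using Fint by (intro lborel_pair.Fubini_integrable) (auto simp: abs_mult)
 \<comment> \<open>The square of the integral is a double integral of f(s) f(r). \<open>G\<close>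
   and \<open>H\<close> are its restrictions to the triangles r \<le> s and s < r; by Fubini and
   symmetry they contribute equally, the diagonal being null. No differentiation of the indefinite
   integral is involved.\<close>
 define G where "G = (\<lambda>(s, r). F s * F r * indicat_real {p. snd p \<le> fst p} (s, r))"
 define H where "H = (\<lambda>(s, r). F s * F r * indicat_real {p. fst p < snd p} (s, r))"
 have ms[measurable]: "{p::real\<times>real. snd p \<le> fst p} \<in> sets (lborel \<Otimes>\<^sub>M lborel)" "{p::real\<times>real. fst p < snd p} \<in> sets (lborel \<Otimes>\<^sub>M lborel)"
 proof -
  have "{p \<in> space (lborel \<Otimes>\<^sub>M lborel). snd p \<le> (fst p::real)} \<in> sets (lborel \<Otimes>\<^sub>M lborel)"
    "{p \<in> space (lborel \<Otimes>\<^sub>M lborel). fst p < (snd p::real)} \<in> sets (lborel \<Otimes>\<^sub>M lborel)" by measurable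
  then show "{p::real\<times>real. snd p \<le> fst p} \<in> sets (lborel \<Otimes>\<^sub>M lborel)" "{p::real\<times>real. fst p < snd p} \<in> sets (lborel \<Otimes>\<^sub>M lborel)"
   by (simp_all add: space_pair_measure)
 qed
 have Gi: "integrable (lborel \<Otimes>\<^sub>M lborel) G" and Hi: "integrable (lborel \<Otimes>\<^sub>M lborel) H"
  unfolding G_def H_def
  by (rule Bochner_Integration.integrable_bound[OF prod_int]; auto split: split_indicator)+
 have dF: "(\<integral>r. F r * indicator {r. r \<le> s} r \<partial>lborel) = (LINT r:{0..s}|lborel. f r)" if "s \<in> {0..t}" for s
  unfolding set_lebesgue_integral_def using that by (intro Bochner_Integration.integral_cong) (auto simp: F_def split: split_indicator)
 have Gs: "(\<integral>r. G (s, r) \<partial>lborel) = indicat_real {0..t} s * ((LINT r:{0..s}|lborel. f r) * f s)" for s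
 proof (cases "s \<in> {0..t}")
  case True
  have "(\<integral>r. G (s, r) \<partial>lborel) = (\<integral>r. F s * (F r * indicator {r. r \<le> s} r) \<partial>lborel)"
   by (intro Bochner_Integration.integral_cong) (auto simp: G_def split: split_indicator)
  also have "... = F s * (LINT r:{0..s}|lborel. f r)" by (simp only: integral_mult_right_zero dF[OF True])
  finally show ?thesis using True by (simp add: F_def)
 next
  case False then show ?thesis by (simp add: G_def F_def)
 qed
 have Hr: "(\<integral>s. H (s, r) \<partial>lborel) = indicat_real {0..t} r * ((LINT s:{0..r}|lborel. f s) * f r)" for r
 proof (cases "r \<in> {0..t}")
  case True
  have "(\<integral>s. H (s, r) \<partial>lborel) = (\<integral>s. F r * (F s * indicator {s. s \<le> r} s) \<partial>lborel)"
  proof (rule integral_cong_AE)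
   have "AE s in lborel. s \<noteq> r" by (rule AE_lborel_singleton)
   then show "AE s in lborel. H (s, r) = F r * (F s * indicator {s. s \<le> r} s)"
    by eventually_elim (auto simp: H_def split: split_indicator)
  qed (auto simp: H_def)
  also have "... = F r * (LINT s:{0..r}|lborel. f s)" by (simp only: integral_mult_right_zero dF[OF True])
  finally show ?thesis using True by (simp add: F_def)
 next
  case False then show ?thesis by (simp add: H_def F_def)
 qed
 have iG: "(\<integral>p. G p \<partial>(lborel \<Otimes>\<^sub>M lborel)) = (LINT s:{0..t}|lborel. (LINT r:{0..s}|lborel. f r) * f s)"
  unfolding lborel_pair.integral_fst'[OF Gi, symmetric] Gs by (simp add: set_lebesgue_integral_def)
 have iH: "(\<integral>p. H p \<partial>(lborel \<Otimes>\<^sub>M lborel)) = (LINT s:{0..t}|lborel. (LINT r:{0..s}|lborel. f r) * f s)"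
  using lborel_pair.integral_snd[of "\<lambda>s r. H (s, r)"] Hi Hr by (simp add: set_lebesgue_integral_def)
 have "?I\<^sup>2 = (\<integral>s. (\<integral>r. F s * F r \<partial>lborel) \<partial>lborel)" by (simp add: power2_eq_square)
 also have "... = (\<integral>p. (\<lambda>(s, r). F s * F r) p \<partial>(lborel \<Otimes>\<^sub>M lborel))"
  using lborel_pair.integral_fst'[OF prod_int] by simp
 also have "... = (\<integral>p. G p + H p \<partial>(lborel \<Otimes>\<^sub>M lborel))"
  by (intro Bochner_Integration.integral_cong) (auto simp: G_def H_def split: split_indicator)
 also have "... = (\<integral>p. G p \<partial>(lborel \<Otimes>\<^sub>M lborel)) + (\<integral>p. H p \<partial>(lborel \<Otimes>\<^sub>M lborel))"
  by (rule Bochner_Integration.integral_add[OF Gi Hi])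
 finally show "(LINT s:{0..t}|lborel. f s)\<^sup>2 = 2 * (LINT s:{0..t}|lborel. (LINT r:{0..s}|lborel. f r) * f s)"
  unfolding iG iH by (simp add: set_lebesgue_integral_def F_def)
 have "integrable lborel (\<lambda>s. \<integral>r. G (s, r) \<partial>lborel)" by (rule lborel_pair.integrable_fst'[OF Gi])
 then show "set_integrable lborel {0..t} (\<lambda>s. (LINT r:{0..s}|lborel. f r) * f s)"
  unfolding Gs by (simp add: set_integrable_def)
qed

text \<open>The energy identity is used coordinatewise only, since the difference of two solutions is
 not known to lie in the domain of \<open>A\<close>.\<close>

lemma monotone_flow_unique:
 fixes d g :: "real \<Rightarrow> 'a::{real_inner, polish_space}"
 assumes e: "orthonormal_basis e"
  and d: "continuous_on {0..T} d" and l: "\<And>k. l k \<le> 0"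
  and gint: "set_integrable lborel {0..T} (\<lambda>s. norm (g s))"
  and gk: "\<And>k. set_borel_measurable lborel {0..T} (\<lambda>s. g s \<bullet> e k)"
  and mono: "AE s in lborel. s \<in> {0..T} \<longrightarrow> 0 \<le> d s \<bullet> g s"
  and eq: "\<And>k t. t \<in> {0..T} \<Longrightarrow> d t \<bullet> e k = (LINT s:{0..t}|lborel. l k * (d s \<bullet> e k) - g s \<bullet> e k)"
  and t: "t \<in> {0..T}"
 shows "d t = 0"
proof -
 have ne: "norm (e k) = 1" for k using e by (auto simp: orthonormal_basis_def norm_eq_sqrt_inner)
 obtain B where B: "\<And>s. s \<in> {0..T} \<Longrightarrow> norm (d s) \<le> B" "B \<ge> 0"
 proof -
  have "bounded (d ` {0..T})" by (intro compact_imp_bounded compact_continuous_image d) auto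
  then obtain B where "\<forall>x\<in>d ` {0..T}. norm x \<le> B" unfolding bounded_iff by blast
  then show ?thesis using that[of "max B 0"] by force
 qed
 have dk: "set_integrable lborel {0..T} (\<lambda>s. d s \<bullet> e k)" for k
  by (rule borel_integrable_atLeastAtMost'[OF continuous_on_inner[OF d continuous_on_const]])
 have gki: "set_integrable lborel {0..T} (\<lambda>s. g s \<bullet> e k)" for k
 proof (rule set_integrable_bound[OF gint gk])
  show "AE x in lborel. x \<in> {0..T} \<longrightarrow> norm (g x \<bullet> e k) \<le> norm (norm (g x))"
   using Cauchy_Schwarz_ineq2[of _ "e k"] by (auto simp: ne)
 qed
 let ?f = "\<lambda>k s. l k * (d s \<bullet> e k) - g s \<bullet> e k"
 have fi: "set_integrable lborel {0..T} (?f k)" for k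
  by (intro set_integral_diff(1) set_integrable_mult_right dk gki)
 have sub: "{0..t} \<subseteq> {0..T}" using t by auto
 have int1: "set_integrable lborel {0..t} (\<lambda>s. (d s \<bullet> e k) * ?f k s)" and sq: "(d t \<bullet> e k)\<^sup>2 = 2 * (LINT s:{0..t}|lborel. (d s \<bullet> e k) * ?f k s)" for k
 proof -
  have c: "(LINT r:{0..s}|lborel. ?f k r) * ?f k s = (d s \<bullet> e k) * ?f k s" if "s \<in> {0..t}" for s
  proof -
   have "s \<in> {0..T}" using that sub by blast
   then show ?thesis by (simp only: eq[symmetric])
  qed
  show "set_integrable lborel {0..t} (\<lambda>s. (d s \<bullet> e k) * ?f k s)"
   using square_of_integral(2)[OF fi[of k] t] c by (subst set_integrable_cong[OF refl refl, symmetric]) auto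
  show "(d t \<bullet> e k)\<^sup>2 = 2 * (LINT s:{0..t}|lborel. (d s \<bullet> e k) * ?f k s)"
   using square_of_integral(1)[OF fi[of k] t] eq[OF t, of k] c
   by (subst set_lebesgue_integral_cong[symmetric, where f="\<lambda>s. (LINT r:{0..s}|lborel. ?f k r) * ?f k s"]) auto
 qed
 have dgi: "set_integrable lborel {0..t} (\<lambda>s. (d s \<bullet> e k) * (g s \<bullet> e k))" for k
 proof (rule set_integrable_bound[where f="\<lambda>s. B * norm (g s)"])
  show "set_integrable lborel {0..t} (\<lambda>s. B * norm (g s))"
   by (intro set_integrable_mult_right set_integrable_subset[OF gint]) (use t in auto)
  have "set_borel_measurable lborel {0..T} (\<lambda>s. (d s \<bullet> e k) * (g s \<bullet> e k))"
  proof -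
   have "(\<lambda>s. (indicat_real {0..T} s *\<^sub>R (d s \<bullet> e k)) * (indicat_real {0..T} s *\<^sub>R (g s \<bullet> e k))) \<in> borel_measurable lborel"
    using dk[of k] gk[of k] unfolding set_integrable_def set_borel_measurable_def by (intro borel_measurable_times) auto
   moreover have "(\<lambda>s. (indicat_real {0..T} s *\<^sub>R (d s \<bullet> e k)) * (indicat_real {0..T} s *\<^sub>R (g s \<bullet> e k))) = (\<lambda>s. indicat_real {0..T} s *\<^sub>R ((d s \<bullet> e k) * (g s \<bullet> e k)))"
    by (auto split: split_indicator)
   ultimately show ?thesis unfolding set_borel_measurable_def by simp
  qed
  then show "set_borel_measurable lborel {0..t} (\<lambda>s. (d s \<bullet> e k) * (g s \<bullet> e k))"
   by (rule set_borel_measurable_subset) (use t in auto)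
  show "AE s in lborel. s \<in> {0..t} \<longrightarrow> norm (d s \<bullet> e k * (g s \<bullet> e k)) \<le> norm (B * norm (g s))"
  proof (intro AE_I2 impI)
   fix s assume s: "s \<in> {0..t}"
   have "\<bar>d s \<bullet> e k\<bar> \<le> B" using Cauchy_Schwarz_ineq2[of "d s" "e k"] B(1)[of s] s sub by (auto simp: ne)
   moreover have "\<bar>g s \<bullet> e k\<bar> \<le> norm (g s)" using Cauchy_Schwarz_ineq2[of "g s" "e k"] by (simp add: ne)
   ultimately show "norm (d s \<bullet> e k * (g s \<bullet> e k)) \<le> norm (B * norm (g s))"
    using B(2) by (simp add: abs_mult mult_mono)
  qed
 qed
 have sumi: "set_integrable lborel {0..t} (\<lambda>s. \<Sum>k<n. (d s \<bullet> e k) * (g s \<bullet> e k))" for n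
  using dgi unfolding set_integrable_def scaleR_sum_right by (intro Bochner_Integration.integrable_sum)
 have "(\<Sum>k<n. (d t \<bullet> e k)\<^sup>2) \<le> - 2 * (LINT s:{0..t}|lborel. \<Sum>k<n. (d s \<bullet> e k) * (g s \<bullet> e k))" for n
 proof -
  have "(d t \<bullet> e k)\<^sup>2 \<le> - 2 * (LINT s:{0..t}|lborel. (d s \<bullet> e k) * (g s \<bullet> e k))" for k
  proof -
   have "(LINT s:{0..t}|lborel. (d s \<bullet> e k) * ?f k s) \<le> (LINT s:{0..t}|lborel. - ((d s \<bullet> e k) * (g s \<bullet> e k)))"
   proof (rule set_integral_mono[OF int1])
    show "set_integrable lborel {0..t} (\<lambda>s. - ((d s \<bullet> e k) * (g s \<bullet> e k)))" using dgi[of k] by (simp add: set_integrable_def)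
    fix s
    have "l k * (d s \<bullet> e k)\<^sup>2 \<le> 0" using l by (simp add: mult_nonpos_nonneg)
    then show "(d s \<bullet> e k) * ?f k s \<le> - ((d s \<bullet> e k) * (g s \<bullet> e k))" by (simp add: algebra_simps power2_eq_square)
   qed
   also have "... = - (LINT s:{0..t}|lborel. (d s \<bullet> e k) * (g s \<bullet> e k))" by (simp add: set_lebesgue_integral_def)
   finally show ?thesis by (simp add: sq)
  qed
  then have "(\<Sum>k<n. (d t \<bullet> e k)\<^sup>2) \<le> (\<Sum>k<n. - 2 * (LINT s:{0..t}|lborel. (d s \<bullet> e k) * (g s \<bullet> e k)))" by (intro sum_mono)
  also have "... = - 2 * (\<Sum>k<n. LINT s:{0..t}|lborel. (d s \<bullet> e k) * (g s \<bullet> e k))" by (simp add: sum_distrib_left)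
  also have "(\<Sum>k<n. LINT s:{0..t}|lborel. (d s \<bullet> e k) * (g s \<bullet> e k)) = (LINT s:{0..t}|lborel. \<Sum>k<n. (d s \<bullet> e k) * (g s \<bullet> e k))"
   using dgi unfolding set_lebesgue_integral_def set_integrable_def scaleR_sum_right
   by (subst Bochner_Integration.integral_sum) auto
  finally show ?thesis .
 qed
 moreover have "(\<lambda>n. \<Sum>k<n. (d t \<bullet> e k)\<^sup>2) \<longlonglongrightarrow> (norm (d t))\<^sup>2"
  using inner_basis_sums[OF e, of "d t" "d t"] by (simp add: power2_eq_square power2_norm_eq_inner[unfolded power2_eq_square])
 moreover have "(\<lambda>n. LINT s:{0..t}|lborel. \<Sum>k<n. (d s \<bullet> e k) * (g s \<bullet> e k)) \<longlonglongrightarrow> (LINT s:{0..t}|lborel. d s \<bullet> g s)"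
  unfolding set_lebesgue_integral_def
 proof (rule integral_dominated_convergence[where w="\<lambda>s. indicat_real {0..t} s *\<^sub>R (B * norm (g s))"])
  have lim: "(\<lambda>n. indicat_real {0..t} s *\<^sub>R (\<Sum>k<n. (d s \<bullet> e k) * (g s \<bullet> e k))) \<longlonglongrightarrow> indicat_real {0..t} s *\<^sub>R (d s \<bullet> g s)" for s
   by (intro tendsto_intros inner_basis_sums[OF e])
  then show "AE s in lborel. (\<lambda>n. indicat_real {0..t} s *\<^sub>R (\<Sum>k<n. (d s \<bullet> e k) * (g s \<bullet> e k))) \<longlonglongrightarrow> indicat_real {0..t} s *\<^sub>R (d s \<bullet> g s)" by simp
  show m: "(\<lambda>s. indicat_real {0..t} s *\<^sub>R (\<Sum>k<n. (d s \<bullet> e k) * (g s \<bullet> e k))) \<in> borel_measurable lborel" for n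
   using sumi[of n] by (simp add: set_integrable_def)
  show "(\<lambda>s. indicat_real {0..t} s *\<^sub>R (d s \<bullet> g s)) \<in> borel_measurable lborel"
   by (rule borel_measurable_LIMSEQ_metric[OF m lim])
  show "integrable lborel (\<lambda>s. indicat_real {0..t} s *\<^sub>R (B * norm (g s)))"
   using set_integrable_mult_right[OF set_integrable_subset[OF gint, of "{0..t}"], of B] t by (simp add: set_integrable_def)
  show "AE s in lborel. norm (indicat_real {0..t} s *\<^sub>R (\<Sum>k<n. d s \<bullet> e k * (g s \<bullet> e k))) \<le> indicat_real {0..t} s *\<^sub>R (B * norm (g s))" for n
  proof (intro AE_I2)
   fix s
   show "norm (indicat_real {0..t} s *\<^sub>R (\<Sum>k<n. d s \<bullet> e k * (g s \<bullet> e k))) \<le> indicat_real {0..t} s *\<^sub>R (B * norm (g s))"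
   proof (cases "s \<in> {0..t}")
    case True
    have "\<bar>basis_proj e n (d s) \<bullet> g s\<bar> \<le> norm (basis_proj e n (d s)) * norm (g s)" by (rule Cauchy_Schwarz_ineq2)
    also have "... \<le> B * norm (g s)" using norm_basis_proj_le[OF e, of n "d s"] B(1)[of s] True sub
     by (intro mult_right_mono) (auto intro: order_trans)
    finally show ?thesis using True by (simp add: basis_proj_inner)
   qed simp
  qed
 qed
 ultimately have "(norm (d t))\<^sup>2 \<le> - 2 * (LINT s:{0..t}|lborel. d s \<bullet> g s)"
  by (intro LIMSEQ_le[of "\<lambda>n. \<Sum>k<n. (d t \<bullet> e k)\<^sup>2" _ "\<lambda>n. - 2 * (LINT s:{0..t}|lborel. \<Sum>k<n. (d s \<bullet> e k) * (g s \<bullet> e k))"] tendsto_intros) auto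
 moreover have "0 \<le> (LINT s:{0..t}|lborel. d s \<bullet> g s)"
  unfolding set_lebesgue_integral_def
 proof (rule Bochner_Integration.integral_nonneg_AE)
  show "AE s in lborel. 0 \<le> indicat_real {0..t} s *\<^sub>R (d s \<bullet> g s)"
   using mono by eventually_elim (use sub in \<open>auto split: split_indicator\<close>)
 qed
 ultimately have "(norm (d t))\<^sup>2 \<le> 0" by linarith
 then show ?thesis by simp
qed

section \<open>Joint laws from exponential moments\<close>

lemma normalised_law:
 fixes xi :: "'w \<Rightarrow> real"
 assumes [measurable]: "xi \<in> borel_measurable M" "g \<in> borel_measurable M" and r: "0 < r" "(\<integral>\<^sup>+om. g om \<partial>M) = ennreal r"
 shows "\<exists>\<mu>. real_distribution \<mu> \<and> (\<forall>f\<in>borel_measurable borel. (\<integral>\<^sup>+x. f x \<partial>\<mu>) = ennreal (1/r) * (\<integral>\<^sup>+om. g om * f (xi om) \<partial>M))"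
proof -
 define \<mu> where "\<mu> = distr (density M (\<lambda>om. ennreal (1/r) * g om)) borel xi"
 have int: "(\<integral>\<^sup>+x. f x \<partial>\<mu>) = ennreal (1/r) * (\<integral>\<^sup>+om. g om * f (xi om) \<partial>M)" if [measurable]: "f \<in> borel_measurable borel" for f
 proof -
  have "(\<integral>\<^sup>+x. f x \<partial>\<mu>) = (\<integral>\<^sup>+om. f (xi om) \<partial>density M (\<lambda>om. ennreal (1/r) * g om))"
   unfolding \<mu>_def by (intro nn_integral_distr) measurable
  also have "... = (\<integral>\<^sup>+om. (ennreal (1/r) * g om) * f (xi om) \<partial>M)" by (rule nn_integral_density) measurable
  finally show ?thesis by (simp add: mult.assoc nn_integral_cmult)
 qed
 have "ennreal (1/r) * ennreal r = 1" using r by (simp add: ennreal_mult[symmetric] del: ennreal_mult')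
 then have "prob_space \<mu>" using int[of "\<lambda>_. 1"] r by (intro prob_spaceI) simp
 then have "real_distribution \<mu>" by (simp add: real_distribution_def real_distribution_axioms_def \<mu>_def)
 then show ?thesis using int by blast
qed

text \<open>The weights will carry the coordinates of a joint law that are not being treated. Their
  total mass is the moment at t = 0; positive mass is normalised to a probability, and zero mass
  makes both sides vanish.\<close>

lemma weighted_law_eqI_exp_moments:
 fixes xi1 :: "'w \<Rightarrow> real" and xi2 :: "'v \<Rightarrow> real"
 assumes [measurable]: "xi1 \<in> borel_measurable M1" "xi2 \<in> borel_measurable M2"
   "g1 \<in> borel_measurable M1" "g2 \<in> borel_measurable M2"
  and fin: "\<And>t. (\<integral>\<^sup>+om. g1 om * ennreal (exp (t * xi1 om)) \<partial>M1) < \<infinity>"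
  and eq: "\<And>t. (\<integral>\<^sup>+om. g1 om * ennreal (exp (t * xi1 om)) \<partial>M1) = (\<integral>\<^sup>+om. g2 om * ennreal (exp (t * xi2 om)) \<partial>M2)"
  and C[measurable]: "C \<in> sets borel"
 shows "(\<integral>\<^sup>+om. g1 om * indicator C (xi1 om) \<partial>M1) = (\<integral>\<^sup>+om. g2 om * indicator C (xi2 om) \<partial>M2)" (is "?X1 = ?X2")
proof -
 obtain r where r: "0 \<le> r" "(\<integral>\<^sup>+om. g1 om \<partial>M1) = ennreal r" using fin[of 0] by (auto elim: ennreal_cases[where x="\<integral>\<^sup>+om. g1 om \<partial>M1"])
 have r2: "(\<integral>\<^sup>+om. g2 om \<partial>M2) = ennreal r" using eq[of 0] r by simp
 have "?X1 \<le> (\<integral>\<^sup>+om. g1 om \<partial>M1)" "?X2 \<le> (\<integral>\<^sup>+om. g2 om \<partial>M2)"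
  by (intro nn_integral_mono; auto split: split_indicator)+
 note le = this[unfolded r r2]
 show ?thesis
 proof (cases "r = 0")
  case True
  then show ?thesis using le by simp
 next
  case False
  then have k: "ennreal (1/r) * ennreal r = 1" using r by (simp add: ennreal_mult[symmetric] del: ennreal_mult')
  have r0: "0 < r" using r False by simp
  obtain \<mu>1 where 1: "real_distribution \<mu>1" "\<And>f. f \<in> borel_measurable borel \<Longrightarrow> (\<integral>\<^sup>+x. f x \<partial>\<mu>1) = ennreal (1/r) * (\<integral>\<^sup>+om. g1 om * f (xi1 om) \<partial>M1)"
   using normalised_law[OF assms(1,3) r0 r(2)] by blast
  obtain \<mu>2 where 2: "real_distribution \<mu>2" "\<And>f. f \<in> borel_measurable borel \<Longrightarrow> (\<integral>\<^sup>+x. f x \<partial>\<mu>2) = ennreal (1/r) * (\<integral>\<^sup>+om. g2 om * f (xi2 om) \<partial>M2)"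
   using normalised_law[OF assms(2,4) r0 r2] by blast
  have "\<mu>1 = \<mu>2"
   using fin by (intro real_distribution_eqI_exp_moments 1(1) 2(1)) (simp_all add: 1(2) 2(2) eq ennreal_mult_less_top)
  then have "ennreal (1/r) * ?X1 = ennreal (1/r) * ?X2" using 1(2)[of "indicator C"] 2(2)[of "indicator C"] by simp
  then have "ennreal (1/r) * ennreal r * ?X1 = ennreal (1/r) * ennreal r * ?X2" by (simp only: mult.commute[of _ "ennreal r"] mult.assoc)
  then show ?thesis by (simp add: k)
 qed
qed

text \<open>In the exponential moment of a linear combination the exponentials are replaced by indicators
 one coordinate at a time.\<close>

lemma joint_law_eqI_exp_moments:
 fixes xi1 :: "'i \<Rightarrow> 'w \<Rightarrow> real" and xi2 :: "'i \<Rightarrow> 'v \<Rightarrow> real"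
 assumes M: "prob_space M1"
  and m1[measurable]: "\<And>i. xi1 i \<in> borel_measurable M1" and m2[measurable]: "\<And>i. xi2 i \<in> borel_measurable M2"
  and fin: "\<And>K a. finite K \<Longrightarrow> (\<integral>\<^sup>+om. ennreal (exp (\<Sum>i\<in>K. a i * xi1 i om)) \<partial>M1) < \<infinity>"
  and eq: "\<And>K a. finite K \<Longrightarrow> (\<integral>\<^sup>+om. ennreal (exp (\<Sum>i\<in>K. a i * xi1 i om)) \<partial>M1) = (\<integral>\<^sup>+om. ennreal (exp (\<Sum>i\<in>K. a i * xi2 i om)) \<partial>M2)"
 shows "distr M1 (\<Pi>\<^sub>M i\<in>UNIV. borel) (\<lambda>om i. xi1 i om) = distr M2 (\<Pi>\<^sub>M i\<in>UNIV. borel) (\<lambda>om i. xi2 i om)"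
proof -
 interpret prob_space M1 by fact
 have step: "(\<integral>\<^sup>+om. (\<Prod>i\<in>J. indicator (C i) (xi1 i om)) * ennreal (exp (\<Sum>i\<in>K. a i * xi1 i om)) \<partial>M1)
   = (\<integral>\<^sup>+om. (\<Prod>i\<in>J. indicator (C i) (xi2 i om)) * ennreal (exp (\<Sum>i\<in>K. a i * xi2 i om)) \<partial>M2)"
  if K: "finite K" and J: "J \<subseteq> K" and C: "\<And>i. C i \<in> sets borel" for J K a and C :: "'i \<Rightarrow> real set"
  using finite_subset[OF J K] J
 proof (induction J arbitrary: a rule: finite_induct)
  case empty
  then show ?case using eq[OF K] by simp
 next
  case (insert j J)
  note [measurable] = C
  let ?g = "\<lambda>xi om. (\<Prod>i\<in>J. indicator (C i) (xi i om)) * ennreal (exp (\<Sum>i\<in>K. a i * xi i om))"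
  have jK: "j \<in> K" using insert by auto
  \<comment> \<open>An additional exponential in the coordinate \<open>j\<close> is absorbed by
    changing the coefficient \<open>a j\<close>. The induction hypothesis holds for all
    coefficients, hence supplies every exponential moment of that coordinate under the
    weight.\<close>
  have sh: "?g xi om * ennreal (exp (t * xi j om)) = (\<Prod>i\<in>J. indicator (C i) (xi i om)) * ennreal (exp (\<Sum>i\<in>K. (a i + (if i = j then t else 0)) * xi i om))"
   for t om and xi :: "'i \<Rightarrow> 'z \<Rightarrow> real"
  proof -
   have "(\<Sum>i\<in>K. (a i + (if i = j then t else 0)) * xi i om) = (\<Sum>i\<in>K. a i * xi i om) + t * xi j om"
    using jK K by (simp add: distrib_right sum.distrib if_distrib[of "\<lambda>x. x * _"] cong: if_cong)
   then show ?thesis by (simp add: mult.assoc ennreal_mult exp_add)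
  qed
  have "(\<integral>\<^sup>+om. ?g xi1 om * indicator (C j) (xi1 j om) \<partial>M1) = (\<integral>\<^sup>+om. ?g xi2 om * indicator (C j) (xi2 j om) \<partial>M2)"
  proof (rule weighted_law_eqI_exp_moments)
   fix t
   have "(\<Prod>i\<in>J. indicator (C i) (xi1 i om)) \<le> (1::ennreal)" for om by (intro prod_le_1) (auto split: split_indicator)
   then have "(\<integral>\<^sup>+om. ?g xi1 om * ennreal (exp (t * xi1 j om)) \<partial>M1) \<le> (\<integral>\<^sup>+om. 1 * ennreal (exp (\<Sum>i\<in>K. (a i + (if i = j then t else 0)) * xi1 i om)) \<partial>M1)"
    unfolding sh by (intro nn_integral_mono mult_right_mono) auto
   then show "(\<integral>\<^sup>+om. ?g xi1 om * ennreal (exp (t * xi1 j om)) \<partial>M1) < \<infinity>"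
    using fin[OF K, of "\<lambda>i. a i + (if i = j then t else 0)"] unfolding mult_1 by (rule le_less_trans)
   show "(\<integral>\<^sup>+om. ?g xi1 om * ennreal (exp (t * xi1 j om)) \<partial>M1) = (\<integral>\<^sup>+om. ?g xi2 om * ennreal (exp (t * xi2 j om)) \<partial>M2)"
    unfolding sh using insert by simp
  qed measurable
  then show ?case using insert.hyps by (simp add: mult_ac)
 qed
 show ?thesis
 proof (rule measure_eqI_PiM_infinite)
  show "finite_measure (distr M1 (\<Pi>\<^sub>M i\<in>UNIV. borel) (\<lambda>om i. xi1 i om))"
   by (intro prob_space.finite_measure prob_space_distr measurable_PiM_single') auto
  fix A :: "'i \<Rightarrow> real set" and J :: "'i set" assume J: "finite J" and A: "\<And>i. i \<in> J \<Longrightarrow> A i \<in> sets borel"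
  define C where "C i = (if i \<in> J then A i else UNIV)" for i
  have C[measurable]: "C i \<in> sets borel" for i using A by (auto simp: C_def)
  have E: "prod_emb UNIV (\<lambda>_. borel) J (Pi\<^sub>E J A) = {f. \<forall>i\<in>J. f i \<in> C i}"
   by (force simp: prod_emb_def C_def PiE_def Pi_def)
  have st: "{f. \<forall>i\<in>J. f i \<in> C i} \<in> sets (\<Pi>\<^sub>M i\<in>UNIV. borel)"
   unfolding E[symmetric] by (rule sets_PiM_I) (use J A in auto)
  have p: "(\<Prod>i\<in>J. indicator (C i) (f i)) = (indicator {f. \<forall>i\<in>J. f i \<in> C i} f :: ennreal)" for f
   using J by (auto simp: indicator_def prod_zero_iff)
  have v: "emeasure (distr M (\<Pi>\<^sub>M i\<in>UNIV. borel) (\<lambda>om i. xi i om)) {f. \<forall>i\<in>J. f i \<in> C i} = (\<integral>\<^sup>+om. (\<Prod>i\<in>J. indicator (C i) (xi i om)) * ennreal (exp (\<Sum>i\<in>J. 0 * xi i om)) \<partial>M)"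
   if "\<And>i. xi i \<in> borel_measurable M" for xi :: "'i \<Rightarrow> 'z \<Rightarrow> real" and M
   using st that by (subst nn_integral_indicator[symmetric], simp, subst nn_integral_distr) (auto intro!: measurable_PiM_single' simp: p)
  show "emeasure (distr M1 (\<Pi>\<^sub>M i\<in>UNIV. borel) (\<lambda>om i. xi1 i om)) (prod_emb UNIV (\<lambda>_. borel) J (Pi\<^sub>E J A))
   = emeasure (distr M2 (\<Pi>\<^sub>M i\<in>UNIV. borel) (\<lambda>om i. xi2 i om)) (prod_emb UNIV (\<lambda>_. borel) J (Pi\<^sub>E J A))"
   unfolding E v[OF m1] v[OF m2] by (rule step) (use J in auto)
 qed auto
qed

section \<open>Step processes and exponential densities\<close>

text \<open>Geometric L1 bounds make the sum of all deviations integrable, hence almost surely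
  finite. This selects almost sure limits with no passage to subsequences.\<close>

lemma AE_tendsto_of_summable_L1:
 fixes f :: "nat \<Rightarrow> 'w \<Rightarrow> real"
 assumes [measurable]: "\<And>n. f n \<in> borel_measurable M" "g \<in> borel_measurable M"
  and b: "\<And>n. (\<integral>\<^sup>+om. ennreal \<bar>f n om - g om\<bar> \<partial>M) \<le> ennreal (K * (1/2)^n)"
 shows "AE om in M. (\<lambda>n. f n om) \<longlonglongrightarrow> g om"
proof -
 have "(\<integral>\<^sup>+om. (\<Sum>n. ennreal \<bar>f n om - g om\<bar>) \<partial>M) = (\<Sum>n. \<integral>\<^sup>+om. ennreal \<bar>f n om - g om\<bar> \<partial>M)"
  by (rule nn_integral_suminf) auto
 also have "... \<le> (\<Sum>n. ennreal (\<bar>K\<bar> * (1/2)^n))"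
  by (intro suminf_le summableI allI order_trans[OF b] ennreal_leI mult_right_mono) auto
 also have "... < \<infinity>"
  by (subst suminf_ennreal2) (auto intro!: summable_mult summable_geometric)
 finally have "(\<integral>\<^sup>+om. (\<Sum>n. ennreal \<bar>f n om - g om\<bar>) \<partial>M) \<noteq> \<infinity>" by simp
 then have "AE om in M. (\<Sum>n. ennreal \<bar>f n om - g om\<bar>) \<noteq> \<infinity>"
  by (intro nn_integral_PInf_AE) auto
 then show ?thesis
 proof eventually_elim
  case (elim om)
  then have "summable (\<lambda>n. \<bar>f n om - g om\<bar>)" by (intro summable_suminf_not_top) auto
  from tendsto_rabs_zero_cancel[OF summable_LIMSEQ_zero[OF this]]
  show ?case by (simp add: LIM_zero_iff)
 qed
qed

lemma AE_convergent_of_summable_L1: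
 fixes f :: "nat \<Rightarrow> 'w \<Rightarrow> real"
 assumes [measurable]: "\<And>n. f n \<in> borel_measurable M"
  and b: "\<And>n. (\<integral>\<^sup>+om. ennreal \<bar>f (Suc n) om - f n om\<bar> \<partial>M) \<le> ennreal (K * (1/2)^n)"
 shows "AE om in M. convergent (\<lambda>n. f n om)"
proof -
 have "(\<integral>\<^sup>+om. (\<Sum>n. ennreal \<bar>f (Suc n) om - f n om\<bar>) \<partial>M) = (\<Sum>n. \<integral>\<^sup>+om. ennreal \<bar>f (Suc n) om - f n om\<bar> \<partial>M)"
  by (rule nn_integral_suminf) auto
 also have "... \<le> (\<Sum>n. ennreal (\<bar>K\<bar> * (1/2)^n))"
  by (intro suminf_le summableI allI order_trans[OF b] ennreal_leI mult_right_mono) auto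
 also have "... < \<infinity>"
  by (subst suminf_ennreal2) (auto intro!: summable_mult summable_geometric)
 finally have "(\<integral>\<^sup>+om. (\<Sum>n. ennreal \<bar>f (Suc n) om - f n om\<bar>) \<partial>M) \<noteq> \<infinity>" by simp
 then have "AE om in M. (\<Sum>n. ennreal \<bar>f (Suc n) om - f n om\<bar>) \<noteq> \<infinity>"
  by (intro nn_integral_PInf_AE) auto
 then show ?thesis
 proof eventually_elim
  case (elim om)
  then have "summable (\<lambda>n. \<bar>f (Suc n) om - f n om\<bar>)" by (intro summable_suminf_not_top) auto
  then have "summable (\<lambda>n. f (Suc n) om - f n om)" by (rule summable_rabs_cancel)
  then have "convergent (\<lambda>n. f 0 om + (\<Sum>i<n. f (Suc i) om - f i om))"
   by (intro convergent_add convergent_const) (simp add: summable_iff_convergent)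
  moreover have "f 0 om + (\<Sum>i<n. f (Suc i) om - f i om) = f n om" for n by (induction n) auto
  ultimately show ?case by simp
 qed
qed

text \<open>Gaussian increments, independence of the coordinates and their joint independence of the
  past are encoded in one family of exponential moments. An equation between integrals is easier to
  transport through limits, densities and augmentation of the filtration than independence
  itself.\<close>

definition bm_system :: "real \<Rightarrow> 'w measure \<Rightarrow> (real \<Rightarrow> 'w measure) \<Rightarrow> (nat \<Rightarrow> real \<Rightarrow> 'w \<Rightarrow> real) \<Rightarrow> bool" where
 "bm_system T M F w \<longleftrightarrow> prob_space M \<and> filtration_on {0..T} M F \<and>
   (\<forall>k. \<forall>t\<in>{0..T}. w k t \<in> borel_measurable (F t)) \<and>
   (\<forall>k. AE om in M. w k 0 om = 0) \<and>
   (\<forall>k. AE om in M. continuous_on {0..T} (\<lambda>t. w k t om)) \<and>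
   (\<forall>n v. \<forall>s\<in>{0..T}. \<forall>t\<in>{s..T}. \<forall>A\<in>sets (F s).
    (\<integral>\<^sup>+om. indicator A om * ennreal (exp (\<Sum>k<n. v k * (w k t om - w k s om))) \<partial>M)
     = emeasure M A * ennreal (exp ((\<Sum>k<n. (v k)\<^sup>2) * (t - s) / 2)))"

definition gp :: "real \<Rightarrow> nat \<Rightarrow> nat \<Rightarrow> real" where "gp T N j = T * real j / 2 ^ N"

locale bm =
 fixes T :: real and M :: "'w measure" and F and w
 assumes T: "0 < T" and bm: "bm_system T M F w"
begin

abbreviation "inc k s t om \<equiv> w k t om - w k s om"

sublocale prob_space M using bm by (simp add: bm_system_def)

lemma sub: "t \<in> {0..T} \<Longrightarrow> subalgebra M (F t)"
 using bm by (auto simp: bm_system_def filtration_on_def)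

lemma mono: "0 \<le> s \<Longrightarrow> s \<le> t \<Longrightarrow> t \<le> T \<Longrightarrow> A \<in> sets (F s) \<Longrightarrow> A \<in> sets (F t)"
proof -
 have "\<forall>s\<in>{0..T}. \<forall>t\<in>{0..T}. s \<le> t \<longrightarrow> sets (F s) \<subseteq> sets (F t)"
  using bm by (simp add: bm_system_def filtration_on_def)
 then show "0 \<le> s \<Longrightarrow> s \<le> t \<Longrightarrow> t \<le> T \<Longrightarrow> A \<in> sets (F s) \<Longrightarrow> A \<in> sets (F t)" by force
qed

lemma F_M: "t \<in> {0..T} \<Longrightarrow> f \<in> borel_measurable (F t) \<Longrightarrow> f \<in> borel_measurable M"
 using measurable_from_subalg[OF sub] by blast

lemma sets_F_M: "t \<in> {0..T} \<Longrightarrow> A \<in> sets (F t) \<Longrightarrow> A \<in> sets M"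
 using sub by (auto simp: subalgebra_def)

lemma space_F: "t \<in> {0..T} \<Longrightarrow> space (F t) = space M"
 using sub by (auto simp: subalgebra_def)

lemma F_mono: "0 \<le> s \<Longrightarrow> s \<le> t \<Longrightarrow> t \<le> T \<Longrightarrow> f \<in> borel_measurable (F s) \<Longrightarrow> f \<in> borel_measurable (F t)"
 by (rule measurable_from_subalg[of "F t" "F s"]) (use mono space_F[of s] space_F[of t] in \<open>auto simp: subalgebra_def\<close>)

lemma wF: "t \<in> {0..T} \<Longrightarrow> w k t \<in> borel_measurable (F t)"
 using bm by (auto simp: bm_system_def)

lemma wM: "t \<in> {0..T} \<Longrightarrow> w k t \<in> borel_measurable M"
 using F_M wF by blast

lemma mgf: "0 \<le> s \<Longrightarrow> s \<le> t \<Longrightarrow> t \<le> T \<Longrightarrow> A \<in> sets (F s) \<Longrightarrow>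
  (\<integral>\<^sup>+om. indicator A om * ennreal (exp (\<Sum>k<n. v k * (inc k s t om))) \<partial>M)
     = emeasure M A * ennreal (exp ((\<Sum>k<n. (v k)\<^sup>2) * (t - s) / 2))"
 using bm by (auto simp: bm_system_def)

text \<open>The coefficients are known at time \<open>s\<close> and take finitely many values, so
  the space splits into finitely many events of \<open>F s\<close> on each of which the coefficient
  vector is constant and \<open>mgf\<close> applies. This is the martingale property of the
  exponential density over one cell, tested with a factor from the past.\<close>

lemma exp_step:
 assumes st: "0 \<le> s" "s \<le> t" "t \<le> T" and xi: "xi \<in> borel_measurable (F s)"
  and c: "\<And>k. c k \<in> borel_measurable (F s)" and fin: "\<And>k. finite (c k ` space M)"
 shows "(\<integral>\<^sup>+om. xi om * ennreal (exp ((\<Sum>k<d. c k om * (inc k s t om)) - (\<Sum>k<d. (c k om)\<^sup>2) * (t - s) / 2)) \<partial>M)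
  = (\<integral>\<^sup>+om. xi om \<partial>M)"
proof -
 have s: "s \<in> {0..T}" and t: "t \<in> {0..T}" using st by auto
 note [measurable] = F_M[OF s xi] F_M[OF s c] wM[OF s] wM[OF t]
 \<comment> \<open>Coordinates beyond \<open>d\<close> are set to 0, so that only finitely many
   coefficient vectors occur.\<close>
 define vec where "vec om = (\<lambda>k. if k < d then c k om else 0)" for om
 define Vs where "Vs = vec ` space M"
 have finV: "finite Vs"
 proof (rule finite_subset)
  show "Vs \<subseteq> {f. (\<forall>k. (k \<in> {..<d} \<longrightarrow> f k \<in> (\<Union>k<d. c k ` space M)) \<and> (k \<notin> {..<d} \<longrightarrow> f k = 0))}"
   unfolding Vs_def vec_def by auto blast
  show "finite {f. (\<forall>k. (k \<in> {..<d} \<longrightarrow> f k \<in> (\<Union>k<d. c k ` space M)) \<and> (k \<notin> {..<d} \<longrightarrow> f k = 0))}"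
   by (rule finite_set_of_finite_funs) (use fin in auto)
 qed
 define A where "A v = {om\<in>space M. vec om = v}" for v
 have A: "A v \<in> sets (F s)" if "v \<in> Vs" for v
 proof -
  note [measurable] = c
  have "v k = 0" if "\<not> k < d" for k using \<open>v \<in> Vs\<close> that by (auto simp: Vs_def vec_def)
  then have "A v = {om\<in>space (F s). \<forall>k<d. c k om = v k}"
   by (auto simp: A_def vec_def fun_eq_iff space_F[OF s])
  also have "... \<in> sets (F s)" by measurable
  finally show ?thesis .
 qed
 have one: "(\<Sum>v\<in>Vs. indicator (A v) om) = (1::ennreal)" if "om \<in> space M" for om
 proof -
  have "(\<Sum>v\<in>Vs. indicator (A v) om) = (\<Sum>v\<in>Vs. if v = vec om then 1 else (0::ennreal))"
   using that by (intro sum.cong) (auto simp: A_def indicator_def)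
  also have "... = 1" using finV that by (simp add: Vs_def)
  finally show ?thesis .
 qed
 let ?Z = "\<lambda>om. ennreal (exp ((\<Sum>k<d. c k om * (inc k s t om)) - (\<Sum>k<d. (c k om)\<^sup>2) * (t - s) / 2))"
 have each: "(\<integral>\<^sup>+om. xi om * indicator (A v) om * ?Z om \<partial>M) = (\<integral>\<^sup>+om. xi om * indicator (A v) om \<partial>M)" if v: "v \<in> Vs" for v
 proof -
  let ?q = "(\<Sum>k<d. (v k)\<^sup>2) * (t - s) / 2"
  note [measurable] = sets_F_M[OF s A[OF v]]
  have "(\<integral>\<^sup>+om. xi om * indicator (A v) om * ?Z om \<partial>M)
    = (\<integral>\<^sup>+om. (ennreal (exp (- ?q)) * (xi om * indicator (A v) om)) * ennreal (exp (\<Sum>k<d. v k * (inc k s t om))) \<partial>M)"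
  proof (rule nn_integral_cong)
   fix om assume "om \<in> space M"
   show "xi om * indicator (A v) om * ?Z om = (ennreal (exp (- ?q)) * (xi om * indicator (A v) om)) * ennreal (exp (\<Sum>k<d. v k * (inc k s t om)))"
   proof (cases "om \<in> A v")
    case True
    then have "c k om = v k" if "k < d" for k using that by (auto simp: A_def vec_def)
    then have "?Z om = ennreal (exp (- ?q)) * ennreal (exp (\<Sum>k<d. v k * (inc k s t om)))"
     by (simp add: ennreal_mult[symmetric] exp_add[symmetric])
    then show ?thesis by (simp add: mult_ac)
   qed simp
  qed
  also have "... = (\<integral>\<^sup>+om. ennreal (exp (- ?q)) * (xi om * indicator (A v) om) \<partial>M) * ennreal (exp ?q)"
  proof (rule nn_integral_subalgebra_mult[OF sub[OF s]])
   have "(\<lambda>om. xi om * indicator (A v) om) \<in> borel_measurable (F s)" using xi A[OF v] by measurable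
   then show "(\<lambda>om. ennreal (exp (- ?q)) * (xi om * indicator (A v) om)) \<in> borel_measurable (F s)" by measurable
  qed (use mgf[OF st] in auto)
  also have "... = ennreal (exp (- ?q)) * ennreal (exp ?q) * (\<integral>\<^sup>+om. xi om * indicator (A v) om \<partial>M)"
   by (subst nn_integral_cmult) (auto simp: mult_ac)
  also have "ennreal (exp (- ?q)) * ennreal (exp ?q) = 1" by (simp add: ennreal_mult[symmetric] exp_add[symmetric])
  finally show ?thesis by simp
 qed
 have split: "(\<integral>\<^sup>+om. f om \<partial>M) = (\<Sum>v\<in>Vs. \<integral>\<^sup>+om. f om * indicator (A v) om \<partial>M)" if [measurable]: "f \<in> borel_measurable M" for f :: "'w \<Rightarrow> ennreal"
 proof -
  have "(\<integral>\<^sup>+om. f om \<partial>M) = (\<integral>\<^sup>+om. (\<Sum>v\<in>Vs. f om * indicator (A v) om) \<partial>M)"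
   by (intro nn_integral_cong) (simp add: sum_distrib_left[symmetric] one)
  then show ?thesis using sets_F_M[OF s A] by (subst (asm) nn_integral_sum) auto
 qed
 show ?thesis
  unfolding split[of "\<lambda>om. xi om * ?Z om", simplified]
  by (subst split) (auto simp: each[symmetric] mult_ac intro!: sum.cong)
qed

lemma gp_in: "j \<le> 2 ^ N \<Longrightarrow> gp T N j \<in> {0..T}"
 using T by (auto simp: gp_def divide_le_eq mult_left_le of_nat_le_iff[of _ "2 ^ N", simplified, symmetric] simp flip: of_nat_power)

lemma gp_mono: "i \<le> j \<Longrightarrow> gp T N i \<le> gp T N j"
 using T by (auto simp: gp_def divide_right_mono)

lemma gp_less: "i < j \<Longrightarrow> gp T N i < gp T N j"
 using T by (auto simp: gp_def divide_strict_right_mono)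

lemma gp_diff: "gp T N (Suc j) - gp T N j = T / 2 ^ N"
 by (simp add: gp_def field_simps)

lemma gp_double: "gp T (Suc N) (2 * j) = gp T N j"
 by (simp add: gp_def)

lemma gp_refine: "N \<le> N' \<Longrightarrow> gp T N' (2 ^ (N' - N) * j) = gp T N j"
 by (auto simp: gp_def le_iff_add power_add)

lemma gp_0[simp]: "gp T N 0 = 0" by (simp add: gp_def)
lemma gp_top[simp]: "gp T N (2 ^ N) = T" by (simp add: gp_def)

text \<open>Dyadic step processes of level N, constant on half-open cells; the values outside [0, T)
  are unconstrained. Finite range is what \<open>exp_step\<close> asks for.\<close>

definition elem :: "nat \<Rightarrow> (nat \<Rightarrow> real \<Rightarrow> 'w \<Rightarrow> real) \<Rightarrow> bool" where
 "elem N c \<longleftrightarrow> (\<forall>j<2^N. \<forall>k. c k (gp T N j) \<in> borel_measurable (F (gp T N j)) \<and> finite (c k (gp T N j) ` space M)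
   \<and> (\<forall>s. gp T N j \<le> s \<and> s < gp T N (Suc j) \<longrightarrow> c k s = c k (gp T N j)))"

lemma elemD:
 assumes "elem N c" "j < 2 ^ N"
 shows "c k (gp T N j) \<in> borel_measurable (F (gp T N j))" "finite (c k (gp T N j) ` space M)"
  "gp T N j \<le> s \<Longrightarrow> s < gp T N (Suc j) \<Longrightarrow> c k s = c k (gp T N j)"
 using assms unfolding elem_def by blast+

lemma elem_Suc:
 assumes "elem N c" shows "elem (Suc N) c"
 unfolding elem_def
proof (intro allI impI)
 fix j k :: nat assume j: "j < 2 ^ Suc N"
 define i where "i = j div 2"
 have i: "i < 2 ^ N" using j by (auto simp: i_def less_mult_imp_div_less mult.commute)
 have ij: "2 * i \<le> j" "Suc j \<le> 2 * Suc i" by (auto simp: i_def)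
 have a: "gp T N i \<le> gp T (Suc N) j" "gp T (Suc N) (Suc j) \<le> gp T N (Suc i)"
  using gp_mono[OF ij(1), of "Suc N"] gp_mono[OF ij(2), of "Suc N"] by (simp_all only: gp_double)
 have l: "gp T (Suc N) j < gp T (Suc N) (Suc j)" by (rule gp_less) simp
 have c: "c k s = c k (gp T N i)" if "gp T N i \<le> s" "s < gp T N (Suc i)" for s
  by (rule elemD(3)[OF assms i that])
 have e: "c k (gp T (Suc N) j) = c k (gp T N i)" using a l by (intro c) auto
 have "c k (gp T N i) \<in> borel_measurable (F (gp T (Suc N) j))"
  using i a gp_in[of j "Suc N"] j gp_in[of i N] by (intro F_mono[of "gp T N i", OF _ _ _ elemD(1)[OF assms i]]) auto
 moreover have "finite (c k (gp T N i) ` space M)" by (rule elemD(2)[OF assms i])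
 moreover have "c k s = c k (gp T N i)" if "gp T (Suc N) j \<le> s" "s < gp T (Suc N) (Suc j)" for s
  using a that by (intro c) auto
 ultimately show "c k (gp T (Suc N) j) \<in> borel_measurable (F (gp T (Suc N) j)) \<and> finite (c k (gp T (Suc N) j) ` space M)
   \<and> (\<forall>s. gp T (Suc N) j \<le> s \<and> s < gp T (Suc N) (Suc j) \<longrightarrow> c k s = c k (gp T (Suc N) j))"
  unfolding e by auto
qed

lemma elem_mono: "N \<le> N' \<Longrightarrow> elem N c \<Longrightarrow> elem N' c"
 by (induction rule: dec_induct) (auto intro: elem_Suc)

lemma elem_lincomb:
 assumes "elem N c" "elem N c'" shows "elem N (\<lambda>k s om. a * c k s om + b * c' k s om)"
 unfolding elem_def
proof (intro allI impI conjI)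
 fix j k :: nat assume j: "j < 2 ^ N"
 note [measurable] = elemD(1)[OF assms(1) j] elemD(1)[OF assms(2) j]
 show "(\<lambda>om. a * c k (gp T N j) om + b * c' k (gp T N j) om) \<in> borel_measurable (F (gp T N j))" by measurable
 have "finite (c k (gp T N j) ` space M)" "finite (c' k (gp T N j) ` space M)" using elemD(2)[OF assms(1) j] elemD(2)[OF assms(2) j] by auto
 then have "finite ((\<lambda>(x, y). a * x + b * y) ` (c k (gp T N j) ` space M \<times> c' k (gp T N j) ` space M))" by blast
 then show "finite ((\<lambda>om. a * c k (gp T N j) om + b * c' k (gp T N j) om) ` space M)"
  by (rule finite_subset[rotated]) auto
 fix s assume "gp T N j \<le> s \<and> s < gp T N (Suc j)"
 then have "c k s = c k (gp T N j)" "c' k s = c' k (gp T N j)" using elemD(3)[OF assms(1) j] elemD(3)[OF assms(2) j] by blast+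
 then show "(\<lambda>om. a * c k s om + b * c' k s om) = (\<lambda>om. a * c k (gp T N j) om + b * c' k (gp T N j) om)" by simp
qed

text \<open>Adding this deterministic integrand to a step process multiplies its density by the
  exponential of an increment, corrected by drift and variance. That is how exponential moments
  under the new measure are computed.\<close>

definition pulse :: "(nat \<Rightarrow> real) \<Rightarrow> real \<Rightarrow> real \<Rightarrow> nat \<Rightarrow> real \<Rightarrow> 'w \<Rightarrow> real" where
 "pulse v a b k s om = (if a \<le> s \<and> s < b then v k else 0)"

lemma pulse_gp: "pulse v (gp T N a) (gp T N b) k (gp T N j) om = (if a \<le> j \<and> j < b then v k else 0)"
 using gp_less[of _ _ N] gp_mono[of _ _ N] by (auto simp: pulse_def not_less) (meson linorder_not_less order.strict_trans1)+

lemma elem_pulse: "elem N (pulse v (gp T N a) (gp T N b))"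
 unfolding elem_def
proof (intro allI impI conjI)
 fix j k s
 show "pulse v (gp T N a) (gp T N b) k (gp T N j) \<in> borel_measurable (F (gp T N j))"
  by (simp add: pulse_def[abs_def])
 show "finite (pulse v (gp T N a) (gp T N b) k (gp T N j) ` space M)"
  by (rule finite_subset[of _ "{v k, 0}"]) (auto simp: pulse_def)
 assume s: "gp T N j \<le> s \<and> s < gp T N (Suc j)"
 have 1: "gp T N a \<le> s \<longleftrightarrow> a \<le> j"
  using s gp_mono[of a j N] gp_mono[of "Suc j" a N] by (cases "a \<le> j") (auto simp: not_le Suc_le_eq)
 have 2: "s < gp T N b \<longleftrightarrow> j < b"
  using s gp_mono[of "Suc j" b N] gp_mono[of b j N] by (cases "j < b") (auto simp: not_less Suc_le_eq)
 show "pulse v (gp T N a) (gp T N b) k s = pulse v (gp T N a) (gp T N b) k (gp T N j)"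
  by (rule ext) (simp add: pulse_gp, simp add: pulse_def 1 2)
qed

text \<open>\<open>SI\<close> is the stochastic integral of a step process up to the m-th grid point
  in the first d directions, \<open>SQ\<close> the bracket of two such integrals, and
  \<open>LR\<close> the logarithm of the exponential density, a log likelihood ratio.\<close>

definition SI :: "nat \<Rightarrow> nat \<Rightarrow> (nat \<Rightarrow> real \<Rightarrow> 'w \<Rightarrow> real) \<Rightarrow> nat \<Rightarrow> 'w \<Rightarrow> real" where
 "SI N d c m om = (\<Sum>j<m. \<Sum>k<d. c k (gp T N j) om * (inc k (gp T N j) (gp T N (Suc j)) om))"

definition SQ :: "nat \<Rightarrow> nat \<Rightarrow> (nat \<Rightarrow> real \<Rightarrow> 'w \<Rightarrow> real) \<Rightarrow> (nat \<Rightarrow> real \<Rightarrow> 'w \<Rightarrow> real) \<Rightarrow> nat \<Rightarrow> 'w \<Rightarrow> real" where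
 "SQ N d c c' m om = (\<Sum>j<m. (\<Sum>k<d. c k (gp T N j) om * c' k (gp T N j) om) * (T / 2 ^ N))"

definition LR :: "nat \<Rightarrow> nat \<Rightarrow> (nat \<Rightarrow> real \<Rightarrow> 'w \<Rightarrow> real) \<Rightarrow> nat \<Rightarrow> 'w \<Rightarrow> real" where
 "LR N d c m om = SI N d c m om - SQ N d c c m om / 2"

lemma LR_measurable:
 assumes c: "elem N c" and m: "m \<le> 2 ^ N"
 shows "LR N d c m \<in> borel_measurable (F (gp T N m))"
proof -
 have [measurable]: "c k (gp T N j) \<in> borel_measurable (F (gp T N m))" "w k (gp T N j) \<in> borel_measurable (F (gp T N m))"
   "w k (gp T N (Suc j)) \<in> borel_measurable (F (gp T N m))" if "j < m" for j k
  using that c m gp_mono[of j m N] gp_mono[of "Suc j" m N] gp_in[of j N] gp_in[of m N] gp_in[of "Suc j" N]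
  by (auto intro!: F_mono[of "gp T N j" "gp T N m" "c k (gp T N j)"] F_mono[of "gp T N j" "gp T N m" "w k (gp T N j)"]
     F_mono[of "gp T N (Suc j)" "gp T N m" "w k (gp T N (Suc j))"] wF simp: elem_def)
 show ?thesis unfolding LR_def SI_def SQ_def by measurable
qed

lemma LR_measurable_M: "elem N c \<Longrightarrow> m \<le> 2 ^ N \<Longrightarrow> LR N d c m \<in> borel_measurable M"
 using LR_measurable F_M gp_in by blast

text \<open>Martingale property of the exponential density along the grid: \<open>exp_step\<close>
  removes one cell after the other, with the density accumulated so far as the factor from the
  past.\<close>

lemma exp_LR:
 assumes c: "elem N c" and i: "i \<le> m" and m: "m \<le> 2 ^ N" and A: "A \<in> sets (F (gp T N i))"
 shows "(\<integral>\<^sup>+om. indicator A om * ennreal (exp (LR N d c m om)) \<partial>M) = (\<integral>\<^sup>+om. indicator A om * ennreal (exp (LR N d c i om)) \<partial>M)"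
 using i m
proof (induction m rule: dec_induct)
 case (step m)
 have m: "m < 2 ^ N" using step by simp
 have gm: "0 \<le> gp T N m" "gp T N m \<le> gp T N (Suc m)" "gp T N (Suc m) \<le> T"
  using gp_in[of m N] gp_in[of "Suc m" N] m gp_mono[of m "Suc m" N] by auto
 have Am[measurable]: "A \<in> sets (F (gp T N m))"
  using mono[of "gp T N i" "gp T N m" A] A step gp_in[of i N] gp_in[of m N] gp_mono[of i m N] by auto
 note [measurable] = LR_measurable[OF c less_imp_le[OF m]]
 have "LR N d c (Suc m) om = LR N d c m om + ((\<Sum>k<d. c k (gp T N m) om * (inc k (gp T N m) (gp T N (Suc m)) om)) - (\<Sum>k<d. (c k (gp T N m) om)\<^sup>2) * (gp T N (Suc m) - gp T N m) / 2)" for om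
  unfolding gp_diff by (simp add: LR_def SI_def SQ_def power2_eq_square diff_divide_distrib algebra_simps)
 then have "(\<integral>\<^sup>+om. indicator A om * ennreal (exp (LR N d c (Suc m) om)) \<partial>M) =
  (\<integral>\<^sup>+om. (indicator A om * ennreal (exp (LR N d c m om))) * ennreal (exp ((\<Sum>k<d. c k (gp T N m) om * (inc k (gp T N m) (gp T N (Suc m)) om)) - (\<Sum>k<d. (c k (gp T N m) om)\<^sup>2) * (gp T N (Suc m) - gp T N m) / 2)) \<partial>M)"
  by (simp add: exp_add ennreal_mult mult.assoc)
 also have "... = (\<integral>\<^sup>+om. indicator A om * ennreal (exp (LR N d c m om)) \<partial>M)"
  by (rule exp_step[OF gm]) (use c m in \<open>auto simp: elem_def\<close>)
 finally show ?case using step by simp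
qed simp

lemma exp_LR_1: "elem N c \<Longrightarrow> (\<integral>\<^sup>+om. ennreal (exp (LR N d c (2 ^ N) om)) \<partial>M) = 1"
 using exp_LR[of N c 0 "2 ^ N" "space M" d] sub[of 0] T
 by (auto simp: LR_def SI_def SQ_def subalgebra_def emeasure_space_1 indicator_def cong: nn_integral_cong)
   (metis (no_types, lifting) nn_integral_cong sets.top emeasure_space_1)

end

section \<open>Bilinearity, refinement of the grid and comparison of densities\<close>

context bm begin

lemma SI_lincomb: "SI N d (\<lambda>k s om. a * c k s om + b * c' k s om) m om = a * SI N d c m om + b * SI N d c' m om"
 by (simp add: SI_def sum_distrib_left sum.distrib distrib_right mult.assoc)

lemma SQ_lincomb_left: "SQ N d (\<lambda>k s om. a * c k s om + b * c' k s om) c'' m om = a * SQ N d c c'' m om + b * SQ N d c' c'' m om"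
proof -
 have "(\<Sum>k<d. (a * c k s om + b * c' k s om) * c'' k s om) = a * (\<Sum>k<d. c k s om * c'' k s om) + b * (\<Sum>k<d. c' k s om * c'' k s om)" for s
  by (simp add: distrib_right sum.distrib sum_distrib_left mult.assoc)
 then show ?thesis
  unfolding SQ_def by (simp only: distrib_right sum.distrib sum_distrib_left[of _ "\<lambda>j. (\<Sum>k<d. _ k j * _ k j) * _"] mult.assoc)
qed

lemma SQ_sym: "SQ N d c c' m om = SQ N d c' c m om"
 by (simp add: SQ_def mult.commute)

lemma SQ_lincomb_right: "SQ N d c'' (\<lambda>k s om. a * c k s om + b * c' k s om) m om = a * SQ N d c'' c m om + b * SQ N d c'' c' m om"
 by (simp only: SQ_sym[of N d c''] SQ_lincomb_left)

lemma SQ_nonneg: "0 \<le> SQ N d c c m om"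
proof -
 have "0 \<le> (\<Sum>k<d. c k s om * c k s om)" for s by (intro sum_nonneg) simp
 then show ?thesis unfolding SQ_def using T by (intro sum_nonneg mult_nonneg_nonneg[of "sum _ _"]) auto
qed

lemma SQ_bound:
 assumes "\<And>j. j < 2 ^ N \<Longrightarrow> (\<Sum>k<d. (c k (gp T N j) om)\<^sup>2) \<le> C"
 shows "SQ N d c c (2 ^ N) om \<le> C * T"
proof -
 have "SQ N d c c (2 ^ N) om \<le> (\<Sum>j<(2::nat)^N. C * (T / 2 ^ N))"
  unfolding SQ_def using T assms by (intro sum_mono mult_right_mono) (auto simp: power2_eq_square)
 then show ?thesis by simp
qed

lemma elem_half:
 assumes "elem N c" "m < 2 ^ N"
 shows "c k (gp T (Suc N) (2 * m)) = c k (gp T N m)" "c k (gp T (Suc N) (Suc (2 * m))) = c k (gp T N m)"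
  "gp T (Suc N) (Suc (Suc (2 * m))) = gp T N (Suc m)"
proof -
 show e: "gp T (Suc N) (Suc (Suc (2 * m))) = gp T N (Suc m)" using gp_double[of N "Suc m"] by simp
 show "c k (gp T (Suc N) (2 * m)) = c k (gp T N m)" by (simp only: gp_double)
 have "gp T N m \<le> gp T (Suc N) (Suc (2 * m))" using gp_mono[of "2 * m" "Suc (2 * m)" "Suc N"] by (simp add: gp_double)
 moreover have "gp T (Suc N) (Suc (2 * m)) < gp T N (Suc m)" using gp_less[of "Suc (2 * m)" "Suc (Suc (2 * m))" "Suc N"] e by simp
 ultimately show "c k (gp T (Suc N) (Suc (2 * m))) = c k (gp T N m)" by (rule elemD(3)[OF assms])
qed

lemma SI_Suc:
 assumes "elem N c" "m \<le> 2 ^ N"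
 shows "SI (Suc N) d c (2 * m) om = SI N d c m om"
 using assms(2)
proof (induction m)
 case (Suc m)
 then have m: "m < 2 ^ N" by simp
 have "SI (Suc N) d c (2 * Suc m) om = SI (Suc N) d c (2 * m) om
   + (\<Sum>k<d. c k (gp T N m) om * (w k (gp T (Suc N) (Suc (2 * m))) om - w k (gp T N m) om))
   + (\<Sum>k<d. c k (gp T N m) om * (w k (gp T N (Suc m)) om - w k (gp T (Suc N) (Suc (2 * m))) om))"
  by (simp add: SI_def elem_half[OF assms(1) m] gp_double)
 also have "... = SI (Suc N) d c (2 * m) om + (\<Sum>k<d. c k (gp T N m) om * (inc k (gp T N m) (gp T N (Suc m)) om))"
  by (simp add: sum.distrib[symmetric] algebra_simps)
 finally show ?case using Suc by (simp add: SI_def)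
qed (simp add: SI_def)

lemma SQ_Suc:
 assumes "elem N c" "elem N c'" "m \<le> 2 ^ N"
 shows "SQ (Suc N) d c c' (2 * m) om = SQ N d c c' m om"
 using assms(3)
proof (induction m)
 case (Suc m)
 then have m: "m < 2 ^ N" by simp
 have "SQ (Suc N) d c c' (2 * Suc m) om = SQ (Suc N) d c c' (2 * m) om + (\<Sum>k<d. c k (gp T N m) om * c' k (gp T N m) om) * (T / 2 ^ N)"
  by (simp add: SQ_def elem_half[OF assms(1) m] elem_half[OF assms(2) m] gp_double)
 then show ?case using Suc by (simp add: SQ_def)
qed (simp add: SQ_def)

text \<open>A step process of level N is also one of every higher level, and splitting a cell leaves
  its contributions unchanged. Two step processes of different levels can thus be compared on a
  common grid.\<close>

lemma LR_refine:
 assumes "N \<le> N'" "elem N c"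
 shows "LR N' d c (2 ^ N') om = LR N d c (2 ^ N) om"
 using assms(1)
proof (induction rule: dec_induct)
 case (step n)
 have e: "elem n c" by (rule elem_mono[OF step(1) assms(2)])
 show ?case using SQ_Suc[OF e e, of "2 ^ n"] SI_Suc[OF e, of "2 ^ n"] step by (simp add: LR_def)
qed simp

lemma LR_dim:
 assumes "d \<le> d'" "\<And>k s. d \<le> k \<Longrightarrow> c k s om = 0"
 shows "LR N d' c m om = LR N d c m om"
proof -
 have "(\<Sum>k<d'. f k) = (\<Sum>k<d. f k)" if "\<And>k. d \<le> k \<Longrightarrow> f k = (0::real)" for f
  by (rule sum.mono_neutral_right) (use assms(1) that in auto)
 then show ?thesis using assms(2) by (simp add: LR_def SI_def SQ_def)
qed

text \<open>Squaring doubles the integrand up to the bracket: 2 LR(c) = LR(2 c) + SQ(c, c). The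
  density of 2 c has mean 1, and the bracket is at most C T.\<close>

lemma exp_LR_square:
 assumes c: "elem N c" and C: "\<And>j om. j < 2 ^ N \<Longrightarrow> (\<Sum>k<d. (c k (gp T N j) om)\<^sup>2) \<le> C"
 shows "(\<integral>\<^sup>+om. ennreal ((exp (LR N d c (2 ^ N) om))\<^sup>2) \<partial>M) \<le> ennreal (exp (C * T))"
proof -
 \<comment> \<open>The vacuous second summand brings the doubled process into the shape of
   \<open>elem_lincomb\<close> and the bilinearity lemmas.\<close>
 let ?c2 = "\<lambda>k s om. 2 * c k s om + 0 * c k s om"
 have e: "elem N ?c2" by (rule elem_lincomb[OF c c])
 have "(exp (LR N d c (2 ^ N) om))\<^sup>2 \<le> exp (C * T) * exp (LR N d ?c2 (2 ^ N) om)" for om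
 proof -
  have "2 * LR N d c (2 ^ N) om = LR N d ?c2 (2 ^ N) om + SQ N d c c (2 ^ N) om"
   unfolding LR_def SI_lincomb SQ_lincomb_left SQ_lincomb_right by (simp add: algebra_simps)
  also have "... \<le> LR N d ?c2 (2 ^ N) om + C * T" using SQ_bound[of N c om d C] C by simp
  finally have "exp (2 * LR N d c (2 ^ N) om) \<le> exp (LR N d ?c2 (2 ^ N) om + C * T)" by simp
  then show ?thesis by (simp add: exp_double exp_add mult.commute)
 qed
 then have "(\<integral>\<^sup>+om. ennreal ((exp (LR N d c (2 ^ N) om))\<^sup>2) \<partial>M) \<le> (\<integral>\<^sup>+om. ennreal (exp (C * T)) * ennreal (exp (LR N d ?c2 (2 ^ N) om)) \<partial>M)"
  by (intro nn_integral_mono) (auto simp: ennreal_mult[symmetric] intro!: ennreal_leI)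
 also have "... = ennreal (exp (C * T))"
  using LR_measurable_M[OF e, of "2 ^ N" d] exp_LR_1[OF e, of d] by (subst nn_integral_cmult) auto
 finally show ?thesis .
qed

text \<open>Hellinger distance: the geometric mean of two exponential densities is, up to the factor
 \<open>exp (- D / 8)\<close>, the exponential density of the mean integrand.\<close>

lemma hellinger:
 assumes c: "elem N c" "elem N c'"
  and C: "\<And>j om. j < 2 ^ N \<Longrightarrow> (\<Sum>k<d. (c k (gp T N j) om)\<^sup>2) \<le> C" "\<And>j om. j < 2 ^ N \<Longrightarrow> (\<Sum>k<d. (c' k (gp T N j) om)\<^sup>2) \<le> C"
  and D: "(\<integral>\<^sup>+om. ennreal (SQ N d (\<lambda>k s om. 1 * c k s om + (-1) * c' k s om) (\<lambda>k s om. 1 * c k s om + (-1) * c' k s om) (2 ^ N) om) \<partial>M) \<le> ennreal ((1/16)^n)"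
 shows "(\<integral>\<^sup>+om. ennreal \<bar>exp (LR N d c (2 ^ N) om / 2) - exp (LR N d c' (2 ^ N) om / 2)\<bar> \<partial>M)
  \<le> ennreal ((1 + (exp (C * T) + 4 * C * T) / 8) / 2 * (1/2)^n)"
proof -
 let ?b = "\<lambda>k s om. (1/2) * c k s om + (1/2) * c' k s om" and ?e = "\<lambda>k s om. 1 * c k s om + (-1) * c' k s om"
 define D where "D om = SQ N d ?e ?e (2 ^ N) om" for om
 define r where "r om = exp (LR N d c (2 ^ N) om)" for om
 define r' where "r' om = exp (LR N d c' (2 ^ N) om)" for om
 define rb where "rb om = exp (LR N d ?b (2 ^ N) om)" for om
 define X where "X om = exp (LR N d c (2 ^ N) om / 2) - exp (LR N d c' (2 ^ N) om / 2)" for om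
 have eb: "elem N ?b" by (rule elem_lincomb[OF c])
 have gpM: "c k (gp T N j) \<in> borel_measurable M" "c' k (gp T N j) \<in> borel_measurable M" if "j < 2 ^ N" for j k
  using elemD(1)[OF c(1) that] elemD(1)[OF c(2) that] by (auto intro!: F_M[OF gp_in[OF less_imp_le[OF that]]])
 have [measurable]: "D \<in> borel_measurable M" unfolding D_def SQ_def using gpM by measurable
 have [measurable]: "r \<in> borel_measurable M" "r' \<in> borel_measurable M" "rb \<in> borel_measurable M" "X \<in> borel_measurable M"
  unfolding r_def r'_def rb_def X_def using LR_measurable_M[OF c(1), of "2 ^ N" d] LR_measurable_M[OF c(2), of "2 ^ N" d] LR_measurable_M[OF eb, of "2 ^ N" d]
  by measurable
 have D0: "0 \<le> D om" for om unfolding D_def by (rule SQ_nonneg)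
 have Cp: "0 \<le> C"
 proof -
  obtain om where "om \<in> space M" using not_empty by blast
  have "0 \<le> (\<Sum>k<d. (c k (gp T N 0) om)\<^sup>2)" by (intro sum_nonneg) auto
  also have "... \<le> C" by (rule C(1)) simp
  finally show ?thesis .
 qed
 have D1: "D om \<le> 4 * C * T" for om
  unfolding D_def
 proof (rule SQ_bound)
  fix j :: nat assume j: "j < 2 ^ N"
  have "(\<Sum>k<d. (?e k (gp T N j) om)\<^sup>2) \<le> (\<Sum>k<d. 2 * (c k (gp T N j) om)\<^sup>2 + 2 * (c' k (gp T N j) om)\<^sup>2)"
  proof (rule sum_mono)
   fix k
   have "0 \<le> (c k (gp T N j) om + c' k (gp T N j) om)\<^sup>2" by simp
   then show "(?e k (gp T N j) om)\<^sup>2 \<le> 2 * (c k (gp T N j) om)\<^sup>2 + 2 * (c' k (gp T N j) om)\<^sup>2"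
    by (simp add: power2_eq_square algebra_simps)
  qed
  also have "... \<le> 4 * C" using C[OF j, of om] by (simp add: sum.distrib sum_distrib_left[symmetric])
  finally show "(\<Sum>k<d. (?e k (gp T N j) om)\<^sup>2) \<le> 4 * C" .
 qed
 have Cb: "(\<Sum>k<d. (?b k (gp T N j) om)\<^sup>2) \<le> C" if j: "j < 2 ^ N" for j om
 proof -
  have "(\<Sum>k<d. (?b k (gp T N j) om)\<^sup>2) \<le> (\<Sum>k<d. (1/2) * (c k (gp T N j) om)\<^sup>2 + (1/2) * (c' k (gp T N j) om)\<^sup>2)"
  proof (rule sum_mono)
   fix k
   have "0 \<le> (c k (gp T N j) om - c' k (gp T N j) om)\<^sup>2" by simp
   then show "(?b k (gp T N j) om)\<^sup>2 \<le> (1/2) * (c k (gp T N j) om)\<^sup>2 + (1/2) * (c' k (gp T N j) om)\<^sup>2"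
    by (simp add: power2_eq_square field_simps)
  qed
  also have "... \<le> C" using C[OF j, of om] by (simp add: sum.distrib sum_divide_distrib[symmetric])
  finally show ?thesis .
 qed
 have I: "integrable M r" "integrable M r'" "integrable M rb" "expectation r = 1" "expectation r' = 1" "expectation rb = 1"
 proof -
  have one: "integrable M f \<and> expectation f = 1"
   if "f \<in> borel_measurable M" "\<And>om. 0 \<le> f om" "(\<integral>\<^sup>+om. ennreal (f om) \<partial>M) = 1" for f
   using that by (auto intro!: integrableI_nonneg simp: integral_eq_nn_integral)
  have "(\<integral>\<^sup>+om. ennreal (r om) \<partial>M) = 1" "(\<integral>\<^sup>+om. ennreal (r' om) \<partial>M) = 1" "(\<integral>\<^sup>+om. ennreal (rb om) \<partial>M) = 1"
   unfolding r_def r'_def rb_def by (rule exp_LR_1[OF c(1)] exp_LR_1[OF c(2)] exp_LR_1[OF eb])+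
  then show "integrable M r" "integrable M r'" "integrable M rb" "expectation r = 1" "expectation r' = 1" "expectation rb = 1"
   using one[of r] one[of r'] one[of rb] by (auto simp: r_def r'_def rb_def)
 qed
 have rb2: "integrable M (\<lambda>om. (rb om)\<^sup>2)" "expectation (\<lambda>om. (rb om)\<^sup>2) \<le> exp (C * T)"
 proof -
  have *: "(\<integral>\<^sup>+om. ennreal ((rb om)\<^sup>2) \<partial>M) \<le> ennreal (exp (C * T))"
   unfolding rb_def by (rule exp_LR_square[OF eb Cb])
  show "integrable M (\<lambda>om. (rb om)\<^sup>2)"
   using * by (intro integrableI_nonneg) (auto intro: le_less_trans)
  then show "expectation (\<lambda>om. (rb om)\<^sup>2) \<le> exp (C * T)"
   using * by (subst (asm) nn_integral_eq_integral) (auto simp: ennreal_le_iff)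
 qed
 have DI: "integrable M D" by (rule integrable_const_bound[of _ "4 * C * T"]) (use D0 D1 in auto)
 have DE: "expectation D \<le> (1/16)^n"
  using D DI D0 by (subst (asm) D_def[symmetric], subst (asm) nn_integral_eq_integral) (auto simp: ennreal_le_iff)
 have rbD: "integrable M (\<lambda>om. rb om * D om)"
 proof (rule Bochner_Integration.integrable_bound[of M "\<lambda>om. (4 * C * T) * rb om"])
  show "integrable M (\<lambda>om. (4 * C * T) * rb om)" by (intro integrable_mult_right I)
  show "AE om in M. norm (rb om * D om) \<le> norm ((4 * C * T) * rb om)"
  proof (intro AE_I2)
   fix om
   have rb0: "0 \<le> rb om" by (simp add: rb_def)
   have "rb om * D om \<le> rb om * (4 * C * T)" by (intro mult_left_mono D1 rb0)
   then show "norm (rb om * D om) \<le> norm ((4 * C * T) * rb om)"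
    using rb0 D0[of om] Cp T by (simp add: abs_mult mult_ac)
  qed
 qed measurable
 \<comment> \<open>Young's inequality with weights 4^-n and 4^n balances the bounded second moment
   of \<open>rb\<close> against D^2 \<le> 4 C T D, whose mean is of order 16^-n. Both terms become
   of order 4^-n.\<close>
 have ErbD: "expectation (\<lambda>om. rb om * D om) \<le> (1/2) * (1/4)^n * (exp (C * T) + 4 * C * T)"
 proof -
  have p: "rb om * D om \<le> (1/2) * ((1/4)^n * (rb om)\<^sup>2 + (4 * C * T) * 4^n * D om)" for om
  proof -
   have "(1/4::real)^n * 4^n = 1" by (simp add: power_mult_distrib[symmetric])
   have "0 \<le> 4^n * ((1/4)^n * rb om - D om)\<^sup>2" by simp
   also have "... = ((1/4)^n * 4^n) * (1/4)^n * (rb om)\<^sup>2 - 2 * ((1/4)^n * 4^n) * rb om * D om + 4^n * (D om)\<^sup>2"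
    by (simp add: power2_eq_square algebra_simps)
   finally have "2 * (rb om * D om) \<le> (1/4)^n * (rb om)\<^sup>2 + 4^n * (D om)\<^sup>2" by (simp add: \<open>(1/4::real)^n * 4^n = 1\<close>)
   moreover have "(D om)\<^sup>2 \<le> (4 * C * T) * D om" unfolding power2_eq_square by (intro mult_right_mono D0 D1)
   then have "4^n * (D om)\<^sup>2 \<le> 4^n * ((4 * C * T) * D om)" by (intro mult_left_mono) auto
   moreover have "(4 * C * T) * 4^n * D om = 4^n * ((4 * C * T) * D om)" by (simp only: mult_ac)
   moreover have "x \<le> 1 / 2 * (y + u)" if "2 * x \<le> y + v" "v \<le> z" "u = z" for x y u v z :: real using that by simp
   ultimately show ?thesis by blast
  qed
  have "expectation (\<lambda>om. rb om * D om) \<le> expectation (\<lambda>om. (1/2) * ((1/4)^n * (rb om)\<^sup>2 + (4 * C * T) * 4^n * D om))"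
   by (intro integral_mono rbD integrable_mult_right Bochner_Integration.integrable_add rb2(1) DI p)
  also have "... = (1/2) * ((1/4)^n * expectation (\<lambda>om. (rb om)\<^sup>2) + (4 * C * T) * 4^n * expectation D)"
   using rb2(1) DI by simp
  also have "... \<le> (1/2) * ((1/4)^n * exp (C * T) + (4 * C * T) * 4^n * (1/16)^n)"
   using rb2(2) DE Cp T by (intro mult_left_mono add_mono) auto
  also have "4^n * (1/16)^n = (1/4::real)^n" by (simp add: power_mult_distrib[symmetric])
  then have "(1/2) * ((1/4)^n * exp (C * T) + (4 * C * T) * 4^n * (1/16)^n) = (1/2) * (1/4)^n * (exp (C * T) + 4 * C * T)"
   by (simp add: algebra_simps)
  finally show ?thesis .
 qed
 \<comment> \<open>Expanding the square leaves the cross term 2 rb exp(-D/8), which is bounded below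
   by exp(-x) \<ge> 1 - x. The terms without \<open>D\<close> cancel in mean because all three
   densities have mean 1.\<close>
 have X2: "(X om)\<^sup>2 \<le> r om + r' om - 2 * rb om + (1/4) * (rb om * D om)" for om
 proof -
  have "LR N d c (2 ^ N) om / 2 + LR N d c' (2 ^ N) om / 2 = LR N d ?b (2 ^ N) om - D om / 8"
   unfolding D_def LR_def SI_lincomb SQ_lincomb_left SQ_lincomb_right SQ_sym[of N d c' c]
   by (simp add: field_simps)
  then have "exp (LR N d c (2 ^ N) om / 2) * exp (LR N d c' (2 ^ N) om / 2) = rb om * exp (- D om / 8)"
   by (simp add: rb_def exp_add[symmetric])
  moreover have "(exp (x / 2))\<^sup>2 = exp x" for x :: real by (simp add: exp_double[symmetric])
  ultimately have "(X om)\<^sup>2 = r om + r' om - 2 * (rb om * exp (- D om / 8))"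
   by (simp add: X_def r_def r'_def power2_diff)
  moreover have "rb om * (1 + (- D om / 8)) \<le> rb om * exp (- D om / 8)"
   by (intro mult_left_mono exp_ge_add_one_self) (simp add: rb_def)
  ultimately show ?thesis by (simp add: algebra_simps)
 qed
 have Xi: "integrable M (\<lambda>om. (X om)\<^sup>2)" and EX: "expectation (\<lambda>om. (X om)\<^sup>2) \<le> (1/4)^n * ((exp (C * T) + 4 * C * T) / 8)"
 proof -
  have i: "integrable M (\<lambda>om. r om + r' om - 2 * rb om + (1/4) * (rb om * D om))"
   by (intro Bochner_Integration.integrable_add Bochner_Integration.integrable_diff integrable_mult_right I rbD)
  show Xi: "integrable M (\<lambda>om. (X om)\<^sup>2)"
  proof (rule Bochner_Integration.integrable_bound[OF i])
   show "AE om in M. norm ((X om)\<^sup>2) \<le> norm (r om + r' om - 2 * rb om + (1/4) * (rb om * D om))"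
    unfolding real_norm_def abs_of_nonneg[OF zero_le_power2] by (intro AE_I2 order_trans[OF X2 abs_ge_self])
  qed simp
  have "expectation (\<lambda>om. (X om)\<^sup>2) \<le> expectation (\<lambda>om. r om + r' om - 2 * rb om + (1/4) * (rb om * D om))"
   by (intro integral_mono Xi i X2)
  also have "... = (1/4) * expectation (\<lambda>om. rb om * D om)" using I rbD by simp
  also have "... \<le> (1/4) * ((1/2) * (1/4)^n * (exp (C * T) + 4 * C * T))" using ErbD by simp
  finally show "expectation (\<lambda>om. (X om)\<^sup>2) \<le> (1/4)^n * ((exp (C * T) + 4 * C * T) / 8)" by simp
 qed
 \<comment> \<open>Young's inequality once more, with weights 2^-n and 2^n, turns a second moment of
   order 4^-n into a first moment of order 2^-n.\<close>
 have absX: "\<bar>X om\<bar> \<le> (1/2) * ((1/2)^n + 2^n * (X om)\<^sup>2)" for om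
 proof -
  have one: "(1/2::real)^n * 2^n = 1" by (simp add: power_mult_distrib[symmetric])
  have "0 \<le> 2^n * ((1/2)^n - \<bar>X om\<bar>)\<^sup>2" by simp
  also have "... = ((1/2)^n * 2^n) * (1/2)^n - 2 * ((1/2)^n * 2^n) * \<bar>X om\<bar> + 2^n * (X om)\<^sup>2"
   by (simp add: power2_eq_square algebra_simps)
  finally show ?thesis by (simp add: one)
 qed
 have iX: "integrable M X"
 proof (rule Bochner_Integration.integrable_bound)
  show "integrable M (\<lambda>om. (1/2) * ((1/2)^n + 2^n * (X om)\<^sup>2))"
   by (intro integrable_mult_right Bochner_Integration.integrable_add Xi) auto
  show "AE om in M. norm (X om) \<le> norm ((1/2) * ((1/2)^n + 2^n * (X om)\<^sup>2))"
   using absX by (intro AE_I2) (simp add: abs_of_nonneg)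
 qed simp
 have "expectation (\<lambda>om. \<bar>X om\<bar>) \<le> expectation (\<lambda>om. (1/2) * ((1/2)^n + 2^n * (X om)\<^sup>2))"
  by (intro integral_mono iX integrable_abs integrable_mult_right Bochner_Integration.integrable_add Xi absX) auto
 also have "... = (1/2) * ((1/2)^n + 2^n * expectation (\<lambda>om. (X om)\<^sup>2))" using Xi by (simp add: prob_space)
 also have "... \<le> (1/2) * ((1/2)^n + 2^n * ((1/4)^n * ((exp (C * T) + 4 * C * T) / 8)))"
  using EX by (intro mult_left_mono add_left_mono) auto
 also have "2^n * (1/4)^n = (1/2::real)^n" by (simp add: power_mult_distrib[symmetric])
 then have "2^n * ((1/4)^n * ((exp (C * T) + 4 * C * T) / 8)) = (1/2)^n * ((exp (C * T) + 4 * C * T) / 8)"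
  by (simp only: mult.assoc[symmetric])
 finally have "expectation (\<lambda>om. \<bar>X om\<bar>) \<le> (1 + (exp (C * T) + 4 * C * T) / 8) / 2 * (1/2)^n"
  by (simp add: field_simps)
 moreover have "(\<integral>\<^sup>+om. ennreal \<bar>X om\<bar> \<partial>M) = ennreal (expectation (\<lambda>om. \<bar>X om\<bar>))"
  using iX by (intro nn_integral_eq_integral) auto
 ultimately show ?thesis by (simp add: X_def ennreal_leI)
qed

lemma sum_if_interval:
 fixes a b m :: nat
 assumes "b \<le> m"
 shows "(\<Sum>j<m. if a \<le> j \<and> j < b then g j else 0) = (\<Sum>j\<in>{a..<b}. g j :: real)"
proof -
 have "(\<Sum>j<m. if a \<le> j \<and> j < b then g j else 0) = (\<Sum>j\<in>{j\<in>{..<m}. a \<le> j \<and> j < b}. g j)"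
  by (rule sum.inter_filter[symmetric]) simp
 also have "{j\<in>{..<m}. a \<le> j \<and> j < b} = {a..<b}" using assms by auto
 finally show ?thesis .
qed

text \<open>Quadratic expansion of the exponent: the integral of the pulse telescopes to the
  increment of the motion, the mixed bracket is the drift that \<open>c\<close> collects over the
  interval, and the bracket of the pulse is the variance. Up to the index \<open>a\<close> the pulse
  is invisible, which is the second claim.\<close>

lemma LR_pulse:
 fixes v :: "nat \<Rightarrow> real"
 assumes ab: "a \<le> b" "b \<le> 2 ^ N"
 defines "f \<equiv> pulse v (gp T N a) (gp T N b)"
 shows "LR N d (\<lambda>k s om. 1 * c k s om + 1 * f k s om) (2 ^ N) om = LR N d c (2 ^ N) om
   + (\<Sum>k<d. v k * (inc k (gp T N a) (gp T N b) om))
   - (\<Sum>k<d. v k * (\<Sum>j\<in>{a..<b}. c k (gp T N j) om * (T / 2 ^ N)))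
   - (\<Sum>k<d. (v k)\<^sup>2) * (gp T N b - gp T N a) / 2"
  and "LR N d (\<lambda>k s om. 1 * c k s om + 1 * f k s om) a om = LR N d c a om"
proof -
 have fj: "f k (gp T N j) om = (if a \<le> j \<and> j < b then v k else 0)" for k j by (simp add: f_def pulse_gp)
 have 1: "SI N d f (2 ^ N) om = (\<Sum>k<d. v k * (inc k (gp T N a) (gp T N b) om))"
 proof -
  have "SI N d f (2 ^ N) om = (\<Sum>j<2^N. if a \<le> j \<and> j < b then (\<Sum>k<d. v k * (inc k (gp T N j) (gp T N (Suc j)) om)) else 0)"
   unfolding SI_def by (intro sum.cong) (auto simp: fj)
  also have "... = (\<Sum>k<d. v k * (\<Sum>j\<in>{a..<b}. inc k (gp T N j) (gp T N (Suc j)) om))"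
   unfolding sum_if_interval[OF ab(2)] by (subst sum.swap) (simp add: sum_distrib_left)
  finally show ?thesis using sum_Suc_diff'[OF ab(1), of "\<lambda>j. w k (gp T N j) om" for k] by simp
 qed
 have 2: "SQ N d c f (2 ^ N) om = (\<Sum>k<d. v k * (\<Sum>j\<in>{a..<b}. c k (gp T N j) om * (T / 2 ^ N)))"
 proof -
  have "SQ N d c f (2 ^ N) om = (\<Sum>j<2^N. if a \<le> j \<and> j < b then (\<Sum>k<d. v k * (c k (gp T N j) om * (T / 2 ^ N))) else 0)"
   unfolding SQ_def sum_distrib_right by (intro sum.cong) (auto simp: fj mult_ac)
  also have "... = (\<Sum>k<d. v k * (\<Sum>j\<in>{a..<b}. c k (gp T N j) om * (T / 2 ^ N)))"
   unfolding sum_if_interval[OF ab(2)] by (subst sum.swap) (simp add: sum_distrib_left)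
  finally show ?thesis .
 qed
 have 3: "SQ N d f f (2 ^ N) om = (\<Sum>k<d. (v k)\<^sup>2) * (gp T N b - gp T N a)"
 proof -
  have "SQ N d f f (2 ^ N) om = (\<Sum>j<2^N. if a \<le> j \<and> j < b then (\<Sum>k<d. (v k)\<^sup>2) * (T / 2 ^ N) else 0)"
   unfolding SQ_def by (intro sum.cong) (auto simp: fj power2_eq_square)
  also have "... = (\<Sum>k<d. (v k)\<^sup>2) * (gp T N b - gp T N a)"
   unfolding sum_if_interval[OF ab(2)] using ab(1) by (simp add: gp_def of_nat_diff field_simps)
  finally show ?thesis .
 qed
 show "LR N d (\<lambda>k s om. 1 * c k s om + 1 * f k s om) (2 ^ N) om = LR N d c (2 ^ N) om
   + (\<Sum>k<d. v k * (inc k (gp T N a) (gp T N b) om))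
   - (\<Sum>k<d. v k * (\<Sum>j\<in>{a..<b}. c k (gp T N j) om * (T / 2 ^ N)))
   - (\<Sum>k<d. (v k)\<^sup>2) * (gp T N b - gp T N a) / 2"
  unfolding LR_def SI_lincomb SQ_lincomb_left SQ_lincomb_right SQ_sym[of N d f c] 1 2 3 by (simp add: field_simps)
 have "SI N d f a om = 0" "SQ N d c f a om = 0" "SQ N d f f a om = 0" by (simp_all add: SI_def SQ_def fj)
 then show "LR N d (\<lambda>k s om. 1 * c k s om + 1 * f k s om) a om = LR N d c a om"
  unfolding LR_def SI_lincomb SQ_lincomb_left SQ_lincomb_right SQ_sym[of N d f c] by simp
qed

lemma piecewise_integral:
 fixes \<phi> :: "real \<Rightarrow> real"
 assumes pc: "\<And>j s. j < 2 ^ N \<Longrightarrow> gp T N j \<le> s \<Longrightarrow> s < gp T N (Suc j) \<Longrightarrow> \<phi> s = \<phi> (gp T N j)"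
  and ab: "a \<le> b" "b \<le> 2 ^ N"
 shows "set_integrable lborel {gp T N a..gp T N b} \<phi>"
  and "(LINT s:{gp T N a..gp T N b}|lborel. \<phi> s) = (\<Sum>j\<in>{a..<b}. \<phi> (gp T N j) * (T / 2 ^ N))"
proof -
 let ?g = "\<lambda>s. \<Sum>j\<in>{a..<b}. \<phi> (gp T N j) * indicat_real {gp T N j..<gp T N (Suc j)} s"
 have tele: "(\<Sum>j\<in>{a..<b}. indicat_real {gp T N j..<gp T N (Suc j)} s) = indicat_real {gp T N a..<gp T N b} s" for s
  using ab(1)
 proof (induction b rule: dec_induct)
  case (step n)
  then show ?case using gp_mono[of a n N] gp_less[of n "Suc n" N] by (auto simp: indicator_def)
 qed simp
 have g: "?g s = indicat_real {gp T N a..<gp T N b} s * \<phi> s" for s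
 proof -
  have "?g s = (\<Sum>j\<in>{a..<b}. indicat_real {gp T N j..<gp T N (Suc j)} s * \<phi> s)"
  proof (intro sum.cong refl)
   fix j assume "j \<in> {a..<b}"
   then have "j < 2 ^ N" using ab(2) by auto
   then show "\<phi> (gp T N j) * indicat_real {gp T N j..<gp T N (Suc j)} s = indicat_real {gp T N j..<gp T N (Suc j)} s * \<phi> s"
    using pc[of j s] by (auto split: split_indicator)
  qed
  then show ?thesis by (simp add: sum_distrib_right[symmetric] tele)
 qed
 \<comment> \<open>The closed interval exceeds the union of the half-open cells by its right end
   point, a null set.\<close>
 have AEg: "AE s in lborel. indicat_real {gp T N a..gp T N b} s *\<^sub>R \<phi> s = ?g s"
  using AE_lborel_singleton[of "gp T N b"] unfolding g by eventually_elim (auto split: split_indicator)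
 have eqg: "indicat_real {gp T N a..gp T N b} s *\<^sub>R \<phi> s = ?g s + indicat_real {gp T N b} s * \<phi> (gp T N b)" for s
  unfolding g using gp_mono[OF ab(1), of N] by (auto split: split_indicator)
 have i1: "integrable lborel (indicat_real {gp T N j..<gp T N (Suc j)})" for j
  by (rule integrable_real_indicator) (auto simp: gp_mono)
 have ig: "integrable lborel ?g" by (intro Bochner_Integration.integrable_sum integrable_mult_right i1)
 have gm: "?g \<in> borel_measurable lborel" using ig by (rule borel_measurable_integrable)
 have m: "(\<lambda>s. indicat_real {gp T N a..gp T N b} s *\<^sub>R \<phi> s) \<in> borel_measurable lborel"
  unfolding eqg by (intro borel_measurable_add gm) simp
 show "set_integrable lborel {gp T N a..gp T N b} \<phi>"
  unfolding set_integrable_def using ig by (subst integrable_cong_AE[OF m gm AEg])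
 have "(LINT s:{gp T N a..gp T N b}|lborel. \<phi> s) = (\<integral>s. ?g s \<partial>lborel)"
  unfolding set_lebesgue_integral_def by (rule integral_cong_AE[OF m gm AEg])
 also have "... = (\<Sum>j\<in>{a..<b}. \<phi> (gp T N j) * (T / 2 ^ N))"
  using i1 by (subst Bochner_Integration.integral_sum) (auto simp: gp_mono gp_diff)
 finally show "(LINT s:{gp T N a..gp T N b}|lborel. \<phi> s) = (\<Sum>j\<in>{a..<b}. \<phi> (gp T N j) * (T / 2 ^ N))" .
qed

end

section \<open>Time integrals of the drift\<close>

lemma ennreal_le_lincomb:
 assumes "x \<le> a * y + b * z" "0 \<le> a" "0 \<le> y" "0 \<le> b" "0 \<le> z"
 shows "ennreal x \<le> ennreal a * ennreal y + ennreal b * ennreal z"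
 using assms by (simp add: ennreal_mult[symmetric] ennreal_plus[symmetric] ennreal_leI del: ennreal_plus)

lemma indefinite_integral_continuous_bounded:
 fixes f :: "real \<Rightarrow> real"
 assumes [measurable]: "f \<in> borel_measurable borel" and b: "\<And>s. \<bar>f s\<bar> \<le> C"
 shows "continuous_on {0..T} (\<lambda>t. LINT s:{0..t}|lborel. f s)"
proof (rule continuous_on_sequentiallyI)
 fix u a assume u: "\<forall>n. u n \<in> {0..T}" and a: "a \<in> {0..T}" and lim: "u \<longlonglongrightarrow> (a::real)"
 show "(\<lambda>n. LINT s:{0..u n}|lborel. f s) \<longlonglongrightarrow> (LINT s:{0..a}|lborel. f s)"
  unfolding set_lebesgue_integral_def
 proof (rule integral_dominated_convergence[where w="\<lambda>s. C * indicat_real {0..T} s"])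
  show "integrable lborel (\<lambda>s. C * indicat_real {0..T} s)"
   by (intro integrable_mult_right integrable_real_indicator) (auto simp: emeasure_lborel_Icc_eq)
  have "AE s in lborel. s \<noteq> a" by (rule AE_lborel_singleton)
  then show "AE s in lborel. (\<lambda>n. indicat_real {0..u n} s *\<^sub>R f s) \<longlonglongrightarrow> indicat_real {0..a} s *\<^sub>R f s"
  proof eventually_elim
   case (elim s)
   have "\<forall>\<^sub>F n in sequentially. indicat_real {0..u n} s = indicat_real {0..a} s"
   proof (cases "s < a")
    case True
    then have "\<forall>\<^sub>F n in sequentially. s < u n" by (rule order_tendstoD[OF lim])
    then show ?thesis by eventually_elim (use True in \<open>auto simp: indicator_def\<close>)
   next
    case False
    then have "\<forall>\<^sub>F n in sequentially. u n < s" using elim by (intro order_tendstoD[OF lim]) auto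
    then show ?thesis by eventually_elim (use False elim in \<open>auto simp: indicator_def\<close>)
   qed
   then show ?case by (intro tendsto_eventually) (auto elim: eventually_mono)
  qed
  show "AE s in lborel. norm (indicat_real {0..u n} s *\<^sub>R f s) \<le> C * indicat_real {0..T} s" for n
   using u[rule_format, of n] b by (intro AE_I2) (auto split: split_indicator intro: order_trans[OF abs_ge_zero b])
 qed auto
qed

context bm begin

text \<open>Rounding up, not down, keeps an event known at time \<open>s\<close> in the past of the
  approximating grid times.\<close>

lemma ceil_grid:
 assumes s: "s \<in> {0..T}"
 defines "a \<equiv> \<lambda>i. nat \<lceil>s * 2 ^ i / T\<rceil>"
 shows "a i \<le> 2 ^ i" "s \<le> gp T i (a i)" "(\<lambda>i. gp T i (a i)) \<longlonglongrightarrow> s"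
proof -
 have 0: "0 \<le> s * 2 ^ i / T" for i using s T by auto
 have "s * 2 ^ i / T \<le> 2 ^ i" using s T by (auto simp: divide_le_eq mult.commute)
 then have "\<lceil>s * 2 ^ i / T\<rceil> \<le> 2 ^ i" by (simp add: ceiling_le_iff)
 then show "a i \<le> 2 ^ i" by (simp add: a_def nat_le_iff)
 have ra: "real (a i) = of_int \<lceil>s * 2 ^ i / T\<rceil>" for i using 0[of i] by (simp add: a_def)
 have lo: "s \<le> gp T i (a i)" for i
 proof -
  have "s * 2 ^ i / T \<le> real (a i)" unfolding ra by (rule le_of_int_ceiling)
  then show ?thesis using T by (simp add: gp_def field_simps)
 qed
 show "s \<le> gp T i (a i)" by (rule lo)
 have hi: "gp T i (a i) \<le> s + T * (1/2) ^ i" for i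
 proof -
  have "real (a i) \<le> s * 2 ^ i / T + 1" unfolding ra by linarith
  then have "T * real (a i) \<le> T * (s * 2 ^ i / T + 1)" using T by (intro mult_left_mono) auto
  also have "... = s * 2 ^ i + T" using T by (simp add: field_simps)
  finally show ?thesis by (simp add: gp_def field_simps power_one_over)
 qed
 have "(\<lambda>i. s + T * (1/2) ^ i) \<longlonglongrightarrow> s + T * 0" by (intro tendsto_intros LIMSEQ_power_zero) auto
 then show "(\<lambda>i. gp T i (a i)) \<longlonglongrightarrow> s"
  by (intro tendsto_sandwich[of "\<lambda>_. s" "\<lambda>i. gp T i (a i)" sequentially "\<lambda>i. s + T * (1/2) ^ i"]) (auto simp: lo hi)
qed

end

text \<open>The coordinates \<open>b\<close> of a bounded drift are approximated by step processes
  \<open>c n\<close> of level \<open>Nf n\<close> with \<open>dm n\<close> active directions. The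
  rate 16^-n / 4 gives mean square distance at most 16^-n between consecutive approximations, since
  2/4 + 2/64 \<le> 1; \<open>hellinger\<close> then yields the summable rate 2^-n for the square
  roots of the densities.\<close>

locale girsanov = bm T M F w for T and M :: "'w measure" and F w +
 fixes Nf dm :: "nat \<Rightarrow> nat" and c :: "nat \<Rightarrow> nat \<Rightarrow> real \<Rightarrow> 'w \<Rightarrow> real" and b :: "nat \<Rightarrow> real \<Rightarrow> 'w \<Rightarrow> real"
  and C C' :: real
 assumes Nmono: "\<And>n. Nf n \<le> Nf (Suc n)"
  and el: "\<And>n. elem (Nf n) (c n)"
  and dim: "\<And>n k s om. dm n \<le> k \<Longrightarrow> c n k s om = 0"
  and bd: "\<And>n s om. (\<Sum>k<dm n. (c n k s om)\<^sup>2) \<le> C"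
  and bM[measurable]: "\<And>k. (\<lambda>p. b k (fst p) (snd p)) \<in> borel_measurable (lborel \<Otimes>\<^sub>M M)"
  and cM[measurable]: "\<And>n k. (\<lambda>p. c n k (fst p) (snd p)) \<in> borel_measurable (lborel \<Otimes>\<^sub>M M)"
  and bb: "\<And>k s om. \<bar>b k s om\<bar> \<le> C'"
  and bF: "\<And>k t. t \<in> {0..T} \<Longrightarrow> (\<lambda>om. LINT s:{0..t}|lborel. b k s om) \<in> borel_measurable (F t)"
  and approx: "\<And>n m. (\<integral>\<^sup>+om. (\<integral>\<^sup>+s\<in>{0..T}. ennreal (\<Sum>k<m. (c n k s om - b k s om)\<^sup>2) \<partial>lborel) \<partial>M) \<le> ennreal ((1/16)^n / 4)"
begin

lemma bd': "(\<Sum>k<d. (c n k s om)\<^sup>2) \<le> C"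
proof -
 have "(\<Sum>k<d. (c n k s om)\<^sup>2) \<le> (\<Sum>k<max d (dm n). (c n k s om)\<^sup>2)" by (intro sum_mono2) auto
 also have "... = (\<Sum>k<dm n. (c n k s om)\<^sup>2)"
  by (rule sum.mono_neutral_right) (auto simp: dim)
 finally show ?thesis using bd by (rule order_trans)
qed

lemma C0: "0 \<le> C" using bd'[where d=0] by simp

lemma D_bound:
 assumes "Nf (Suc n) \<le> N"
 defines "e \<equiv> \<lambda>k s om. c n k s om - c (Suc n) k s om"
 shows "(\<integral>\<^sup>+om. ennreal (SQ N d e e (2 ^ N) om) \<partial>M) \<le> ennreal ((1/16)^n)"
proof -
 have eN: "elem N (c n)" "elem N (c (Suc n))"
  using elem_mono[OF order_trans[OF Nmono assms(1)] el[of n]] elem_mono[OF assms(1) el[of "Suc n"]] by auto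
 let ?q = "\<lambda>n s om. \<Sum>k<d. (c n k s om - b k s om)\<^sup>2"
 have 1: "ennreal (SQ N d e e (2 ^ N) om) \<le> (\<integral>\<^sup>+s\<in>{0..T}. (ennreal 2 * ennreal (?q n s om) + ennreal 2 * ennreal (?q (Suc n) s om)) \<partial>lborel)" for om
 proof -
  define \<phi> where "\<phi> s = (\<Sum>k<d. e k s om * e k s om)" for s
  have \<phi>0: "0 \<le> \<phi> s" for s unfolding \<phi>_def by (intro sum_nonneg) simp
  have pc: "\<phi> s = \<phi> (gp T N j)" if "j < 2 ^ N" "gp T N j \<le> s" "s < gp T N (Suc j)" for j s
   unfolding \<phi>_def e_def using elemD(3)[OF eN(1) that] elemD(3)[OF eN(2) that] by simp
  have "(LINT s:{gp T N 0..gp T N (2^N)}|lborel. \<phi> s) = (\<Sum>j\<in>{0..<2^N}. \<phi> (gp T N j) * (T / 2 ^ N))"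
   by (rule piecewise_integral(2)) (rule pc, assumption+, simp_all)
  then have "SQ N d e e (2 ^ N) om = (LINT s:{gp T N 0..gp T N (2^N)}|lborel. \<phi> s)"
   by (simp only: SQ_def \<phi>_def atLeast0LessThan)
  moreover have "set_integrable lborel {gp T N 0..gp T N (2^N)} \<phi>" by (rule piecewise_integral(1)) (rule pc, assumption+, simp_all)
  ultimately have "ennreal (SQ N d e e (2 ^ N) om) = (\<integral>\<^sup>+s. ennreal (indicat_real {0..T} s * \<phi> s) \<partial>lborel)"
   unfolding set_integrable_def set_lebesgue_integral_def
   using \<phi>0 by (subst nn_integral_eq_integral) auto
  also have "... \<le> (\<integral>\<^sup>+s\<in>{0..T}. (ennreal 2 * ennreal (?q n s om) + ennreal 2 * ennreal (?q (Suc n) s om)) \<partial>lborel)"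
  proof (rule nn_integral_mono)
   fix s
   have "\<phi> s \<le> (\<Sum>k<d. 2 * (c n k s om - b k s om)\<^sup>2 + 2 * (c (Suc n) k s om - b k s om)\<^sup>2)"
    unfolding \<phi>_def
   proof (rule sum_mono)
    fix k
    have "0 \<le> ((c n k s om - b k s om) + (c (Suc n) k s om - b k s om))\<^sup>2" by simp
    then show "e k s om * e k s om \<le> 2 * (c n k s om - b k s om)\<^sup>2 + 2 * (c (Suc n) k s om - b k s om)\<^sup>2"
     unfolding e_def by (simp add: power2_eq_square algebra_simps)
   qed
   then have "\<phi> s \<le> 2 * ?q n s om + 2 * ?q (Suc n) s om" by (simp add: sum.distrib sum_distrib_left)
   then have "ennreal (\<phi> s) \<le> ennreal 2 * ennreal (?q n s om) + ennreal 2 * ennreal (?q (Suc n) s om)"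
    by (rule ennreal_le_lincomb) (auto intro!: sum_nonneg)
   then show "ennreal (indicat_real {0..T} s * \<phi> s) \<le> (ennreal 2 * ennreal (?q n s om) + ennreal 2 * ennreal (?q (Suc n) s om)) * indicator {0..T} s"
    by (auto split: split_indicator)
  qed
  finally show ?thesis .
 qed
 have "(\<integral>\<^sup>+om. ennreal (SQ N d e e (2 ^ N) om) \<partial>M) \<le> (\<integral>\<^sup>+om. (\<integral>\<^sup>+s\<in>{0..T}. (ennreal 2 * ennreal (?q n s om) + ennreal 2 * ennreal (?q (Suc n) s om)) \<partial>lborel) \<partial>M)"
  by (intro nn_integral_mono 1)
 also have "... = (\<integral>\<^sup>+om. (ennreal 2 * (\<integral>\<^sup>+s\<in>{0..T}. ennreal (?q n s om) \<partial>lborel) + ennreal 2 * (\<integral>\<^sup>+s\<in>{0..T}. ennreal (?q (Suc n) s om) \<partial>lborel)) \<partial>M)"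
 proof (rule nn_integral_cong)
  fix om assume [measurable]: "om \<in> space M"
  have [measurable]: "(\<lambda>s. c n k s om) \<in> borel_measurable lborel" "(\<lambda>s. b k s om) \<in> borel_measurable lborel" for n k
   using measurable_compose[OF measurable_Pair2'[of om M lborel] cM[of n k]] measurable_compose[OF measurable_Pair2'[of om M lborel] bM[of k]] by simp_all
  show "(\<integral>\<^sup>+s\<in>{0..T}. (ennreal 2 * ennreal (?q n s om) + ennreal 2 * ennreal (?q (Suc n) s om)) \<partial>lborel)
   = ennreal 2 * (\<integral>\<^sup>+s\<in>{0..T}. ennreal (?q n s om) \<partial>lborel) + ennreal 2 * (\<integral>\<^sup>+s\<in>{0..T}. ennreal (?q (Suc n) s om) \<partial>lborel)"
   by (simp add: distrib_right nn_integral_add nn_integral_cmult mult.assoc del: ennreal_numeral)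
 qed
 also have "... = ennreal 2 * (\<integral>\<^sup>+om. (\<integral>\<^sup>+s\<in>{0..T}. ennreal (?q n s om) \<partial>lborel) \<partial>M) + ennreal 2 * (\<integral>\<^sup>+om. (\<integral>\<^sup>+s\<in>{0..T}. ennreal (?q (Suc n) s om) \<partial>lborel) \<partial>M)"
 proof -
  have [measurable]: "(\<lambda>om. \<integral>\<^sup>+s\<in>{0..T}. ennreal (?q n s om) \<partial>lborel) \<in> borel_measurable M" for n
  proof -
   have "(\<lambda>p. ennreal (\<Sum>k<d. (c n k (fst p) (snd p) - b k (fst p) (snd p))\<^sup>2) * indicator {0..T} (fst p)) \<in> borel_measurable (lborel \<Otimes>\<^sub>M M)" by measurable
   from measurable_compose[OF measurable_pair_swap' this] show ?thesis
    by (intro lborel.borel_measurable_nn_integral) (simp add: split_beta')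
  qed
  show ?thesis by (simp add: nn_integral_add nn_integral_cmult del: ennreal_numeral)
 qed
 also have "... \<le> ennreal 2 * ennreal ((1/16)^n / 4) + ennreal 2 * ennreal ((1/16)^(Suc n) / 4)"
  by (intro add_mono mult_left_mono approx) auto
 also have "... \<le> ennreal ((1/16)^n)"
  by (simp add: ennreal_mult[symmetric] ennreal_plus[symmetric] ennreal_leI del: ennreal_plus ennreal_numeral)
 finally show ?thesis .
qed

definition L where "L n = LR (Nf n) (dm n) (c n) (2 ^ Nf n)"

lemma L_measurable[measurable]: "L n \<in> borel_measurable M"
 unfolding L_def by (rule LR_measurable_M[OF el]) simp

lemma LR_L: "Nf n \<le> N \<Longrightarrow> dm n \<le> d \<Longrightarrow> LR N d (c n) (2 ^ N) om = L n om"
proof -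
 assume N: "Nf n \<le> N" and d: "dm n \<le> d"
 have "LR N d (c n) (2 ^ N) om = LR N (dm n) (c n) (2 ^ N) om" by (rule LR_dim[OF d]) (rule dim)
 then show ?thesis unfolding L_def by (simp only: LR_refine[OF N el])
qed

text \<open>The sign is a parameter because the companion densities of \<open>- c n\<close> must
  converge as well: they bound the limit density away from 0. Consecutive terms are compared at the
  finer level and in the larger dimension.\<close>

lemma conv_signed:
 assumes sg: "sg = 1 \<or> sg = (-1::real)"
 defines "cs \<equiv> \<lambda>n k s om. sg * c n k s om + 0 * c n k s om"
 shows "AE om in M. convergent (\<lambda>n. exp (LR (Nf n) (dm n) (cs n) (2 ^ Nf n) om / 2))"
proof (rule AE_convergent_of_summable_L1)
 have els: "elem (Nf n) (cs n)" for n unfolding cs_def by (rule elem_lincomb[OF el el])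
 show "(\<lambda>om. exp (LR (Nf n) (dm n) (cs n) (2 ^ Nf n) om / 2)) \<in> borel_measurable M" for n
  using LR_measurable_M[OF els order_refl, of n "dm n"] by measurable
 fix n
 let ?N = "Nf (Suc n)" and ?d = "max (dm n) (dm (Suc n))"
 have e: "elem ?N (cs n)" "elem ?N (cs (Suc n))" using elem_mono[OF Nmono els] els by auto
 have r: "LR (Nf n) (dm n) (cs n) (2 ^ Nf n) om = LR ?N ?d (cs n) (2 ^ ?N) om"
   "LR (Nf (Suc n)) (dm (Suc n)) (cs (Suc n)) (2 ^ Nf (Suc n)) om = LR ?N ?d (cs (Suc n)) (2 ^ ?N) om" for om
  using LR_dim[of "dm n" ?d "cs n" om ?N "2^?N"] LR_dim[of "dm (Suc n)" ?d "cs (Suc n)" om ?N "2^?N"] LR_refine[OF Nmono els]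
  by (auto simp: cs_def dim)
 have s2: "sg * sg = 1" using sg by auto
 have "(\<integral>\<^sup>+om. ennreal \<bar>exp (LR ?N ?d (cs (Suc n)) (2 ^ ?N) om / 2) - exp (LR ?N ?d (cs n) (2 ^ ?N) om / 2)\<bar> \<partial>M)
   \<le> ennreal ((1 + (exp (C * T) + 4 * C * T) / 8) / 2 * (1/2)^n)"
 proof (rule hellinger[OF e(2,1)])
  show "(\<Sum>k<?d. (cs n k (gp T ?N j) om)\<^sup>2) \<le> C" "(\<Sum>k<?d. (cs (Suc n) k (gp T ?N j) om)\<^sup>2) \<le> C" for j om
   using bd'[where d="?d"] sg by (auto simp: cs_def power_mult_distrib)
  have "SQ ?N ?d (\<lambda>k s om. 1 * cs (Suc n) k s om + (-1) * cs n k s om) (\<lambda>k s om. 1 * cs (Suc n) k s om + (-1) * cs n k s om) (2 ^ ?N) om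
   = SQ ?N ?d (\<lambda>k s om. c n k s om - c (Suc n) k s om) (\<lambda>k s om. c n k s om - c (Suc n) k s om) (2 ^ ?N) om" for om
  proof -
   have "(1 * cs (Suc n) k s om + (-1) * cs n k s om) * (1 * cs (Suc n) k s om + (-1) * cs n k s om) = (c n k s om - c (Suc n) k s om) * (c n k s om - c (Suc n) k s om)" for k s
    using sg by (auto simp: cs_def algebra_simps)
   then show ?thesis by (simp only: SQ_def)
  qed
  then show "(\<integral>\<^sup>+om. ennreal (SQ ?N ?d (\<lambda>k s om. 1 * cs (Suc n) k s om + (-1) * cs n k s om) (\<lambda>k s om. 1 * cs (Suc n) k s om + (-1) * cs n k s om) (2 ^ ?N) om) \<partial>M) \<le> ennreal ((1/16)^n)"
   using D_bound[of n ?N ?d] by simp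
 qed
 then show "(\<integral>\<^sup>+om. ennreal \<bar>exp (LR (Nf (Suc n)) (dm (Suc n)) (cs (Suc n)) (2 ^ Nf (Suc n)) om / 2) - exp (LR (Nf n) (dm n) (cs n) (2 ^ Nf n) om / 2)\<bar> \<partial>M)
   \<le> ennreal ((1 + (exp (C * T) + 4 * C * T) / 8) / 2 * (1/2)^n)"
  unfolding r .
qed

text \<open>The limit density is positive because the exponential densities of \<open>c\<close> and of \<open>- c\<close>
 multiply to \<open>exp (- \<integral> c\<^sup>2)\<close>, which is bounded below.\<close>

lemma density_exists:
 "\<exists>\<rho>. \<rho> \<in> borel_measurable M \<and> (\<forall>om. 0 < \<rho> om) \<and> (AE om in M. (\<lambda>n. exp (L n om)) \<longlonglongrightarrow> \<rho> om)"
proof -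
 define r where "r n om = exp (L n om / 2)" for n om
 define cm where "cm = (\<lambda>n k s om. (-1) * c n k s om + 0 * c n k s om)"
 define rm where "rm n om = exp (LR (Nf n) (dm n) (cm n) (2 ^ Nf n) om / 2)" for n om
 have [measurable]: "r n \<in> borel_measurable M" for n unfolding r_def by measurable
 define g where "g om = lim (\<lambda>n. r n om)" for om
 have [measurable]: "g \<in> borel_measurable M" unfolding g_def by measurable
 \<comment> \<open>The default value 1 is taken on a null set. It makes the density positive
   everywhere, so that old and new measure have the same null sets.\<close>
 define \<rho> where "\<rho> om = (if g om > 0 then (g om)\<^sup>2 else 1)" for om
 have [measurable]: "\<rho> \<in> borel_measurable M" unfolding \<rho>_def by measurable
 have c1: "AE om in M. convergent (\<lambda>n. r n om)" using conv_signed[of 1] by (simp add: r_def L_def)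
 have c2: "AE om in M. convergent (\<lambda>n. rm n om)" unfolding rm_def cm_def by (rule conv_signed) simp
 have prod: "exp (- (C * T) / 2) \<le> r n om * rm n om" for n om
 proof -
  have "L n om / 2 + LR (Nf n) (dm n) (cm n) (2 ^ Nf n) om / 2 = - SQ (Nf n) (dm n) (c n) (c n) (2 ^ Nf n) om / 2"
   unfolding L_def cm_def LR_def SI_lincomb SQ_lincomb_left SQ_lincomb_right by (simp add: field_simps)
  moreover have "SQ (Nf n) (dm n) (c n) (c n) (2 ^ Nf n) om \<le> C * T" by (rule SQ_bound) (rule bd)
  ultimately show ?thesis by (simp add: r_def rm_def exp_add[symmetric])
 qed
 have "AE om in M. (\<lambda>n. exp (L n om)) \<longlonglongrightarrow> \<rho> om"
  using c1 c2
 proof eventually_elim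
  case (elim om)
  have lg: "(\<lambda>n. r n om) \<longlonglongrightarrow> g om" using elim(1) by (simp add: g_def convergent_LIMSEQ_iff)
  obtain h where lh: "(\<lambda>n. rm n om) \<longlonglongrightarrow> h" using elim(2) by (auto simp: convergent_def)
  have "exp (- (C * T) / 2) \<le> g om * h"
   by (rule LIMSEQ_le_const[OF tendsto_mult[OF lg lh]]) (use prod in auto)
  moreover have "g om \<ge> 0" by (rule LIMSEQ_le_const[OF lg]) (auto simp: r_def)
  ultimately have gp: "g om > 0" by (metis exp_gt_zero less_eq_real_def linorder_not_le mult_zero_left)
  have "exp (L n om) = (r n om)\<^sup>2" for n by (simp add: r_def exp_double[symmetric])
  then show ?case using tendsto_power[OF lg, of 2] gp by (simp add: \<rho>_def)
 qed
 then show ?thesis by (intro exI[of _ \<rho>]) (auto simp: \<rho>_def)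
qed

lemma b_section: "om \<in> space M \<Longrightarrow> (\<lambda>s. b k s om) \<in> borel_measurable borel"
 using measurable_compose[OF measurable_Pair2'[of om M lborel] bM[of k]] by simp

lemma c_section: "om \<in> space M \<Longrightarrow> (\<lambda>s. c n k s om) \<in> borel_measurable borel"
 using measurable_compose[OF measurable_Pair2'[of om M lborel] cM[of n k]] by simp

lemma c_bounded: "\<bar>c n k s om\<bar> \<le> 1 + C"
proof -
 have "(c n k s om)\<^sup>2 \<le> (\<Sum>k<Suc k. (c n k s om)\<^sup>2)" by (simp add: sum_nonneg)
 also have "... \<le> C" by (rule bd')
 finally have a: "(c n k s om)\<^sup>2 \<le> C" .
 have "0 \<le> (\<bar>c n k s om\<bar> - 1)\<^sup>2" by simp
 then have "2 * \<bar>c n k s om\<bar> \<le> 1 + (c n k s om)\<^sup>2" by (simp add: power2_eq_square algebra_simps)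
 then show ?thesis using a C0 by linarith
qed

lemma set_int_bounded:
 fixes u t :: real
 assumes [measurable]: "f \<in> borel_measurable borel" and "\<And>s. \<bar>f s\<bar> \<le> (K::real)"
 shows "set_integrable lborel {u..t} f"
 unfolding set_integrable_def
proof (rule Bochner_Integration.integrable_bound)
 show "integrable lborel (\<lambda>s. K * indicat_real {u..t} s)"
  by (intro integrable_mult_right integrable_real_indicator) (auto simp: emeasure_lborel_Icc_eq)
 show "AE s in lborel. norm (indicat_real {u..t} s *\<^sub>R f s) \<le> norm (K * indicat_real {u..t} s)"
  using assms(2) by (intro AE_I2) (auto split: split_indicator intro: order_trans[OF assms(2) abs_ge_self])
qed measurable

lemma drift_int_measurable:
 fixes u t :: real
 assumes "(\<lambda>p. f (fst p) (snd p)) \<in> borel_measurable (lborel \<Otimes>\<^sub>M M)"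
 shows "(\<lambda>om. LINT s:{u..t}|lborel. f s om :: real) \<in> borel_measurable M"
proof -
 have "(\<lambda>p. indicat_real {u..t} (fst p) *\<^sub>R f (fst p) (snd p)) \<in> borel_measurable (lborel \<Otimes>\<^sub>M M)" using assms by measurable
 from measurable_compose[OF measurable_pair_swap' this]
 have "(\<lambda>(om, s). indicat_real {u..t} s *\<^sub>R f s om) \<in> borel_measurable (M \<Otimes>\<^sub>M lborel)" by (simp add: split_beta')
 then show ?thesis unfolding set_lebesgue_integral_def by (rule lborel.borel_measurable_lebesgue_integral)
qed

text \<open>Young's inequality in the form 2 |x| \<le> 2^-n + 2^n x^2 converts the mean square rate
  16^-n into an absolute rate of order 2^-n, which is summable.\<close>

lemma drift_conv:
 assumes "0 \<le> u" "t \<le> T"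
 shows "AE om in M. (\<lambda>n. LINT s:{u..t}|lborel. c n k s om) \<longlonglongrightarrow> (LINT s:{u..t}|lborel. b k s om)"
proof (rule AE_tendsto_of_summable_L1[where K="T + 1"])
 show "(\<lambda>om. LINT s:{u..t}|lborel. c n k s om) \<in> borel_measurable M" for n by (rule drift_int_measurable) simp
 show "(\<lambda>om. LINT s:{u..t}|lborel. b k s om) \<in> borel_measurable M" by (rule drift_int_measurable) simp
 fix n
 let ?q = "\<lambda>s om. \<Sum>k<Suc k. (c n k s om - b k s om)\<^sup>2"
 have one: "(1/2::real)^n * 2^n = 1" by (simp add: power_mult_distrib[symmetric])
 have 1: "ennreal \<bar>(LINT s:{u..t}|lborel. c n k s om) - (LINT s:{u..t}|lborel. b k s om)\<bar>
  \<le> ennreal (T * (1/2)^n) + ennreal (2^n) * (\<integral>\<^sup>+s\<in>{0..T}. ennreal (?q s om) \<partial>lborel)" if om[measurable]: "om \<in> space M" for om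
 proof -
  note [measurable] = b_section[OF om] c_section[OF om]
  have i: "set_integrable lborel {u..t} (\<lambda>s. c n k s om)" "set_integrable lborel {u..t} (\<lambda>s. b k s om)"
   by (rule set_int_bounded[OF _ c_bounded] set_int_bounded[OF _ bb], measurable)+
  have "\<bar>(LINT s:{u..t}|lborel. c n k s om) - (LINT s:{u..t}|lborel. b k s om)\<bar> = \<bar>LINT s:{u..t}|lborel. c n k s om - b k s om\<bar>"
   using i by (simp add: set_integral_diff)
  also have "ennreal ... \<le> (\<integral>\<^sup>+s. ennreal (norm (indicat_real {u..t} s *\<^sub>R (c n k s om - b k s om))) \<partial>lborel)"
   unfolding set_lebesgue_integral_def real_norm_def[symmetric]
   by (rule integral_norm_bound_ennreal) (use set_integral_diff(1)[OF i] in \<open>simp add: set_integrable_def\<close>)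
  also have "... \<le> (\<integral>\<^sup>+s. ennreal ((1/2)^n) * indicator {0..T} s + ennreal (2^n) * (ennreal (?q s om) * indicator {0..T} s) \<partial>lborel)"
  proof (rule nn_integral_mono)
   fix s
   let ?x = "c n k s om - b k s om"
   have "0 \<le> 2^n * ((1/2)^n - \<bar>?x\<bar>)\<^sup>2" by simp
   also have "... = ((1/2)^n * 2^n) * (1/2)^n - 2 * ((1/2)^n * 2^n) * \<bar>?x\<bar> + 2^n * ?x\<^sup>2" by (simp add: power2_eq_square algebra_simps)
   finally have "2 * \<bar>?x\<bar> \<le> (1/2)^n + 2^n * ?x\<^sup>2" by (simp add: one)
   moreover have "?x\<^sup>2 \<le> ?q s om" by (simp add: sum_nonneg)
   then have "2^n * ?x\<^sup>2 \<le> 2^n * ?q s om" by simp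
   moreover have "0 \<le> 2^n * ?x\<^sup>2" "(0::real) \<le> (1/2)^n" by auto
   moreover have "x \<le> p + r" if "2 * x \<le> p + y" "y \<le> r" "0 \<le> y" "0 \<le> p" for x p y r :: real using that by linarith
   ultimately have "\<bar>?x\<bar> \<le> (1/2)^n + 2^n * ?q s om" by blast
   then have "ennreal \<bar>?x\<bar> \<le> ennreal ((1/2)^n) + ennreal (2^n) * ennreal (?q s om)"
   proof -
    have "0 \<le> ?q s om" by (intro sum_nonneg) auto
    then show ?thesis
     using \<open>\<bar>?x\<bar> \<le> _\<close> ennreal_le_lincomb[of "\<bar>?x\<bar>" "(1/2)^n" 1 "2^n" "?q s om"] by (simp del: sum.lessThan_Suc)
   qed
   then show "ennreal (norm (indicat_real {u..t} s *\<^sub>R ?x)) \<le> ennreal ((1/2)^n) * indicator {0..T} s + ennreal (2^n) * (ennreal (?q s om) * indicator {0..T} s)"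
    using assms by (auto split: split_indicator)
  qed
  also have "... = ennreal (T * (1/2)^n) + ennreal (2^n) * (\<integral>\<^sup>+s\<in>{0..T}. ennreal (?q s om) \<partial>lborel)"
  proof -
   have "(\<integral>\<^sup>+s. ennreal ((1/2)^n) * indicator {0..T} s \<partial>lborel) = ennreal (T * (1/2)^n)"
    using T by (subst nn_integral_cmult_indicator) (auto simp: ennreal_mult[symmetric] mult.commute)
   moreover have [measurable]: "(\<lambda>s. ennreal (?q s om) * indicator {0..T} s) \<in> borel_measurable lborel" by measurable
   ultimately show ?thesis by (simp add: nn_integral_add nn_integral_cmult del: sum.lessThan_Suc)
  qed
  finally show ?thesis .
 qed
 have qm[measurable]: "(\<lambda>om. \<integral>\<^sup>+s\<in>{0..T}. ennreal (?q s om) \<partial>lborel) \<in> borel_measurable M"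
 proof -
  have "(\<lambda>p. ennreal (\<Sum>k<Suc k. (c n k (fst p) (snd p) - b k (fst p) (snd p))\<^sup>2) * indicator {0..T} (fst p)) \<in> borel_measurable (lborel \<Otimes>\<^sub>M M)" by measurable
  from measurable_compose[OF measurable_pair_swap' this] show ?thesis
   by (intro lborel.borel_measurable_nn_integral) (simp add: split_beta')
 qed
 have "(\<integral>\<^sup>+om. ennreal \<bar>(LINT s:{u..t}|lborel. c n k s om) - (LINT s:{u..t}|lborel. b k s om)\<bar> \<partial>M)
   \<le> (\<integral>\<^sup>+om. ennreal (T * (1/2)^n) + ennreal (2^n) * (\<integral>\<^sup>+s\<in>{0..T}. ennreal (?q s om) \<partial>lborel) \<partial>M)"
  by (intro nn_integral_mono 1)
 also have "... = ennreal (T * (1/2)^n) + ennreal (2^n) * (\<integral>\<^sup>+om. (\<integral>\<^sup>+s\<in>{0..T}. ennreal (?q s om) \<partial>lborel) \<partial>M)"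
  using qm by (simp add: nn_integral_add nn_integral_cmult emeasure_space_1 del: sum.lessThan_Suc)
 also have "... \<le> ennreal (T * (1/2)^n) + ennreal (2^n) * ennreal ((1/16)^n / 4)"
  by (intro add_left_mono mult_left_mono approx) auto
 also have "... = ennreal (T * (1/2)^n + (1/8)^n / 4)"
  using T by (simp add: ennreal_mult[symmetric] ennreal_plus[symmetric] power_mult_distrib[symmetric] del: ennreal_plus)
 also have "... \<le> ennreal ((T + 1) * (1/2)^n)"
 proof (rule ennreal_leI)
  have "(1/8::real)^n \<le> (1/2)^n" by (intro power_mono) auto
  moreover have "(0::real) \<le> (1/2)^n" by simp
  ultimately have "(1/8::real)^n / 4 \<le> (1/2)^n" by linarith
  then show "T * (1/2)^n + (1/8)^n / 4 \<le> (T + 1) * (1/2)^n" by (simp add: distrib_right)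
 qed
 finally show "(\<integral>\<^sup>+om. ennreal \<bar>(LINT s:{u..t}|lborel. c n k s om) - (LINT s:{u..t}|lborel. b k s om)\<bar> \<partial>M) \<le> ennreal ((T + 1) * (1/2)^n)" .
qed

end

section \<open>Change of measure\<close>

context girsanov begin

lemma LINT_split:
 assumes "om \<in> space M" "0 \<le> u" "u \<le> t"
 shows "(LINT s:{0..t}|lborel. b k s om) - (LINT s:{0..u}|lborel. b k s om) = (LINT s:{u..t}|lborel. b k s om)"
proof -
 note [measurable] = b_section[OF assms(1)]
 have i: "set_integrable lborel {x..y} (\<lambda>s. b k s om)" for x y by (rule set_int_bounded[OF _ bb]) measurable
 have "(LINT s:{0..t}|lborel. b k s om) = (\<integral>s. indicat_real {0..u} s *\<^sub>R b k s om + indicat_real {u..t} s *\<^sub>R b k s om \<partial>lborel)"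
  unfolding set_lebesgue_integral_def
 proof (rule integral_cong_AE)
  show "AE s in lborel. indicat_real {0..t} s *\<^sub>R b k s om = indicat_real {0..u} s *\<^sub>R b k s om + indicat_real {u..t} s *\<^sub>R b k s om"
   using AE_lborel_singleton[of u] by eventually_elim (use assms in \<open>auto simp: indicator_def\<close>)
 qed measurable
 also have "... = (LINT s:{0..u}|lborel. b k s om) + (LINT s:{u..t}|lborel. b k s om)"
  using Bochner_Integration.integral_add[OF i[of 0 u, unfolded set_integrable_def] i[of u t, unfolded set_integrable_def]]
  by (simp add: set_lebesgue_integral_def)
 finally show ?thesis by simp
qed

context
 fixes \<rho> :: "'w \<Rightarrow> real"
 assumes \<rho>[measurable]: "\<rho> \<in> borel_measurable M" and \<rho>0: "\<And>om. 0 < \<rho> om"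
  and lim: "AE om in M. (\<lambda>n. exp (L n om)) \<longlonglongrightarrow> \<rho> om"
begin

definition wt where "wt k t om = w k t om - (LINT s:{0..t}|lborel. b k s om)"

lemma wt_F: "t \<in> {0..T} \<Longrightarrow> wt k t \<in> borel_measurable (F t)"
 unfolding wt_def[abs_def] by (intro borel_measurable_diff wF bF)

lemma wt_M: "t \<in> {0..T} \<Longrightarrow> wt k t \<in> borel_measurable M"
 using F_M wt_F by blast

text \<open>Girsanov's formula before the limit: the density of \<open>c n\<close> times the
  exponential of v against the increment corrected by the integral of \<open>c n\<close> is, up to
  the constant exp q, the density of \<open>c n\<close> plus a pulse. Its mass on an event preceding
  the pulse is that of the density of \<open>c n\<close> alone. Uniform second moments justify the
  passage to the limit in n.\<close>

lemma grid_limit: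
 fixes m :: nat and v :: "nat \<Rightarrow> real"
 assumes ab: "a \<le> a'" "a' \<le> 2 ^ i" and A: "A \<in> sets (F (gp T i a))"
 defines "u \<equiv> gp T i a" and "t \<equiv> gp T i a'"
 defines "q \<equiv> (\<Sum>k<m. (v k)\<^sup>2) * (t - u) / 2"
 shows "(\<lambda>n. ennreal (exp q) * (\<integral>\<^sup>+om. indicator A om * ennreal (exp (L n om)) \<partial>M))
  \<longlonglongrightarrow> (\<integral>\<^sup>+om. indicator A om * ennreal (\<rho> om * exp (\<Sum>k<m. v k * (wt k t om - wt k u om))) \<partial>M)"
proof -
 have ut: "0 \<le> u" "u \<le> t" "t \<le> T" "u \<in> {0..T}" "t \<in> {0..T}"
  using gp_in[of a i] gp_in[of a' i] ab gp_mono[OF ab(1), of i] by (auto simp: u_def t_def)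
 note [measurable] = wM[OF ut(4)] wM[OF ut(5)] sets_F_M[OF ut(4) A[folded u_def]] wt_M[OF ut(4)] wt_M[OF ut(5)]
  drift_int_measurable[OF cM]
 define f where "f n om = indicat_real A om * exp (L n om) * exp ((\<Sum>k<m. v k * (inc k u t om)) - (\<Sum>k<m. v k * (LINT s:{u..t}|lborel. c n k s om)))" for n om
 define g where "g om = indicat_real A om * \<rho> om * exp (\<Sum>k<m. v k * (wt k t om - wt k u om))" for om
 have fm[measurable]: "f n \<in> borel_measurable M" for n unfolding f_def by measurable
 have gm[measurable]: "g \<in> borel_measurable M" unfolding g_def by measurable
 define v' where "v' k = (if k < m then v k else 0)" for k
 \<comment> \<open>A common level and dimension for \<open>c n\<close> and the pulse;
   \<open>aa n\<close> and \<open>bb' n\<close> are the indices of the two given times at that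
   level.\<close>
 define N where "N n = max (Nf n) i" for n
 define d where "d n = max m (dm n)" for n
 define aa where "aa n = 2 ^ (N n - i) * a" for n
 define bb' where "bb' n = 2 ^ (N n - i) * a'" for n
 have ug: "gp T (N n) (aa n) = u" "gp T (N n) (bb' n) = t" for n
  unfolding aa_def bb'_def u_def t_def by (rule gp_refine; simp add: N_def)+
 have le: "aa n \<le> bb' n" "bb' n \<le> 2 ^ N n" for n
 proof -
  show "aa n \<le> bb' n" using ab by (simp add: aa_def bb'_def)
  have "bb' n \<le> 2 ^ (N n - i) * 2 ^ i" unfolding bb'_def using ab(2) by (intro mult_left_mono) auto
  also have "... = 2 ^ N n" by (simp add: power_add[symmetric] N_def)
  finally show "bb' n \<le> 2 ^ N n" .
 qed
 define cp where "cp n = (\<lambda>k s om. 1 * c n k s om + 1 * pulse v' (gp T (N n) (aa n)) (gp T (N n) (bb' n)) k s om)" for n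
 have elN: "elem (N n) (c n)" for n by (rule elem_mono[OF _ el]) (simp add: N_def)
 have elcp: "elem (N n) (cp n)" for n unfolding cp_def by (rule elem_lincomb[OF elN elem_pulse])
 have sumv: "(\<Sum>k<d n. v' k * h k) = (\<Sum>k<m. v k * h k)" for n and h :: "nat \<Rightarrow> real"
  by (rule sum.mono_neutral_cong_right) (auto simp: v'_def d_def)
 have sumv2: "(\<Sum>k<d n. (v' k)\<^sup>2) = (\<Sum>k<m. (v k)\<^sup>2)" for n
  by (rule sum.mono_neutral_cong_right) (auto simp: v'_def d_def)
 have LRN: "LR (N n) (d n) (c n) (2 ^ N n) om = L n om" for n om
  by (rule LR_L) (auto simp: N_def d_def)
 have ci: "(\<Sum>j\<in>{aa n..<bb' n}. c n k (gp T (N n) j) om * (T / 2 ^ N n)) = (LINT s:{u..t}|lborel. c n k s om)" for n k om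
 proof -
  have "c n k s om = c n k (gp T (N n) j) om" if "j < 2 ^ N n" "gp T (N n) j \<le> s" "s < gp T (N n) (Suc j)" for j s
   using elemD(3)[OF elN that(1), where k=k and s=s] that by simp
  then have "(LINT s:{gp T (N n) (aa n)..gp T (N n) (bb' n)}|lborel. c n k s om) = (\<Sum>j\<in>{aa n..<bb' n}. c n k (gp T (N n) j) om * (T / 2 ^ N n))"
   by (rule piecewise_integral(2)[OF _ le])
  then show ?thesis by (simp only: ug)
 qed
 have key: "LR (N n) (d n) (cp n) (2 ^ N n) om = L n om + ((\<Sum>k<m. v k * (inc k u t om)) - (\<Sum>k<m. v k * (LINT s:{u..t}|lborel. c n k s om))) - q" for n om
  unfolding cp_def LR_pulse(1)[OF le] unfolding LRN ci ug sumv sumv2 q_def by simp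
 have f_eq: "f n om = exp q * (indicat_real A om * exp (LR (N n) (d n) (cp n) (2 ^ N n) om))" for n om
 proof -
  have "exp q * exp (l + x - q) = exp l * exp x" for l x by (simp add: exp_add[symmetric])
  then show ?thesis unfolding f_def key by (simp only: mult.left_commute[of "exp q"] mult.assoc)
 qed
 have int_f: "(\<integral>\<^sup>+om. ennreal (f n om) \<partial>M) = ennreal (exp q) * (\<integral>\<^sup>+om. indicator A om * ennreal (exp (L n om)) \<partial>M)" for n
 proof -
  have An: "A \<in> sets (F (gp T (N n) (aa n)))" using A by (simp add: ug u_def)
  note [measurable] = LR_measurable_M[OF elcp order_refl]
  have "(\<integral>\<^sup>+om. ennreal (f n om) \<partial>M) = (\<integral>\<^sup>+om. ennreal (exp q) * (indicator A om * ennreal (exp (LR (N n) (d n) (cp n) (2 ^ N n) om))) \<partial>M)"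
   by (intro nn_integral_cong) (auto simp: f_eq ennreal_mult[symmetric] split: split_indicator)
  also have "... = ennreal (exp q) * (\<integral>\<^sup>+om. indicator A om * ennreal (exp (LR (N n) (d n) (cp n) (2 ^ N n) om)) \<partial>M)"
   by (rule nn_integral_cmult) measurable
  \<comment> \<open>The martingale is run back from T to the beginning of the pulse,
    \<open>cp n\<close> is exchanged for \<open>c n\<close>, with which it agrees until then, and
    the martingale is run forward again.\<close>
  also have "(\<integral>\<^sup>+om. indicator A om * ennreal (exp (LR (N n) (d n) (cp n) (2 ^ N n) om)) \<partial>M) = (\<integral>\<^sup>+om. indicator A om * ennreal (exp (LR (N n) (d n) (cp n) (aa n) om)) \<partial>M)"
   by (rule exp_LR[OF elcp _ _ An]) (use le order_trans in blast)+
  also have "... = (\<integral>\<^sup>+om. indicator A om * ennreal (exp (LR (N n) (d n) (c n) (aa n) om)) \<partial>M)"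
   unfolding cp_def LR_pulse(2)[OF le] ..
  also have "... = (\<integral>\<^sup>+om. indicator A om * ennreal (exp (LR (N n) (d n) (c n) (2 ^ N n) om)) \<partial>M)"
   by (rule exp_LR[OF elN _ _ An, symmetric]) (use le order_trans in blast)+
  finally show ?thesis by (simp only: LRN)
 qed
 have "(\<lambda>n. \<integral>\<^sup>+om. ennreal (f n om) \<partial>M) \<longlonglongrightarrow> (\<integral>\<^sup>+om. ennreal (g om) \<partial>M)"
 proof (rule nn_integral_tendsto_of_L2_bounded[OF prob_space_axioms fm gm])
  show "0 \<le> f n om" for n om by (simp add: f_def)
  \<comment> \<open>Bound for the squared coefficients of \<open>cp n\<close>, from (x + y)^2 \<le>
    2 x^2 + 2 y^2; it is uniform in n.\<close>
  define C2 where "C2 = 2 * C + 2 * (\<Sum>k<m. (v k)\<^sup>2)"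
  show "(\<integral>\<^sup>+om. ennreal ((f n om)\<^sup>2) \<partial>M) \<le> ennreal (exp (2 * q) * exp (C2 * T))" for n
  proof -
   note [measurable] = LR_measurable_M[OF elcp order_refl]
   have "(\<integral>\<^sup>+om. ennreal ((f n om)\<^sup>2) \<partial>M) \<le> (\<integral>\<^sup>+om. ennreal (exp (2 * q)) * ennreal ((exp (LR (N n) (d n) (cp n) (2 ^ N n) om))\<^sup>2) \<partial>M)"
    by (intro nn_integral_mono) (auto simp: f_eq ennreal_mult[symmetric] power_mult_distrib exp_double split: split_indicator)
   also have "... = ennreal (exp (2 * q)) * (\<integral>\<^sup>+om. ennreal ((exp (LR (N n) (d n) (cp n) (2 ^ N n) om))\<^sup>2) \<partial>M)"
    by (rule nn_integral_cmult) measurable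
   also have "... \<le> ennreal (exp (2 * q)) * ennreal (exp (C2 * T))"
   proof (intro mult_left_mono exp_LR_square[OF elcp])
    fix j om
    have "(\<Sum>k<d n. (cp n k (gp T (N n) j) om)\<^sup>2) \<le> (\<Sum>k<d n. 2 * (c n k (gp T (N n) j) om)\<^sup>2 + 2 * (v' k)\<^sup>2)"
    proof (rule sum_mono)
     fix k
     have "0 \<le> (c n k (gp T (N n) j) om - v' k)\<^sup>2" by simp
     then have "(c n k (gp T (N n) j) om + v' k)\<^sup>2 \<le> 2 * (c n k (gp T (N n) j) om)\<^sup>2 + 2 * (v' k)\<^sup>2"
      by (simp add: power2_eq_square algebra_simps)
     moreover have "(c n k (gp T (N n) j) om)\<^sup>2 \<le> 2 * (c n k (gp T (N n) j) om)\<^sup>2 + 2 * (v' k)\<^sup>2" by simp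
     ultimately show "(cp n k (gp T (N n) j) om)\<^sup>2 \<le> 2 * (c n k (gp T (N n) j) om)\<^sup>2 + 2 * (v' k)\<^sup>2"
      by (simp add: cp_def pulse_def)
    qed
    also have "... \<le> C2" using bd'[where d="d n" and n=n and s="gp T (N n) j" and om=om]
     by (simp add: sum.distrib sum_distrib_left[symmetric] sumv2 C2_def)
    finally show "(\<Sum>k<d n. (cp n k (gp T (N n) j) om)\<^sup>2) \<le> C2" .
   qed simp
   finally show ?thesis by (simp add: ennreal_mult[symmetric])
  qed
  have dc: "AE om in M. \<forall>k. (\<lambda>n. LINT s:{u..t}|lborel. c n k s om) \<longlonglongrightarrow> (LINT s:{u..t}|lborel. b k s om)"
   unfolding AE_all_countable using drift_conv[OF ut(1,3)] by blast
  show "AE om in M. (\<lambda>n. f n om) \<longlonglongrightarrow> g om"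
   using lim dc AE_space
  proof eventually_elim
   case (elim om)
   have "(\<lambda>n. f n om) \<longlonglongrightarrow> indicat_real A om * \<rho> om * exp ((\<Sum>k<m. v k * (inc k u t om)) - (\<Sum>k<m. v k * (LINT s:{u..t}|lborel. b k s om)))"
    unfolding f_def using elim by (intro tendsto_intros) auto
   moreover have "(\<Sum>k<m. v k * (inc k u t om)) - (\<Sum>k<m. v k * (LINT s:{u..t}|lborel. b k s om)) = (\<Sum>k<m. v k * (wt k t om - wt k u om))"
    using LINT_split[OF elim(3) ut(1,2)] by (simp add: wt_def sum_subtractf[symmetric] algebra_simps)
   ultimately show ?case by (simp add: g_def)
  qed
 qed
 moreover have "(\<integral>\<^sup>+om. ennreal (g om) \<partial>M) = (\<integral>\<^sup>+om. indicator A om * ennreal (\<rho> om * exp (\<Sum>k<m. v k * (wt k t om - wt k u om))) \<partial>M)"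
  by (intro nn_integral_cong) (auto simp: g_def split: split_indicator)
 ultimately show ?thesis unfolding int_f by simp
qed

lemma L_limit:
 assumes "s \<in> {0..T}" "A \<in> sets (F s)"
 shows "(\<lambda>n. \<integral>\<^sup>+om. indicator A om * ennreal (exp (L n om)) \<partial>M) \<longlonglongrightarrow> (\<integral>\<^sup>+om. indicator A om * ennreal (\<rho> om) \<partial>M)"
proof -
 \<comment> \<open>The grid point of index 1 at level 0 is T, whose past contains every event
   considered. With an empty pulse the formula is the plain convergence of the densities on
   \<open>A\<close>.\<close>
 have "A \<in> sets (F (gp T 0 1))" using assms by (intro mono[OF _ _ _ assms(2)]) (auto simp: gp_def)
 then show ?thesis using grid_limit[of 1 1 0 A "\<lambda>_. 0" 0] by simp
qed

lemma density_mgf_grid: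
 fixes m :: nat and v :: "nat \<Rightarrow> real"
 assumes ab: "a \<le> a'" "a' \<le> 2 ^ i" and A: "A \<in> sets (F (gp T i a))"
 shows "(\<integral>\<^sup>+om. indicator A om * ennreal (exp (\<Sum>k<m. v k * (wt k (gp T i a') om - wt k (gp T i a) om))) \<partial>density M \<rho>)
  = emeasure (density M \<rho>) A * ennreal (exp ((\<Sum>k<m. (v k)\<^sup>2) * (gp T i a' - gp T i a) / 2))"
proof -
 have g: "gp T i a \<in> {0..T}" "gp T i a' \<in> {0..T}" using gp_in[of a i] gp_in[of a' i] ab by auto
 note [measurable] = sets_F_M[OF g(1) A] wt_M[OF g(1)] wt_M[OF g(2)]
 let ?q = "(\<Sum>k<m. (v k)\<^sup>2) * (gp T i a' - gp T i a) / 2"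
 have "(\<lambda>n. ennreal (exp ?q) * (\<integral>\<^sup>+om. indicator A om * ennreal (exp (L n om)) \<partial>M)) \<longlonglongrightarrow> ennreal (exp ?q) * (\<integral>\<^sup>+om. indicator A om * ennreal (\<rho> om) \<partial>M)"
  by (intro ennreal_tendsto_cmult L_limit[OF g(1) A]) simp
 from LIMSEQ_unique[OF this grid_limit[OF assms]]
 have "ennreal (exp ?q) * (\<integral>\<^sup>+om. indicator A om * ennreal (\<rho> om) \<partial>M) = (\<integral>\<^sup>+om. indicator A om * ennreal (\<rho> om * exp (\<Sum>k<m. v k * (wt k (gp T i a') om - wt k (gp T i a) om))) \<partial>M)" .
 then show ?thesis
  using less_imp_le[OF \<rho>0] by (simp add: nn_integral_density emeasure_density ennreal_mult mult_ac)
qed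

lemma density_prob: "prob_space (density M \<rho>)"
proof
 have z: "0 \<in> {0..T}" using T by simp
 have "space M \<in> sets (F 0)" using space_F[OF z] by (metis sets.top)
 from L_limit[OF z this]
 have "(\<lambda>n. \<integral>\<^sup>+om. indicator (space M) om * ennreal (exp (L n om)) \<partial>M) \<longlonglongrightarrow> (\<integral>\<^sup>+om. indicator (space M) om * ennreal (\<rho> om) \<partial>M)" .
 moreover have "(\<integral>\<^sup>+om. indicator (space M) om * ennreal (exp (L n om)) \<partial>M) = 1" for n
  using exp_LR_1[OF el[of n], of "dm n"] by (simp add: L_def cong: nn_integral_cong)
 ultimately have "(\<integral>\<^sup>+om. indicator (space M) om * ennreal (\<rho> om) \<partial>M) = 1"
  by (simp add: LIMSEQ_const_iff)
 then show "emeasure (density M (\<lambda>x. ennreal (\<rho> x))) (space (density M (\<lambda>x. ennreal (\<rho> x)))) = 1"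
  by (simp add: emeasure_density mult.commute)
qed

lemma AE_density_iff: "(AE om in density M \<rho>. P om) \<longleftrightarrow> (AE om in M. P om)"
 using \<rho>0 by (simp add: AE_density)

lemma wt_continuous: "AE om in M. continuous_on {0..T} (\<lambda>t. wt k t om)"
proof -
 have "AE om in M. continuous_on {0..T} (\<lambda>t. w k t om)" using bm by (simp add: bm_system_def)
 then show ?thesis using AE_space
 proof eventually_elim
  case (elim om)
  then show ?case unfolding wt_def
   by (intro continuous_on_diff indefinite_integral_continuous_bounded[OF b_section bb])
 qed
qed

text \<open>The exponential moments are known between grid times; approaching s and t from the right
  by grid times keeps \<open>A\<close> in the past. The grid identity itself, with 2 v in place of
  v, bounds the second moments needed for the limit.\<close>

theorem girsanov: "bm_system T (density M \<rho>) F (\<lambda>k t om. w k t om - (LINT s:{0..t}|lborel. b k s om))"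
 unfolding wt_def[symmetric] bm_system_def
proof (intro conjI allI ballI)
 interpret Q: prob_space "density M \<rho>" by (rule density_prob)
 show "prob_space (density M \<rho>)" by (rule density_prob)
 show "filtration_on {0..T} (density M \<rho>) F"
  using bm by (simp add: bm_system_def filtration_on_def subalgebra_def)
 show "wt k t \<in> borel_measurable (F t)" if "t \<in> {0..T}" for k t by (rule wt_F[OF that])
 show "AE om in density M \<rho>. wt k 0 om = 0" for k
 proof -
  have "AE om in M. w k 0 om = 0" using bm by (simp add: bm_system_def)
  moreover have "(LINT s:{0..0}|lborel. b k s om) = 0" for om
  proof -
   have "AE s in lborel. indicat_real {0..0} s *\<^sub>R b k s om = 0"
    using AE_lborel_singleton[of 0] by eventually_elim auto
   then show ?thesis unfolding set_lebesgue_integral_def by (rule integral_eq_zero_AE)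
  qed
  ultimately show ?thesis unfolding AE_density_iff wt_def by simp
 qed
 show "AE om in density M \<rho>. continuous_on {0..T} (\<lambda>t. wt k t om)" for k
  unfolding AE_density_iff by (rule wt_continuous)
 fix m v s t A
 assume s: "s \<in> {0..T}" and t: "t \<in> {s..T}" and A: "A \<in> sets (F s)"
 have tT: "t \<in> {0..T}" using s t by auto
 define a where "a i = nat \<lceil>s * 2 ^ i / T\<rceil>" for i
 define a' where "a' i = nat \<lceil>t * 2 ^ i / T\<rceil>" for i
 note ga = ceil_grid[OF s, folded a_def] and ga' = ceil_grid[OF tT, folded a'_def]
 have aa': "a i \<le> a' i" for i
  unfolding a_def a'_def using t T by (intro nat_mono ceiling_mono divide_right_mono mult_right_mono) auto
 have gin: "gp T i (a i) \<in> {0..T}" "gp T i (a' i) \<in> {0..T}" for i by (rule gp_in[OF ga(1)] gp_in[OF ga'(1)])+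
 have Ai: "A \<in> sets (F (gp T i (a i)))" for i using mono[OF _ ga(2) _ A] s gin[of i] by auto
 define h where "h i om = indicat_real A om * exp (\<Sum>k<m. v k * (wt k (gp T i (a' i)) om - wt k (gp T i (a i)) om))" for i om
 define h0 where "h0 om = indicat_real A om * exp (\<Sum>k<m. v k * (wt k t om - wt k s om))" for om
 note [measurable] = sets_F_M[OF s A] wt_M[OF gin(1)] wt_M[OF gin(2)] wt_M[OF s] wt_M[OF tT]
 have hm: "h i \<in> borel_measurable (density M \<rho>)" "h0 \<in> borel_measurable (density M \<rho>)" for i
  unfolding h_def h0_def by simp_all
 have ind: "ennreal (indicat_real A om * x) = indicator A om * ennreal x" for om x by (auto split: split_indicator)
 have hi: "(\<integral>\<^sup>+om. ennreal (h i om) \<partial>density M \<rho>) = ennreal (Q.prob A * exp ((\<Sum>k<m. (v k)\<^sup>2) * (gp T i (a' i) - gp T i (a i)) / 2))" for i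
  unfolding h_def ind density_mgf_grid[OF aa' ga'(1) Ai] by (simp add: Q.emeasure_eq_measure ennreal_mult)
 have "(\<lambda>i. \<integral>\<^sup>+om. ennreal (h i om) \<partial>density M \<rho>) \<longlonglongrightarrow> (\<integral>\<^sup>+om. ennreal (h0 om) \<partial>density M \<rho>)"
 proof (rule nn_integral_tendsto_of_L2_bounded[OF density_prob hm])
  show "0 \<le> h i om" for i om by (simp add: h_def)
  show "(\<integral>\<^sup>+om. ennreal ((h i om)\<^sup>2) \<partial>density M \<rho>) \<le> ennreal (exp (2 * (\<Sum>k<m. (v k)\<^sup>2) * T))" for i
  proof -
   have "(h i om)\<^sup>2 = indicat_real A om * exp (\<Sum>k<m. (2 * v k) * (wt k (gp T i (a' i)) om - wt k (gp T i (a i)) om))" for om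
    by (simp add: h_def power_mult_distrib exp_double[symmetric] sum_distrib_left mult.assoc split: split_indicator)
   then have "(\<integral>\<^sup>+om. ennreal ((h i om)\<^sup>2) \<partial>density M \<rho>) = emeasure (density M \<rho>) A * ennreal (exp ((\<Sum>k<m. (2 * v k)\<^sup>2) * (gp T i (a' i) - gp T i (a i)) / 2))"
    by (simp only: ind density_mgf_grid[OF aa' ga'(1) Ai])
   also have "... \<le> 1 * ennreal (exp (2 * (\<Sum>k<m. (v k)\<^sup>2) * T))"
   proof (intro mult_mono ennreal_leI)
    show "emeasure (density M \<rho>) A \<le> 1" by (rule Q.emeasure_le_1)
    have "2 * (\<Sum>k<m. (v k)\<^sup>2) * (gp T i (a' i) - gp T i (a i)) \<le> 2 * (\<Sum>k<m. (v k)\<^sup>2) * T"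
     using gin[of i] by (intro mult_left_mono mult_nonneg_nonneg sum_nonneg) auto
    moreover have "(\<Sum>k<m. (2 * v k)\<^sup>2) = 4 * (\<Sum>k<m. (v k)\<^sup>2)" by (simp add: power_mult_distrib sum_distrib_left)
    ultimately show "exp ((\<Sum>k<m. (2 * v k)\<^sup>2) * (gp T i (a' i) - gp T i (a i)) / 2) \<le> exp (2 * (\<Sum>k<m. (v k)\<^sup>2) * T)"
     by simp
   qed auto
   finally show ?thesis by simp
  qed
  have "AE om in M. \<forall>k. continuous_on {0..T} (\<lambda>t. wt k t om)"
   unfolding AE_all_countable using wt_continuous by blast
  then show "AE om in density M \<rho>. (\<lambda>i. h i om) \<longlonglongrightarrow> h0 om"
   unfolding AE_density_iff
  proof eventually_elim
   case (elim om)
   have "(\<lambda>i. wt k (gp T i (a i)) om) \<longlonglongrightarrow> wt k s om" "(\<lambda>i. wt k (gp T i (a' i)) om) \<longlonglongrightarrow> wt k t om" for k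
    by (rule continuous_on_tendsto_compose[OF elim[rule_format]]; use ga(3) ga'(3) s tT gin in auto)+
   then show ?case unfolding h_def h0_def by (intro tendsto_intros)
  qed
 qed
 moreover have "(\<lambda>i. \<integral>\<^sup>+om. ennreal (h i om) \<partial>density M \<rho>) \<longlonglongrightarrow> ennreal (Q.prob A * exp ((\<Sum>k<m. (v k)\<^sup>2) * (t - s) / 2))"
  unfolding hi by (intro tendsto_ennrealI tendsto_intros ga(3) ga'(3)) simp
 ultimately have "(\<integral>\<^sup>+om. ennreal (h0 om) \<partial>density M \<rho>) = ennreal (Q.prob A * exp ((\<Sum>k<m. (v k)\<^sup>2) * (t - s) / 2))"
  by (rule LIMSEQ_unique)
 then show "(\<integral>\<^sup>+om. indicator A om * ennreal (exp (\<Sum>k<m. v k * (wt k t om - wt k s om))) \<partial>density M \<rho>)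
   = emeasure (density M \<rho>) A * ennreal (exp ((\<Sum>k<m. (v k)\<^sup>2) * (t - s) / 2))"
  unfolding h0_def ind by (simp add: Q.emeasure_eq_measure ennreal_mult)
qed

end

end

section \<open>Approximation of the drift\<close>

text \<open>One continuous function has to serve both measures, so the compact set from which it is
  built is the union of two compact subsets of \<open>A\<close>, one nearly exhausting
  \<open>A\<close> for each measure.\<close>

lemma indicator_continuous_approx:
 fixes \<mu>1 \<mu>2 :: "'a::polish_space measure"
 assumes "finite_measure \<mu>1" "finite_measure \<mu>2" "sets \<mu>1 = sets borel" "sets \<mu>2 = sets borel"
  and A[measurable]: "A \<in> sets borel" and eps: "0 < (eps::real)"
 shows "\<exists>\<phi>. continuous_on UNIV \<phi> \<and> (\<forall>x. 0 \<le> \<phi> x \<and> \<phi> x \<le> 1) \<and>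
  (\<integral>\<^sup>+x. ennreal \<bar>\<phi> x - indicator A x\<bar> \<partial>\<mu>1) \<le> ennreal eps \<and> (\<integral>\<^sup>+x. ennreal \<bar>\<phi> x - indicator A x\<bar> \<partial>\<mu>2) \<le> ennreal eps"
proof -
 have ex: "\<exists>K. compact K \<and> K \<subseteq> A \<and> emeasure \<mu> (A - K) \<le> ennreal (eps/2)"
  if "finite_measure \<mu>" "sets \<mu> = sets borel" for \<mu> :: "'a measure"
 proof -
  interpret finite_measure \<mu> by fact
  have reg: "emeasure \<mu> A = (SUP K \<in> {K. K \<subseteq> A \<and> compact K}. emeasure \<mu> K)"
   by (rule inner_regular) (use that in auto)
  have "\<exists>K\<in>{K. K \<subseteq> A \<and> compact K}. emeasure \<mu> A \<le> emeasure \<mu> K + ennreal (eps/2)"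
  proof (rule ccontr)
   assume "\<not> ?thesis"
   then have *: "emeasure \<mu> K + ennreal (eps/2) \<le> emeasure \<mu> A" if "K \<subseteq> A" "compact K" for K
   proof -
    from \<open>\<not> _\<close> that have "\<not> emeasure \<mu> A \<le> emeasure \<mu> K + ennreal (eps/2)" by blast
    then show ?thesis by simp
   qed
   have "(SUP K \<in> {K. K \<subseteq> A \<and> compact K}. emeasure \<mu> K) + ennreal (eps/2) \<le> emeasure \<mu> A"
    by (subst ennreal_SUP_add_left[symmetric]) (auto intro!: SUP_least * exI[of _ "{}"])
   then have "emeasure \<mu> A + ennreal (eps/2) \<le> emeasure \<mu> A" unfolding reg[symmetric] .
   then have "ennreal (measure \<mu> A + eps/2) \<le> ennreal (measure \<mu> A)"
    using eps by (simp add: emeasure_eq_measure)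
   then show False using eps by (simp add: ennreal_le_iff)
  qed
  then obtain K where K: "K \<subseteq> A" "compact K" "emeasure \<mu> A \<le> emeasure \<mu> K + ennreal (eps/2)" by blast
  have [measurable]: "K \<in> sets \<mu>" using K that by (auto intro: borel_closed compact_imp_closed)
  have "measure \<mu> (A - K) = measure \<mu> A - measure \<mu> K" using K that by (intro finite_measure_Diff) auto
  moreover have "measure \<mu> A \<le> measure \<mu> K + eps/2" using K(3) eps by (simp add: emeasure_eq_measure ennreal_plus[symmetric] del: ennreal_plus)
  ultimately show ?thesis using K by (auto simp: emeasure_eq_measure intro!: ennreal_leI)
 qed
 obtain K1 where K1: "compact K1" "K1 \<subseteq> A" "emeasure \<mu>1 (A - K1) \<le> ennreal (eps/2)" using ex assms by blast
 obtain K2 where K2: "compact K2" "K2 \<subseteq> A" "emeasure \<mu>2 (A - K2) \<le> ennreal (eps/2)" using ex assms by blast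
 define K where "K = K1 \<union> K2"
 have K: "compact K" "K \<subseteq> A" using K1 K2 by (auto simp: K_def)
 have Kb[measurable]: "K \<in> sets borel" "K1 \<in> sets borel" "K2 \<in> sets borel" using K K1 K2 by (auto intro: borel_closed compact_imp_closed)
 \<comment> \<open>Cut-offs that tend to the indicator of \<open>K\<close>. The empty set is
   separated because \<open>infdist\<close> to it is 0 by convention, which would give the constant
   1.\<close>
 define \<psi> where "\<psi> n x = (if K = {} then 0 else max 0 (1 - real n * infdist x K))" for n x
 have \<psi>c: "continuous_on UNIV (\<psi> n)" for n
  unfolding \<psi>_def by (cases "K = {}") (auto intro!: continuous_intros)
 then have [measurable]: "\<psi> n \<in> borel_measurable borel" for n by (rule borel_measurable_continuous_onI)
 have \<psi>b: "0 \<le> \<psi> n x" "\<psi> n x \<le> 1" for n x by (auto simp: \<psi>_def infdist_nonneg)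
 have lim: "(\<lambda>n. \<psi> n x) \<longlonglongrightarrow> indicator K x" for x
 proof (cases "x \<in> K")
  case True
  then have "\<psi> n x = 1" for n by (auto simp: \<psi>_def)
  then show ?thesis using True by simp
 next
  case False
  show ?thesis
  proof (cases "K = {}")
   case ne: False
   then have pos: "infdist x K > 0" using False K by (metis compact_imp_closed in_closed_iff_infdist_zero infdist_nonneg less_eq_real_def)
   have "\<forall>\<^sub>F n in sequentially. 1 / infdist x K \<le> real n"
    using filterlim_real_sequentially unfolding filterlim_at_top by blast
   then have "\<forall>\<^sub>F n in sequentially. \<psi> n x = 0"
    by eventually_elim (use pos in \<open>auto simp: \<psi>_def field_simps max_def\<close>)
   then show ?thesis using False by (simp add: tendsto_eventually)
  qed (simp add: \<psi>_def)
 qed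
 have ev: "\<forall>\<^sub>F n in sequentially. (\<integral>\<^sup>+x. ennreal \<bar>\<psi> n x - indicator A x\<bar> \<partial>\<mu>) \<le> ennreal eps"
  if "finite_measure \<mu>" "sets \<mu> = sets borel" and e: "emeasure \<mu> (A - K) \<le> ennreal (eps/2)" for \<mu> :: "'a measure"
 proof -
  interpret finite_measure \<mu> by fact
  note [measurable_cong] = that(2)
  have "(\<lambda>n. \<integral>\<^sup>+x. ennreal \<bar>\<psi> n x - indicator K x\<bar> \<partial>\<mu>) \<longlonglongrightarrow> (\<integral>\<^sup>+x. ennreal \<bar>indicator K x - indicat_real K x\<bar> \<partial>\<mu>)"
  proof (rule nn_integral_dominated_convergence[where w="\<lambda>_. 1"])
   show "AE x in \<mu>. (\<lambda>n. ennreal \<bar>\<psi> n x - indicator K x\<bar>) \<longlonglongrightarrow> ennreal \<bar>indicator K x - indicat_real K x\<bar>"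
    by (intro AE_I2 tendsto_ennrealI tendsto_rabs tendsto_diff lim tendsto_const)
   have "\<bar>\<psi> n x - indicator K x\<bar> \<le> 1" for n x using \<psi>b[of n x] by (auto split: split_indicator)
   then show "AE x in \<mu>. ennreal \<bar>\<psi> j x - indicator K x\<bar> \<le> 1" for j
    by (simp add: ennreal_le_1)
  qed (auto simp: less_top[symmetric])
  then have "(\<lambda>n. \<integral>\<^sup>+x. ennreal \<bar>\<psi> n x - indicator K x\<bar> \<partial>\<mu>) \<longlonglongrightarrow> 0" by simp
  then have "\<forall>\<^sub>F n in sequentially. (\<integral>\<^sup>+x. ennreal \<bar>\<psi> n x - indicator K x\<bar> \<partial>\<mu>) < ennreal (eps/2)"
   by (rule order_tendstoD(2)) (use eps in simp)
  then show ?thesis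
  proof eventually_elim
   case (elim n)
   have "(\<integral>\<^sup>+x. ennreal \<bar>\<psi> n x - indicator A x\<bar> \<partial>\<mu>) \<le> (\<integral>\<^sup>+x. ennreal \<bar>\<psi> n x - indicator K x\<bar> + indicator (A - K) x \<partial>\<mu>)"
   proof (rule nn_integral_mono)
    fix x
    show "ennreal \<bar>\<psi> n x - indicator A x\<bar> \<le> ennreal \<bar>\<psi> n x - indicator K x\<bar> + indicator (A - K) x"
     using \<psi>b[of n x] K(2) by (auto split: split_indicator simp: ennreal_1[symmetric] ennreal_plus[symmetric] simp del: ennreal_1 ennreal_plus intro!: ennreal_leI)
   qed
   also have "... = (\<integral>\<^sup>+x. ennreal \<bar>\<psi> n x - indicator K x\<bar> \<partial>\<mu>) + emeasure \<mu> (A - K)"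
    by (subst nn_integral_add) (auto simp: that(2))
   also have "... \<le> ennreal (eps/2) + ennreal (eps/2)" using elim e by (intro add_mono) auto
   also have "... = ennreal eps" using eps by (simp add: ennreal_plus[symmetric] del: ennreal_plus)
   finally show ?case .
  qed
 qed
 have "emeasure \<mu>1 (A - K) \<le> ennreal (eps/2)" "emeasure \<mu>2 (A - K) \<le> ennreal (eps/2)"
 proof -
  have "emeasure \<mu>1 (A - K) \<le> emeasure \<mu>1 (A - K1)"
   by (rule emeasure_mono) (use assms(3) in \<open>auto simp: K_def\<close>)
  then show "emeasure \<mu>1 (A - K) \<le> ennreal (eps/2)" using K1(3) by (rule order_trans)
  have "emeasure \<mu>2 (A - K) \<le> emeasure \<mu>2 (A - K2)"
   by (rule emeasure_mono) (use assms(4) in \<open>auto simp: K_def\<close>)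
  then show "emeasure \<mu>2 (A - K) \<le> ennreal (eps/2)" using K2(3) by (rule order_trans)
 qed
 then have "\<forall>\<^sub>F n in sequentially. (\<integral>\<^sup>+x. ennreal \<bar>\<psi> n x - indicator A x\<bar> \<partial>\<mu>1) \<le> ennreal eps \<and> (\<integral>\<^sup>+x. ennreal \<bar>\<psi> n x - indicator A x\<bar> \<partial>\<mu>2) \<le> ennreal eps"
  using ev assms by (intro eventually_conj) auto
 then obtain n where "(\<integral>\<^sup>+x. ennreal \<bar>\<psi> n x - indicator A x\<bar> \<partial>\<mu>1) \<le> ennreal eps" "(\<integral>\<^sup>+x. ennreal \<bar>\<psi> n x - indicator A x\<bar> \<partial>\<mu>2) \<le> ennreal eps"
  by (auto simp: eventually_sequentially)
 then show ?thesis using \<psi>c \<psi>b by blast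
qed

lemma indicator_continuous_AE:
 fixes \<mu>1 \<mu>2 :: "'a::polish_space measure"
 assumes "finite_measure \<mu>1" "finite_measure \<mu>2" "sets \<mu>1 = sets borel" "sets \<mu>2 = sets borel"
  and A[measurable]: "A \<in> sets borel"
 shows "\<exists>\<phi>. (\<forall>n. continuous_on UNIV (\<phi> n) \<and> (\<forall>x. 0 \<le> \<phi> n x \<and> \<phi> n x \<le> (1::real))) \<and>
  (AE x in \<mu>1. (\<lambda>n. \<phi> n x) \<longlonglongrightarrow> indicator A x) \<and> (AE x in \<mu>2. (\<lambda>n. \<phi> n x) \<longlonglongrightarrow> indicator A x)"
proof -
 have "\<forall>n. \<exists>\<phi>. continuous_on UNIV \<phi> \<and> (\<forall>x. 0 \<le> \<phi> x \<and> \<phi> x \<le> 1) \<and>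
  (\<integral>\<^sup>+x. ennreal \<bar>\<phi> x - indicator A x\<bar> \<partial>\<mu>1) \<le> ennreal ((1/2)^n) \<and> (\<integral>\<^sup>+x. ennreal \<bar>\<phi> x - indicator A x\<bar> \<partial>\<mu>2) \<le> ennreal ((1/2)^n)"
  by (intro allI indicator_continuous_approx[OF assms]) simp
 from choice[OF this] obtain \<phi> where "\<forall>n. continuous_on UNIV (\<phi> n) \<and> (\<forall>x. 0 \<le> \<phi> n x \<and> \<phi> n x \<le> 1) \<and>
  (\<integral>\<^sup>+x. ennreal \<bar>\<phi> n x - indicator A x\<bar> \<partial>\<mu>1) \<le> ennreal ((1/2)^n) \<and> (\<integral>\<^sup>+x. ennreal \<bar>\<phi> n x - indicator A x\<bar> \<partial>\<mu>2) \<le> ennreal ((1/2)^n)"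
  by blast
 then have \<phi>: "\<And>n. continuous_on UNIV (\<phi> n)" "\<And>n x. 0 \<le> \<phi> n x \<and> \<phi> n x \<le> 1"
  "\<And>n. (\<integral>\<^sup>+x. ennreal \<bar>\<phi> n x - indicator A x\<bar> \<partial>\<mu>1) \<le> ennreal ((1/2)^n)" "\<And>n. (\<integral>\<^sup>+x. ennreal \<bar>\<phi> n x - indicator A x\<bar> \<partial>\<mu>2) \<le> ennreal ((1/2)^n)"
  by blast+
 have m: "\<phi> n \<in> borel_measurable borel" for n by (rule borel_measurable_continuous_onI[OF \<phi>(1)])
 have "AE x in \<mu>1. (\<lambda>n. \<phi> n x) \<longlonglongrightarrow> indicator A x" "AE x in \<mu>2. (\<lambda>n. \<phi> n x) \<longlonglongrightarrow> indicator A x"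
  using \<phi>(3,4) m by (auto intro!: AE_tendsto_of_summable_L1[where K=1] simp: measurable_cong_sets[OF assms(3) refl] measurable_cong_sets[OF assms(4) refl])
 then show ?thesis using \<phi>(1,2) by blast
qed

section \<open>Rounding of vectors and step approximation of the drift\<close>

definition round_coeff :: "nat \<Rightarrow> real \<Rightarrow> real" where
 "round_coeff p t = of_int \<lfloor>real (Suc p) * t\<rfloor> / real (Suc p)"

lemma round_coeff_bound: "\<bar>round_coeff p t - t\<bar> \<le> 1 / real (Suc p)"
proof -
 have "\<bar>of_int \<lfloor>real (Suc p) * t\<rfloor> - real (Suc p) * t\<bar> \<le> 1" by linarith
 then have "\<bar>(of_int \<lfloor>real (Suc p) * t\<rfloor> - real (Suc p) * t) / real (Suc p)\<bar> \<le> 1 / real (Suc p)"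
  by (simp add: divide_right_mono del: of_nat_Suc)
 moreover have "(of_int \<lfloor>real (Suc p) * t\<rfloor> - real (Suc p) * t) / real (Suc p) = round_coeff p t - t"
  by (simp add: round_coeff_def diff_divide_distrib del: of_nat_Suc)
 ultimately show ?thesis by (simp only:)
qed

lemma round_coeff_measurable[measurable]: "round_coeff p \<in> borel_measurable borel"
 unfolding round_coeff_def[abs_def] by measurable

lemma finite_round_coeff: "finite (round_coeff p ` {-R..R})"
proof (rule finite_subset)
 show "round_coeff p ` {-R..R} \<subseteq> (\<lambda>i::int. of_int i / real (Suc p)) ` {\<lfloor>- (real (Suc p) * R)\<rfloor>..\<lfloor>real (Suc p) * R\<rfloor>}"
 proof safe
  fix t assume t: "t \<in> {-R..R}"
  have "real (Suc p) * t \<le> real (Suc p) * R" "real (Suc p) * (- R) \<le> real (Suc p) * t" using t by (intro mult_left_mono; auto)+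
  then show "round_coeff p t \<in> (\<lambda>i::int. of_int i / real (Suc p)) ` {\<lfloor>- (real (Suc p) * R)\<rfloor>..\<lfloor>real (Suc p) * R\<rfloor>}"
   unfolding round_coeff_def by (intro imageI) (auto intro!: floor_mono simp del: of_nat_Suc)
 qed
qed simp

definition round_vec :: "(nat \<Rightarrow> 'a::real_inner) \<Rightarrow> nat \<Rightarrow> nat \<Rightarrow> 'a \<Rightarrow> 'a" where
 "round_vec e d p x = (\<Sum>k<d. round_coeff p (x \<bullet> e k) *\<^sub>R e k)"

lemma norm_lincomb:
 assumes "orthonormal_basis e"
 shows "(norm (\<Sum>k<d. a k *\<^sub>R e k))\<^sup>2 = (\<Sum>k<d. (a k)\<^sup>2)"
proof -
 have "(\<Sum>k<d. a k *\<^sub>R e k) \<bullet> e i = a i" if "i < d" for i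
 proof -
  have "(\<Sum>k<d. a k *\<^sub>R e k) \<bullet> e i = (\<Sum>k<d. if k = i then a i else 0)"
   unfolding inner_sum_left using assms by (intro sum.cong) (auto simp: orthonormal_basis_def)
  then show ?thesis using that by simp
 qed
 then show ?thesis unfolding power2_norm_eq_inner
  by (subst inner_sum_right) (simp add: power2_eq_square)
qed

lemma norm_round_vec_diff:
 assumes e: "orthonormal_basis e"
 shows "norm (round_vec e d p x - basis_proj e d x) \<le> sqrt (real d) / real (Suc p)"
proof -
 have "(norm (round_vec e d p x - basis_proj e d x))\<^sup>2 = (\<Sum>k<d. (round_coeff p (x \<bullet> e k) - x \<bullet> e k)\<^sup>2)"
  unfolding round_vec_def basis_proj_def by (simp only: sum_subtractf[symmetric] scaleR_diff_left[symmetric] norm_lincomb[OF e])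
 also have "... \<le> (\<Sum>k<d. (1 / real (Suc p))\<^sup>2)"
  by (intro sum_mono) (metis round_coeff_bound power2_abs power_mono abs_ge_zero)
 also have "... = (sqrt (real d) / real (Suc p))\<^sup>2" by (simp add: power_divide)
 finally show ?thesis by (rule power2_le_imp_le) simp
qed

lemma round_vec_norm:
 assumes e: "orthonormal_basis e" and p: "d \<le> p" and x: "norm x \<le> R"
 shows "norm (round_vec e d p x) \<le> R + 1"
proof -
 have "sqrt (real d) / real (Suc p) \<le> 1"
 proof -
  have "real d \<le> real (Suc p)" "real (Suc p) \<le> (real (Suc p))\<^sup>2" using p by (auto simp: power2_eq_square)
  then have "sqrt (real d) \<le> sqrt ((real (Suc p))\<^sup>2)" by (intro real_sqrt_le_mono) linarith
  then show ?thesis by (simp add: divide_le_eq)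
 qed
 moreover have "norm (round_vec e d p x) \<le> norm (round_vec e d p x - basis_proj e d x) + norm (basis_proj e d x)"
  by (metis diff_add_cancel norm_triangle_ineq)
 ultimately show ?thesis using norm_round_vec_diff[OF e, of d p x] norm_basis_proj_le[OF e, of d x] x by linarith
qed

lemma nn_integral_sq_tendsto_0:
 fixes f :: "nat \<Rightarrow> 'x \<Rightarrow> 'a::{real_inner, polish_space}"
 assumes "finite_measure R" and [measurable]: "\<And>n. f n \<in> borel_measurable R" "g \<in> borel_measurable R"
  and b: "\<And>n x. norm (f n x) \<le> K" "\<And>x. norm (g x) \<le> K" and lim: "AE x in R. (\<lambda>n. f n x) \<longlonglongrightarrow> g x"
 shows "(\<lambda>n. \<integral>\<^sup>+x. ennreal ((norm (f n x - g x))\<^sup>2) \<partial>R) \<longlonglongrightarrow> 0"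
proof -
 interpret finite_measure R by fact
 have "(\<lambda>n. \<integral>\<^sup>+x. ennreal ((norm (f n x - g x))\<^sup>2) \<partial>R) \<longlonglongrightarrow> (\<integral>\<^sup>+x. ennreal 0 \<partial>R)"
 proof (rule nn_integral_dominated_convergence[where w="\<lambda>_. ennreal ((2 * K)\<^sup>2)"])
  have "norm (f n x - g x) \<le> 2 * K" for n x using norm_triangle_ineq4[of "f n x" "g x"] b(1)[of n x] b(2)[of x] by linarith
  then show "AE x in R. ennreal ((norm (f n x - g x))\<^sup>2) \<le> ennreal ((2 * K)\<^sup>2)" for n
   by (intro AE_I2 ennreal_leI power_mono) auto
  show "AE x in R. (\<lambda>n. ennreal ((norm (f n x - g x))\<^sup>2)) \<longlonglongrightarrow> ennreal 0"
   using lim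
  proof eventually_elim
   case (elim x)
   have "(\<lambda>n. (norm (f n x - g x))\<^sup>2) \<longlonglongrightarrow> (norm (g x - g x))\<^sup>2" by (intro tendsto_intros elim)
   then show ?case by (intro tendsto_ennrealI) simp
  qed
 qed (auto simp: ennreal_mult_eq_top_iff less_top[symmetric])
 then show ?thesis by simp
qed

text \<open>The discontinuous drift is replaced by a continuous function in mean square with respect to
 both occupation measures, which makes it insensitive to the time discretisation; rounding then
 makes it finitely valued.\<close>

lemma drift_approx:
 fixes B :: "'a \<Rightarrow> 'a::{real_inner, polish_space}" and R1 :: "'x measure" and R2 :: "'y measure" and R :: real
 assumes fin: "finite_measure R1" "finite_measure R2"
  and m1[measurable]: "y1 \<in> borel_measurable R1" "\<And>N. z1 N \<in> borel_measurable R1"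
  and m2[measurable]: "y2 \<in> borel_measurable R2" "\<And>N. z2 N \<in> borel_measurable R2"
  and lim: "\<And>om. om \<in> space R1 \<Longrightarrow> (\<lambda>N. z1 N om) \<longlonglongrightarrow> y1 om" "\<And>om. om \<in> space R2 \<Longrightarrow> (\<lambda>N. z2 N om) \<longlonglongrightarrow> y2 om"
  and B[measurable]: "B \<in> borel_measurable borel" and BR: "\<And>x. norm (B x) \<le> R" and e: "orthonormal_basis e" and eps: "0 < (eps::real)"
 shows "\<exists>d (\<beta> :: nat \<Rightarrow> 'a \<Rightarrow> real) N0. (\<forall>k. \<beta> k \<in> borel_measurable borel \<and> finite (range (\<beta> k))) \<and> (\<forall>k\<ge>d. \<forall>x. \<beta> k x = 0) \<and>
   (\<forall>x. (\<Sum>k<d. (\<beta> k x)\<^sup>2) \<le> (R + 2)\<^sup>2) \<and>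
   (\<forall>N\<ge>N0. (\<integral>\<^sup>+om. ennreal ((norm ((\<Sum>k<d. \<beta> k (z1 N om) *\<^sub>R e k) - B (y1 om)))\<^sup>2) \<partial>R1) \<le> ennreal eps \<and>
    (\<integral>\<^sup>+om. ennreal ((norm ((\<Sum>k<d. \<beta> k (z2 N om) *\<^sub>R e k) - B (y2 om)))\<^sup>2) \<partial>R2) \<le> ennreal eps)"
proof -
 interpret f1: finite_measure R1 by fact
 interpret f2: finite_measure R2 by fact
 have R0: "0 \<le> R" using BR norm_ge_zero order_trans by blast
 have ne: "norm (e k) = 1" for k using e by (auto simp: orthonormal_basis_def norm_eq_sqrt_inner)
 \<comment> \<open>Four errors add up: rounding, time discretisation, continuity approximation and
   reduction of \<open>B\<close> to finitely many values. The square of a sum of four terms costs a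
   factor 4, hence 4 times 4 times \<open>dl\<close>.\<close>
 define dl where "dl = eps / 16"
 have dl: "0 < dl" using eps by (simp add: dl_def)
 \<comment> \<open>Rounding \<open>B\<close> itself leaves a Borel function with finitely many
   values, so that only finitely many indicators need a continuous approximation.\<close>
 define sn where "sn n x = round_vec e n n (B x)" for n x
 have snm[measurable]: "sn n \<in> borel_measurable borel" for n unfolding sn_def round_vec_def by measurable
 have snR: "norm (sn n x) \<le> R + 1" for n x unfolding sn_def by (rule round_vec_norm[OF e order_refl BR])
 have snlim: "(\<lambda>n. sn n x) \<longlonglongrightarrow> B x" for x
 proof -
  have "(\<lambda>n. sqrt (real n) / real (Suc n)) \<longlonglongrightarrow> 0"
  proof (rule tendsto_sandwich[of "\<lambda>_. 0" _ _ "\<lambda>n. 1 / sqrt (real (Suc n))"])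
   have "sqrt (real n) / real (Suc n) \<le> 1 / sqrt (real (Suc n))" for n
   proof -
    have "sqrt (real n) * sqrt (real (Suc n)) \<le> sqrt (real (Suc n)) * sqrt (real (Suc n))" by (intro mult_right_mono real_sqrt_le_mono) auto
    then show ?thesis by (simp add: field_simps)
   qed
   then show "\<forall>\<^sub>F n in sequentially. sqrt (real n) / real (Suc n) \<le> 1 / sqrt (real (Suc n))" by simp
   have "(\<lambda>n. sqrt (1 / real (Suc n))) \<longlonglongrightarrow> sqrt 0" by (intro tendsto_real_sqrt LIMSEQ_Suc lim_1_over_n)
   then show "(\<lambda>n. 1 / sqrt (real (Suc n))) \<longlonglongrightarrow> 0" by (simp add: real_sqrt_divide)
  qed auto
  then have "(\<lambda>n. round_vec e n n (B x) - basis_proj e n (B x)) \<longlonglongrightarrow> 0"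
   by (rule Lim_null_comparison[rotated]) (intro always_eventually allI norm_round_vec_diff[OF e])
  from tendsto_add[OF this basis_proj_tendsto[OF e, of "B x"]] show ?thesis by (simp add: sn_def)
 qed
 have "\<forall>\<^sub>F n in sequentially. (\<integral>\<^sup>+om. ennreal ((norm (sn n (y1 om) - B (y1 om)))\<^sup>2) \<partial>R1) < ennreal dl \<and> (\<integral>\<^sup>+om. ennreal ((norm (sn n (y2 om) - B (y2 om)))\<^sup>2) \<partial>R2) < ennreal dl"
  using dl snR order_trans[OF BR, of "R + 1"]
  by (intro eventually_conj order_tendstoD(2)[OF nn_integral_sq_tendsto_0[where K="R+1"]] fin) (auto simp: snlim)
 then obtain d where d: "(\<integral>\<^sup>+om. ennreal ((norm (sn d (y1 om) - B (y1 om)))\<^sup>2) \<partial>R1) \<le> ennreal dl" "(\<integral>\<^sup>+om. ennreal ((norm (sn d (y2 om) - B (y2 om)))\<^sup>2) \<partial>R2) \<le> ennreal dl"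
  by (auto simp: eventually_sequentially intro: less_imp_le)
 define S where "S = range (sn d)"
 have finS: "finite S"
 proof (rule finite_subset)
  have "\<bar>B x \<bullet> e k\<bar> \<le> R" for x k using Cauchy_Schwarz_ineq2[of "B x" "e k"] BR[of x] by (simp add: ne)
  then have c: "round_coeff d (B x \<bullet> e k) \<in> round_coeff d ` {-R..R}" for x k by (intro imageI) (simp add: abs_le_iff minus_le_iff)
  show "S \<subseteq> (\<lambda>f. \<Sum>k<d. f k *\<^sub>R e k) ` (Pi\<^sub>E {..<d} (\<lambda>_. round_coeff d ` {-R..R}))"
  proof
   fix v assume "v \<in> S"
   then obtain x where "v = (\<Sum>k<d. (restrict (\<lambda>k. round_coeff d (B x \<bullet> e k)) {..<d}) k *\<^sub>R e k)" by (auto simp: S_def sn_def round_vec_def)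
   then show "v \<in> (\<lambda>f. \<Sum>k<d. f k *\<^sub>R e k) ` (Pi\<^sub>E {..<d} (\<lambda>_. round_coeff d ` {-R..R}))"
    by (rule image_eqI[where x="restrict (\<lambda>k. round_coeff d (B x \<bullet> e k)) {..<d}"]) (use c in auto)
  qed
  show "finite ((\<lambda>f. \<Sum>k<d. f k *\<^sub>R e k) ` (Pi\<^sub>E {..<d} (\<lambda>_. round_coeff d ` {-R..R})))"
   by (intro finite_imageI finite_PiE finite_round_coeff) auto
 qed
 define A where "A v = {x. sn d x = v}" for v
 have A[measurable]: "A v \<in> sets borel" for v
 proof -
  have "sn d -` {v} \<inter> space borel \<in> sets borel" by (rule measurable_sets[OF snm]) simp
  moreover have "sn d -` {v} \<inter> space borel = A v" by (auto simp: A_def)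
  ultimately show ?thesis by simp
 qed
 have "\<forall>v. \<exists>\<phi>. (\<forall>n. continuous_on UNIV (\<phi> n) \<and> (\<forall>x. 0 \<le> \<phi> n x \<and> \<phi> n x \<le> (1::real))) \<and>
  (AE x in distr R1 borel y1. (\<lambda>n. \<phi> n x) \<longlonglongrightarrow> indicator (A v) x) \<and> (AE x in distr R2 borel y2. (\<lambda>n. \<phi> n x) \<longlonglongrightarrow> indicator (A v) x)"
  by (intro allI indicator_continuous_AE f1.finite_measure_distr f2.finite_measure_distr) auto
 from choice[OF this] obtain \<phi> where "\<forall>v. (\<forall>n. continuous_on UNIV (\<phi> v n) \<and> (\<forall>x. 0 \<le> \<phi> v n x \<and> \<phi> v n x \<le> (1::real))) \<and>
  (AE x in distr R1 borel y1. (\<lambda>n. \<phi> v n x) \<longlonglongrightarrow> indicator (A v) x) \<and> (AE x in distr R2 borel y2. (\<lambda>n. \<phi> v n x) \<longlonglongrightarrow> indicator (A v) x)"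
  by blast
 then have \<phi>: "\<And>v n. continuous_on UNIV (\<phi> v n)" "\<And>v n x. 0 \<le> \<phi> v n x" "\<And>v n x. \<phi> v n x \<le> (1::real)"
  and \<phi>1: "\<And>v. AE x in distr R1 borel y1. (\<lambda>n. \<phi> v n x) \<longlonglongrightarrow> indicator (A v) x" and \<phi>2: "\<And>v. AE x in distr R2 borel y2. (\<lambda>n. \<phi> v n x) \<longlonglongrightarrow> indicator (A v) x"
  by blast+
 \<comment> \<open>A continuous superposition of the finitely many values. Dividing by the total
   weight, where it exceeds 1, preserves the bound R + 1; in the limit exactly one indicator is
   active and the divisor is 1.\<close>
 define f where "f n x = (1 / max 1 (\<Sum>v\<in>S. \<phi> v n x)) *\<^sub>R (\<Sum>v\<in>S. \<phi> v n x *\<^sub>R v)" for n x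
 have fc: "continuous_on UNIV (f n)" for n
  unfolding f_def by (intro continuous_intros \<phi>) auto
 then have fm[measurable]: "f n \<in> borel_measurable borel" for n by (rule borel_measurable_continuous_onI)
 have fR: "norm (f n x) \<le> R + 1" for n x
 proof -
  have "norm (\<Sum>v\<in>S. \<phi> v n x *\<^sub>R v) \<le> (\<Sum>v\<in>S. \<phi> v n x * (R + 1))"
  proof (rule order_trans[OF norm_sum], rule sum_mono)
   fix v assume "v \<in> S"
   then have "norm v \<le> R + 1" using snR by (auto simp: S_def)
   then show "norm (\<phi> v n x *\<^sub>R v) \<le> \<phi> v n x * (R + 1)" using \<phi>(2)[of v n x] by (simp add: mult_left_mono)
  qed
  also have "... \<le> max 1 (\<Sum>v\<in>S. \<phi> v n x) * (R + 1)" unfolding sum_distrib_right[symmetric] using R0 by (intro mult_right_mono) auto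
  finally show ?thesis by (simp add: f_def divide_le_eq mult.commute)
 qed
 have flim: "(\<lambda>n. f n x) \<longlonglongrightarrow> sn d x" if "\<And>v. v \<in> S \<Longrightarrow> (\<lambda>n. \<phi> v n x) \<longlonglongrightarrow> indicator (A v) x" for x
 proof -
  have "(\<lambda>n. f n x) \<longlonglongrightarrow> (1 / max 1 (\<Sum>v\<in>S. indicator (A v) x)) *\<^sub>R (\<Sum>v\<in>S. indicat_real (A v) x *\<^sub>R v)"
   unfolding f_def by (intro tendsto_intros that) auto
  moreover have "(\<Sum>v\<in>S. indicator (A v) x) = (\<Sum>v\<in>S. if v = sn d x then 1 else (0::real))"
   by (intro sum.cong) (auto simp: A_def indicator_def)
  moreover have "(\<Sum>v\<in>S. indicat_real (A v) x *\<^sub>R v) = (\<Sum>v\<in>S. if v = sn d x then sn d x else 0)"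
   by (intro sum.cong) (auto simp: A_def indicator_def)
  ultimately show ?thesis using finS by (simp add: S_def)
 qed
 have fl1: "AE om in R1. (\<lambda>n. f n (y1 om)) \<longlonglongrightarrow> sn d (y1 om)"
 proof -
  have "AE x in distr R1 borel y1. \<forall>v\<in>S. (\<lambda>n. \<phi> v n x) \<longlonglongrightarrow> indicator (A v) x" using \<phi>1 finS by (simp add: AE_finite_all)
  then have "AE om in R1. \<forall>v\<in>S. (\<lambda>n. \<phi> v n (y1 om)) \<longlonglongrightarrow> indicator (A v) (y1 om)" by (rule AE_distrD[OF m1(1)])
  then show ?thesis by eventually_elim (rule flim, blast)
 qed
 have fl2: "AE om in R2. (\<lambda>n. f n (y2 om)) \<longlonglongrightarrow> sn d (y2 om)"
 proof -
  have "AE x in distr R2 borel y2. \<forall>v\<in>S. (\<lambda>n. \<phi> v n x) \<longlonglongrightarrow> indicator (A v) x" using \<phi>2 finS by (simp add: AE_finite_all)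
  then have "AE om in R2. \<forall>v\<in>S. (\<lambda>n. \<phi> v n (y2 om)) \<longlonglongrightarrow> indicator (A v) (y2 om)" by (rule AE_distrD[OF m2(1)])
  then show ?thesis by eventually_elim (rule flim, blast)
 qed
 have "\<forall>\<^sub>F n in sequentially. (\<integral>\<^sup>+om. ennreal ((norm (f n (y1 om) - sn d (y1 om)))\<^sup>2) \<partial>R1) < ennreal dl \<and> (\<integral>\<^sup>+om. ennreal ((norm (f n (y2 om) - sn d (y2 om)))\<^sup>2) \<partial>R2) < ennreal dl"
  using dl by (intro eventually_conj order_tendstoD(2)[OF nn_integral_sq_tendsto_0[where K="R+1"]] fin fl1 fl2 fR snR) auto
 then obtain n where n: "(\<integral>\<^sup>+om. ennreal ((norm (f n (y1 om) - sn d (y1 om)))\<^sup>2) \<partial>R1) \<le> ennreal dl" "(\<integral>\<^sup>+om. ennreal ((norm (f n (y2 om) - sn d (y2 om)))\<^sup>2) \<partial>R2) \<le> ennreal dl"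
  by (auto simp: eventually_sequentially intro: less_imp_le)
 have "\<forall>\<^sub>F N in sequentially. (\<integral>\<^sup>+om. ennreal ((norm (f n (z1 N om) - f n (y1 om)))\<^sup>2) \<partial>R1) < ennreal dl \<and> (\<integral>\<^sup>+om. ennreal ((norm (f n (z2 N om) - f n (y2 om)))\<^sup>2) \<partial>R2) < ennreal dl"
  using dl by (intro eventually_conj order_tendstoD(2)[OF nn_integral_sq_tendsto_0[where K="R+1"]] fin fR AE_I2 continuous_on_tendsto_compose[OF fc] lim) auto
 then obtain N0 where N0: "\<And>N. N0 \<le> N \<Longrightarrow> (\<integral>\<^sup>+om. ennreal ((norm (f n (z1 N om) - f n (y1 om)))\<^sup>2) \<partial>R1) \<le> ennreal dl"
   "\<And>N. N0 \<le> N \<Longrightarrow> (\<integral>\<^sup>+om. ennreal ((norm (f n (z2 N om) - f n (y2 om)))\<^sup>2) \<partial>R2) \<le> ennreal dl"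
  by (auto simp: eventually_sequentially intro: less_imp_le)
 \<comment> \<open>A bound for the total masses of both measures. The rounding precision
   \<open>p\<close> is chosen so that the squared rounding error, multiplied by this mass, stays
   below \<open>dl\<close>.\<close>
 define W where "W = 1 + measure R1 (space R1) + measure R2 (space R2)"
 have W: "0 < W" by (simp add: W_def add_pos_nonneg)
 obtain p where p: "d \<le> p" "real d * W / dl \<le> real p"
  by (metis max.cobounded1 max.cobounded2 of_nat_mono order_trans real_arch_simple)
 \<comment> \<open>The values of \<open>sn d\<close> lie in the span of the first d basis vectors,
   hence so do those of \<open>f n\<close>. The second rounding therefore incurs no projection
   error.\<close>
 have fproj: "basis_proj e d (f n x) = f n x" for x
 proof -
  have "basis_proj e d v = v" if vS: "v \<in> S" for v
  proof -
   obtain x where v: "v = round_vec e d d (B x)" using vS by (auto simp: S_def sn_def)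
   have "v \<bullet> e k = (if k < d then round_coeff d (B x \<bullet> e k) else 0)" for k
   proof -
    have "v \<bullet> e k = (\<Sum>i<d. if i = k then round_coeff d (B x \<bullet> e k) else 0)"
     unfolding v round_vec_def inner_sum_left using e by (intro sum.cong) (auto simp: orthonormal_basis_def)
    then show ?thesis by simp
   qed
   then show ?thesis by (simp add: basis_proj_def v round_vec_def)
  qed
  moreover have "basis_proj e d (\<Sum>v\<in>S. \<phi> v n x *\<^sub>R v) = (\<Sum>v\<in>S. \<phi> v n x *\<^sub>R basis_proj e d v)"
   unfolding basis_proj_def by (simp add: inner_sum_left scaleR_sum_left scaleR_sum_right) (rule sum.swap)
  moreover have "basis_proj e d (a *\<^sub>R u) = a *\<^sub>R basis_proj e d u" for a u by (simp add: basis_proj_def scaleR_sum_right)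
  ultimately show ?thesis by (simp add: f_def)
 qed
 \<comment> \<open>Rounding the continuous function makes the step process finitely valued. Each of
   the two roundings enlarges the norm by at most 1, whence the constant R + 2.\<close>
 define \<beta> where "\<beta> k x = (if k < d then round_coeff p (f n x \<bullet> e k) else 0)" for k x
 have \<beta>v: "(\<Sum>k<d. \<beta> k x *\<^sub>R e k) = round_vec e d p (f n x)" for x by (simp add: \<beta>_def round_vec_def)
 have r: "(norm (round_vec e d p (f n x) - f n x))\<^sup>2 \<le> dl / W" for x
 proof -
  have "(norm (round_vec e d p (f n x) - f n x))\<^sup>2 \<le> (sqrt (real d) / real (Suc p))\<^sup>2"
   using norm_round_vec_diff[OF e, of d p "f n x"] unfolding fproj by (intro power_mono) auto
  also have "... = real d / (real (Suc p))\<^sup>2" by (simp add: power_divide)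
  also have "... \<le> real d / real (Suc p)"
   by (intro divide_left_mono) (auto simp: power2_eq_square)
  also have "... \<le> dl / W"
  proof -
   have "real d * W \<le> real p * dl" using p(2) dl by (simp add: field_simps)
   also have "... \<le> real (Suc p) * dl" using dl by simp
   finally show ?thesis using W by (simp add: field_simps)
  qed
  finally show ?thesis .
 qed
 have comb: "(\<integral>\<^sup>+om. ennreal ((norm ((\<Sum>k<d. \<beta> k (z om) *\<^sub>R e k) - B (y om)))\<^sup>2) \<partial>Q) \<le> ennreal eps"
  if Q: "finite_measure Q" "measure Q (space Q) \<le> W" and [measurable]: "z \<in> borel_measurable Q" "y \<in> borel_measurable Q"
  and a: "(\<integral>\<^sup>+om. ennreal ((norm (f n (z om) - f n (y om)))\<^sup>2) \<partial>Q) \<le> ennreal dl"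
   "(\<integral>\<^sup>+om. ennreal ((norm (f n (y om) - sn d (y om)))\<^sup>2) \<partial>Q) \<le> ennreal dl"
   "(\<integral>\<^sup>+om. ennreal ((norm (sn d (y om) - B (y om)))\<^sup>2) \<partial>Q) \<le> ennreal dl" for Q :: "'z measure" and z y
 proof -
  interpret q: finite_measure Q by fact
  have pt: "(norm (round_vec e d p (f n (z om)) - B (y om)))\<^sup>2 \<le> 4 * (dl / W) + 4 * (norm (f n (z om) - f n (y om)))\<^sup>2 + 4 * (norm (f n (y om) - sn d (y om)))\<^sup>2 + 4 * (norm (sn d (y om) - B (y om)))\<^sup>2" for om
  proof -
   let ?a = "round_vec e d p (f n (z om)) - f n (z om)" and ?b = "f n (z om) - f n (y om)" and ?c = "f n (y om) - sn d (y om)" and ?g = "sn d (y om) - B (y om)"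
   have eq: "round_vec e d p (f n (z om)) - B (y om) = (?a + ?b) + (?c + ?g)" by simp
   then have "norm (round_vec e d p (f n (z om)) - B (y om)) \<le> (norm ?a + norm ?b) + (norm ?c + norm ?g)"
    using norm_triangle_ineq[of "?a + ?b" "?c + ?g"] norm_triangle_ineq[of ?a ?b] norm_triangle_ineq[of ?c ?g] arg_cong[OF eq, of norm] by linarith
   then have "(norm (round_vec e d p (f n (z om)) - B (y om)))\<^sup>2 \<le> ((norm ?a + norm ?b) + (norm ?c + norm ?g))\<^sup>2" by (intro power_mono) auto
   also have "... \<le> 4 * (norm ?a)\<^sup>2 + 4 * (norm ?b)\<^sup>2 + 4 * (norm ?c)\<^sup>2 + 4 * (norm ?g)\<^sup>2"
   proof -
    have 2: "(x + y)\<^sup>2 \<le> 2 * x\<^sup>2 + 2 * y\<^sup>2" for x y :: real using sum_squares_bound[of x y] by (simp add: power2_sum)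
    show ?thesis using 2[of "norm ?a + norm ?b" "norm ?c + norm ?g"] 2[of "norm ?a" "norm ?b"] 2[of "norm ?c" "norm ?g"] by linarith
   qed
   finally show ?thesis using r[of "z om"] by linarith
  qed
  have "(\<integral>\<^sup>+om. ennreal ((norm ((\<Sum>k<d. \<beta> k (z om) *\<^sub>R e k) - B (y om)))\<^sup>2) \<partial>Q)
   \<le> (\<integral>\<^sup>+om. ennreal 4 * ennreal (dl / W) + ennreal 4 * ennreal ((norm (f n (z om) - f n (y om)))\<^sup>2) + ennreal 4 * ennreal ((norm (f n (y om) - sn d (y om)))\<^sup>2) + ennreal 4 * ennreal ((norm (sn d (y om) - B (y om)))\<^sup>2) \<partial>Q)"
   unfolding \<beta>v using dl W pt
   by (intro nn_integral_mono) (simp add: ennreal_mult[symmetric] ennreal_plus[symmetric] ennreal_leI del: ennreal_plus ennreal_numeral)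
  also have "... = ennreal 4 * (ennreal (dl / W) * emeasure Q (space Q)) + ennreal 4 * (\<integral>\<^sup>+om. ennreal ((norm (f n (z om) - f n (y om)))\<^sup>2) \<partial>Q)
    + ennreal 4 * (\<integral>\<^sup>+om. ennreal ((norm (f n (y om) - sn d (y om)))\<^sup>2) \<partial>Q) + ennreal 4 * (\<integral>\<^sup>+om. ennreal ((norm (sn d (y om) - B (y om)))\<^sup>2) \<partial>Q)"
   by (simp add: nn_integral_add nn_integral_cmult mult.assoc del: ennreal_numeral)
  also have "... \<le> ennreal 4 * ennreal dl + ennreal 4 * ennreal dl + ennreal 4 * ennreal dl + ennreal 4 * ennreal dl"
  proof (intro add_mono mult_left_mono a)
   have "ennreal (dl / W) * emeasure Q (space Q) \<le> ennreal (dl / W) * ennreal W" using Q(2) by (intro mult_left_mono) (auto simp: q.emeasure_eq_measure intro!: ennreal_leI)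
   also have "... = ennreal dl" using W dl by (simp add: ennreal_mult[symmetric])
   finally show "ennreal (dl / W) * emeasure Q (space Q) \<le> ennreal dl" .
  qed auto
  also have "... = ennreal eps" using dl by (simp add: ennreal_mult[symmetric] ennreal_plus[symmetric] dl_def del: ennreal_plus ennreal_numeral)
  finally show ?thesis .
 qed
 show ?thesis
 proof (rule exI[of _ d], rule exI[of _ \<beta>], rule exI[of _ N0], intro conjI allI impI)
  fix k
  show "\<beta> k \<in> borel_measurable borel" unfolding \<beta>_def[abs_def] by measurable
  have "\<bar>f n x \<bullet> e k\<bar> \<le> R + 1" for x using Cauchy_Schwarz_ineq2[of "f n x" "e k"] fR[of n x] by (simp add: ne)
  then have "range (\<beta> k) \<subseteq> insert 0 (round_coeff p ` {-(R+1)..R+1})" by (force simp: \<beta>_def abs_le_iff minus_le_iff)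
  then show "finite (range (\<beta> k))" by (rule finite_subset) (intro finite.insertI finite_round_coeff)
 next
  fix k x assume "d \<le> k" then show "\<beta> k x = 0" by (simp add: \<beta>_def)
 next
  fix x
  have "(\<Sum>k<d. (\<beta> k x)\<^sup>2) = (norm (round_vec e d p (f n x)))\<^sup>2" unfolding \<beta>v[symmetric] norm_lincomb[OF e] ..
  also have "... \<le> (R + 2)\<^sup>2" using round_vec_norm[OF e p(1) fR[of n x]] by (intro power_mono) auto
  finally show "(\<Sum>k<d. (\<beta> k x)\<^sup>2) \<le> (R + 2)\<^sup>2" .
 next
  fix N assume N: "N0 \<le> N"
  show "(\<integral>\<^sup>+om. ennreal ((norm ((\<Sum>k<d. \<beta> k (z1 N om) *\<^sub>R e k) - B (y1 om)))\<^sup>2) \<partial>R1) \<le> ennreal eps"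
   by (rule comb[OF fin(1)]) (use N0(1)[OF N] n(1) d(1) in \<open>auto simp: W_def\<close>)
  show "(\<integral>\<^sup>+om. ennreal ((norm ((\<Sum>k<d. \<beta> k (z2 N om) *\<^sub>R e k) - B (y2 om)))\<^sup>2) \<partial>R2) \<le> ennreal eps"
   by (rule comb[OF fin(2)]) (use N0(2)[OF N] n(2) d(2) in \<open>auto simp: W_def\<close>)
 qed
qed

section \<open>Independent Brownian motions and the filtration\<close>

lemma integral_double_sum:
 fixes f :: "'i \<Rightarrow> 'j \<Rightarrow> 'w \<Rightarrow> 'b::{banach, second_countable_topology}"
 assumes "\<And>k l. integrable M (f k l)"
 shows "(\<integral>om. (\<Sum>k\<in>I. \<Sum>l\<in>J. f k l om) \<partial>M) = (\<Sum>k\<in>I. \<Sum>l\<in>J. \<integral>om. f k l om \<partial>M)"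
 using assms by (simp add: Bochner_Integration.integral_sum)

lemma nn_integral_indep:
 fixes De :: "'w \<Rightarrow> real" and f :: "real \<Rightarrow> ennreal"
 assumes M: "prob_space M" and sub: "subalgebra M G" and [measurable]: "De \<in> borel_measurable M" "f \<in> borel_measurable borel"
  and ind: "prob_space.indep_set M (sets G) (sets (vimage_algebra (space M) De borel))" and A: "A \<in> sets G"
 shows "(\<integral>\<^sup>+om. indicator A om * f (De om) \<partial>M) = emeasure M A * (\<integral>\<^sup>+om. f (De om) \<partial>M)"
proof -
 interpret prob_space M by fact
 have AM[measurable]: "A \<in> events" using A sub by (auto simp: subalgebra_def)
 show ?thesis
 proof (cases "prob A = 0")
  case True
  then have "AE om in M. indicator A om * f (De om) = 0"
   using AE_not_in[of A M] AM by (auto simp: null_sets_def emeasure_eq_measure elim!: AE_mp)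
  then have "(\<integral>\<^sup>+om. indicator A om * f (De om) \<partial>M) = (\<integral>\<^sup>+om. 0 \<partial>M)" by (rule nn_integral_cong_AE)
  then show ?thesis using True by (simp add: emeasure_eq_measure)
 next
  case False
  then have p: "0 < prob A" by (simp add: zero_less_measure_iff)
  have "distr (uniform_measure M A) borel De = distr M borel De"
  proof (rule measure_eqI)
   fix C assume "C \<in> sets (distr (uniform_measure M A) borel De)"
   then have C[measurable]: "C \<in> sets borel" by simp
   define S where "S = De -` C \<inter> space M"
   have S[measurable]: "S \<in> events" unfolding S_def by measurable
   have "S \<in> sets (vimage_algebra (space M) De borel)" using C by (auto simp: S_def sets_vimage_algebra2)
   then have "prob (A \<inter> S) = prob A * prob S" using indep_setD[OF ind A] by simp
   then have "emeasure (uniform_measure M A) S = emeasure M S"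
    using p by (simp add: emeasure_uniform_measure emeasure_eq_measure divide_ennreal)
   then show "emeasure (distr (uniform_measure M A) borel De) C = emeasure (distr M borel De) C"
    by (simp add: emeasure_distr S_def)
  qed simp
  then have "(\<integral>\<^sup>+x. f x \<partial>distr (uniform_measure M A) borel De) = (\<integral>\<^sup>+x. f x \<partial>distr M borel De)" by simp
  then have "(\<integral>\<^sup>+om. f (De om) * indicator A om \<partial>M) / emeasure M A = (\<integral>\<^sup>+om. f (De om) \<partial>M)"
   by (simp add: nn_integral_distr nn_integral_uniform_measure)
  then have "emeasure M A * ((\<integral>\<^sup>+om. f (De om) * indicator A om \<partial>M) / emeasure M A) = emeasure M A * (\<integral>\<^sup>+om. f (De om) \<partial>M)"
   by simp
  moreover have "a * (x / a) = x" if "a \<noteq> 0" "a \<noteq> \<top>" for a x :: ennreal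
   using ennreal_mult_divide_eq[OF that, of x] by (simp add: ennreal_times_divide mult.commute)
  ultimately show ?thesis using p by (simp add: mult.commute emeasure_eq_measure)
 qed
qed

lemma integral_indep:
 fixes De :: "'w \<Rightarrow> real" and f :: "real \<Rightarrow> complex" and xi :: "'w \<Rightarrow> complex"
 assumes M: "prob_space M" and sub: "subalgebra M G" and [measurable]: "De \<in> borel_measurable M" "f \<in> borel_measurable borel"
  and ind: "prob_space.indep_set M (sets G) (sets (vimage_algebra (space M) De borel))"
  and xi: "xi \<in> borel_measurable G" "integrable M xi" and f: "integrable M (\<lambda>om. f (De om))"
 shows "(\<integral>om. xi om * f (De om) \<partial>M) = (\<integral>om. xi om \<partial>M) * (\<integral>om. f (De om) \<partial>M)" "integrable M (\<lambda>om. xi om * f (De om))"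
proof -
 interpret prob_space M by fact
 have spG: "space G = space M" using sub by (simp add: subalgebra_def)
 have "indep_var borel xi borel (\<lambda>om. f (De om))"
  unfolding indep_var_eq
 proof (intro conjI)
  show xm: "xi \<in> borel_measurable M" using xi(2) by simp
  show fm: "(\<lambda>om. f (De om)) \<in> borel_measurable M" by measurable
  have 1: "sigma_sets (space M) {xi -` A \<inter> space M |A. A \<in> sets borel} \<subseteq> sets G"
   by (rule sets.sigma_sets_subset[of _ G, unfolded spG]) (use measurable_sets[OF xi(1)] in \<open>auto simp: spG\<close>)
  have 2: "sigma_sets (space M) {(\<lambda>om. f (De om)) -` A \<inter> space M |A. A \<in> sets borel} \<subseteq> sets (vimage_algebra (space M) De borel)"
  proof -
   have "(\<lambda>om. f (De om)) -` A \<inter> space M \<in> sets (vimage_algebra (space M) De borel)" if "A \<in> sets borel" for A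
   proof -
    have "f -` A \<in> sets borel" using measurable_sets_borel[of f borel A] that by simp
    moreover have "(\<lambda>om. f (De om)) -` A \<inter> space M = De -` (f -` A) \<inter> space M" by auto
    ultimately show ?thesis by (auto simp: sets_vimage_algebra2)
   qed
   then have "{(\<lambda>om. f (De om)) -` A \<inter> space M |A. A \<in> sets borel} \<subseteq> sets (vimage_algebra (space M) De borel)" by blast
   from sets.sigma_sets_subset[OF this] show ?thesis by simp
  qed
  show "indep_set (sigma_sets (space M) {xi -` A \<inter> space M |A. A \<in> sets borel}) (sigma_sets (space M) {(\<lambda>om. f (De om)) -` A \<inter> space M |A. A \<in> sets borel})"
  proof (rule indep_setI)
   show "sigma_sets (space M) {xi -` A \<inter> space M |A. A \<in> sets borel} \<subseteq> events" using 1 sub by (auto simp: subalgebra_def)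
   show "sigma_sets (space M) {(\<lambda>om. f (De om)) -` A \<inter> space M |A. A \<in> sets borel} \<subseteq> events"
    using fm by (intro sets.sigma_sets_subset) auto
  qed (use indep_setD[OF ind] 1 2 in blast)
 qed
 from indep_var_lebesgue_integral[OF this xi(2) f] indep_var_integrable[OF this xi(2) f]
 show "(\<integral>om. xi om * f (De om) \<partial>M) = (\<integral>om. xi om \<partial>M) * (\<integral>om. f (De om) \<partial>M)" "integrable M (\<lambda>om. xi om * f (De om))" by auto
qed

section \<open>Joint independence of the past for independent Brownian motions\<close>

locale indep_bms = prob_space M for M :: "'w measure" +
 fixes F and W :: "nat \<Rightarrow> real \<Rightarrow> 'w \<Rightarrow> real" and T :: real
 assumes filt: "filtration_on {0..} M F" and bms: "\<And>k. brownian_motion {0..} M F (W k)"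
  and indep: "indep_vars (\<lambda>_. \<Pi>\<^sub>M t\<in>{0..}. borel) (\<lambda>k om. restrict (\<lambda>t. W k t om) {0..}) UNIV"
begin

abbreviation "inc k s t om \<equiv> W k t om - W k s om"

lemma sub: "0 \<le> t \<Longrightarrow> subalgebra M (F t)" using filt by (auto simp: filtration_on_def)

lemma F_mono: "0 \<le> s \<Longrightarrow> s \<le> t \<Longrightarrow> f \<in> borel_measurable (F s) \<Longrightarrow> f \<in> borel_measurable (F t)"
 using filt sub[of s] sub[of t] by (intro measurable_from_subalg[of "F t" "F s"]) (auto simp: filtration_on_def subalgebra_def)

lemma F_M: "0 \<le> t \<Longrightarrow> f \<in> borel_measurable (F t) \<Longrightarrow> f \<in> borel_measurable M"
 using measurable_from_subalg[OF sub] by blast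

lemma WF: "0 \<le> t \<Longrightarrow> W k t \<in> borel_measurable (F t)" using bms by (auto simp: brownian_motion_def)

lemma WM: "0 \<le> t \<Longrightarrow> W k t \<in> borel_measurable M" using F_M WF by blast

lemma dist: "0 \<le> s \<Longrightarrow> s < t \<Longrightarrow> distributed M lborel (\<lambda>om. inc k s t om) (normal_density 0 (sqrt (t - s)))"
 and ind: "0 \<le> s \<Longrightarrow> s < t \<Longrightarrow> indep_set (sets (F s)) (sets (vimage_algebra (space M) (\<lambda>om. inc k s t om) borel))"
 using bms[of k] by (auto simp: brownian_motion_def)

lemma moments:
 assumes "0 \<le> s" "s < t"
 shows "integrable M (\<lambda>om. inc k s t om)" "(\<integral>om. inc k s t om \<partial>M) = 0"
  "integrable M (\<lambda>om. (inc k s t om)\<^sup>2)" "(\<integral>om. (inc k s t om)\<^sup>2 \<partial>M) = t - s"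
  "integrable M (\<lambda>om. \<bar>inc k s t om\<bar>^3)" "(\<integral>om. \<bar>inc k s t om\<bar>^3 \<partial>M) \<le> 2 * sqrt (t - s) ^ 3"
proof -
 note D = dist[OF assms, of k]
 let ?sg = "sqrt (t - s)"
 have sg: "?sg > 0" using assms by simp
 show "integrable M (\<lambda>om. inc k s t om)"
  using distributed_integrable[OF D, of "\<lambda>x. x"] integrable_normal_moment_nz_1[OF sg, of 0] by simp
 show "(\<integral>om. inc k s t om \<partial>M) = 0"
  using distributed_integral[OF D, of "\<lambda>x. x"] integral_normal_moment_nz_1[OF sg, of 0] by simp
 show "integrable M (\<lambda>om. (inc k s t om)\<^sup>2)"
  using distributed_integrable[OF D, of "\<lambda>x. x^2"] integrable_normal_moment[OF sg, of 0 2] by simp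
 show "(\<integral>om. (inc k s t om)\<^sup>2 \<partial>M) = t - s"
  using distributed_integral[OF D, of "\<lambda>x. x^2"] integral_normal_moment_even[OF sg, of 0 1] assms by simp
 show "integrable M (\<lambda>om. \<bar>inc k s t om\<bar>^3)"
  using distributed_integrable[OF D, of "\<lambda>x. \<bar>x\<bar>^3"] integrable_normal_moment_abs[OF sg, of 0 3] by simp
 have "(\<integral>om. \<bar>inc k s t om\<bar>^3 \<partial>M) = (2 ^ 1 * ?sg ^ (2 * 1 + 1) * fact 1 * sqrt (2 / pi))"
  using distributed_integral[OF D, of "\<lambda>x. \<bar>x\<bar>^3"] integral_normal_moment_abs_odd[OF sg, of 0 1] by (simp add: numeral_3_eq_3)
 also have "... \<le> 2 * ?sg ^ 3"
 proof -
  have "sqrt (2 / pi) \<le> sqrt 1" using pi_ge_two by (intro real_sqrt_le_mono) (simp add: divide_le_eq)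
  then have "2 * ?sg ^ 3 * sqrt (2 / pi) \<le> 2 * ?sg ^ 3 * 1" using sg by (intro mult_left_mono) auto
  then show ?thesis by (simp add: numeral_3_eq_3 mult_ac)
 qed
 finally show "(\<integral>om. \<bar>inc k s t om\<bar>^3 \<partial>M) \<le> 2 * sqrt (t - s) ^ 3" .
qed

lemma martingale_part:
 assumes st: "0 \<le> s" "s < t" and xi: "xi \<in> borel_measurable (F s)" "integrable M (xi :: 'w \<Rightarrow> complex)"
 shows "integrable M (\<lambda>om. xi om * of_real (inc k s t om))" "(\<integral>om. xi om * of_real (inc k s t om) \<partial>M) = 0"
  and "integrable M (\<lambda>om. xi om * of_real ((inc k s t om)\<^sup>2))" "(\<integral>om. xi om * of_real ((inc k s t om)\<^sup>2) \<partial>M) = (t - s) * (\<integral>om. xi om \<partial>M)"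
proof -
 have t: "0 \<le> t" using st by simp
 note [measurable] = WM[OF st(1)] WM[OF t]
 note I = integral_indep[OF prob_space_axioms sub[OF st(1)] _ _ ind[OF st] xi]
 show "integrable M (\<lambda>om. xi om * of_real (inc k s t om))"
  by (rule I(2)[where f=of_real]) (auto simp del: of_real_diff intro!: integrable_of_real moments(1)[OF st])
 have "(\<integral>om. xi om * of_real (inc k s t om) \<partial>M) = (\<integral>om. xi om \<partial>M) * (\<integral>om. complex_of_real (inc k s t om) \<partial>M)"
  by (rule I(1)[where f=of_real]) (auto simp del: of_real_diff intro!: integrable_of_real moments(1)[OF st])
 then show "(\<integral>om. xi om * of_real (inc k s t om) \<partial>M) = 0"
  by (simp only: integral_complex_of_real moments(2)[OF st]) simp
 show "integrable M (\<lambda>om. xi om * of_real ((inc k s t om)\<^sup>2))"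
  by (rule I(2)[where f="\<lambda>x. of_real (x\<^sup>2)"]) (auto intro!: integrable_of_real moments(3)[OF st] simp del: of_real_power of_real_diff)
 have "(\<integral>om. xi om * of_real ((inc k s t om)\<^sup>2) \<partial>M) = (\<integral>om. xi om \<partial>M) * (\<integral>om. complex_of_real ((inc k s t om)\<^sup>2) \<partial>M)"
  by (rule I(1)[where f="\<lambda>x. of_real (x\<^sup>2)"]) (auto intro!: integrable_of_real moments(3)[OF st] simp del: of_real_power of_real_diff)
 then show "(\<integral>om. xi om * of_real ((inc k s t om)\<^sup>2) \<partial>M) = (t - s) * (\<integral>om. xi om \<partial>M)"
  by (simp only: integral_complex_of_real moments(4)[OF st] mult.commute)
qed

text \<open>Mutual independence of the motions enters in this form: products of two increments of
  one motion are uncorrelated with the corresponding products for another. This evaluates the second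
  moment of the discretised cross variation.\<close>

lemma cross_expectation:
 assumes ij: "i \<noteq> j" and pos: "0 \<le> a" "0 \<le> b" "0 \<le> c" "0 \<le> d"
  and I: "\<And>k. integrable M (\<lambda>om. (inc k a b om) * (inc k c d om))"
 defines "X \<equiv> \<lambda>k om. (inc k a b om) * (inc k c d om)"
 shows "(\<integral>om. X i om * X j om \<partial>M) = (\<integral>om. X i om \<partial>M) * (\<integral>om. X j om \<partial>M)" "integrable M (\<lambda>om. X i om * X j om)"
proof -
 let ?f = "\<lambda>x. (x b - x a) * (x d - x c) :: real"
 have [measurable]: "(\<lambda>x. x u) \<in> borel_measurable (\<Pi>\<^sub>M t\<in>{0..}. borel :: real measure)" if "0 \<le> u" for u :: real
  using that by (intro measurable_component_singleton) auto
 have f: "?f \<in> borel_measurable (\<Pi>\<^sub>M t\<in>{0..}. borel)" using pos by measurable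
 have "indep_vars (\<lambda>_. \<Pi>\<^sub>M t\<in>{0..}. borel) (\<lambda>k om. restrict (\<lambda>t. W k t om) {0..}) {i, j}"
  by (rule indep_vars_subset[OF indep]) auto
 then have "indep_vars (\<lambda>_. borel) (\<lambda>k om. ?f (restrict (\<lambda>t. W k t om) {0..})) {i, j}"
  by (rule indep_vars_compose2) (use f in auto)
 then have iv: "indep_vars (\<lambda>_. borel) X {i, j}" using pos by (simp add: X_def)
 show "(\<integral>om. X i om * X j om \<partial>M) = (\<integral>om. X i om \<partial>M) * (\<integral>om. X j om \<partial>M)"
  using indep_vars_lebesgue_integral[OF _ iv] I ij by (simp add: X_def)
 show "integrable M (\<lambda>om. X i om * X j om)"
  using indep_vars_integrable[OF _ iv] I ij by (simp add: X_def)
qed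

lemma orthogonal_increments:
 assumes "0 \<le> a" "a < b" "b \<le> c" "c < d"
 shows "integrable M (\<lambda>om. (inc k a b om) * (inc k c d om))" "(\<integral>om. (inc k a b om) * (inc k c d om) \<partial>M) = 0"
proof -
 have c0: "0 \<le> c" using assms by simp
 have [measurable]: "W k b \<in> borel_measurable (F c)" "W k a \<in> borel_measurable (F c)"
  by (rule F_mono[OF _ _ WF]; use assms in simp)+
 have "(\<lambda>om. complex_of_real (inc k a b om)) \<in> borel_measurable (F c)" by measurable
 note * = martingale_part[OF c0 assms(4) this integrable_of_real[OF moments(1)[OF assms(1,2)]], of k]
 show "integrable M (\<lambda>om. (inc k a b om) * (inc k c d om))"
  using integrable_Re[OF *(1)] by simp
 show "(\<integral>om. (inc k a b om) * (inc k c d om) \<partial>M) = 0"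
  using *(2) by (simp only: of_real_mult[symmetric] integral_complex_of_real of_real_eq_0_iff)
qed

text \<open>Each \<open>W k\<close> is a Brownian motion for the filtration and different \<open>W k\<close> are independent of each
 other; that they are jointly independent of the past is a consequence (Levy), whose heart is that
 products of increments of two of them are orthogonal to the past. This follows by subdivision.\<close>

lemma cross_variation:
 assumes ij: "i \<noteq> j" and st: "0 \<le> s" "s < t" and xi: "xi \<in> borel_measurable (F s)" "\<And>om. cmod (xi om) \<le> 1"
 shows "integrable M (\<lambda>om. xi om * of_real ((inc i s t om) * (inc j s t om)))"
  "(\<integral>om. xi om * of_real ((inc i s t om) * (inc j s t om)) \<partial>M) = 0"
proof -
 have t0: "0 \<le> t" using st by simp
 have xiM[measurable]: "xi \<in> borel_measurable M" using F_M[OF st(1) xi(1)] .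
 have prod_int: "integrable M (\<lambda>om. (inc p a b om) * (inc q c d om))"
  if "0 \<le> a" "a < b" "0 \<le> c" "c < d" for a b c d p q
 proof (rule Bochner_Integration.integrable_bound)
  show "integrable M (\<lambda>om. (inc p a b om)\<^sup>2 + (inc q c d om)\<^sup>2)"
   using that by (intro Bochner_Integration.integrable_add moments(3))
  have "\<bar>x * y\<bar> \<le> x\<^sup>2 + y\<^sup>2" for x y :: real
  proof -
   have "0 \<le> \<bar>x\<bar> * \<bar>y\<bar>" by simp
   then show ?thesis using sum_squares_bound[of "\<bar>x\<bar>" "\<bar>y\<bar>"] by (simp only: abs_mult power2_abs)
  qed
  then show "AE om in M. norm ((inc p a b om) * (inc q c d om)) \<le> norm ((inc p a b om)\<^sup>2 + (inc q c d om)\<^sup>2)"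
   by (intro AE_I2) simp
  show "(\<lambda>om. (inc p a b om) * (inc q c d om)) \<in> borel_measurable M"
   using that by (intro borel_measurable_times borel_measurable_diff WM) simp_all
 qed
 have ti: "integrable M (\<lambda>om. xi om * of_real ((inc i a b om) * (inc j c d om)))"
  if "0 \<le> a" "a < b" "0 \<le> c" "c < d" for a b c d
 proof (rule Bochner_Integration.integrable_bound[OF prod_int[OF that, of i j]])
  show "AE om in M. norm (xi om * of_real ((inc i a b om) * (inc j c d om))) \<le> norm ((inc i a b om) * (inc j c d om))"
  proof (intro AE_I2)
   fix om
   have "cmod (xi om) * \<bar>(inc i a b om) * (inc j c d om)\<bar> \<le> 1 * \<bar>(inc i a b om) * (inc j c d om)\<bar>"
    by (intro mult_right_mono xi) auto
   then show "norm (xi om * of_real ((inc i a b om) * (inc j c d om))) \<le> norm ((inc i a b om) * (inc j c d om))"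
    by (simp only: norm_mult norm_of_real real_norm_def abs_mult mult_1)
  qed
  show "(\<lambda>om. xi om * of_real ((inc i a b om) * (inc j c d om))) \<in> borel_measurable M"
   by (rule borel_measurable_times[OF xiM measurable_compose[OF borel_measurable_integrable[OF prod_int[OF that]] borel_measurable_of_real]])
 qed
 show "integrable M (\<lambda>om. xi om * of_real ((inc i s t om) * (inc j s t om)))" by (rule ti) (use st in auto)
 \<comment> \<open>Over n + 1 equal cells, products of increments from different cells vanish
   because the later increment is orthogonal to the past. The sum \<open>S\<close> of the diagonal
   products has second moment (t - s)^2 / (n + 1), since the two motions are independent.\<close>
 have bound: "cmod (\<integral>om. xi om * of_real ((inc i s t om) * (inc j s t om)) \<partial>M) \<le> sqrt ((t - s)\<^sup>2 / real (Suc n))" for n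
 proof -
  define dl where "dl = (t - s) / real (Suc n)"
  define u where "u l = s + real l * ((t - s) / real (Suc n))" for l
  have dl: "0 < dl" using st by (simp add: dl_def)
  have u0: "0 \<le> u l" for l using st by (simp add: u_def)
  have ul: "u (Suc l) = u l + dl" for l unfolding u_def dl_def[symmetric] by (simp add: distrib_right)
  have us: "u l < u (Suc l)" for l using dl by (simp add: ul)
  have umono: "l \<le> m \<Longrightarrow> u l \<le> u m" for l m using dl unfolding u_def dl_def[symmetric] by (simp add: mult_right_mono)
  have ue: "u 0 = s" "u (Suc n) = t" by (simp_all add: u_def)
  let ?d = "\<lambda>k l om. inc k (u l) (u (Suc l)) om"
  have tele: "inc k s t om = (\<Sum>l<Suc n. ?d k l om)" for k om
   by (simp only: sum_lessThan_telescope[of "\<lambda>l. W k (u l) om"] ue)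
  have off: "(\<integral>om. xi om * of_real (?d i l om * ?d j m om) \<partial>M) = 0" if "l \<noteq> m" for l m
  proof -
   have *: "(\<integral>om. xi om * of_real (?d p l om * ?d q m om) \<partial>M) = 0" if lm: "l < m" for p q l m
   proof -
    have "u (Suc l) \<le> u m" "u l \<le> u m" "s \<le> u m" using umono[of "Suc l" m] umono[of l m] umono[of 0 m] lm ue by auto
    then have "(\<lambda>om. xi om * of_real (?d p l om)) \<in> borel_measurable (F (u m))"
     using F_mono[OF u0 _ WF[OF u0], of "Suc l" "u m" p] F_mono[OF u0 _ WF[OF u0], of l "u m" p] F_mono[OF st(1) _ xi(1), of "u m"]
     by measurable
    moreover have "integrable M (\<lambda>om. xi om * of_real (?d p l om))"
     by (rule martingale_part(1)[OF u0 us F_mono[OF st(1) _ xi(1)]])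
       (use umono[of 0 l] ue xi(2) in \<open>auto intro!: integrable_const_bound[of _ 1]\<close>)
    ultimately have "(\<integral>om. (xi om * of_real (?d p l om)) * of_real (?d q m om) \<partial>M) = 0"
     by (rule martingale_part(2)[OF u0 us])
    then show ?thesis by (simp add: mult.assoc)
   qed
   from that consider "l < m" | "m < l" by linarith
   then show ?thesis
   proof cases
    case 2
    have "(\<lambda>om. xi om * of_real (?d i l om * ?d j m om)) = (\<lambda>om. xi om * of_real (?d j m om * ?d i l om))"
     by (simp only: mult.commute)
    then show ?thesis using *[OF 2, of j i] by (simp only:)
   qed (rule *)
  qed
  define S where "S om = (\<Sum>l<Suc n. ?d i l om * ?d j l om)" for om
  have Sint: "integrable M S" unfolding S_def by (intro Bochner_Integration.integrable_sum prod_int u0 us)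
  have "(\<integral>om. xi om * of_real ((inc i s t om) * (inc j s t om)) \<partial>M)
    = (\<integral>om. (\<Sum>l<Suc n. \<Sum>m<Suc n. xi om * of_real (?d i l om * ?d j m om)) \<partial>M)"
   unfolding tele sum_product by (simp only: of_real_sum sum_distrib_left)
  also have "... = (\<Sum>l<Suc n. \<Sum>m<Suc n. \<integral>om. xi om * of_real (?d i l om * ?d j m om) \<partial>M)"
   by (rule integral_double_sum) (rule ti[OF u0 us u0 us])
  also have "... = (\<Sum>l<Suc n. \<Sum>m<Suc n. if m = l then (\<integral>om. xi om * of_real (?d i l om * ?d j l om) \<partial>M) else 0)"
   using off by (intro sum.cong refl) auto
  also have "... = (\<Sum>l<Suc n. \<integral>om. xi om * of_real (?d i l om * ?d j l om) \<partial>M)" by (simp only: sum.delta finite_lessThan) simp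
  also have "... = (\<integral>om. xi om * of_real (S om) \<partial>M)"
   unfolding S_def of_real_sum sum_distrib_left using ti[OF u0 us u0 us] by (intro Bochner_Integration.integral_sum[symmetric]) blast
  finally have 1: "(\<integral>om. xi om * of_real ((inc i s t om) * (inc j s t om)) \<partial>M) = (\<integral>om. xi om * of_real (S om) \<partial>M)" .
  have dd: "integrable M (\<lambda>om. ?d k l om * ?d k m om)" for k l m by (rule prod_int[OF u0 us u0 us])
  have Edd: "(\<integral>om. ?d k l om * ?d k m om \<partial>M) = (if l = m then dl else 0)" for k l m
  proof (cases l m rule: linorder_cases)
   case less
   then show ?thesis using orthogonal_increments(2)[OF u0 us _ us, of l m k] umono[of "Suc l" m] by simp
  next
   case equal
   then show ?thesis using moments(4)[OF u0 us, of k l] by (simp add: power2_eq_square ul)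
  next
   case greater
   then show ?thesis using orthogonal_increments(2)[OF u0 us _ us, of m l k] umono[of "Suc m" l] by (simp add: mult.commute)
  qed
  have S2: "(S om)\<^sup>2 = (\<Sum>l<Suc n. \<Sum>m<Suc n. (?d i l om * ?d i m om) * (?d j l om * ?d j m om))" for om
   by (simp only: S_def power2_eq_square sum_product) (simp only: mult_ac)
  note ce = cross_expectation[OF ij u0 u0 u0 u0 dd]
  have S2int: "integrable M (\<lambda>om. (S om)\<^sup>2)" unfolding S2 by (intro Bochner_Integration.integrable_sum ce(2))
  have ES2: "(\<integral>om. (S om)\<^sup>2 \<partial>M) = (t - s)\<^sup>2 / real (Suc n)"
  proof -
   have "(\<integral>om. (S om)\<^sup>2 \<partial>M) = (\<Sum>l<Suc n. \<Sum>m<Suc n. \<integral>om. (?d i l om * ?d i m om) * (?d j l om * ?d j m om) \<partial>M)"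
    unfolding S2 by (rule integral_double_sum) (rule ce(2))
   also have "... = (\<Sum>l<Suc n. \<Sum>m<Suc n. if m = l then dl * dl else 0)"
    unfolding ce(1) Edd by (intro sum.cong refl) auto
   also have "... = real (Suc n) * (dl * dl)" by (simp only: sum.delta finite_lessThan) simp
   also have "... = (t - s)\<^sup>2 / real (Suc n)" by (simp add: dl_def power2_eq_square field_simps del: of_nat_Suc)
   finally show ?thesis .
  qed
  have "cmod (\<integral>om. xi om * of_real (S om) \<partial>M) \<le> (\<integral>om. \<bar>S om\<bar> \<partial>M)"
  proof (rule order_trans[OF integral_norm_bound])
   have b: "norm (xi om * of_real (S om)) \<le> \<bar>S om\<bar>" for om
    using mult_right_mono[OF xi(2)[of om], of "\<bar>S om\<bar>"] by (simp add: norm_mult)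
   show "(\<integral>om. norm (xi om * of_real (S om)) \<partial>M) \<le> (\<integral>om. \<bar>S om\<bar> \<partial>M)"
    by (rule integral_mono_AE') (use Sint b in auto)
  qed
  \<comment> \<open>Jensen's inequality, as nonnegativity of the variance of |S|.\<close>
  also have "... \<le> sqrt (\<integral>om. (S om)\<^sup>2 \<partial>M)"
  proof (rule real_le_rsqrt)
   have "0 \<le> variance (\<lambda>om. \<bar>S om\<bar>)" by simp
   also have "... = expectation (\<lambda>om. \<bar>S om\<bar>\<^sup>2) - (expectation (\<lambda>om. \<bar>S om\<bar>))\<^sup>2"
    by (rule variance_eq) (use Sint S2int in auto)
   finally show "(\<integral>om. \<bar>S om\<bar> \<partial>M)\<^sup>2 \<le> (\<integral>om. (S om)\<^sup>2 \<partial>M)" by simp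
  qed
  finally show ?thesis unfolding 1 ES2 .
 qed
 have "(\<lambda>n. sqrt ((t - s)\<^sup>2 / real (Suc n))) \<longlonglongrightarrow> sqrt 0"
  by (intro tendsto_real_sqrt LIMSEQ_Suc lim_const_over_n)
 then have "cmod (\<integral>om. xi om * of_real ((inc i s t om) * (inc j s t om)) \<partial>M) \<le> sqrt 0"
  by (rule LIMSEQ_le_const) (use bound in blast)
 then show "(\<integral>om. xi om * of_real ((inc i s t om) * (inc j s t om)) \<partial>M) = 0" by simp
qed

text \<open>Taylor expansion of second order: the linear term vanishes as a martingale increment,
  the mixed quadratic terms vanish by \<open>cross_variation\<close>, and the remainder is cubic.
  The resulting order 3/2 in b - a exceeds 1, so the errors of many short cells sum to something
  small.\<close>

lemma increment_expansion:
 fixes v :: "nat \<Rightarrow> real" and n :: nat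
 assumes st: "0 \<le> a" "a < b" and xi: "xi \<in> borel_measurable (F a)" "\<And>om. cmod (xi om) \<le> 1"
 defines "De \<equiv> \<lambda>om. \<Sum>k<n. v k * (inc k a b om)"
 shows "cmod ((\<integral>om. xi om * iexp (De om) \<partial>M) - of_real (1 - (\<Sum>k<n. (v k)\<^sup>2) * (b - a) / 2) * (\<integral>om. xi om \<partial>M))
  \<le> (real n ^ 3 * (\<Sum>k<n. \<bar>v k\<bar> ^ 3)) * sqrt (b - a) ^ 3"
proof -
 have b0: "0 \<le> b" using st by simp
 note [measurable] = WM[OF st(1)] WM[OF b0]
 have xiM[measurable]: "xi \<in> borel_measurable M" using F_M[OF st(1) xi(1)] .
 have xii: "integrable M xi" by (rule integrable_const_bound[of _ 1]) (use xi(2) in auto)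
 let ?d = "\<lambda>k om. inc k a b om"
 have Dem[measurable]: "De \<in> borel_measurable M" unfolding De_def by measurable
 \<comment> \<open>A sum of n terms is at most n times the largest, and the largest cube is at most
   the sum of the cubes; hence the factor n^3.\<close>
 have cube: "\<bar>De om\<bar> ^ 3 \<le> real n ^ 3 * (\<Sum>k<n. \<bar>v k\<bar> ^ 3 * \<bar>?d k om\<bar> ^ 3)" for om
 proof -
  let ?x = "\<lambda>k. \<bar>v k * ?d k om\<bar>"
  have "\<bar>De om\<bar> \<le> real n * Max (insert 0 (?x ` {..<n}))"
  proof -
   have "\<bar>De om\<bar> \<le> (\<Sum>k<n. ?x k)" unfolding De_def by (rule sum_abs)
   also have "... \<le> (\<Sum>k<n. Max (insert 0 (?x ` {..<n})))" by (intro sum_mono Max_ge) auto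
   finally show ?thesis by simp
  qed
  then have "\<bar>De om\<bar> ^ 3 \<le> real n ^ 3 * Max (insert 0 (?x ` {..<n})) ^ 3"
   unfolding power_mult_distrib[symmetric] by (intro power_mono) auto
  also have "Max (insert 0 (?x ` {..<n})) ^ 3 \<le> (\<Sum>k<n. (?x k) ^ 3)"
  proof -
   have "Max (insert 0 (?x ` {..<n})) \<in> insert 0 (?x ` {..<n})" by (rule Max_in) auto
   then consider "Max (insert 0 (?x ` {..<n})) = 0" | k where "k < n" "Max (insert 0 (?x ` {..<n})) = ?x k" by auto
   then show ?thesis
   proof cases
    case 1 show ?thesis unfolding 1 by (simp add: sum_nonneg)
   next
    case 2
    have "(?x k) ^ 3 \<le> (\<Sum>k<n. (?x k) ^ 3)" by (rule member_le_sum[of k]) (use 2 in auto)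
    then show ?thesis unfolding 2(2) .
   qed
  qed
  finally show ?thesis by (simp add: abs_mult power_mult_distrib mult_left_mono)
 qed
 have ci: "integrable M (\<lambda>om. real n ^ 3 * (\<Sum>k<n. \<bar>v k\<bar> ^ 3 * \<bar>?d k om\<bar> ^ 3))"
  by (intro integrable_mult_right Bochner_Integration.integrable_sum moments(5)[OF st])
 define R where "R x = iexp x - (1 + \<i> * x - x\<^sup>2 / 2)" for x :: real
 have Rb: "cmod (R x) \<le> \<bar>x\<bar> ^ 3 / 6" for x
 proof -
  have "cmod (iexp x - (\<Sum>k\<le>2. (\<i> * x) ^ k / fact k)) \<le> \<bar>x\<bar> ^ Suc 2 / fact (Suc 2)" by (rule iexp_approx1)
  then show ?thesis unfolding R_def by (simp add: numeral_2_eq_2 numeral_3_eq_3 power_mult_distrib power2_eq_square fact_numeral)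
 qed
 have i1: "integrable M (\<lambda>om. xi om * of_real (De om))" and e1: "(\<integral>om. xi om * of_real (De om) \<partial>M) = 0"
 proof -
  have eq: "xi om * of_real (De om) = (\<Sum>k<n. of_real (v k) * (xi om * of_real (?d k om)))" for om
   by (simp add: De_def sum_distrib_left mult_ac del: of_real_diff)
  note m = martingale_part(1,2)[OF st xi(1) xii]
  show "integrable M (\<lambda>om. xi om * of_real (De om))" unfolding eq by (intro Bochner_Integration.integrable_sum integrable_mult_right m(1))
  have "(\<integral>om. (\<Sum>k<n. of_real (v k) * (xi om * of_real (?d k om))) \<partial>M) = (\<Sum>k<n. \<integral>om. of_real (v k) * (xi om * of_real (?d k om)) \<partial>M)"
   by (rule Bochner_Integration.integral_sum) (intro integrable_mult_right m(1))
  then show "(\<integral>om. xi om * of_real (De om) \<partial>M) = 0" unfolding eq by (simp only: integral_mult_right_zero m(2)) simp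
 qed
 have i2: "integrable M (\<lambda>om. xi om * of_real ((De om)\<^sup>2))" and e2: "(\<integral>om. xi om * of_real ((De om)\<^sup>2) \<partial>M) = of_real ((\<Sum>k<n. (v k)\<^sup>2) * (b - a)) * (\<integral>om. xi om \<partial>M)"
 proof -
  have eq: "xi om * of_real ((De om)\<^sup>2) = (\<Sum>k<n. \<Sum>l<n. of_real (v k * v l) * (xi om * of_real (?d k om * ?d l om)))" for om
  proof -
   have "(De om)\<^sup>2 = (\<Sum>k<n. \<Sum>l<n. (v k * v l) * (?d k om * ?d l om))"
    by (simp only: De_def power2_eq_square sum_product) (simp only: mult_ac)
   then show ?thesis by (simp only: of_real_sum of_real_mult[of "v _ * v _"] sum_distrib_left mult.left_commute)
  qed
  have ii: "integrable M (\<lambda>om. xi om * of_real (?d k om * ?d l om))"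
   and ee: "(\<integral>om. xi om * of_real (?d k om * ?d l om) \<partial>M) = (if l = k then (b - a) * (\<integral>om. xi om \<partial>M) else 0)" for k l
   using cross_variation[OF _ st xi, of k l] martingale_part(3,4)[OF st xi(1) xii, of k]
   by (cases "l = k"; simp add: power2_eq_square del: of_real_mult)+
  show "integrable M (\<lambda>om. xi om * of_real ((De om)\<^sup>2))" unfolding eq by (intro Bochner_Integration.integrable_sum integrable_mult_right ii)
  have "(\<integral>om. xi om * of_real ((De om)\<^sup>2) \<partial>M) = (\<Sum>k<n. \<Sum>l<n. of_real (v k * v l) * (\<integral>om. xi om * of_real (?d k om * ?d l om) \<partial>M))"
  proof -
   have "(\<integral>om. (\<Sum>k<n. \<Sum>l<n. of_real (v k * v l) * (xi om * of_real (?d k om * ?d l om))) \<partial>M) = (\<Sum>k<n. \<Sum>l<n. \<integral>om. of_real (v k * v l) * (xi om * of_real (?d k om * ?d l om)) \<partial>M)"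
    by (rule integral_double_sum) (intro integrable_mult_right ii)
   then show ?thesis unfolding eq by (simp only: integral_mult_right_zero)
  qed
  also have "... = (\<Sum>k<n. \<Sum>l<n. if l = k then of_real ((v k)\<^sup>2) * ((b - a) * (\<integral>om. xi om \<partial>M)) else 0)"
   unfolding ee by (intro sum.cong refl) (simp add: power2_eq_square)
  also have "... = (\<Sum>k<n. of_real ((v k)\<^sup>2) * ((b - a) * (\<integral>om. xi om \<partial>M)))" by (intro sum.cong refl) simp
  also have "... = of_real ((\<Sum>k<n. (v k)\<^sup>2) * (b - a)) * (\<integral>om. xi om \<partial>M)" by (simp add: sum_distrib_right mult.assoc)
  finally show "(\<integral>om. xi om * of_real ((De om)\<^sup>2) \<partial>M) = of_real ((\<Sum>k<n. (v k)\<^sup>2) * (b - a)) * (\<integral>om. xi om \<partial>M)" .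
 qed
 have Rn: "norm (xi om * R (De om)) \<le> (1/6) * (real n ^ 3 * (\<Sum>k<n. \<bar>v k\<bar> ^ 3 * \<bar>?d k om\<bar> ^ 3))" for om
 proof -
  have "norm (xi om * R (De om)) \<le> 1 * (\<bar>De om\<bar> ^ 3 / 6)" unfolding norm_mult by (intro mult_mono xi(2) Rb) auto
  then show ?thesis using cube[of om] by linarith
 qed
 have Rm[measurable]: "(\<lambda>om. xi om * R (De om)) \<in> borel_measurable M" unfolding R_def by measurable
 have Ri: "integrable M (\<lambda>om. xi om * R (De om))"
  by (rule Bochner_Integration.integrable_bound[OF integrable_mult_right[OF ci, of "1/6"] Rm])
    (use Rn in \<open>auto intro!: AE_I2 intro: order_trans[OF _ abs_ge_self]\<close>)
 have "xi om * iexp (De om) = xi om + \<i> * (xi om * of_real (De om)) + (-1/2) * (xi om * of_real ((De om)\<^sup>2)) + xi om * R (De om)" for om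
  by (simp add: R_def algebra_simps)
 then have "(\<integral>om. xi om * iexp (De om) \<partial>M) = (\<integral>om. xi om + \<i> * (xi om * of_real (De om)) + (-1/2) * (xi om * of_real ((De om)\<^sup>2)) + xi om * R (De om) \<partial>M)" by simp
 also have "... = (\<integral>om. xi om \<partial>M) + \<i> * (\<integral>om. xi om * of_real (De om) \<partial>M) + (-1/2) * (\<integral>om. xi om * of_real ((De om)\<^sup>2) \<partial>M) + (\<integral>om. xi om * R (De om) \<partial>M)"
  using xii i1 i2 Ri by (simp del: of_real_power)
 finally have "(\<integral>om. xi om * iexp (De om) \<partial>M) - of_real (1 - (\<Sum>k<n. (v k)\<^sup>2) * (b - a) / 2) * (\<integral>om. xi om \<partial>M) = (\<integral>om. xi om * R (De om) \<partial>M)"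
  unfolding e1 e2 by (simp add: left_diff_distrib del: of_real_mult of_real_sum)
 moreover have "cmod (\<integral>om. xi om * R (De om) \<partial>M) \<le> (\<integral>om. (1/6) * (real n ^ 3 * (\<Sum>k<n. \<bar>v k\<bar> ^ 3 * \<bar>?d k om\<bar> ^ 3)) \<partial>M)"
  by (rule order_trans[OF integral_norm_bound]) (intro integral_mono integrable_norm Ri integrable_mult_right[OF ci] Rn)
 moreover have "(\<integral>om. (1/6) * (real n ^ 3 * (\<Sum>k<n. \<bar>v k\<bar> ^ 3 * \<bar>?d k om\<bar> ^ 3)) \<partial>M) \<le> (real n ^ 3 * (\<Sum>k<n. \<bar>v k\<bar> ^ 3)) * sqrt (b - a) ^ 3"
 proof -
  have "(\<integral>om. (1/6) * (real n ^ 3 * (\<Sum>k<n. \<bar>v k\<bar> ^ 3 * \<bar>?d k om\<bar> ^ 3)) \<partial>M) = (1/6) * (real n ^ 3 * (\<Sum>k<n. \<bar>v k\<bar> ^ 3 * (\<integral>om. \<bar>?d k om\<bar> ^ 3 \<partial>M)))"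
  proof -
   have "(\<integral>om. (\<Sum>k<n. \<bar>v k\<bar> ^ 3 * \<bar>?d k om\<bar> ^ 3) \<partial>M) = (\<Sum>k<n. \<integral>om. \<bar>v k\<bar> ^ 3 * \<bar>?d k om\<bar> ^ 3 \<partial>M)"
    by (rule Bochner_Integration.integral_sum) (intro integrable_mult_right moments(5)[OF st])
   then show ?thesis by (simp only: integral_mult_right_zero)
  qed
  also have "... \<le> (1/6) * (real n ^ 3 * (\<Sum>k<n. \<bar>v k\<bar> ^ 3 * (2 * sqrt (b - a) ^ 3)))"
   by (intro mult_left_mono sum_mono moments(6)[OF st]) auto
  also have "... = (1/3) * ((real n ^ 3 * (\<Sum>k<n. \<bar>v k\<bar> ^ 3)) * sqrt (b - a) ^ 3)" by (simp add: sum_distrib_right[symmetric])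
  also have "... \<le> 1 * ((real n ^ 3 * (\<Sum>k<n. \<bar>v k\<bar> ^ 3)) * sqrt (b - a) ^ 3)"
   using st by (intro mult_right_mono mult_nonneg_nonneg sum_nonneg) auto
  finally show ?thesis by simp
 qed
 ultimately show ?thesis by simp
qed

text \<open>Each of N equal cells multiplies the conditional characteristic function by q = 1 - sg
  dl / 2 up to an error of order dl^(3/2). The total error is of order N^(-1/2), and q^N tends to
  the Gaussian exponential.\<close>

lemma increment_char:
 fixes v :: "nat \<Rightarrow> real" and n :: nat
 assumes st: "0 \<le> s" "s < t" and A: "A \<in> sets (F s)"
 shows "(\<integral>om. indicator A om *\<^sub>R iexp (\<Sum>k<n. v k * (inc k s t om)) \<partial>M) = of_real (prob A * exp (- ((\<Sum>k<n. (v k)\<^sup>2) * (t - s) / 2)))"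
proof -
 define sg where "sg = (\<Sum>k<n. (v k)\<^sup>2)"
 have sg0: "0 \<le> sg" unfolding sg_def by (intro sum_nonneg) auto
 define K where "K = real n ^ 3 * (\<Sum>k<n. \<bar>v k\<bar> ^ 3)"
 have K0: "0 \<le> K" unfolding K_def by (intro mult_nonneg_nonneg sum_nonneg) auto
 define \<phi> where "\<phi> = (\<integral>om. indicator A om *\<^sub>R iexp (\<Sum>k<n. v k * (inc k s t om)) \<partial>M)"
 have AM[measurable]: "A \<in> events" using A sub[OF st(1)] by (auto simp: subalgebra_def)
 have bound: "cmod (\<phi> - of_real ((1 + (- (sg * (t - s) / 2)) / real N) ^ N * prob A)) \<le> K * sqrt (t - s) ^ 3 * sqrt (1 / real N)"
  if N: "N > 0" "sg * (t - s) / 2 / real N \<le> 1" for N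
 proof -
  define dl where "dl = (t - s) / real N"
  define u where "u l = s + real l * dl" for l
  have dl: "0 < dl" using st N by (simp add: dl_def)
  have u0: "0 \<le> u l" "s \<le> u l" for l using st dl by (auto simp: u_def)
  have us: "u l < u (Suc l)" "u (Suc l) - u l = dl" for l using dl by (simp_all add: u_def algebra_simps)
  have ue: "u 0 = s" "u N = t" using N by (simp_all add: u_def dl_def)
  define q where "q = 1 - sg * dl / 2"
  \<comment> \<open>Errors made in earlier cells are not amplified by later factors.\<close>
  have q1: "\<bar>q\<bar> \<le> 1"
  proof -
   have "0 \<le> sg * dl" using sg0 dl by simp
   moreover have "sg * dl / 2 \<le> 1" using N(2) by (simp add: dl_def mult.commute)
   ultimately show ?thesis unfolding q_def by linarith
  qed
  define xi where "xi l om = indicator A om *\<^sub>R iexp (\<Sum>k<n. v k * (inc k s (u l) om))" for l om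
  have xim: "xi l \<in> borel_measurable (F (u l))" for l
  proof -
   have [measurable]: "W k (u l) \<in> borel_measurable (F (u l))" "W k s \<in> borel_measurable (F (u l))" for k
    using u0[of l] st by (auto intro: WF F_mono[OF _ _ WF])
   have "sets (F s) \<subseteq> sets (F (u l))" using filt st u0[of l] by (simp add: filtration_on_def)
   then have [measurable]: "A \<in> sets (F (u l))" using A by blast
   show ?thesis unfolding xi_def by measurable
  qed
  have xib: "cmod (xi l om) \<le> 1" for l om by (auto simp: xi_def split: split_indicator)
  have step: "cmod ((\<integral>om. xi (Suc l) om \<partial>M) - of_real q * (\<integral>om. xi l om \<partial>M)) \<le> K * sqrt dl ^ 3" for l
  proof -
   have "xi (Suc l) om = xi l om * iexp (\<Sum>k<n. v k * (inc k (u l) (u (Suc l)) om))" for om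
   proof -
    have "(\<Sum>k<n. v k * (inc k s (u (Suc l)) om)) = (\<Sum>k<n. v k * (inc k s (u l) om)) + (\<Sum>k<n. v k * (inc k (u l) (u (Suc l)) om))"
     by (simp add: sum.distrib[symmetric] algebra_simps)
    then show ?thesis by (simp only: xi_def of_real_add distrib_left exp_add) simp
   qed
   then show ?thesis using increment_expansion[OF u0(1) us(1) xim xib, where n=n and v=v] by (simp add: us K_def q_def sg_def)
  qed
  have "cmod ((\<integral>om. xi l om \<partial>M) - of_real (q ^ l) * (\<integral>om. xi 0 om \<partial>M)) \<le> real l * (K * sqrt dl ^ 3)" for l
  proof (induction l)
   case (Suc l)
   let ?e = "\<lambda>l. \<integral>om. xi l om \<partial>M"
   have "?e (Suc l) - of_real (q ^ Suc l) * ?e 0 = (?e (Suc l) - of_real q * ?e l) + of_real q * (?e l - of_real (q ^ l) * ?e 0)"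
    by (simp add: algebra_simps)
   then have "cmod (?e (Suc l) - of_real (q ^ Suc l) * ?e 0) \<le> cmod (?e (Suc l) - of_real q * ?e l) + cmod (of_real q * (?e l - of_real (q ^ l) * ?e 0))"
    by (simp only: norm_triangle_ineq)
   also have "cmod (of_real q * (?e l - of_real (q ^ l) * ?e 0)) \<le> 1 * (real l * (K * sqrt dl ^ 3))"
    unfolding norm_mult norm_of_real by (intro mult_mono q1 Suc.IH) auto
   finally show ?case using step[of l] by (simp add: distrib_right)
  qed simp
  from this[of N] have "cmod (\<phi> - of_real (q ^ N) * (\<integral>om. xi 0 om \<partial>M)) \<le> real N * (K * sqrt dl ^ 3)"
   by (simp add: \<phi>_def xi_def ue)
  moreover have "(\<integral>om. xi 0 om \<partial>M) = of_real (prob A)"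
   by (simp add: xi_def ue scaleR_conv_of_real integral_complex_of_real)
  moreover have "real N * (K * sqrt dl ^ 3) = K * sqrt (t - s) ^ 3 * sqrt (1 / real N)"
  proof -
   have "sqrt dl = sqrt (t - s) * sqrt (1 / real N)" by (simp add: dl_def real_sqrt_divide)
   moreover have "sqrt (1 / real N) ^ 3 = (1 / real N) * sqrt (1 / real N)" by (simp add: numeral_3_eq_3)
   ultimately show ?thesis using N(1) by (simp add: power_mult_distrib)
  qed
  moreover have "q = 1 + (- (sg * (t - s) / 2)) / real N" by (simp add: q_def dl_def)
  ultimately show ?thesis by simp
 qed
 have "(\<lambda>N. \<phi> - of_real ((1 + (- (sg * (t - s) / 2)) / real N) ^ N * prob A)) \<longlonglongrightarrow> 0"
 proof (rule Lim_null_comparison)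
  have "\<forall>\<^sub>F N in sequentially. sg * (t - s) / 2 + 1 \<le> real N"
   using filterlim_real_sequentially unfolding filterlim_at_top by blast
  then show "\<forall>\<^sub>F N in sequentially. norm (\<phi> - of_real ((1 + (- (sg * (t - s) / 2)) / real N) ^ N * prob A)) \<le> K * sqrt (t - s) ^ 3 * sqrt (1 / real N)"
  proof eventually_elim
   case (elim N)
   have "0 \<le> sg * (t - s) / 2" using sg0 st by simp
   then have "0 < N" "sg * (t - s) / 2 / real N \<le> 1" using elim by (auto simp: divide_le_eq intro: Nat.gr0I)
   then show ?case by (rule bound)
  qed
  have "(\<lambda>N. K * sqrt (t - s) ^ 3 * sqrt (1 / real N)) \<longlonglongrightarrow> K * sqrt (t - s) ^ 3 * sqrt 0"
   by (intro tendsto_intros lim_1_over_n)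
  then show "(\<lambda>N. K * sqrt (t - s) ^ 3 * sqrt (1 / real N)) \<longlonglongrightarrow> 0" by simp
 qed
 moreover have "(\<lambda>N. \<phi> - of_real ((1 + (- (sg * (t - s) / 2)) / real N) ^ N * prob A)) \<longlonglongrightarrow> \<phi> - of_real (exp (- (sg * (t - s) / 2)) * prob A)"
  by (intro tendsto_diff tendsto_const tendsto_of_real tendsto_mult tendsto_exp_limit_sequentially)
 ultimately have "\<phi> - of_real (exp (- (sg * (t - s) / 2)) * prob A) = 0" by (rule LIMSEQ_unique[rotated])
 then show ?thesis by (simp add: \<phi>_def sg_def mult.commute)
qed

theorem bm_system_of_indep: "bm_system T M F W"
 unfolding bm_system_def
proof (intro conjI allI ballI)
 show "prob_space M" by unfold_locales
 show "filtration_on {0..T} M F" using filt by (auto simp: filtration_on_def)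
 show "W k t \<in> borel_measurable (F t)" if "t \<in> {0..T}" for k t using WF that by simp
 show "AE om in M. W k 0 om = 0" for k using bms by (simp add: brownian_motion_def)
 show "AE om in M. continuous_on {0..T} (\<lambda>t. W k t om)" for k
 proof -
  have "AE om in M. continuous_on {0..} (\<lambda>t. W k t om)" using bms by (simp add: brownian_motion_def)
  then show ?thesis by eventually_elim (rule continuous_on_subset, auto)
 qed
 fix n v s t A assume s: "s \<in> {0..T}" and t: "t \<in> {s..T}" and A: "A \<in> sets (F s)"
 have s0: "0 \<le> s" "0 \<le> t" using s t by auto
 note [measurable] = WM[OF s0(1)] WM[OF s0(2)]
 have AM[measurable]: "A \<in> events" using A sub[OF s0(1)] by (auto simp: subalgebra_def)
 let ?De = "\<lambda>om. \<Sum>k<n. v k * (inc k s t om)" and ?sg = "\<Sum>k<n. (v k)\<^sup>2"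
 show "(\<integral>\<^sup>+om. indicator A om * ennreal (exp (?De om)) \<partial>M) = emeasure M A * ennreal (exp (?sg * (t - s) / 2))"
 \<comment> \<open>A vanishing variance is outside the scope of \<open>normal_density\<close>; there
   the exponent is identically 0.\<close>
 proof (cases "?sg * (t - s) = 0")
  case True
  then have 0: "?De om = 0" for om by (auto simp: sum_nonneg_eq_0_iff)
  show ?thesis unfolding 0 True by simp
 next
  case False
  have sg0: "0 \<le> ?sg" by (intro sum_nonneg) auto
  have st: "s < t" using False t by auto
  have pos: "0 < ?sg * (t - s)" using False sg0 st by (simp add: zero_less_mult_iff less_le)
  have ch: "(\<integral>om. indicator A om *\<^sub>R iexp (th * ?De om) \<partial>M) = of_real (prob A * exp (- (th\<^sup>2 * (?sg * (t - s)) / 2)))" if "A \<in> sets (F s)" for A th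
   using increment_char[OF s0(1) st that, where n=n and v="\<lambda>k. th * v k"]
   by (simp add: sum_distrib_left power_mult_distrib mult_ac)
  have Dem: "?De \<in> borel_measurable M" by measurable
  note D = indep_normal_of_char[OF prob_space_axioms sub[OF s0(1)] Dem pos ch]
  have "(\<integral>\<^sup>+om. indicator A om * ennreal (exp (?De om)) \<partial>M) = emeasure M A * (\<integral>\<^sup>+om. ennreal (exp (?De om)) \<partial>M)"
   by (rule nn_integral_indep[OF prob_space_axioms sub[OF s0(1)] Dem _ D(2) A, where f="\<lambda>x. ennreal (exp x)"]) measurable
  also have "(\<integral>\<^sup>+om. ennreal (exp (?De om)) \<partial>M) = (\<integral>\<^sup>+x. ennreal (exp (1 * x)) \<partial>distr M lborel ?De)"
   by (subst nn_integral_distr) auto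
  also have "... = ennreal (exp (?sg * (t - s) / 2))"
   using D(1) pos nn_integral_exp_normal[of "sqrt (?sg * (t - s))" 1] by (simp add: distributed_def)
  finally show ?thesis .
 qed
qed

end

text \<open>Processes are constrained on [0, T] alone. Composition with \<open>clip\<close> extends
  their paths continuously to the whole line, which spares domain conditions in statements on joint
  measurability.\<close>

definition clip :: "real \<Rightarrow> real \<Rightarrow> real" where "clip T s = max 0 (min T s)"

lemma clip_in: "0 \<le> T \<Longrightarrow> clip T s \<in> {0..T}" by (auto simp: clip_def)
lemma clip_id: "s \<in> {0..T} \<Longrightarrow> clip T s = s" by (auto simp: clip_def)
lemma continuous_clip: "continuous_on S (clip T)" unfolding clip_def by (intro continuous_intros)
lemma continuous_on_clip: "0 \<le> T \<Longrightarrow> continuous_on {0..T} f \<Longrightarrow> continuous_on UNIV (\<lambda>s. f (clip T s))"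
 by (rule continuous_on_compose2[OF _ continuous_clip]) (auto dest: clip_in)

lemma grid_floor_tendsto: "0 < T \<Longrightarrow> (\<lambda>N. T * real_of_int \<lfloor>s * 2 ^ N / T\<rfloor> / 2 ^ N) \<longlonglongrightarrow> s"
proof -
 assume T: "0 < T"
 have a: "\<bar>T * real_of_int \<lfloor>s * 2 ^ N / T\<rfloor> / 2 ^ N - s\<bar> \<le> T * (1/2) ^ N" for N
 proof -
  let ?x = "s * 2 ^ N / T"
  have "\<bar>real_of_int \<lfloor>?x\<rfloor> - ?x\<bar> \<le> 1" by linarith
  then have "(T / 2 ^ N) * \<bar>real_of_int \<lfloor>?x\<rfloor> - ?x\<bar> \<le> (T / 2 ^ N) * 1" using T by (intro mult_left_mono) auto
  moreover have "T * real_of_int \<lfloor>?x\<rfloor> / 2 ^ N - s = (T / 2 ^ N) * (real_of_int \<lfloor>?x\<rfloor> - ?x)" using T by (simp add: field_simps)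
  ultimately show ?thesis using T by (simp add: abs_mult power_one_over field_simps)
 qed
 have "(\<lambda>N. T * (1/2) ^ N) \<longlonglongrightarrow> T * 0" by (intro tendsto_intros) auto
 then have "(\<lambda>N. T * real_of_int \<lfloor>s * 2 ^ N / T\<rfloor> / 2 ^ N - s) \<longlonglongrightarrow> 0"
  unfolding mult_zero_right by (rule Lim_null_comparison[rotated]) (intro always_eventually allI, simp only: real_norm_def a)
 then show ?thesis by (simp add: LIM_zero_iff)
qed

lemma grid_section_measurable:
 fixes f :: "real \<Rightarrow> 'w \<Rightarrow> 'b::metric_space"
 assumes [measurable]: "\<And>s. f s \<in> borel_measurable G"
 shows "(\<lambda>p. f (T * real_of_int \<lfloor>fst p * 2 ^ N / T\<rfloor> / 2 ^ N) (snd p)) \<in> borel_measurable (lborel \<Otimes>\<^sub>M G)"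
 by (rule measurable_compose_countable[where f="\<lambda>i p. f (T * real_of_int i / 2 ^ N) (snd p)" and g="\<lambda>p. \<lfloor>fst p * 2 ^ N / T\<rfloor>"]) measurable

lemma continuous_jointly_measurable:
 fixes f :: "real \<Rightarrow> 'w \<Rightarrow> 'b::metric_space"
 assumes f: "\<And>s. f s \<in> borel_measurable G" and c: "\<And>om. om \<in> space G \<Longrightarrow> continuous_on UNIV (\<lambda>s. f s om)"
 shows "(\<lambda>p. f (fst p) (snd p)) \<in> borel_measurable (lborel \<Otimes>\<^sub>M G)"
proof (rule borel_measurable_LIMSEQ_metric[OF grid_section_measurable[OF f, where T=1]])
 fix p :: "real \<times> 'w" assume "p \<in> space (lborel \<Otimes>\<^sub>M G)"
 then have "isCont (\<lambda>s. f s (snd p)) (fst p)" using c by (auto simp: space_pair_measure continuous_on_eq_continuous_at)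
 then show "(\<lambda>N. f (1 * real_of_int \<lfloor>fst p * 2 ^ N / 1\<rfloor> / 2 ^ N) (snd p)) \<longlonglongrightarrow> f (fst p) (snd p)"
  by (rule isCont_tendsto_compose[OF _ grid_floor_tendsto]) simp
qed

section \<open>Continuous adapted processes and drifts frozen on dyadic cells\<close>

locale adapted_process = bm T M F w for T and M :: "'w measure" and F w +
 fixes Y :: "real \<Rightarrow> 'w \<Rightarrow> 'a::{real_inner, polish_space}"
 assumes YF: "\<And>t. t \<in> {0..T} \<Longrightarrow> Y t \<in> borel_measurable (F t)"
  and Yc: "\<And>om. om \<in> space M \<Longrightarrow> continuous_on {0..T} (\<lambda>t. Y t om)"
begin

lemma YM: "t \<in> {0..T} \<Longrightarrow> Y t \<in> borel_measurable M" using F_M YF by blast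

text \<open>Progressive measurability: clipping at \<open>t\<close> ensures that only values up to
  time t occur, so the past at time t suffices for joint measurability.\<close>

lemma Y_joint: "t \<in> {0..T} \<Longrightarrow> (\<lambda>p. Y (clip t (fst p)) (snd p)) \<in> borel_measurable (lborel \<Otimes>\<^sub>M F t)"
proof (rule continuous_jointly_measurable)
 assume t: "t \<in> {0..T}"
 fix s
 have s: "clip t s \<in> {0..t}" using t by (intro clip_in) auto
 show "Y (clip t s) \<in> borel_measurable (F t)" using s t by (intro F_mono[of "clip t s" t] YF) auto
next
 fix om assume t: "t \<in> {0..T}" and om: "om \<in> space (F t)"
 then have "continuous_on {0..t} (\<lambda>t. Y t om)" using Yc[of om] space_F[OF t] by (auto intro: continuous_on_subset)
 then show "continuous_on UNIV (\<lambda>s. Y (clip t s) om)" using t by (intro continuous_on_clip) auto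
qed

lemma Y_joint_M[measurable]: "(\<lambda>p. Y (clip T (fst p)) (snd p)) \<in> borel_measurable (lborel \<Otimes>\<^sub>M M)"
 using T YM Yc clip_in by (intro continuous_jointly_measurable continuous_on_clip) auto

lemma integral_adapted:
 assumes f[measurable]: "(f :: 'a \<Rightarrow> real) \<in> borel_measurable borel" and t: "t \<in> {0..T}"
 shows "(\<lambda>om. LINT s:{0..t}|lborel. f (Y (clip T s) om)) \<in> borel_measurable (F t)"
proof -
 note [measurable] = Y_joint[OF t]
 have "(\<lambda>om. LINT s|lborel. indicator {0..t} s * f (Y (clip t s) om)) \<in> borel_measurable (F t)"
 proof (rule lborel.borel_measurable_lebesgue_integral)
  have "(\<lambda>q. (\<lambda>p. Y (clip t (fst p)) (snd p)) (snd q, fst q)) \<in> borel_measurable (F t \<Otimes>\<^sub>M lborel)" by measurable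
  then have [measurable]: "(\<lambda>q. Y (clip t (snd q)) (fst q)) \<in> borel_measurable (F t \<Otimes>\<^sub>M lborel)" by simp
  show "(\<lambda>(om, s). indicator {0..t} s * f (Y (clip t s) om)) \<in> borel_measurable (F t \<Otimes>\<^sub>M lborel)"
   unfolding case_prod_beta by measurable
 qed
 also have "(\<lambda>om. LINT s|lborel. indicator {0..t} s * f (Y (clip t s) om)) = (\<lambda>om. LINT s:{0..t}|lborel. f (Y (clip T s) om))"
  using t by (auto simp: set_lebesgue_integral_def clip_def fun_eq_iff intro!: Bochner_Integration.integral_cong split: split_indicator)
 finally show ?thesis .
qed

text \<open>The path frozen at the left end of its dyadic cell: a finitely valued function of it is
  a step process, and it converges to the path by continuity.\<close>

definition Yg :: "nat \<Rightarrow> real \<Rightarrow> 'w \<Rightarrow> 'a" where "Yg N s om = Y (clip T (T * real_of_int \<lfloor>s * 2 ^ N / T\<rfloor> / 2 ^ N)) om"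

lemma Yg_measurable[measurable]: "(\<lambda>p. Yg N (fst p) (snd p)) \<in> borel_measurable (lborel \<Otimes>\<^sub>M M)"
 unfolding Yg_def using T YM clip_in by (intro grid_section_measurable[where f="\<lambda>s. Y (clip T s)"]) auto

lemma Yg_tendsto: "om \<in> space M \<Longrightarrow> (\<lambda>N. Yg N s om) \<longlonglongrightarrow> Y (clip T s) om"
proof -
 assume "om \<in> space M"
 then have "isCont (\<lambda>s. Y (clip T s) om) s"
  using continuous_on_clip[OF _ Yc] T by (simp add: continuous_on_eq_continuous_at)
 then show ?thesis unfolding Yg_def by (rule isCont_tendsto_compose[OF _ grid_floor_tendsto[OF T]])
qed

lemma Yg_cell:
 assumes "j < 2 ^ N" "gp T N j \<le> s" "s < gp T N (Suc j)"
 shows "Yg N s = Y (gp T N j)"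
proof -
 have "real j \<le> s * 2 ^ N / T" "s * 2 ^ N / T < real (Suc j)"
  using assms T by (simp_all add: gp_def field_simps)
 then have "\<lfloor>s * 2 ^ N / T\<rfloor> = int j" by (intro floor_unique) auto
 then show ?thesis using clip_id[OF gp_in, of j N] assms(1) by (simp add: Yg_def gp_def fun_eq_iff)
qed

lemma Yg_gp: "j < 2 ^ N \<Longrightarrow> Yg N (gp T N j) = Y (gp T N j)"
 by (rule Yg_cell) (auto simp: gp_less)

definition RM :: "(real \<times> 'w) measure" where "RM = density lborel (indicator {0..T}) \<Otimes>\<^sub>M M"

lemma RM_sets[measurable_cong]: "sets RM = sets (lborel \<Otimes>\<^sub>M M)" and RM_space: "space RM = UNIV \<times> space M"
 by (auto simp: RM_def space_pair_measure intro!: sets_pair_measure_cong)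

lemma RM_pair: "pair_sigma_finite (density lborel (indicator {0..T})) M" and RM_finite: "finite_measure RM"
proof -
 interpret prob_space M using bm by (simp add: bm_system_def)
 interpret f: finite_measure "density lborel (indicator {0..T})"
  by (rule finite_measureI) (use T in \<open>simp add: emeasure_density\<close>)
 show p: "pair_sigma_finite (density lborel (indicator {0..T})) M" by unfold_locales
 interpret p: pair_sigma_finite "density lborel (indicator {0..T})" M by fact
 have "emeasure RM (UNIV \<times> space M) = ennreal T"
  unfolding RM_def by (subst emeasure_pair_measure_Times) (use T in \<open>auto simp: emeasure_density emeasure_space_1\<close>)
 then show "finite_measure RM" by (intro finite_measureI) (simp add: RM_space)
qed

lemma nn_integral_RM:
 assumes "f \<in> borel_measurable (lborel \<Otimes>\<^sub>M M)"
 shows "(\<integral>\<^sup>+p. f p \<partial>RM) = (\<integral>\<^sup>+om. (\<integral>\<^sup>+s\<in>{0..T}. f (s, om) \<partial>lborel) \<partial>M)"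
proof -
 have f: "f \<in> borel_measurable RM" using assms measurable_cong_sets[OF RM_sets refl] by blast
 have "(\<integral>\<^sup>+p. f p \<partial>RM) = (\<integral>\<^sup>+om. (\<integral>\<^sup>+s. f (s, om) \<partial>density lborel (indicator {0..T})) \<partial>M)"
  using pair_sigma_finite.nn_integral_snd[OF RM_pair f[unfolded RM_def]] by (simp add: RM_def)
 also have "... = (\<integral>\<^sup>+om. (\<integral>\<^sup>+s\<in>{0..T}. f (s, om) \<partial>lborel) \<partial>M)"
 proof (rule nn_integral_cong)
  fix om assume "om \<in> space M"
  then have "(\<lambda>s. f (s, om)) \<in> borel_measurable lborel" by (rule measurable_compose[OF measurable_Pair2' assms])
  then show "(\<integral>\<^sup>+s. f (s, om) \<partial>density lborel (indicator {0..T})) = (\<integral>\<^sup>+s\<in>{0..T}. f (s, om) \<partial>lborel)"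
   by (subst nn_integral_density) (auto simp: mult.commute)
 qed
 finally show ?thesis .
qed

lemma girsanov_of_approx:
 fixes B :: "'a \<Rightarrow> 'a" and \<beta> :: "nat \<Rightarrow> nat \<Rightarrow> 'a \<Rightarrow> real"
 assumes B[measurable]: "B \<in> borel_measurable borel" and BR: "\<And>x. norm (B x) \<le> R" and e: "orthonormal_basis e"
  and Nf: "\<And>n. Nf n \<le> Nf (Suc n)"
  and \<beta>: "\<And>n k. \<beta> n k \<in> borel_measurable borel \<and> finite (range (\<beta> n k))" "\<And>n k x. dm n \<le> k \<Longrightarrow> \<beta> n k x = 0" "\<And>n x. (\<Sum>k<dm n. (\<beta> n k x)\<^sup>2) \<le> (R + 2)\<^sup>2"
  and ap: "\<And>n. (\<integral>\<^sup>+p. ennreal ((norm ((\<Sum>k<dm n. \<beta> n k (Yg (Nf n) (fst p) (snd p)) *\<^sub>R e k) - B (Y (clip T (fst p)) (snd p))))\<^sup>2) \<partial>RM) \<le> ennreal ((1/16) ^ n / 4)"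
 shows "girsanov T M F w Nf dm (\<lambda>n k s om. \<beta> n k (Yg (Nf n) s om)) (\<lambda>k s om. B (Y (clip T s) om) \<bullet> e k) ((R + 2)\<^sup>2) R"
proof unfold_locales
 have [measurable]: "\<beta> n k \<in> borel_measurable borel" for n k using \<beta>(1) by blast
 show "Nf n \<le> Nf (Suc n)" for n by (rule Nf)
 show "elem (Nf n) (\<lambda>k s om. \<beta> n k (Yg (Nf n) s om))" for n
  unfolding elem_def
 proof (intro allI impI conjI)
  fix j k :: nat assume j: "j < 2 ^ Nf n"
  have [measurable]: "Y (gp T (Nf n) j) \<in> borel_measurable (F (gp T (Nf n) j))" using YF[OF gp_in] j by simp
  show "(\<lambda>om. \<beta> n k (Yg (Nf n) (gp T (Nf n) j) om)) \<in> borel_measurable (F (gp T (Nf n) j))"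
   unfolding Yg_gp[OF j] by measurable
  show "finite ((\<lambda>om. \<beta> n k (Yg (Nf n) (gp T (Nf n) j) om)) ` space M)"
   by (rule finite_subset[OF _ conjunct2[OF \<beta>(1)[of n k]]]) auto
  fix s assume s: "gp T (Nf n) j \<le> s \<and> s < gp T (Nf n) (Suc j)"
  show "(\<lambda>om. \<beta> n k (Yg (Nf n) s om)) = (\<lambda>om. \<beta> n k (Yg (Nf n) (gp T (Nf n) j) om))"
   using Yg_cell[OF j] Yg_gp[OF j] s by simp
 qed
 show "\<beta> n k (Yg (Nf n) s om) = 0" if "dm n \<le> k" for n k s om using \<beta>(2) that by blast
 show "(\<Sum>k<dm n. (\<beta> n k (Yg (Nf n) s om))\<^sup>2) \<le> (R + 2)\<^sup>2" for n s om by (rule \<beta>(3))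
 show "(\<lambda>p. B (Y (clip T (fst p)) (snd p)) \<bullet> e k) \<in> borel_measurable (lborel \<Otimes>\<^sub>M M)" for k by measurable
 show "(\<lambda>p. \<beta> n k (Yg (Nf n) (fst p) (snd p))) \<in> borel_measurable (lborel \<Otimes>\<^sub>M M)" for n k by measurable
 show "\<bar>B (Y (clip T s) om) \<bullet> e k\<bar> \<le> R" for k s om
 proof -
  have "norm (e k) = 1" using e by (simp add: orthonormal_basis_def norm_eq_sqrt_inner)
  then show ?thesis using Cauchy_Schwarz_ineq2[of "B (Y (clip T s) om)" "e k"] BR[of "Y (clip T s) om"] by simp
 qed
 show "(\<lambda>om. LINT s:{0..t}|lborel. B (Y (clip T s) om) \<bullet> e k) \<in> borel_measurable (F t)" if "t \<in> {0..T}" for k t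
  by (rule integral_adapted[OF _ that]) measurable
 fix n m
 let ?x = "\<lambda>s om. (\<Sum>k<dm n. \<beta> n k (Yg (Nf n) s om) *\<^sub>R e k) - B (Y (clip T s) om)"
 \<comment> \<open>Bessel's inequality: the error in finitely many coordinates is dominated by the
   vector error, uniformly in m.\<close>
 have le: "(\<Sum>k<m. (\<beta> n k (Yg (Nf n) s om) - B (Y (clip T s) om) \<bullet> e k)\<^sup>2) \<le> (norm (?x s om))\<^sup>2" for s om
 proof -
  have "(\<Sum>i<dm n. \<beta> n i (Yg (Nf n) s om) *\<^sub>R e i) \<bullet> e k = (\<Sum>i<dm n. if i = k then \<beta> n k (Yg (Nf n) s om) else 0)" for k
   unfolding inner_sum_left using e by (intro sum.cong) (auto simp: orthonormal_basis_def)
  then have "?x s om \<bullet> e k = \<beta> n k (Yg (Nf n) s om) - B (Y (clip T s) om) \<bullet> e k" for k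
   using \<beta>(2)[of n k] by (auto simp: inner_diff_left)
  then have "(\<Sum>k<m. (\<beta> n k (Yg (Nf n) s om) - B (Y (clip T s) om) \<bullet> e k)\<^sup>2) = (norm (basis_proj e m (?x s om)))\<^sup>2"
   by (simp only: norm_basis_proj[OF e])
  also have "... \<le> (norm (?x s om))\<^sup>2" by (intro power_mono norm_basis_proj_le[OF e]) simp
  finally show ?thesis .
 qed
 have "(\<integral>\<^sup>+om. (\<integral>\<^sup>+s\<in>{0..T}. ennreal (\<Sum>k<m. (\<beta> n k (Yg (Nf n) s om) - B (Y (clip T s) om) \<bullet> e k)\<^sup>2) \<partial>lborel) \<partial>M)
   \<le> (\<integral>\<^sup>+om. (\<integral>\<^sup>+s\<in>{0..T}. ennreal ((norm (?x s om))\<^sup>2) \<partial>lborel) \<partial>M)"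
  by (intro nn_integral_mono mult_right_mono ennreal_leI le) auto
 also have "... = (\<integral>\<^sup>+p. ennreal ((norm (?x (fst p) (snd p)))\<^sup>2) \<partial>RM)"
  by (subst nn_integral_RM) auto
 also have "... \<le> ennreal ((1/16) ^ n / 4)" by (rule ap)
 finally show "(\<integral>\<^sup>+om. (\<integral>\<^sup>+s\<in>{0..T}. ennreal (\<Sum>k<m. (\<beta> n k (Yg (Nf n) s om) - B (Y (clip T s) om) \<bullet> e k)\<^sup>2) \<partial>lborel) \<partial>M) \<le> ennreal ((1/16) ^ n / 4)" .
qed

end

text \<open>The same levels, dimensions and functions \<beta> serve both processes. Uniqueness
  depends on this, because the two densities must be one function of the path; existence applies the
  lemma to two copies of a single process.\<close>

lemma girsanov_pair:
 fixes B :: "'a \<Rightarrow> 'a::{real_inner, polish_space}"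
 assumes Y1: "adapted_process T M1 F1 w1 Y1" and Y2: "adapted_process T M2 F2 w2 Y2"
  and B: "B \<in> borel_measurable borel" and BR: "\<And>x. norm (B x) \<le> R" and e: "orthonormal_basis e"
 shows "\<exists>Nf dm \<beta>. (\<forall>n k. \<beta> n k \<in> borel_measurable borel) \<and>
  girsanov T M1 F1 w1 Nf dm (\<lambda>n k s om. \<beta> n k (adapted_process.Yg T Y1 (Nf n) s om)) (\<lambda>k s om. B (Y1 (clip T s) om) \<bullet> e k) ((R + 2)\<^sup>2) R \<and>
  girsanov T M2 F2 w2 Nf dm (\<lambda>n k s om. \<beta> n k (adapted_process.Yg T Y2 (Nf n) s om)) (\<lambda>k s om. B (Y2 (clip T s) om) \<bullet> e k) ((R + 2)\<^sup>2) R"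
proof -
 interpret y1: adapted_process T M1 F1 w1 Y1 by fact
 interpret y2: adapted_process T M2 F2 w2 Y2 by fact
 let ?x1 = "\<lambda>d \<beta> N p. (\<Sum>k<d. \<beta> k (y1.Yg N (fst p) (snd p)) *\<^sub>R e k) - B (Y1 (clip T (fst p)) (snd p))"
 let ?x2 = "\<lambda>d \<beta> N p. (\<Sum>k<d. \<beta> k (y2.Yg N (fst p) (snd p)) *\<^sub>R e k) - B (Y2 (clip T (fst p)) (snd p))"
 define Q where "Q n d \<beta> N0 \<longleftrightarrow> (\<forall>k. \<beta> k \<in> borel_measurable borel \<and> finite (range (\<beta> k))) \<and> (\<forall>k\<ge>d. \<forall>x. \<beta> k x = 0) \<and>
   (\<forall>x. (\<Sum>k<d. (\<beta> k x)\<^sup>2) \<le> (R + 2)\<^sup>2) \<and>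
   (\<forall>N\<ge>N0. (\<integral>\<^sup>+p. ennreal ((norm (?x1 d \<beta> N p))\<^sup>2) \<partial>y1.RM) \<le> ennreal ((1/16) ^ n / 4) \<and>
    (\<integral>\<^sup>+p. ennreal ((norm (?x2 d \<beta> N p))\<^sup>2) \<partial>y2.RM) \<le> ennreal ((1/16) ^ n / 4))" for n d N0 :: nat and \<beta> :: "nat \<Rightarrow> 'a \<Rightarrow> real"
 have "\<exists>d \<beta> N0. Q n d \<beta> N0" for n unfolding Q_def
 proof (rule drift_approx[OF y1.RM_finite y2.RM_finite _ _ _ _ _ _ B BR e])
  show "(\<lambda>N. y1.Yg N (fst p) (snd p)) \<longlonglongrightarrow> Y1 (clip T (fst p)) (snd p)" if "p \<in> space y1.RM" for p
   using that by (intro y1.Yg_tendsto) (auto simp: y1.RM_space)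
  show "(\<lambda>N. y2.Yg N (fst p) (snd p)) \<longlonglongrightarrow> Y2 (clip T (fst p)) (snd p)" if "p \<in> space y2.RM" for p
   using that by (intro y2.Yg_tendsto) (auto simp: y2.RM_space)
 qed simp_all
 then obtain d \<beta> N0 where Q: "\<And>n. Q n (d n) (\<beta> n) (N0 n)" by metis
 have *: "\<And>n k. \<beta> n k \<in> borel_measurable borel \<and> finite (range (\<beta> n k))" "\<And>n k x. d n \<le> k \<Longrightarrow> \<beta> n k x = 0"
   "\<And>n x. (\<Sum>k<d n. (\<beta> n k x)\<^sup>2) \<le> (R + 2)\<^sup>2"
   "\<And>n N. N0 n \<le> N \<Longrightarrow> (\<integral>\<^sup>+p. ennreal ((norm (?x1 (d n) (\<beta> n) N p))\<^sup>2) \<partial>y1.RM) \<le> ennreal ((1/16) ^ n / 4) \<and>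
    (\<integral>\<^sup>+p. ennreal ((norm (?x2 (d n) (\<beta> n) N p))\<^sup>2) \<partial>y2.RM) \<le> ennreal ((1/16) ^ n / 4)"
  using Q unfolding Q_def by blast+
 \<comment> \<open>Partial sums of the thresholds are monotone and dominate each threshold.\<close>
 define Nf where "Nf n = (\<Sum>i\<le>n. N0 i)" for n
 have Nf: "Nf n \<le> Nf (Suc n)" "N0 n \<le> Nf n" for n by (auto simp: Nf_def intro: member_le_sum)
 show ?thesis
  by (intro exI[of _ Nf] exI[of _ d] exI[of _ \<beta>] conjI allI conjunct1[OF *(1)]
    y1.girsanov_of_approx[OF B BR e Nf(1) *(1,2,3) conjunct1[OF *(4)[OF Nf(2)]]]
    y2.girsanov_of_approx[OF B BR e Nf(1) *(1,2,3) conjunct2[OF *(4)[OF Nf(2)]]])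
qed

section \<open>Cylindrical Brownian motion\<close>

context bm
begin

text \<open>Starting times, coefficients and dimension may all vary with i, and \<open>A\<close>
  need agree with an event of the past only up to a null set. This covers augmentation of the
  filtration, series in infinitely many directions, and limits with vanishing coefficients.
  Convergent variances bound the second moments.\<close>

lemma mgf_limit:
 fixes m :: "nat \<Rightarrow> nat" and c :: "nat \<Rightarrow> nat \<Rightarrow> real" and u :: "nat \<Rightarrow> real"
 assumes u: "\<And>i. 0 \<le> u i" "\<And>i. u i \<le> t" and t: "t \<le> T" and A[measurable]: "A \<in> sets M"
  and AB: "\<And>i. \<exists>B\<in>sets (F (u i)). AE om in M. om \<in> A \<longleftrightarrow> om \<in> B"
  and De[measurable]: "De \<in> borel_measurable M"
  and lim: "AE om in M. (\<lambda>i. \<Sum>k<m i. c i k * (inc k (u i) t om)) \<longlonglongrightarrow> De om"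
  and q: "(\<lambda>i. (\<Sum>k<m i. (c i k)\<^sup>2) * (t - u i)) \<longlonglongrightarrow> q"
 shows "(\<integral>\<^sup>+om. indicator A om * ennreal (exp (De om)) \<partial>M) = emeasure M A * ennreal (exp (q / 2))"
proof -
 have ui: "u i \<in> {0..T}" "t \<in> {0..T}" for i using u[of i] t by auto
 note [measurable] = wM[OF ui(1)] wM[OF ui(2)]
 define D where "D i om = (\<Sum>k<m i. c i k * (inc k (u i) t om))" for i om
 define p where "p i = (\<Sum>k<m i. (c i k)\<^sup>2) * (t - u i)" for i
 have [measurable]: "D i \<in> borel_measurable M" for i unfolding D_def by measurable
 have ind: "ennreal (indicator A om * x) = indicator A om * ennreal x" for om x by (auto split: split_indicator)
 have val: "(\<integral>\<^sup>+om. ennreal (indicator A om * exp (D i om)) \<partial>M) = emeasure M A * ennreal (exp (p i / 2))" for i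
 proof -
  obtain B where B: "B \<in> sets (F (u i))" "AE om in M. om \<in> A \<longleftrightarrow> om \<in> B" using AB by blast
  note [measurable] = sets_F_M[OF ui(1) B(1)]
  have "(\<integral>\<^sup>+om. ennreal (indicator A om * exp (D i om)) \<partial>M) = (\<integral>\<^sup>+om. indicator B om * ennreal (exp (D i om)) \<partial>M)"
   unfolding ind using B(2) by (intro nn_integral_cong_AE) (auto simp: indicator_def)
  also have "... = emeasure M B * ennreal (exp (p i / 2))" unfolding D_def p_def by (rule mgf[OF u t B(1)])
  also have "emeasure M B = emeasure M A" using B(2) by (intro emeasure_eq_AE) auto
  finally show ?thesis .
 qed
 obtain K where K: "\<And>i. \<bar>p i\<bar> \<le> K"
  using Bseq_eq_bounded[of p] q convergent_imp_Bseq[of p] unfolding p_def[symmetric] by (metis Bseq_def convergentI real_norm_def)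
 have "(\<lambda>i. \<integral>\<^sup>+om. ennreal (indicator A om * exp (D i om)) \<partial>M) \<longlonglongrightarrow> (\<integral>\<^sup>+om. ennreal (indicator A om * exp (De om)) \<partial>M)"
 proof (rule nn_integral_tendsto_of_L2_bounded[OF prob_space_axioms])
  show "AE om in M. (\<lambda>i. indicator A om * exp (D i om)) \<longlonglongrightarrow> indicator A om * exp (De om)"
   using lim unfolding D_def[symmetric] by eventually_elim (intro tendsto_intros)
  fix i
  have "(\<integral>\<^sup>+om. ennreal ((indicator A om * exp (D i om))\<^sup>2) \<partial>M) \<le> (\<integral>\<^sup>+om. indicator (space M) om * ennreal (exp (\<Sum>k<m i. (2 * c i k) * (inc k (u i) t om))) \<partial>M)"
   by (intro nn_integral_mono) (auto simp: D_def sum_distrib_left mult.assoc exp_double[symmetric] split: split_indicator)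
  also have "... = ennreal (exp ((\<Sum>k<m i. (2 * c i k)\<^sup>2) * (t - u i) / 2))"
   by (subst mgf[OF u t]) (use sets.top[of "F (u i)"] space_F[OF ui(1)] emeasure_space_1 in auto)
  also have "... = ennreal (exp (2 * p i))" by (simp add: p_def power_mult_distrib sum_distrib_left[symmetric])
  also have "... \<le> ennreal (exp (2 * K))" using abs_le_D1[OF K[of i]] by (intro ennreal_leI) simp
  finally show "(\<integral>\<^sup>+om. ennreal ((indicator A om * exp (D i om))\<^sup>2) \<partial>M) \<le> ennreal (exp (2 * K))" .
 qed auto
 moreover have "(\<lambda>i. emeasure M A * ennreal (exp (p i / 2))) \<longlonglongrightarrow> emeasure M A * ennreal (exp (q / 2))"
  using q unfolding p_def[symmetric] by (intro ennreal_tendsto_cmult tendsto_ennrealI tendsto_intros) (auto simp: less_top[symmetric])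
 ultimately show ?thesis unfolding val ind[symmetric] by (rule LIMSEQ_unique)
qed

lemma AE_w0: "AE om in M. \<forall>k. w k 0 om = 0"
 using bm by (simp add: bm_system_def AE_all_countable)

lemma AE_w_continuous: "AE om in M. \<forall>k. continuous_on {0..T} (\<lambda>t. w k t om)"
 using bm by (simp add: bm_system_def AE_all_countable)

text \<open>In the limit both exp(Z) and exp(-Z) have mean 1, whereas exp x + exp(-x) \<ge> 2 with
  equality at 0 only.\<close>

lemma AE_zero_of_small_coefficients:
 fixes m :: "nat \<Rightarrow> nat" and c :: "nat \<Rightarrow> nat \<Rightarrow> real"
 assumes t: "t \<in> {0..T}" and Z[measurable]: "Z \<in> borel_measurable M"
  and lim: "AE om in M. (\<lambda>i. \<Sum>k<m i. c i k * (inc k 0 t om)) \<longlonglongrightarrow> Z om"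
  and c: "(\<lambda>i. \<Sum>k<m i. (c i k)\<^sup>2) \<longlonglongrightarrow> 0"
 shows "AE om in M. Z om = 0"
proof -
 have 1: "(\<integral>\<^sup>+om. ennreal (exp (s * Z om)) \<partial>M) = 1" if "s\<^sup>2 = 1" for s
 proof -
  have "(\<integral>\<^sup>+om. indicator (space M) om * ennreal (exp (s * Z om)) \<partial>M) = emeasure M (space M) * ennreal (exp (0 / 2))"
  proof (rule mgf_limit[where u="\<lambda>_. 0" and t=t and m=m and c="\<lambda>i k. s * c i k"])
   show "AE om in M. (\<lambda>i. \<Sum>k<m i. s * c i k * (inc k 0 t om)) \<longlonglongrightarrow> s * Z om"
    using lim by eventually_elim (simp add: mult.assoc sum_distrib_left[symmetric] tendsto_mult_left)
   show "(\<lambda>i. (\<Sum>k<m i. (s * c i k)\<^sup>2) * (t - 0)) \<longlonglongrightarrow> 0"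
    using tendsto_mult_right[OF c, of t] that by (simp add: power_mult_distrib)
   show "\<exists>B\<in>sets (F 0). AE om in M. (om \<in> space M) = (om \<in> B)"
    using sets.top[of "F 0"] space_F[of 0] T by auto
  qed (use t in auto)
  then show ?thesis by (simp add: emeasure_space_1 cong: nn_integral_cong)
 qed
 have pos: "2 \<le> exp x + exp (- x)" "exp x + exp (- x) = 2 \<Longrightarrow> x = 0" for x :: real
 proof -
  have "exp x + exp (- x) - 2 = (exp (x / 2) - exp (- x / 2))\<^sup>2"
   by (simp add: power2_diff exp_double[symmetric] mult.assoc exp_add[symmetric])
  then show "2 \<le> exp x + exp (- x)" "exp x + exp (- x) = 2 \<Longrightarrow> x = 0" by (simp_all add: algebra_simps)
 qed
 have "(\<integral>\<^sup>+om. ennreal (exp (Z om) + exp (- Z om)) \<partial>M) = (\<integral>\<^sup>+om. ennreal 2 \<partial>M)"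
  using 1[of 1] 1[of "-1"] by (simp add: ennreal_plus nn_integral_add emeasure_space_1)
 moreover have "(\<integral>\<^sup>+om. ennreal (exp (Z om) + exp (- Z om) - 2) \<partial>M) = (\<integral>\<^sup>+om. ennreal (exp (Z om) + exp (- Z om)) \<partial>M) - (\<integral>\<^sup>+om. ennreal 2 \<partial>M)"
  using pos(1) by (subst nn_integral_diff[symmetric]) (auto simp: emeasure_space_1 ennreal_minus[symmetric] intro!: AE_I2 simp del: ennreal_plus ennreal_numeral)
 ultimately have "(\<integral>\<^sup>+om. ennreal (exp (Z om) + exp (- Z om) - 2) \<partial>M) = 0" by (simp add: emeasure_space_1)
 then have "AE om in M. ennreal (exp (Z om) + exp (- Z om) - 2) = 0" by (subst (asm) nn_integral_0_iff_AE) auto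
 then show ?thesis
 proof eventually_elim
  case (elim om)
  then have "exp (Z om) + exp (- Z om) - 2 \<le> 0" by (simp only: ennreal_eq_0_iff)
  then show ?case using pos[of "Z om"] by linarith
 qed
qed

text \<open>Only the null sets of \<open>M\<close> itself are added, since \<open>M\<close> need not be complete.\<close>

definition fam :: "real \<Rightarrow> 'w set set" where
 "fam t = {A \<in> sets M. \<exists>B\<in>sets (F t). AE om in M. om \<in> A \<longleftrightarrow> om \<in> B}"

text \<open>The right limits of the filtration, up to null sets. No time follows T; the clause
  \<open>u = T\<close> makes the condition at T membership in \<open>fam T\<close>.\<close>

definition aug :: "real \<Rightarrow> 'w measure" where
 "aug t = sigma (space M) {A \<in> sets M. \<forall>u\<in>{0..T}. t < u \<or> u = T \<longrightarrow> A \<in> fam u}"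

lemma space_aug[simp]: "space (aug t) = space M"
 unfolding aug_def by (rule space_measure_of) (auto dest: sets.sets_into_space)

lemma sets_aug: "sets (aug t) = {A \<in> sets M. \<forall>u\<in>{0..T}. t < u \<or> u = T \<longrightarrow> A \<in> fam u}" (is "_ = ?G")
proof -
 have "sigma_algebra (space M) ?G"
  unfolding sigma_algebra_iff2
 proof (intro conjI ballI allI impI)
  show "?G \<subseteq> Pow (space M)" by (auto dest: sets.sets_into_space)
  have "{} \<in> fam u" for u by (auto simp: fam_def intro!: bexI[of _ "{}"])
  then show "{} \<in> ?G" by auto
  fix A assume A: "A \<in> ?G"
  have "space M - A \<in> fam u" if u: "u \<in> {0..T}" "A \<in> fam u" for u
  proof -
   obtain B where B: "B \<in> sets (F u)" "AE om in M. om \<in> A \<longleftrightarrow> om \<in> B" using u by (auto simp: fam_def)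
   have "space M - B \<in> sets (F u)" using B(1) sets.compl_sets[of B "F u"] space_F[OF u(1)] by simp
   moreover have "AE om in M. om \<in> space M - A \<longleftrightarrow> om \<in> space M - B" using B(2) by eventually_elim auto
   moreover have "space M - A \<in> sets M" using A by auto
   ultimately show ?thesis unfolding fam_def by blast
  qed
  then show "space M - A \<in> ?G" using A by auto
 next
  fix A :: "nat \<Rightarrow> 'w set" assume A: "range A \<subseteq> ?G"
  have "(\<Union>i. A i) \<in> fam u" if u: "u \<in> {0..T}" "\<And>i. A i \<in> fam u" for u
  proof -
   have "\<forall>i. \<exists>B. B \<in> sets (F u) \<and> (AE om in M. om \<in> A i \<longleftrightarrow> om \<in> B)" using u by (auto simp: fam_def)
   then obtain B where B: "\<And>i. B i \<in> sets (F u)" "\<And>i. AE om in M. om \<in> A i \<longleftrightarrow> om \<in> B i" by metis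
   have "AE om in M. \<forall>i. om \<in> A i \<longleftrightarrow> om \<in> B i" unfolding AE_all_countable using B(2) by blast
   then have "AE om in M. om \<in> (\<Union>i. A i) \<longleftrightarrow> om \<in> (\<Union>i. B i)" by eventually_elim auto
   moreover have "(\<Union>i. A i) \<in> sets M" using A by auto
   ultimately show ?thesis using B(1) by (auto simp: fam_def intro!: bexI[of _ "\<Union>i. B i"])
  qed
  moreover have "A i \<in> fam u" if "u \<in> {0..T}" "t < u \<or> u = T" for i u using A that by blast
  moreover have "(\<Union>i. A i) \<in> sets M" using A by auto
  ultimately show "(\<Union>i. A i) \<in> ?G" by simp
 qed
 then show ?thesis unfolding aug_def by (rule sigma_algebra.sets_measure_of_eq)
qed

lemma fam_mono: "0 \<le> s \<Longrightarrow> s \<le> t \<Longrightarrow> t \<le> T \<Longrightarrow> fam s \<subseteq> fam t"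
 unfolding fam_def using mono by blast

lemma F_aug: "t \<in> {0..T} \<Longrightarrow> sets (F t) \<subseteq> sets (aug t)"
proof
 fix A assume t: "t \<in> {0..T}" and A: "A \<in> sets (F t)"
 have "A \<in> fam t" using sets_F_M[OF t A] A by (auto simp: fam_def)
 then have "A \<in> fam u" if "u \<in> {0..T}" "t < u \<or> u = T" for u using subsetD[OF fam_mono[of t u]] that t by auto
 then show "A \<in> sets (aug t)" using sets_F_M[OF t A] by (simp add: sets_aug)
qed

lemma measurable_aug: "t \<in> {0..T} \<Longrightarrow> f \<in> measurable (F t) B \<Longrightarrow> f \<in> measurable (aug t) B"
 by (rule measurable_from_subalg[of "aug t" "F t"]) (use F_aug space_F in \<open>auto simp: subalgebra_def\<close>)

lemma normal_filtration_aug: "normal_filtration {0..T} M aug"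
 unfolding normal_filtration_def filtration_on_def
proof (intro conjI ballI impI)
 show "subalgebra M (aug t)" for t by (auto simp: subalgebra_def sets_aug)
 show "sets (aug s) \<subseteq> sets (aug t)" if "s \<in> {0..T}" "t \<in> {0..T}" "s \<le> t" for s t using that by (auto simp: sets_aug)
 show "null_sets M \<subseteq> sets (aug 0)"
 proof
  fix A assume A: "A \<in> null_sets M"
  have "A \<in> fam u" for u using A AE_not_in[OF A] by (auto simp: fam_def intro!: bexI[of _ "{}"])
  then show "A \<in> sets (aug 0)" using A by (auto simp: sets_aug)
 qed
 fix t assume t: "t \<in> {0..T}" and "\<exists>s\<in>{0..T}. t < s"
 then have tT: "t < T" by auto
 show "sets (aug t) = (\<Inter>s\<in>{s \<in> {0..T}. t < s}. sets (aug s))"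
 proof
  show "sets (aug t) \<subseteq> (\<Inter>s\<in>{s \<in> {0..T}. t < s}. sets (aug s))" by (auto simp: sets_aug)
  show "(\<Inter>s\<in>{s \<in> {0..T}. t < s}. sets (aug s)) \<subseteq> sets (aug t)"
  proof
   fix A assume A: "A \<in> (\<Inter>s\<in>{s \<in> {0..T}. t < s}. sets (aug s))"
   have "A \<in> fam u" if u: "u \<in> {0..T}" "t < u \<or> u = T" for u
   proof -
    \<comment> \<open>The midpoint lies strictly after t, so \<open>A\<close> belongs to the
      augmented past there, and strictly before u, so this membership reaches
      \<open>fam u\<close>.\<close>
    have "(t + u) / 2 \<in> {s \<in> {0..T}. t < s}" "(t + u) / 2 < u \<or> u = T" using t u tT by auto
    then have "A \<in> sets (aug ((t + u) / 2))" "(t + u) / 2 < u \<or> u = T" using A by blast+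
    then show ?thesis using u(1) unfolding sets_aug by blast
   qed
   moreover have "A \<in> sets (aug T)" using A tT t by auto
   then have "A \<in> sets M" by (simp add: sets_aug)
   ultimately show "A \<in> sets (aug t)" by (auto simp: sets_aug)
  qed
 qed
qed

text \<open>For s < t, an event of \<open>aug s\<close> agrees almost surely with an event known at
  each later time u. Letting u decrease to s in the exponential moments uses continuity of the
  paths.\<close>

lemma bm_system_aug: "bm_system T M aug w"
 unfolding bm_system_def
proof (intro conjI allI ballI)
 show "prob_space M" by (rule prob_space_axioms)
 show "filtration_on {0..T} M aug" using normal_filtration_aug by (simp add: normal_filtration_def)
 show "w k t \<in> borel_measurable (aug t)" if "t \<in> {0..T}" for k t by (rule measurable_aug[OF that wF[OF that]])
 show "AE om in M. w k 0 om = 0" for k using AE_w0 by eventually_elim simp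
 show "AE om in M. continuous_on {0..T} (\<lambda>t. w k t om)" for k using AE_w_continuous by eventually_elim simp
 fix n and v :: "nat \<Rightarrow> real" and s t A assume s: "s \<in> {0..T}" and t: "t \<in> {s..T}" and A: "A \<in> sets (aug s)"
 have tT: "t \<in> {0..T}" using s t by auto
 note [measurable] = wM[OF s] wM[OF tT]
 have AM[measurable]: "A \<in> events" using A by (simp add: sets_aug)
 show "(\<integral>\<^sup>+om. indicator A om * ennreal (exp (\<Sum>k<n. v k * (inc k s t om))) \<partial>M)
     = emeasure M A * ennreal (exp ((\<Sum>k<n. (v k)\<^sup>2) * (t - s) / 2))"
 proof (cases "s = t")
  case True
  then show ?thesis by simp
 next
  case False
 define u where "u i = s + (t - s) * (1 / real (Suc i))" for i
 have u: "s \<le> u i" "u i \<le> t" for i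
 proof -
  show "s \<le> u i" using s t by (simp add: u_def)
  have "(t - s) * (1 / real (Suc i)) \<le> (t - s) * 1" using t by (intro mult_left_mono) auto
  then show "u i \<le> t" by (simp add: u_def)
 qed
 have "u \<longlonglongrightarrow> s + (t - s) * 0" unfolding u_def by (intro tendsto_intros lim_1_over_n[THEN LIMSEQ_Suc])
 then have us: "u \<longlonglongrightarrow> s" by simp
 have cont: "AE om in M. (\<lambda>i. \<Sum>k<n. v k * (inc k (u i) t om)) \<longlonglongrightarrow> (\<Sum>k<n. v k * (inc k s t om))"
  using AE_w_continuous
 proof eventually_elim
  case (elim om)
  have "(\<lambda>i. w k (u i) om) \<longlonglongrightarrow> w k s om" for k
  proof (rule continuous_on_tendsto_compose[OF elim[rule_format] us s])
   have "u i \<in> {0..T}" for i using s u[of i] t by auto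
   then show "\<forall>\<^sub>F i in sequentially. u i \<in> {0..T}" by simp
  qed
  then show ?case by (intro tendsto_intros)
 qed
 show ?thesis
 proof (rule mgf_limit[where u=u and t=t and m="\<lambda>_. n" and c="\<lambda>_. v"])
  show "0 \<le> u i" "u i \<le> t" "t \<le> T" for i using s t u[of i] by auto
  show "A \<in> events" by (rule AM)
  show "\<exists>B\<in>sets (F (u i)). AE om in M. (om \<in> A) = (om \<in> B)" for i
  proof -
   have "s < u i" using False t by (auto simp: u_def)
   moreover have "u i \<in> {0..T}" using u[of i] s t by auto
   ultimately have "A \<in> fam (u i)" using A unfolding sets_aug by blast
   then show ?thesis by (simp add: fam_def)
  qed
  show "(\<lambda>i. (\<Sum>k<n. (v k)\<^sup>2) * (t - u i)) \<longlonglongrightarrow> (\<Sum>k<n. (v k)\<^sup>2) * (t - s)" by (intro tendsto_intros us)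
 qed (use cont in auto)
 qed
qed

end

section \<open>Maximal inequality and the cylindrical series\<close>

context bm
begin

definition lin :: "nat \<Rightarrow> (nat \<Rightarrow> real) \<Rightarrow> real \<Rightarrow> 'w \<Rightarrow> real" where
 "lin d v t om = (\<Sum>k<d. v k * (inc k 0 t om))"

lemma lin_F: "t \<in> {0..T} \<Longrightarrow> lin d v t \<in> borel_measurable (F t)"
proof -
 assume t: "t \<in> {0..T}"
 have [measurable]: "w k 0 \<in> borel_measurable (F t)" "w k t \<in> borel_measurable (F t)" for k
  using F_mono[of 0 t "w k 0"] wF[of 0 k] wF[OF t] t by auto
 show ?thesis unfolding lin_def by measurable
qed

lemma lin_M: "t \<in> {0..T} \<Longrightarrow> lin d v t \<in> borel_measurable M" using F_M lin_F by blast

text \<open>Doob's argument for the exponential martingale \<open>Z\<close>: on the event of first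
  passage at the j-th grid point, \<open>Z\<close> is at least \<open>K\<close>. The martingale
  property moves \<open>Z\<close> forward to time T, and the disjoint passage events together carry
  at most the mean of \<open>Z T\<close>, which is 1.\<close>

lemma maximal_inequality_grid:
 assumes th: "0 < th" and v: "(\<Sum>k<d. (v k)\<^sup>2) \<le> sg"
 shows "emeasure M {om\<in>space M. \<exists>j\<le>2^N. eps < lin d v (gp T N j) om} \<le> ennreal (exp (th\<^sup>2 * sg * T / 2 - th * eps))"
proof -
 let ?s = "\<Sum>k<d. (v k)\<^sup>2" and ?X = "\<lambda>j. lin d v (gp T N j)"
 define Z where "Z t om = exp (th * lin d v t om - th\<^sup>2 * ?s * t / 2)" for t om
 define A where "A j = {om\<in>space M. eps < ?X j om \<and> (\<forall>i<j. ?X i om \<le> eps)}" for j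
 define K where "K = exp (th * eps - th\<^sup>2 * sg * T / 2)"
 have g: "gp T N j \<in> {0..T}" if "j \<le> 2 ^ N" for j using gp_in that .
 have AF: "A j \<in> sets (F (gp T N j))" if j: "j \<le> 2 ^ N" for j
 proof -
  have [measurable]: "?X i \<in> borel_measurable (F (gp T N j))" if "i \<le> j" for i
   using that j g[of i] g[OF j] gp_mono[OF that, of N] by (intro F_mono[OF _ _ _ lin_F]) auto
  have "A j = {om\<in>space (F (gp T N j)). eps < ?X j om} \<inter> (\<Inter>i\<in>{..<j}. {om\<in>space (F (gp T N j)). ?X i om \<le> eps}) \<inter> space (F (gp T N j))"
   by (auto simp: A_def space_F[OF g[OF j]])
  moreover have "... \<in> sets (F (gp T N j))"
  proof (cases "j = 0")
   case False
   then show ?thesis by (intro sets.Int sets.top sets.finite_INT) auto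
  next
   case True
   have [measurable]: "lin d v 0 \<in> borel_measurable (F 0)" using T by (intro lin_F) auto
   show ?thesis using True by simp
  qed
  ultimately show ?thesis by simp
 qed
 have mart: "(\<integral>\<^sup>+om. xi om * ennreal (Z T om) \<partial>M) = (\<integral>\<^sup>+om. xi om * ennreal (Z s om) \<partial>M)"
  if s: "s \<in> {0..T}" and xi[measurable]: "xi \<in> borel_measurable (F s)" for s xi
 proof -
  have [measurable]: "lin d v s \<in> borel_measurable (F s)" by (rule lin_F[OF s])
  have "(\<integral>\<^sup>+om. (xi om * ennreal (Z s om)) * ennreal (exp ((\<Sum>k<d. (th * v k) * (inc k s T om)) - (\<Sum>k<d. (th * v k)\<^sup>2) * (T - s) / 2)) \<partial>M)
   = (\<integral>\<^sup>+om. xi om * ennreal (Z s om) \<partial>M)"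
   using s by (intro exp_step[where c="\<lambda>k _. th * v k"]) (auto simp: Z_def intro: finite_subset[of _ "{th * v _}"])
  moreover have "Z s om * exp ((\<Sum>k<d. (th * v k) * (inc k s T om)) - (\<Sum>k<d. (th * v k)\<^sup>2) * (T - s) / 2) = Z T om" for om
  proof -
   have "(\<Sum>k<d. (th * v k) * (inc k s T om)) = th * (lin d v T om - lin d v s om)"
    by (simp add: lin_def sum_distrib_left sum_subtractf[symmetric] algebra_simps)
   moreover have "(\<Sum>k<d. (th * v k)\<^sup>2) = th\<^sup>2 * ?s" by (simp add: power_mult_distrib sum_distrib_left)
   ultimately show ?thesis unfolding Z_def exp_add[symmetric] by (simp add: field_simps)
  qed
  ultimately show ?thesis by (simp add: mult.assoc ennreal_mult[symmetric] Z_def del: ennreal_mult')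
 qed
 have E: "{om\<in>space M. \<exists>j\<le>2^N. eps < ?X j om} = (\<Union>j\<le>2^N. A j)"
 proof (intro equalityI subsetI)
  fix om assume "om \<in> {om\<in>space M. \<exists>j\<le>2^N. eps < ?X j om}"
  then obtain j where j: "om \<in> space M" "j \<le> 2 ^ N" "eps < ?X j om" by auto
  let ?i = "LEAST j. eps < ?X j om"
  have "eps < ?X ?i om" "?i \<le> j" "\<And>i. i < ?i \<Longrightarrow> \<not> eps < ?X i om" using j(3) by (auto intro: LeastI Least_le dest: not_less_Least)
  then show "om \<in> (\<Union>j\<le>2^N. A j)" using j(1,2) by (auto simp: A_def not_less intro!: bexI[of _ ?i])
 qed (auto simp: A_def)
 have AM[measurable]: "A j \<in> events" if "j \<le> 2 ^ N" for j using sets_F_M[OF g AF] that by blast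
 have disj: "disjoint_family_on A {..2^N}"
  unfolding disjoint_family_on_def
 proof (intro ballI impI)
  fix i j :: nat assume "i \<noteq> j"
  then consider "i < j" | "j < i" by linarith
  then show "A i \<inter> A j = {}" by cases (auto simp: A_def not_le[symmetric])
 qed
 have [measurable]: "Z t \<in> borel_measurable M" if "t \<in> {0..T}" for t using lin_M[OF that] unfolding Z_def by measurable
 have T0: "T \<in> {0..T}" "0 \<in> {0..T}" using T by auto
 note [measurable] = lin_M[OF T0(1), of d v]
 have Aj: "emeasure M (A j) * ennreal K \<le> (\<integral>\<^sup>+om. indicator (A j) om * ennreal (Z T om) \<partial>M)" if j: "j \<le> 2 ^ N" for j
 proof -
  have "indicator (A j) om * ennreal K \<le> indicator (A j) om * ennreal (Z (gp T N j) om)" for om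
  proof (cases "om \<in> A j")
   case True
   then have "th * eps \<le> th * ?X j om" using th by (auto simp: A_def)
   moreover have "th\<^sup>2 * ?s * gp T N j \<le> th\<^sup>2 * sg * T"
    using v g[OF j] by (intro mult_mono mult_nonneg_nonneg order_trans[OF _ v] sum_nonneg) auto
   ultimately have "th * eps - th\<^sup>2 * sg * T / 2 \<le> th * ?X j om - th\<^sup>2 * ?s * gp T N j / 2" by linarith
   then show ?thesis using True by (simp add: K_def Z_def ennreal_leI)
  qed simp
  then have "(\<integral>\<^sup>+om. indicator (A j) om * ennreal K \<partial>M) \<le> (\<integral>\<^sup>+om. indicator (A j) om * ennreal (Z (gp T N j) om) \<partial>M)"
   by (rule nn_integral_mono)
  also have "... = (\<integral>\<^sup>+om. indicator (A j) om * ennreal (Z T om) \<partial>M)"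
   using AF[OF j] by (intro mart[symmetric] g j) auto
  finally show ?thesis using AM[OF j] by (simp add: nn_integral_multc)
 qed
 have "emeasure M (\<Union>j\<le>2^N. A j) * ennreal K \<le> (\<Sum>j\<le>2^N. emeasure M (A j)) * ennreal K"
  using AM by (intro mult_right_mono emeasure_subadditive_finite) auto
 also have "... \<le> (\<Sum>j\<le>2^N. \<integral>\<^sup>+om. indicator (A j) om * ennreal (Z T om) \<partial>M)"
  unfolding sum_distrib_right by (intro sum_mono Aj) auto
 also have "... = (\<integral>\<^sup>+om. (\<Sum>j\<le>2^N. indicator (A j) om * ennreal (Z T om)) \<partial>M)"
  using AM T0 by (intro nn_integral_sum[symmetric]) auto
 also have "... \<le> (\<integral>\<^sup>+om. 1 * ennreal (Z T om) \<partial>M)"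
  unfolding sum_distrib_right[symmetric]
  by (intro nn_integral_mono mult_right_mono) (simp_all add: indicator_UN_disjoint[OF _ disj, symmetric] split: split_indicator)
 also have "... = (\<integral>\<^sup>+om. 1 * ennreal (Z 0 om) \<partial>M)" by (rule mart[OF T0(2)]) simp
 also have "... = 1" by (simp add: Z_def lin_def emeasure_space_1)
 finally have "emeasure M (\<Union>j\<le>2^N. A j) * ennreal K \<le> 1" .
 then have "emeasure M (\<Union>j\<le>2^N. A j) * ennreal K * ennreal (1 / K) \<le> 1 * ennreal (1 / K)" by (rule mult_right_mono) simp
 moreover have "1 / K = exp (th\<^sup>2 * sg * T / 2 - th * eps)" by (simp add: K_def exp_diff)
 moreover have "ennreal K * ennreal (1 / K) = 1" by (subst ennreal_mult[symmetric]) (auto simp: K_def)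
 ultimately show ?thesis unfolding E by (simp only: mult.assoc mult_1_left mult_1_right)
qed

text \<open>The grid events increase with the level, so their bound extends to all dyadic times;
  continuity adds the remaining times, and the two signs give the factor 2. A measurable exceptional
  set \<open>E\<close> stands in for the event that the supremum is large.\<close>

lemma maximal_inequality:
 assumes th: "0 < th" and v: "(\<Sum>k<d. (v k)\<^sup>2) \<le> sg"
 shows "\<exists>E\<in>sets M. emeasure M E \<le> ennreal (2 * exp (th\<^sup>2 * sg * T / 2 - th * eps)) \<and>
  (\<forall>om\<in>space M - E. (\<forall>k. continuous_on {0..T} (\<lambda>t. w k t om)) \<longrightarrow> (\<forall>t\<in>{0..T}. \<bar>lin d v t om\<bar> \<le> eps))"
proof -
 define q where "q = exp (th\<^sup>2 * sg * T / 2 - th * eps)"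
 define E where "E v N = {om\<in>space M. \<exists>j\<le>2^N. eps < lin d v (gp T N j) om}" for v N
 have EM[measurable]: "E v N \<in> events" for v N
 proof -
  have "E v N = (\<Union>j\<le>2^N. {om\<in>space M. eps < lin d v (gp T N j) om})" by (auto simp: E_def)
  then show ?thesis using lin_M[OF gp_in] by auto
 qed
 have b: "emeasure M (\<Union>N. E v N) \<le> ennreal q" if "(\<Sum>k<d. (v k)\<^sup>2) \<le> sg" for v
 proof -
  have "incseq (E v)"
  proof (rule incseq_SucI, rule subsetI)
   fix N om assume "om \<in> E v N"
   then obtain j where "om \<in> space M" "j \<le> 2 ^ N" "eps < lin d v (gp T N j) om" by (auto simp: E_def)
   then show "om \<in> E v (Suc N)" unfolding E_def by (auto intro!: exI[of _ "2 * j"] simp: gp_double)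
  qed
  then have "emeasure M (\<Union>N. E v N) = (SUP N. emeasure M (E v N))" using EM by (intro SUP_emeasure_incseq[symmetric]) auto
  also have "... \<le> ennreal q" unfolding q_def E_def using maximal_inequality_grid[OF th that] by (intro SUP_least)
  finally show ?thesis .
 qed
 have out: "lin d v t om \<le> eps" if om: "om \<in> space M" "om \<notin> (\<Union>N. E v N)" and c: "\<And>k. continuous_on {0..T} (\<lambda>t. w k t om)" and t: "t \<in> {0..T}" for v om t
 proof (rule LIMSEQ_le_const2)
  let ?u = "\<lambda>N. T * real_of_int \<lfloor>t * 2 ^ N / T\<rfloor> / 2 ^ N"
  have u: "?u N = gp T N (nat \<lfloor>t * 2 ^ N / T\<rfloor>)" "nat \<lfloor>t * 2 ^ N / T\<rfloor> \<le> 2 ^ N" for N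
  proof -
   have "t * 2 ^ N / T \<le> 2 ^ N" using t T by (simp add: divide_le_eq mult.commute)
   then have "\<lfloor>t * 2 ^ N / T\<rfloor> \<le> 2 ^ N" by (simp add: floor_le_iff)
   then show "nat \<lfloor>t * 2 ^ N / T\<rfloor> \<le> 2 ^ N" by (simp add: nat_le_iff)
   show "?u N = gp T N (nat \<lfloor>t * 2 ^ N / T\<rfloor>)" using t T by (simp add: gp_def)
  qed
  have "continuous_on {0..T} (\<lambda>t. lin d v t om)" unfolding lin_def by (intro continuous_intros c)
  then show "(\<lambda>N. lin d v (?u N) om) \<longlonglongrightarrow> lin d v t om"
   by (rule continuous_on_tendsto_compose[OF _ grid_floor_tendsto[OF T] t]) (intro always_eventually allI, unfold u(1), rule gp_in[OF u(2)])
  show "\<exists>N0. \<forall>N\<ge>N0. lin d v (?u N) om \<le> eps" unfolding u(1) using om u(2) by (auto simp: E_def not_less)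
 qed
 have neg: "(\<Sum>k<d. (- v k)\<^sup>2) \<le> sg" using v by simp
 have lneg: "lin d (\<lambda>k. - v k) t om = - lin d v t om" for t om by (simp add: lin_def sum_negf)
 have "emeasure M ((\<Union>N. E v N) \<union> (\<Union>N. E (\<lambda>k. - v k) N)) \<le> emeasure M (\<Union>N. E v N) + emeasure M (\<Union>N. E (\<lambda>k. - v k) N)"
  by (intro emeasure_subadditive) auto
 also have "... \<le> ennreal q + ennreal q" using b[OF v] b[OF neg] by (rule add_mono)
 also have "... = ennreal (2 * q)" by (simp add: ennreal_plus[symmetric] q_def del: ennreal_plus)
 finally have "emeasure M ((\<Union>N. E v N) \<union> (\<Union>N. E (\<lambda>k. - v k) N)) \<le> ennreal (2 * q)" .
 moreover have "\<bar>lin d v t om\<bar> \<le> eps" if "om \<in> space M - ((\<Union>N. E v N) \<union> (\<Union>N. E (\<lambda>k. - v k) N))"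
   "\<forall>k. continuous_on {0..T} (\<lambda>t. w k t om)" "t \<in> {0..T}" for om t
  using out[of om v t] out[of om "\<lambda>k. - v k" t] that unfolding lneg by (simp add: abs_le_iff)
 ultimately show ?thesis unfolding q_def by (intro bexI[of _ "(\<Union>N. E v N) \<union> (\<Union>N. E (\<lambda>k. - v k) N)"]) auto
qed

text \<open>Beyond the cut the coefficients of \<open>h\<close> have squares summing to at most
  16^-i, fast enough for almost sure uniform convergence of the partial sums along the cuts. The
  condition i \<le> n makes the cuts tend to infinity even for a finite combination of basis
  vectors.\<close>

definition cut :: "(nat \<Rightarrow> 'a::real_inner) \<Rightarrow> 'a \<Rightarrow> nat \<Rightarrow> nat" where
 "cut e h i = (LEAST n. i \<le> n \<and> (norm h)\<^sup>2 - (\<Sum>k<n. (h \<bullet> e k)\<^sup>2) \<le> (1/16) ^ i)"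

definition cyl :: "(nat \<Rightarrow> 'a::real_inner) \<Rightarrow> real \<Rightarrow> 'a \<Rightarrow> 'w \<Rightarrow> real" where
 "cyl e t h om = lim (\<lambda>i. lin (cut e h i) (\<lambda>k. h \<bullet> e k) t om)"

lemma parseval: "orthonormal_basis e \<Longrightarrow> (\<lambda>n. \<Sum>k<n. (h \<bullet> e k)\<^sup>2) \<longlonglongrightarrow> (norm h)\<^sup>2"
 using inner_basis_sums[of e h h] by (simp only: power2_norm_eq_inner power2_eq_square[of "_ \<bullet> _"])

lemma parseval_le: "orthonormal_basis e \<Longrightarrow> (\<Sum>k<n. (h \<bullet> e k)\<^sup>2) \<le> (norm h)\<^sup>2"
 using norm_basis_proj[of e n h] norm_basis_proj_le[of e n h] by (metis norm_ge_zero power_mono)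

lemma cut_props: "orthonormal_basis e \<Longrightarrow> i \<le> cut e h i \<and> (norm h)\<^sup>2 - (\<Sum>k<cut e h i. (h \<bullet> e k)\<^sup>2) \<le> (1/16) ^ i"
 unfolding cut_def
proof (rule LeastI_ex)
 assume e: "orthonormal_basis e"
 have "\<forall>\<^sub>F n in sequentially. (norm h)\<^sup>2 - (1/16) ^ i < (\<Sum>k<n. (h \<bullet> e k)\<^sup>2)"
  by (rule order_tendstoD(1)[OF parseval[OF e]]) simp
 with eventually_ge_at_top[of i] have "\<forall>\<^sub>F n in sequentially. i \<le> n \<and> (norm h)\<^sup>2 - (\<Sum>k<n. (h \<bullet> e k)\<^sup>2) \<le> (1/16) ^ i"
  by eventually_elim simp
 then show "\<exists>n. i \<le> n \<and> (norm h)\<^sup>2 - (\<Sum>k<n. (h \<bullet> e k)\<^sup>2) \<le> (1/16) ^ i" by (auto simp: eventually_sequentially)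
qed

lemmas cut = conjunct2[OF cut_props]

text \<open>In the existence proof the equation itself makes the full series converge along each
  path; its limit must then be the one taken along the cuts.\<close>

lemma cyl_eqI:
 assumes "orthonormal_basis e" "(\<lambda>n. lin n (\<lambda>k. h \<bullet> e k) t om) \<longlonglongrightarrow> x"
 shows "cyl e t h om = x"
 unfolding cyl_def
proof (rule limI, rule filterlim_compose[OF assms(2)])
 show "filterlim (cut e h) sequentially sequentially"
  using cut_props[OF assms(1)] by (intro filterlim_at_top_mono[OF filterlim_ident] always_eventually allI) blast
qed

lemma cut_Suc: "orthonormal_basis e \<Longrightarrow> cut e h i \<le> cut e h (Suc i)"
proof -
 assume e: "orthonormal_basis e"
 have "(norm h)\<^sup>2 - (\<Sum>k<cut e h (Suc i). (h \<bullet> e k)\<^sup>2) \<le> (1/16) ^ i"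
  using cut[OF e, of h "Suc i"] by (rule order_trans) (simp add: power_Suc mult_le_cancel_right1)
 then have "i \<le> cut e h (Suc i) \<and> (norm h)\<^sup>2 - (\<Sum>k<cut e h (Suc i). (h \<bullet> e k)\<^sup>2) \<le> (1/16) ^ i"
  using cut_props[OF e, of "Suc i" h] by linarith
 then show ?thesis unfolding cut_def[of e h i] by (rule Least_le)
qed

lemma cut_tail:
 assumes "orthonormal_basis e"
 shows "(\<Sum>k<m. (if cut e h i \<le> k then h \<bullet> e k else 0)\<^sup>2) \<le> (1/16) ^ i"
proof -
 have "(\<Sum>k<m. (if cut e h i \<le> k then h \<bullet> e k else 0)\<^sup>2) + (\<Sum>k<cut e h i. (h \<bullet> e k)\<^sup>2)
  \<le> (\<Sum>k<m + cut e h i. (if cut e h i \<le> k then h \<bullet> e k else 0)\<^sup>2) + (\<Sum>k<m + cut e h i. (if k < cut e h i then h \<bullet> e k else 0)\<^sup>2)"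
  by (intro add_mono sum_mono2 order_trans[OF eq_refl sum_mono2[of "{..<m + cut e h i}" "{..<cut e h i}"]] sum.cong) auto
 also have "... = (\<Sum>k<m + cut e h i. (h \<bullet> e k)\<^sup>2)" unfolding sum.distrib[symmetric] by (intro sum.cong) auto
 also have "... \<le> (norm h)\<^sup>2" by (rule parseval_le[OF assms])
 finally show ?thesis using cut[OF assms, of h i] by linarith
qed

text \<open>By the maximal inequality two consecutive partial sums differ by more than 2^-i
  somewhere on [0, T] with probability at most a constant times 2^-i. Borel-Cantelli and the
  Weierstrass test give uniform convergence, hence a continuous limit.\<close>

lemma AE_cyl:
 assumes e: "orthonormal_basis e"
 shows "AE om in M. continuous_on {0..T} (\<lambda>t. cyl e t h om) \<and>
  (\<forall>t\<in>{0..T}. (\<lambda>i. lin (cut e h i) (\<lambda>k. h \<bullet> e k) t om) \<longlonglongrightarrow> cyl e t h om)"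
proof -
 let ?S = "\<lambda>i t om. lin (cut e h i) (\<lambda>k. h \<bullet> e k) t om"
 have D: "?S (Suc i) t om - ?S i t om = lin (cut e h (Suc i)) (\<lambda>k. if cut e h i \<le> k then h \<bullet> e k else 0) t om" for i t om
 proof -
  have "?S i t om = (\<Sum>k<cut e h (Suc i). if k < cut e h i then (h \<bullet> e k) * (inc k 0 t om) else 0)"
   unfolding lin_def using cut_Suc[OF e, of h i] by (intro sum.mono_neutral_cong_left) auto
  then show ?thesis unfolding lin_def sum_subtractf[symmetric] by (auto simp: sum_subtractf[symmetric] intro!: sum.cong)
 qed
 define P where "P i E \<longleftrightarrow> E \<in> events \<and> emeasure M E \<le> ennreal (2 * exp (T / 2) * (1/2) ^ i) \<and>
  (\<forall>om\<in>space M - E. (\<forall>k. continuous_on {0..T} (\<lambda>t. w k t om)) \<longrightarrow> (\<forall>t\<in>{0..T}. \<bar>?S (Suc i) t om - ?S i t om\<bar> \<le> (1/2) ^ i))" for i E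
 have "\<exists>E. P i E" for i
 proof -
  \<comment> \<open>The parameter 4^i suits tails of size 16^-i and threshold 2^-i: the quadratic
    term becomes the constant T/2, and the linear term becomes 2^i, with exp(-2^i) \<le>
    2^-i.\<close>
  have "exp ((4 ^ i)\<^sup>2 * (1/16) ^ i * T / 2 - 4 ^ i * (1/2) ^ i) \<le> exp (T / 2) * (1/2) ^ i"
  proof -
   have "((4::real) ^ i)\<^sup>2 * (1/16) ^ i = 1" "(4::real) ^ i * (1/2) ^ i = 2 ^ i"
    by (simp_all add: power_mult_distrib[symmetric] power_mult[symmetric] power2_eq_square)
   then have "exp ((4 ^ i)\<^sup>2 * (1/16) ^ i * T / 2 - 4 ^ i * (1/2) ^ i) = exp (T / 2) * exp (- (2 ^ i))"
    by (simp add: exp_add[symmetric])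
   also have "exp (- (2 ^ i)) \<le> (1/2 :: real) ^ i"
   proof -
    have "(2::real) ^ i \<le> exp (2 ^ i)" using exp_ge_add_one_self[of "2 ^ i"] by (rule order_trans[rotated]) simp
    then have "inverse (exp (2 ^ i)) \<le> inverse ((2::real) ^ i)" by (rule le_imp_inverse_le) simp
    then show ?thesis by (simp only: exp_minus power_one_over inverse_eq_divide)
   qed
   finally show ?thesis by simp
  qed
  then have "ennreal (2 * exp ((4 ^ i)\<^sup>2 * (1/16) ^ i * T / 2 - 4 ^ i * (1/2) ^ i)) \<le> ennreal (2 * exp (T / 2) * (1/2) ^ i)"
   by (intro ennreal_leI) simp
  moreover obtain E where "E \<in> sets M" "emeasure M E \<le> ennreal (2 * exp ((4 ^ i)\<^sup>2 * (1/16) ^ i * T / 2 - 4 ^ i * (1/2) ^ i))"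
   "\<forall>om\<in>space M - E. (\<forall>k. continuous_on {0..T} (\<lambda>t. w k t om)) \<longrightarrow>
    (\<forall>t\<in>{0..T}. \<bar>lin (cut e h (Suc i)) (\<lambda>k. if cut e h i \<le> k then h \<bullet> e k else 0) t om\<bar> \<le> (1/2) ^ i)"
   using maximal_inequality[OF _ cut_tail[OF e, where m="cut e h (Suc i)" and h=h and i=i], of "4 ^ i" "(1/2) ^ i"] by auto
  ultimately show ?thesis unfolding P_def D by (intro exI[of _ E]) (auto intro: order_trans)
 qed
 then obtain E where E: "\<And>i. P i (E i)" by metis
 have "AE om in M. \<forall>\<^sub>F i in sequentially. om \<in> space M - E i"
 proof (rule borel_cantelli_AE1)
  show "E i \<in> events" "emeasure M (E i) < \<infinity>" for i using E[of i] by (auto simp: P_def less_top[symmetric])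
  show "summable (\<lambda>i. prob (E i))"
  proof (rule summable_comparison_test')
   show "summable (\<lambda>i. 2 * exp (T / 2) * (1/2) ^ i)" by (intro summable_mult summable_geometric) simp
   show "norm (prob (E i)) \<le> 2 * exp (T / 2) * (1/2) ^ i" if "0 \<le> i" for i
    using E[of i] by (simp add: P_def emeasure_eq_measure)
  qed
 qed
 then show ?thesis using AE_w_continuous
 proof eventually_elim
  case (elim om)
  have b: "\<forall>t\<in>{0..T}. \<bar>?S (Suc i) t om - ?S i t om\<bar> \<le> (1/2) ^ i" if "om \<in> space M - E i" for i
   using E[of i] elim(2) that unfolding P_def by blast
  have "\<forall>\<^sub>F i in sequentially. \<forall>t\<in>{0..T}. norm (?S (Suc i) t om - ?S i t om) \<le> (1/2) ^ i"
   using elim(1)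
  proof (rule eventually_mono)
   show "\<forall>t\<in>{0..T}. norm (?S (Suc i) t om - ?S i t om) \<le> (1/2) ^ i" if "om \<in> space M - E i" for i
    unfolding real_norm_def by (rule b[OF that])
  qed
  from Weierstrass_m_test_ev[OF this] have U: "uniform_limit {0..T} (\<lambda>n t. \<Sum>i<n. ?S (Suc i) t om - ?S i t om) (\<lambda>t. \<Sum>i. ?S (Suc i) t om - ?S i t om) sequentially"
   by (simp add: summable_geometric)
  have tel: "(\<Sum>i<n. ?S (Suc i) t om - ?S i t om) + ?S 0 t om = ?S n t om" for n t
   by (simp only: sum_lessThan_telescope[of "\<lambda>i. ?S i t om"] diff_add_cancel)
  from uniform_limit_add[OF U uniform_limit_const[where c="\<lambda>t. ?S 0 t om"]]
  have u: "uniform_limit {0..T} (\<lambda>n t. ?S n t om) (\<lambda>t. (\<Sum>i. ?S (Suc i) t om - ?S i t om) + ?S 0 t om) sequentially"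
   by (simp only: tel)
  have l: "(\<lambda>n. ?S n t om) \<longlonglongrightarrow> (\<Sum>i. ?S (Suc i) t om - ?S i t om) + ?S 0 t om" if "t \<in> {0..T}" for t
   using tendsto_uniform_limitI[OF u that] .
  then have c: "cyl e t h om = (\<Sum>i. ?S (Suc i) t om - ?S i t om) + ?S 0 t om" if "t \<in> {0..T}" for t
   unfolding cyl_def using that by (intro limI) auto
  have "continuous_on {0..T} (\<lambda>t. ?S n t om)" for n unfolding lin_def using elim(2) by (intro continuous_intros) auto
  then have "continuous_on {0..T} (\<lambda>t. (\<Sum>i. ?S (Suc i) t om - ?S i t om) + ?S 0 t om)"
   by (intro uniform_limit_theorem[OF _ u]) auto
  then have "continuous_on {0..T} (\<lambda>t. cyl e t h om)" by (subst continuous_on_cong[OF refl c]) auto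
  then show ?case using l c by simp
 qed
qed

lemma cyl_F: "t \<in> {0..T} \<Longrightarrow> cyl e t h \<in> borel_measurable (F t)"
 unfolding cyl_def[abs_def] by (intro borel_measurable_lim_metric lin_F)

lemma lin_diff: "lin d v t om - lin d v s om = (\<Sum>k<d. v k * (inc k s t om))"
 by (simp add: lin_def sum_subtractf[symmetric] right_diff_distrib[symmetric])

lemma cyl_mgf:
 assumes e: "orthonormal_basis e" and h: "norm h = 1" and s: "0 \<le> s" and st: "s \<le> t" and t: "t \<le> T" and A: "A \<in> sets (F s)"
 shows "(\<integral>\<^sup>+om. indicator A om * ennreal (exp (th * (cyl e t h om - cyl e s h om))) \<partial>M) = emeasure M A * ennreal (exp (th\<^sup>2 * (t - s) / 2))"
proof (rule mgf_limit[where u="\<lambda>_. s" and t=t and m="cut e h" and c="\<lambda>i k. th * (h \<bullet> e k)"])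
 have st': "s \<in> {0..T}" "t \<in> {0..T}" using s st t by auto
 show "A \<in> events" by (rule sets_F_M[OF st'(1) A])
 show "(\<lambda>om. th * (cyl e t h om - cyl e s h om)) \<in> borel_measurable M"
  using F_M[OF st'(1) cyl_F[OF st'(1)]] F_M[OF st'(2) cyl_F[OF st'(2)]] by measurable
 show "AE om in M. (\<lambda>i. \<Sum>k<cut e h i. th * (h \<bullet> e k) * (inc k s t om)) \<longlonglongrightarrow> th * (cyl e t h om - cyl e s h om)"
  using AE_cyl[OF e, of h]
  by eventually_elim (use st' in \<open>auto simp: mult.assoc sum_distrib_left[symmetric] lin_diff[symmetric] intro!: tendsto_intros\<close>)
 have "(\<lambda>i. \<Sum>k<cut e h i. (h \<bullet> e k)\<^sup>2) \<longlonglongrightarrow> 1"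
 proof (rule tendsto_sandwich[of "\<lambda>i. 1 - (1/16) ^ i" _ _ "\<lambda>_. 1"])
  show "\<forall>\<^sub>F i in sequentially. 1 - (1/16) ^ i \<le> (\<Sum>k<cut e h i. (h \<bullet> e k)\<^sup>2)"
   using cut[OF e, of h] h by (intro always_eventually allI) (simp add: algebra_simps)
  show "\<forall>\<^sub>F i in sequentially. (\<Sum>k<cut e h i. (h \<bullet> e k)\<^sup>2) \<le> 1"
   using parseval_le[OF e, of h] h by (intro always_eventually allI) simp
  have "(\<lambda>i. 1 - (1/16) ^ i :: real) \<longlonglongrightarrow> 1 - 0" by (intro tendsto_intros) auto
  then show "(\<lambda>i. 1 - (1/16) ^ i :: real) \<longlonglongrightarrow> 1" by simp
 qed simp
 then have "(\<lambda>i. (th\<^sup>2 * (\<Sum>k<cut e h i. (h \<bullet> e k)\<^sup>2)) * (t - s)) \<longlonglongrightarrow> (th\<^sup>2 * 1) * (t - s)" by (intro tendsto_intros)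
 then show "(\<lambda>i. (\<Sum>k<cut e h i. (th * (h \<bullet> e k))\<^sup>2) * (t - s)) \<longlonglongrightarrow> th\<^sup>2 * (t - s)"
  by (simp add: power_mult_distrib sum_distrib_left)
qed (use s st t A in auto)

theorem cylindrical_bm_cyl:
 assumes e: "orthonormal_basis e"
 shows "cylindrical_bm {0..T} M F (cyl e)"
 unfolding cylindrical_bm_def brownian_motion_def
proof (intro conjI allI impI ballI)
 fix h :: 'a assume h: "norm h = 1"
 show "cyl e t h \<in> borel_measurable (F t)" if "t \<in> {0..T}" for t by (rule cyl_F[OF that])
 show "AE om in M. cyl e 0 h om = 0" by (simp add: cyl_def lin_def)
 show "AE om in M. continuous_on {0..T} (\<lambda>t. cyl e t h om)" using AE_cyl[OF e, of h] by eventually_elim simp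
 fix s t assume s: "s \<in> {0..T}" and t: "t \<in> {0..T}" and st: "s < t"
 have m: "(\<lambda>om. cyl e t h om - cyl e s h om) \<in> borel_measurable M"
  using F_M[OF s cyl_F[OF s]] F_M[OF t cyl_F[OF t]] by measurable
 have "t - s > 0" "0 \<le> s" "s \<le> t" "t \<le> T" using s t st by auto
 note * = indep_normal_of_exp_moments[OF prob_space_axioms sub[OF s] m this(1) cyl_mgf[OF e h this(2-4)]]
 show "distributed M lborel (\<lambda>om. cyl e t h om - cyl e s h om) (normal_density 0 (sqrt (t - s)))" by (rule *(1))
 show "indep_set (sets (F s)) (sets (vimage_algebra (space M) (\<lambda>om. cyl e t h om - cyl e s h om) borel))" by (rule *(2))
next
 fix t :: real and h k :: 'a and a b :: real assume t: "t \<in> {0..T}"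
 have [measurable]: "cyl e t h \<in> borel_measurable M" for h using F_M[OF t cyl_F[OF t]] .
 \<comment> \<open>A dimension exceeding all three cuts, so that the three partial sums are written
   over one index range.\<close>
 define m where "m i = cut e h i + cut e k i + cut e (a *\<^sub>R h + b *\<^sub>R k) i" for i
 define ta where "ta h i l = (if cut e h i \<le> l then h \<bullet> e l else 0)" for h i l
 define c where "c i l = ta (a *\<^sub>R h + b *\<^sub>R k) i l - (a * ta h i l + b * ta k i l)" for i l
 have L: "lin (cut e h i) (\<lambda>k. h \<bullet> e k) t om = lin (m i) (\<lambda>l. h \<bullet> e l - ta h i l) t om" if "cut e h i \<le> m i" for h i om
  unfolding lin_def using that by (intro sum.mono_neutral_cong_left) (auto simp: ta_def)
 \<comment> \<open>Without truncation the finite sums would be exactly linear in the direction.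
   Their defect involves tail coefficients only, whose squares sum to order 16^-i, so its almost
   sure limit vanishes.\<close>
 have "AE om in M. (a * cyl e t h om + b * cyl e t k om) - cyl e t (a *\<^sub>R h + b *\<^sub>R k) om = 0"
 proof (rule AE_zero_of_small_coefficients[OF t, where m=m and c=c])
  show "AE om in M. (\<lambda>i. \<Sum>l<m i. c i l * (inc l 0 t om)) \<longlonglongrightarrow> (a * cyl e t h om + b * cyl e t k om) - cyl e t (a *\<^sub>R h + b *\<^sub>R k) om"
   using AE_cyl[OF e, of h] AE_cyl[OF e, of k] AE_cyl[OF e, of "a *\<^sub>R h + b *\<^sub>R k"]
  proof eventually_elim
   case (elim om)
   have "(\<Sum>l<m i. c i l * (inc l 0 t om)) = (a * lin (cut e h i) (\<lambda>l. h \<bullet> e l) t om + b * lin (cut e k i) (\<lambda>l. k \<bullet> e l) t om)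
     - lin (cut e (a *\<^sub>R h + b *\<^sub>R k) i) (\<lambda>l. (a *\<^sub>R h + b *\<^sub>R k) \<bullet> e l) t om" for i
    by (subst (1 2 3) L) (simp_all add: m_def lin_def sum_distrib_left sum.distrib[symmetric] sum_subtractf[symmetric] c_def inner_add_left algebra_simps)
   then show ?case using elim t by (simp only:) (intro tendsto_intros; blast)
  qed
  have bd: "(\<Sum>l<m i. (c i l)\<^sup>2) \<le> 3 * (1 + a\<^sup>2 + b\<^sup>2) * (1/16) ^ i" for i
  proof -
   have "(x - (y + z))\<^sup>2 \<le> 3 * (x\<^sup>2 + (y\<^sup>2 + z\<^sup>2))" for x y z :: real
   proof -
    have "0 \<le> (x + y)\<^sup>2 + (x + z)\<^sup>2 + (y - z)\<^sup>2" by simp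
    then show ?thesis by (simp add: power2_eq_square algebra_simps)
   qed
   then have "(\<Sum>l<m i. (c i l)\<^sup>2) \<le> (\<Sum>l<m i. 3 * ((ta (a *\<^sub>R h + b *\<^sub>R k) i l)\<^sup>2 + ((a * ta h i l)\<^sup>2 + (b * ta k i l)\<^sup>2)))"
    unfolding c_def by (intro sum_mono)
   also have "... = 3 * ((\<Sum>l<m i. (ta (a *\<^sub>R h + b *\<^sub>R k) i l)\<^sup>2) + (a\<^sup>2 * (\<Sum>l<m i. (ta h i l)\<^sup>2) + b\<^sup>2 * (\<Sum>l<m i. (ta k i l)\<^sup>2)))"
    by (simp add: sum_distrib_left sum.distrib power_mult_distrib)
   also have "... \<le> 3 * ((1/16) ^ i + (a\<^sup>2 * (1/16) ^ i + b\<^sup>2 * (1/16) ^ i))"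
    unfolding ta_def by (intro mult_left_mono add_mono cut_tail[OF e]) auto
   finally show ?thesis by (simp add: algebra_simps)
  qed
  have "(\<lambda>i. 3 * (1 + a\<^sup>2 + b\<^sup>2) * (1/16) ^ i) \<longlonglongrightarrow> 3 * (1 + a\<^sup>2 + b\<^sup>2) * 0" by (intro tendsto_intros) auto
  then show "(\<lambda>i. \<Sum>l<m i. (c i l)\<^sup>2) \<longlonglongrightarrow> 0" unfolding mult_zero_right
   by (rule Lim_null_comparison[rotated]) (intro always_eventually allI, simp only: real_norm_def abs_of_nonneg sum_nonneg zero_le_power2 bd)
 qed measurable
 then show "AE om in M. cyl e t (a *\<^sub>R h + b *\<^sub>R k) om = a * cyl e t h om + b * cyl e t k om" by eventually_elim simp
qed

end

section \<open>Existence\<close>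

lemma set_integrable_inner:
 fixes f :: "real \<Rightarrow> 'a::{real_inner, polish_space}"
 assumes f: "set_integrable lborel {a..b} (\<lambda>s. norm (f s))" and [measurable]: "f \<in> borel_measurable borel"
 shows "set_integrable lborel {a..b} (\<lambda>s. f s \<bullet> u)"
 unfolding set_integrable_def
proof (rule Bochner_Integration.integrable_bound[OF set_integrable_mult_left[OF f, of "norm u", unfolded set_integrable_def]])
 show "AE s in lborel. norm (indicat_real {a..b} s *\<^sub>R (f s \<bullet> u)) \<le> norm (indicat_real {a..b} s *\<^sub>R (norm (f s) * norm u))"
  using Cauchy_Schwarz_ineq2[of "f _" u] by (intro AE_I2) (auto split: split_indicator)
qed measurable

text \<open>The coordinate equations are summed against the coefficients of \<open>h\<close>. Here
  \<open>a\<close> stands for A h: the relation between coefficients turns the eigenvalue terms into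
  the projection of \<open>a\<close>, so A never acts on the path. Integrability of the norm of the
  drift gives the dominating function.\<close>

lemma series_of_components:
 fixes x f :: "real \<Rightarrow> 'a::{real_inner, polish_space}"
 assumes e: "orthonormal_basis e" and a: "\<And>k. a \<bullet> e k = l k * (h \<bullet> e k)"
  and x: "continuous_on {0..t} x"
  and fm: "f \<in> borel_measurable borel" and fi: "set_integrable lborel {0..t} (\<lambda>s. norm (f s))"
  and eq: "\<And>k. x t \<bullet> e k = z \<bullet> e k + (LINT s:{0..t}|lborel. l k * (x s \<bullet> e k) + f s \<bullet> e k) + w k"
 shows "(\<lambda>n. \<Sum>k<n. (h \<bullet> e k) * w k) \<longlonglongrightarrow> x t \<bullet> h - z \<bullet> h - (LINT s:{0..t}|lborel. x s \<bullet> a + f s \<bullet> h)"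
proof -
 note [measurable] = fm
 have [measurable]: "(\<lambda>s. indicator {0..t} s *\<^sub>R x s) \<in> borel_measurable borel"
  using borel_measurable_continuous_on_indicator[OF _ x] by simp
 have xi: "set_integrable lborel {0..t} (\<lambda>s. x s \<bullet> u)" for u
  by (intro borel_integrable_atLeastAtMost' continuous_intros x)
 have nx: "set_integrable lborel {0..t} (\<lambda>s. norm (x s))"
  by (intro borel_integrable_atLeastAtMost' continuous_intros x)
 have fu: "set_integrable lborel {0..t} (\<lambda>s. f s \<bullet> u)" for u by (rule set_integrable_inner[OF fi fm])
 let ?p = "basis_proj e"
 have sum_eq: "(\<Sum>k<n. (h \<bullet> e k) * w k) = ?p n h \<bullet> x t - ?p n h \<bullet> z - (LINT s:{0..t}|lborel. x s \<bullet> ?p n a + f s \<bullet> ?p n h)" for n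
 proof -
  have "(LINT s:{0..t}|lborel. x s \<bullet> ?p n a + f s \<bullet> ?p n h) = (LINT s:{0..t}|lborel. (\<Sum>k<n. (h \<bullet> e k) * (l k * (x s \<bullet> e k) + f s \<bullet> e k)))"
   by (intro set_lebesgue_integral_cong) (auto simp: inner_commute[of _ "?p n _"] basis_proj_inner a sum.distrib[symmetric] algebra_simps)
  also have "... = (\<Sum>k<n. (h \<bullet> e k) * (LINT s:{0..t}|lborel. l k * (x s \<bullet> e k) + f s \<bullet> e k))"
  proof -
   have "set_integrable lborel {0..t} (\<lambda>s. l k * (x s \<bullet> e k) + f s \<bullet> e k)" for k
    by (intro set_integral_add(1) set_integrable_mult_right xi fu)
   then have "integrable lborel (\<lambda>s. (h \<bullet> e k) * (indicator {0..t} s *\<^sub>R (l k * (x s \<bullet> e k) + f s \<bullet> e k)))" for k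
    unfolding set_integrable_def by (rule integrable_mult_right)
   then have "(\<integral>s. (\<Sum>k<n. (h \<bullet> e k) * (indicator {0..t} s *\<^sub>R (l k * (x s \<bullet> e k) + f s \<bullet> e k))) \<partial>lborel) =
     (\<Sum>k<n. \<integral>s. (h \<bullet> e k) * (indicator {0..t} s *\<^sub>R (l k * (x s \<bullet> e k) + f s \<bullet> e k)) \<partial>lborel)"
    by (intro Bochner_Integration.integral_sum)
   then show ?thesis by (simp add: set_lebesgue_integral_def sum_distrib_left mult.left_commute)
  qed
  also have "... = (\<Sum>k<n. (h \<bullet> e k) * (x t \<bullet> e k)) - (\<Sum>k<n. (h \<bullet> e k) * (z \<bullet> e k)) - (\<Sum>k<n. (h \<bullet> e k) * w k)"
   unfolding sum_subtractf[symmetric] by (intro sum.cong refl) (simp add: eq right_diff_distrib[symmetric])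
  finally show ?thesis by (simp add: basis_proj_inner)
 qed
 have "(\<lambda>n. LINT s:{0..t}|lborel. x s \<bullet> ?p n a + f s \<bullet> ?p n h) \<longlonglongrightarrow> (LINT s:{0..t}|lborel. x s \<bullet> a + f s \<bullet> h)"
  unfolding set_lebesgue_integral_def
 proof (rule integral_dominated_convergence[where w="\<lambda>s. indicator {0..t} s *\<^sub>R (norm (x s) * norm a + norm (f s) * norm h)"])
  show "integrable lborel (\<lambda>s. indicator {0..t} s *\<^sub>R (norm (x s) * norm a + norm (f s) * norm h))"
   using set_integral_add(1)[OF set_integrable_mult_left[OF nx, of "norm a"] set_integrable_mult_left[OF fi, of "norm h"]]
   by (simp add: set_integrable_def)
  have m: "(\<lambda>s. indicator {0..t} s *\<^sub>R (x s \<bullet> u + f s \<bullet> v)) \<in> borel_measurable lborel" for u v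
  proof -
   have "(\<lambda>s. (indicator {0..t} s *\<^sub>R x s) \<bullet> u + indicator {0..t} s *\<^sub>R (f s \<bullet> v)) \<in> borel_measurable lborel" by measurable
   then show ?thesis by (simp add: distrib_left)
  qed
  show "(\<lambda>s. indicator {0..t} s *\<^sub>R (x s \<bullet> a + f s \<bullet> h)) \<in> borel_measurable lborel"
   "(\<lambda>s. indicator {0..t} s *\<^sub>R (x s \<bullet> ?p n a + f s \<bullet> ?p n h)) \<in> borel_measurable lborel" for n by (rule m)+
  show "AE s in lborel. (\<lambda>n. indicator {0..t} s *\<^sub>R (x s \<bullet> ?p n a + f s \<bullet> ?p n h)) \<longlonglongrightarrow> indicator {0..t} s *\<^sub>R (x s \<bullet> a + f s \<bullet> h)"
   by (intro AE_I2 tendsto_intros basis_proj_tendsto[OF e])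
  have "\<bar>y \<bullet> ?p n v\<bar> \<le> norm y * norm v" for y v n
   by (rule order_trans[OF Cauchy_Schwarz_ineq2]) (intro mult_left_mono norm_basis_proj_le[OF e] norm_ge_zero)
  then have "\<bar>x s \<bullet> ?p n a + f s \<bullet> ?p n h\<bar> \<le> norm (x s) * norm a + norm (f s) * norm h" for n s
   by (intro order_trans[OF abs_triangle_ineq] add_mono)
  then show "AE s in lborel. norm (indicator {0..t} s *\<^sub>R (x s \<bullet> ?p n a + f s \<bullet> ?p n h)) \<le> indicator {0..t} s *\<^sub>R (norm (x s) * norm a + norm (f s) * norm h)" for n
   by (intro AE_I2) (auto split: split_indicator)
 qed
 then show ?thesis unfolding sum_eq inner_commute[of _ h] inner_commute[of "x t" h] inner_commute[of z h]
  by (intro tendsto_intros basis_proj_tendsto[OF e])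
qed

section \<open>Measurability of path functionals\<close>

context adapted_process
begin

lemma nn_integral_path_measurable:
 assumes [measurable]: "f \<in> borel_measurable borel"
 shows "(\<lambda>om. \<integral>\<^sup>+s\<in>{0..T}. f (Y s om) \<partial>lborel) \<in> borel_measurable M"
proof -
 have "(\<lambda>q. (\<lambda>p. Y (clip T (fst p)) (snd p)) (snd q, fst q)) \<in> borel_measurable (M \<Otimes>\<^sub>M lborel)" by measurable
 then have [measurable]: "(\<lambda>q. Y (clip T (snd q)) (fst q)) \<in> borel_measurable (M \<Otimes>\<^sub>M lborel)" by simp
 have "(\<lambda>om. \<integral>\<^sup>+s. f (Y (clip T s) om) * indicator {0..T} s \<partial>lborel) \<in> borel_measurable M"
  by (rule lborel.borel_measurable_nn_integral) (unfold case_prod_beta, measurable)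
 also have "(\<lambda>om. \<integral>\<^sup>+s. f (Y (clip T s) om) * indicator {0..T} s \<partial>lborel) = (\<lambda>om. \<integral>\<^sup>+s\<in>{0..T}. f (Y s om) \<partial>lborel)"
  by (intro ext nn_integral_cong) (auto simp: clip_id split: split_indicator)
 finally show ?thesis .
qed

lemma path_borel: "om \<in> space M \<Longrightarrow> (\<lambda>s. Y (clip T s) om) \<in> borel_measurable borel"
 using continuous_on_clip[OF _ Yc] T by (intro borel_measurable_continuous_onI) auto

lemma AE_paths_iff:
 assumes [measurable]: "C \<in> sets borel"
 shows "(AE p in lborel \<Otimes>\<^sub>M M. fst p \<in> {0..T} \<longrightarrow> Y (fst p) (snd p) \<in> C) \<longleftrightarrow>
   (AE om in M. AE s in lborel. s \<in> {0..T} \<longrightarrow> Y s om \<in> C)" (is "?L \<longleftrightarrow> ?R")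
proof -
 interpret pair_sigma_finite lborel M by unfold_locales
 define g :: "real \<times> 'w \<Rightarrow> ennreal" where "g p = indicator {0..T} (fst p) * indicator (- C) (Y (clip T (fst p)) (snd p))" for p
 have [measurable]: "g \<in> borel_measurable (lborel \<Otimes>\<^sub>M M)" unfolding g_def[abs_def] by measurable
 have g0: "g p = 0 \<longleftrightarrow> (fst p \<in> {0..T} \<longrightarrow> Y (fst p) (snd p) \<in> C)" for p
  by (auto simp: g_def clip_id split: split_indicator)
 have "?L \<longleftrightarrow> (\<integral>\<^sup>+p. g p \<partial>(lborel \<Otimes>\<^sub>M M)) = 0"
  by (subst nn_integral_0_iff_AE) (simp_all add: g0)
 also have "... \<longleftrightarrow> (\<integral>\<^sup>+om. (\<integral>\<^sup>+s. g (s, om) \<partial>lborel) \<partial>M) = 0" by (subst nn_integral_snd) simp_all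
 also have "... \<longleftrightarrow> (AE om in M. (\<integral>\<^sup>+s. g (s, om) \<partial>lborel) = 0)" by (subst nn_integral_0_iff_AE) simp_all
 also have "... \<longleftrightarrow> ?R"
 proof (intro AE_cong)
  fix om assume "om \<in> space M"
  then have "(\<lambda>s. g (s, om)) \<in> borel_measurable lborel" by measurable
  then show "(\<integral>\<^sup>+s. g (s, om) \<partial>lborel) = 0 \<longleftrightarrow> (AE s in lborel. s \<in> {0..T} \<longrightarrow> Y s om \<in> C)"
   by (subst nn_integral_0_iff_AE) (simp_all add: g0)
 qed
 finally show ?thesis .
qed

lemma AE_paths_of_nn_integral:
 assumes [measurable]: "C \<in> sets borel" and 0: "(\<integral>\<^sup>+om. (\<integral>\<^sup>+s\<in>{0..T}. indicator (- C) (Y s om) \<partial>lborel) \<partial>M) = 0"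
 shows "AE om in M. AE s in lborel. s \<in> {0..T} \<longrightarrow> Y s om \<in> C"
proof -
 have "AE om in M. (\<integral>\<^sup>+s\<in>{0..T}. indicator (- C) (Y s om) \<partial>lborel) = 0"
  using 0 by (subst (asm) nn_integral_0_iff_AE) (auto intro!: nn_integral_path_measurable)
 then show ?thesis using AE_space
 proof eventually_elim
  case (elim om)
  note [measurable] = path_borel[OF elim(2)]
  have "(\<integral>\<^sup>+s. indicator (- C) (Y (clip T s) om) * indicator {0..T} s \<partial>lborel) = 0"
   unfolding elim(1)[symmetric] by (intro nn_integral_cong) (auto simp: clip_id split: split_indicator)
  then have "AE s in lborel. indicator (- C) (Y (clip T s) om) * indicator {0..T} s = (0::ennreal)"
   by (subst (asm) nn_integral_0_iff_AE) simp_all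
  then show ?case by eventually_elim (auto simp: clip_id split: split_indicator_asm)
 qed
qed

end

lemma hitting_time_mono_time: "hitting_time {0..} C x \<le> hitting_time {0..T} C x"
 unfolding hitting_time_def by (intro Inf_superset_mono) auto

section \<open>The equation with convex potential and bounded drift\<close>

locale convex_sde =
 fixes D :: "'a::{real_inner, polish_space} set" and A B :: "'a \<Rightarrow> 'a" and V :: "'a \<Rightarrow> ereal" and e :: "nat \<Rightarrow> 'a"
  and l :: "nat \<Rightarrow> real" and T R :: real
 assumes T: "0 < T" and e: "orthonormal_basis e" and eD: "\<And>k. e k \<in> D"
  and l: "\<And>k. l k \<le> 0" "\<And>k. A (e k) = l k *\<^sub>R e k" "\<And>h k. h \<in> D \<Longrightarrow> A h \<bullet> e k = l k * (h \<bullet> e k)"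
  and V: "convex_potential V" and dom[measurable]: "diff_dom V \<in> sets borel" and ne: "diff_dom V \<noteq> {}"
  and B[measurable]: "B \<in> borel_measurable borel" and BR: "\<And>x. norm (B x) \<le> R"
begin

lemma grad_measurable[measurable]: "gradV V \<in> borel_measurable borel" by (rule gradV_measurable[OF V dom e])

lemma Ae: "A (e k) \<bullet> x = l k * (x \<bullet> e k)" "x \<bullet> A (e k) = l k * (x \<bullet> e k)"
 by (simp_all add: l(2) inner_commute)

lemma drift_integrable:
 assumes x: "continuous_on {0..T} x" and dx: "AE s in lborel. s \<in> {0..T} \<longrightarrow> x s \<in> diff_dom V"
  and fin: "\<And>k. (\<integral>\<^sup>+s\<in>{0..T}. ennreal \<bar>gradV V (x s) \<bullet> e k\<bar> \<partial>lborel) < \<infinity>" and t: "t \<in> {0..T}"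
 defines "y \<equiv> \<lambda>s. x (clip T s)"
 shows "set_integrable lborel {0..t} (\<lambda>s. norm (gradV V (y s)))" "set_integrable lborel {0..t} (\<lambda>s. norm (B (y s) - gradV V (y s)))"
proof -
 have y: "continuous_on UNIV y" unfolding y_def using T x by (intro continuous_on_clip) auto
 have [measurable]: "y \<in> borel_measurable borel" by (rule borel_measurable_continuous_onI[OF y])
 have yx: "y s = x s" if "s \<in> {0..T}" for s using that by (simp add: y_def clip_id)
 have "set_integrable lborel {0..T} (\<lambda>s. norm (gradV V (y s)))"
 proof (rule path_gradV_integrable[OF V dom ne e y])
  show "AE s in lborel. s \<in> {0..T} \<longrightarrow> y s \<in> diff_dom V" using dx by eventually_elim (simp add: yx)
  have "(\<integral>\<^sup>+s\<in>{0..T}. ennreal \<bar>gradV V (y s) \<bullet> e k\<bar> \<partial>lborel) = (\<integral>\<^sup>+s\<in>{0..T}. ennreal \<bar>gradV V (x s) \<bullet> e k\<bar> \<partial>lborel)" for k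
   by (intro nn_integral_cong) (auto simp: yx split: split_indicator)
  then show "(\<integral>\<^sup>+s\<in>{0..T}. ennreal \<bar>gradV V (y s) \<bullet> e k\<bar> \<partial>lborel) < \<infinity>" for k using fin by simp
 qed
 then show g: "set_integrable lborel {0..t} (\<lambda>s. norm (gradV V (y s)))"
  by (rule set_integrable_subset) (use t in auto)
 have c: "set_integrable lborel {0..t} (\<lambda>s. R)" by (intro borel_integrable_atLeastAtMost' continuous_intros)
 show "set_integrable lborel {0..t} (\<lambda>s. norm (B (y s) - gradV V (y s)))"
  unfolding set_integrable_def
 proof (rule Bochner_Integration.integrable_bound[OF set_integral_add(1)[OF c g, unfolded set_integrable_def]])
  show "(\<lambda>s. indicat_real {0..t} s *\<^sub>R norm (B (y s) - gradV V (y s))) \<in> borel_measurable lborel" by measurable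
  have "norm (B (y s) - gradV V (y s)) \<le> R + norm (gradV V (y s))" for s
   using norm_triangle_ineq4[of "B (y s)" "gradV V (y s)"] BR[of "y s"] by linarith
  then show "AE s in lborel. norm (indicat_real {0..t} s *\<^sub>R norm (B (y s) - gradV V (y s))) \<le> norm (indicat_real {0..t} s *\<^sub>R (R + norm (gradV V (y s))))"
   by (intro AE_I2) (auto split: split_indicator intro: order_trans[OF _ abs_ge_self])
 qed
qed

text \<open>Separates the part of the drift that the change of measure exchanges with the noise.
  Splitting the integral requires both parts to be integrable, which for the gradient is
  \<open>drift_integrable\<close>.\<close>

lemma drift_split:
 assumes x: "continuous_on {0..T} x" and dx: "AE s in lborel. s \<in> {0..T} \<longrightarrow> x s \<in> diff_dom V"
  and fin: "\<And>k. (\<integral>\<^sup>+s\<in>{0..T}. ennreal \<bar>gradV V (x s) \<bullet> e k\<bar> \<partial>lborel) < \<infinity>" and t: "t \<in> {0..T}"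
 defines "y \<equiv> \<lambda>s. x (clip T s)"
 shows "(LINT s:{0..t}|lborel. x s \<bullet> A (e k) + (B (x s) - gradV V (x s)) \<bullet> e k) =
  (LINT s:{0..t}|lborel. l k * (y s \<bullet> e k) - gradV V (y s) \<bullet> e k) + (LINT s:{0..t}|lborel. B (y s) \<bullet> e k)"
proof -
 have yc: "continuous_on S y" for S unfolding y_def using continuous_on_clip[OF _ x] T by (auto intro: continuous_on_subset)
 have [measurable]: "y \<in> borel_measurable borel" by (rule borel_measurable_continuous_onI[OF yc])
 have n1: "norm (e k) = 1" using e by (simp add: orthonormal_basis_def norm_eq_sqrt_inner)
 have gi: "set_integrable lborel {0..t} (\<lambda>s. norm (gradV V (y s)))"
  unfolding y_def by (rule drift_integrable(1)[OF x dx fin t])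
 then have "set_integrable lborel {0..t} (\<lambda>s. gradV V (y s) \<bullet> e k)" by (rule set_integrable_inner) measurable
 moreover have "set_integrable lborel {0..t} (\<lambda>s. l k * (y s \<bullet> e k))"
  by (intro borel_integrable_atLeastAtMost' continuous_on_mult continuous_on_inner yc continuous_on_const)
 ultimately have i1: "set_integrable lborel {0..t} (\<lambda>s. l k * (y s \<bullet> e k) - gradV V (y s) \<bullet> e k)" by (intro set_integral_diff(1))
 have i2: "set_integrable lborel {0..t} (\<lambda>s. B (y s) \<bullet> e k)"
  unfolding set_integrable_def
 proof (rule Bochner_Integration.integrable_bound)
  show "integrable lborel (\<lambda>s. indicat_real {0..t} s *\<^sub>R R)"
   using borel_integrable_atLeastAtMost'[of 0 t "\<lambda>_. R"] by (simp add: set_integrable_def)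
  have "\<bar>B (y s) \<bullet> e k\<bar> \<le> R" for s using Cauchy_Schwarz_ineq2[of "B (y s)" "e k"] BR[of "y s"] n1 by simp
  then show "AE s in lborel. norm (indicat_real {0..t} s *\<^sub>R (B (y s) \<bullet> e k)) \<le> norm (indicat_real {0..t} s *\<^sub>R R)"
   by (intro AE_I2) (auto split: split_indicator intro: order_trans[OF _ abs_ge_self])
 qed measurable
 have "(LINT s:{0..t}|lborel. x s \<bullet> A (e k) + (B (x s) - gradV V (x s)) \<bullet> e k) = (LINT s:{0..t}|lborel. (l k * (y s \<bullet> e k) - gradV V (y s) \<bullet> e k) + B (y s) \<bullet> e k)"
  using t by (intro set_lebesgue_integral_cong) (auto simp: y_def clip_id Ae inner_diff_left)
 then show ?thesis using set_integral_add(2)[OF i1 i2] by simp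
qed

text \<open>The path process is kept and only measure and noise change. Under the new measure
  \<open>w'\<close>, the old noise minus the integral of B, is Brownian; read with
  \<open>w'\<close>, the equation for \<open>X\<close> therefore contains the drift B. Positivity of
  the density preserves all almost sure properties of \<open>X\<close>.\<close>

theorem weak_existence:
 fixes M :: "'w measure" and X :: "real \<Rightarrow> 'w \<Rightarrow> 'a"
 assumes bm0: "bm_system T M F w" and X: "\<And>t. t \<in> {0..T} \<Longrightarrow> X t \<in> borel_measurable (F t)"
  and Xc: "\<And>om. om \<in> space M \<Longrightarrow> continuous_on {0..T} (\<lambda>t. X t om)" and X0: "AE om in M. X 0 om = z"
  and Xd: "AE om in M. AE s in lborel. s \<in> {0..T} \<longrightarrow> X s om \<in> diff_dom V"
  and fin: "\<And>h. h \<in> D \<Longrightarrow> AE om in M. (\<integral>\<^sup>+s\<in>{0..T}. ennreal \<bar>gradV V (X s om) \<bullet> h\<bar> \<partial>lborel) < \<infinity>"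
  and eq: "AE om in M. \<forall>t\<in>{0..T}. \<forall>k. X t om \<bullet> e k = z \<bullet> e k + (LINT s:{0..t}|lborel. l k * (X s om \<bullet> e k) - gradV V (X s om) \<bullet> e k) + w k t om"
 shows "\<exists>\<rho> F' W. \<rho> \<in> borel_measurable M \<and> (\<forall>om. 0 < \<rho> om) \<and> solution T D A V B z (density M (\<lambda>om. ennreal (\<rho> om))) F' W X"
proof -
 interpret X: adapted_process T M F w X using T bm0 X Xc by unfold_locales
 obtain Nf dm \<beta> where \<beta>: "girsanov T M F w Nf dm (\<lambda>n k s om. \<beta> n k (X.Yg (Nf n) s om)) (\<lambda>k s om. B (X (clip T s) om) \<bullet> e k) ((R + 2)\<^sup>2) R"
  using girsanov_pair[OF X.adapted_process_axioms X.adapted_process_axioms B BR e] by blast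
 interpret g: girsanov T M F w Nf dm "\<lambda>n k s om. \<beta> n k (X.Yg (Nf n) s om)" "\<lambda>k s om. B (X (clip T s) om) \<bullet> e k" "(R + 2)\<^sup>2" R by fact
 obtain \<rho> where \<rho>: "\<rho> \<in> borel_measurable M" "\<And>om. 0 < \<rho> om" "AE om in M. (\<lambda>n. exp (g.L n om)) \<longlonglongrightarrow> \<rho> om"
  using g.density_exists by blast
 define Q where "Q = density M (\<lambda>om. ennreal (\<rho> om))"
 define w' where "w' k t om = w k t om - (LINT s:{0..t}|lborel. B (X (clip T s) om) \<bullet> e k)" for k t om
 have bmQ: "bm_system T Q F w'" unfolding Q_def w'_def[abs_def] by (rule g.girsanov[OF \<rho>])
 have AEQ: "(AE om in Q. P om) \<longleftrightarrow> (AE om in M. P om)" for P unfolding Q_def by (rule g.AE_density_iff[OF \<rho>])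
 have spQ: "space Q = space M" by (simp add: Q_def)
 interpret q: bm T Q F w' using T bmQ by unfold_locales
 \<comment> \<open>The cylindrical motion is formed relative to the augmented filtration, since a
   solution requires a normal one.\<close>
 interpret a: bm T Q q.aug w' using T q.bm_system_aug by unfold_locales
 interpret Y: adapted_process T Q F w' X using X Xc spQ by unfold_locales auto
 \<comment> \<open>One null set serves all \<open>h\<close> and \<open>t\<close>: off it the
   coordinate equations hold simultaneously, and \<open>series_of_components\<close> works along the
   single path.\<close>
 have main: "AE om in Q. \<forall>h\<in>D. \<forall>t\<in>{0..T}. X t om \<bullet> h = z \<bullet> h + (LINT s:{0..t}|lborel. X s om \<bullet> A h + (B (X s om) - gradV V (X s om)) \<bullet> h) + a.cyl e t h om"
 proof -
  have "AE om in M. \<forall>k. (\<integral>\<^sup>+s\<in>{0..T}. ennreal \<bar>gradV V (X s om) \<bullet> e k\<bar> \<partial>lborel) < \<infinity>"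
   unfolding AE_all_countable using fin[OF eD] by blast
  then have "AE om in Q. om \<in> space Q \<and> (\<forall>k. w' k 0 om = 0) \<and> (AE s in lborel. s \<in> {0..T} \<longrightarrow> X s om \<in> diff_dom V) \<and>
    (\<forall>k. (\<integral>\<^sup>+s\<in>{0..T}. ennreal \<bar>gradV V (X s om) \<bullet> e k\<bar> \<partial>lborel) < \<infinity>) \<and>
    (\<forall>t\<in>{0..T}. \<forall>k. X t om \<bullet> e k = z \<bullet> e k + (LINT s:{0..t}|lborel. l k * (X s om \<bullet> e k) - gradV V (X s om) \<bullet> e k) + w k t om)"
   using Xd eq by (intro AE_conjI AE_space q.AE_w0) (simp_all only: AEQ)
  then show ?thesis
  proof (eventually_elim, intro ballI)
   fix om h t assume *: "om \<in> space Q \<and> (\<forall>k. w' k 0 om = 0) \<and> (AE s in lborel. s \<in> {0..T} \<longrightarrow> X s om \<in> diff_dom V) \<and>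
    (\<forall>k. (\<integral>\<^sup>+s\<in>{0..T}. ennreal \<bar>gradV V (X s om) \<bullet> e k\<bar> \<partial>lborel) < \<infinity>) \<and>
    (\<forall>t\<in>{0..T}. \<forall>k. X t om \<bullet> e k = z \<bullet> e k + (LINT s:{0..t}|lborel. l k * (X s om \<bullet> e k) - gradV V (X s om) \<bullet> e k) + w k t om)"
    and h: "h \<in> D" and t: "t \<in> {0..T}"
   let ?y = "\<lambda>s. X (clip T s) om" and ?f = "\<lambda>s. B (X (clip T s) om) - gradV V (X (clip T s) om)"
   have om: "om \<in> space Q" using * by blast
   note [measurable] = Y.path_borel[OF om]
   have c: "continuous_on {0..T} (\<lambda>t. X t om)" using Xc om spQ by simp
   have yc: "continuous_on S ?y" for S using continuous_on_clip[OF _ c] T by (auto intro: continuous_on_subset)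
   have gi: "set_integrable lborel {0..t} (\<lambda>s. norm (?f s))"
    using drift_integrable(2)[OF c _ _ t] * by blast
   have cl: "?y s = X s om" if "s \<in> {0..t}" for s using t that by (simp add: clip_id)
   have "(\<lambda>n. \<Sum>k<n. (h \<bullet> e k) * w' k t om) \<longlonglongrightarrow> ?y t \<bullet> h - z \<bullet> h - (LINT s:{0..t}|lborel. ?y s \<bullet> A h + ?f s \<bullet> h)"
   proof (rule series_of_components[OF e l(3)[OF h] yc _ gi])
    show "?f \<in> borel_measurable borel" by measurable
    fix k
    have "(LINT s:{0..t}|lborel. l k * (?y s \<bullet> e k) + ?f s \<bullet> e k) = (LINT s:{0..t}|lborel. X s om \<bullet> A (e k) + (B (X s om) - gradV V (X s om)) \<bullet> e k)"
     by (intro set_lebesgue_integral_cong) (use cl in \<open>auto simp: Ae\<close>)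
    also have "... = (LINT s:{0..t}|lborel. l k * (?y s \<bullet> e k) - gradV V (?y s) \<bullet> e k) + (LINT s:{0..t}|lborel. B (?y s) \<bullet> e k)"
     using drift_split[OF c _ _ t] * by blast
    also have "(LINT s:{0..t}|lborel. l k * (?y s \<bullet> e k) - gradV V (?y s) \<bullet> e k) = (LINT s:{0..t}|lborel. l k * (X s om \<bullet> e k) - gradV V (X s om) \<bullet> e k)"
     by (intro set_lebesgue_integral_cong) (use cl in auto)
    finally show "?y t \<bullet> e k = z \<bullet> e k + (LINT s:{0..t}|lborel. l k * (?y s \<bullet> e k) + ?f s \<bullet> e k) + w' k t om"
     using * t clip_id[OF t] unfolding w'_def by simp
   qed
   moreover have "(LINT s:{0..t}|lborel. ?y s \<bullet> A h + ?f s \<bullet> h) = (LINT s:{0..t}|lborel. X s om \<bullet> A h + (B (X s om) - gradV V (X s om)) \<bullet> h)"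
    by (intro set_lebesgue_integral_cong) (use cl in auto)
   ultimately have "a.cyl e t h om = X t om \<bullet> h - z \<bullet> h - (LINT s:{0..t}|lborel. X s om \<bullet> A h + (B (X s om) - gradV V (X s om)) \<bullet> h)"
    using * t by (intro a.cyl_eqI[OF e]) (simp add: a.lin_def clip_id)
   then show "X t om \<bullet> h = z \<bullet> h + (LINT s:{0..t}|lborel. X s om \<bullet> A h + (B (X s om) - gradV V (X s om)) \<bullet> h) + a.cyl e t h om" by simp
  qed
 qed
 have "solution T D A V B z Q q.aug (a.cyl e) X"
  unfolding solution_def
 proof (intro conjI ballI)
  show "prob_space Q" by (rule q.prob_space_axioms)
  show "normal_filtration {0..T} Q q.aug" by (rule q.normal_filtration_aug)
  show "cylindrical_bm {0..T} Q q.aug (a.cyl e)" by (rule a.cylindrical_bm_cyl[OF e])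
  show "X t \<in> borel_measurable (q.aug t)" if "t \<in> {0..T}" for t by (rule q.measurable_aug[OF that X[OF that]])
  show "continuous_on {0..T} (\<lambda>t. X t om)" if "om \<in> space Q" for om using Xc that spQ by simp
  show "AE om in Q. X 0 om = z" unfolding AEQ by (rule X0)
  show "AE p in lborel \<Otimes>\<^sub>M Q. fst p \<in> {0..T} \<longrightarrow> X (fst p) (snd p) \<in> diff_dom V"
   unfolding Y.AE_paths_iff[OF dom] AEQ by (rule Xd)
  show "AE om in Q. (\<integral>\<^sup>+s\<in>{0..T}. ennreal \<bar>gradV V (X s om) \<bullet> h\<bar> \<partial>lborel) < \<infinity>" if "h \<in> D" for h
   unfolding AEQ by (rule fin[OF that])
  show "AE om in Q. X t om \<bullet> h = z \<bullet> h + (LINT s:{0..t}|lborel. X s om \<bullet> A h + (B (X s om) - gradV V (X s om)) \<bullet> h) + a.cyl e t h om"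
   if "h \<in> D" "t \<in> {0..T}" for h t using main by eventually_elim (use that in blast)
 qed
 then show ?thesis using \<rho> unfolding Q_def by blast
qed

end

section \<open>Uniqueness\<close>

context bm
begin

text \<open>A combination of values at grid times is the stochastic integral of a deterministic step
  process, namely the sum of those \<open>a i\<close> whose time lies ahead. The exponential moment
  is half its energy in the exponent, a number in which the motion itself no longer occurs.\<close>

lemma exp_grid_combination:
 fixes a :: "'i \<Rightarrow> real" and ka ta :: "'i \<Rightarrow> nat"
 assumes K: "finite K" and d: "\<And>i. i \<in> K \<Longrightarrow> ka i < d" and ta: "\<And>i. i \<in> K \<Longrightarrow> ta i \<le> 2 ^ N"
 shows "(\<integral>\<^sup>+om. ennreal (exp (\<Sum>i\<in>K. a i * w (ka i) (gp T N (ta i)) om)) \<partial>M)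
  = ennreal (exp ((\<Sum>j<2^N. (\<Sum>k<d. (\<Sum>i\<in>K. if ka i = k \<and> j < ta i then a i else 0)\<^sup>2) * (T / 2 ^ N)) / 2))" (is "_ = ennreal (exp (?q / 2))")
proof -
 define c :: "nat \<Rightarrow> real \<Rightarrow> 'w \<Rightarrow> real" where "c k s om = (\<Sum>i\<in>K. if ka i = k \<and> s < gp T N (ta i) then a i else 0)" for k s om
 have gl: "gp T N i < gp T N j \<longleftrightarrow> i < j" for i j using gp_less[of i j N] gp_mono[of j i N] by (meson not_le)
 have el: "elem N c"
  unfolding elem_def
 proof (intro allI impI conjI)
  fix j k :: nat assume "j < 2 ^ N"
  show "c k (gp T N j) \<in> borel_measurable (F (gp T N j))" unfolding c_def[abs_def] by simp
  show "finite (c k (gp T N j) ` space M)" unfolding c_def by (rule finite_subset[of _ "{c k (gp T N j) undefined}"]) (auto simp: c_def)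
  fix s assume s: "gp T N j \<le> s \<and> s < gp T N (Suc j)"
  have "s < gp T N m \<longleftrightarrow> gp T N j < gp T N m" for m
   using s gp_mono[of "Suc j" m N] gl[of j m] by (metis Suc_leI le_less_trans less_le_trans)
  then show "c k s = c k (gp T N j)" by (simp add: c_def fun_eq_iff)
 qed
 have SQ: "SQ N d c c (2 ^ N) om = ?q" for om
  unfolding SQ_def by (simp add: c_def gl power2_eq_square)
 have SI: "SI N d c (2 ^ N) om = (\<Sum>i\<in>K. a i * (inc (ka i) 0 (gp T N (ta i)) om))" for om
 proof -
  let ?De = "\<lambda>k j. inc k (gp T N j) (gp T N (Suc j)) om"
  have "SI N d c (2 ^ N) om = (\<Sum>j<2^N. \<Sum>k<d. \<Sum>i\<in>K. if ka i = k then (if j < ta i then a i * ?De k j else 0) else 0)"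
   unfolding SI_def c_def sum_distrib_right by (intro sum.cong refl) (auto simp: gl)
  also have "... = (\<Sum>j<2^N. \<Sum>i\<in>K. \<Sum>k<d. if ka i = k then (if j < ta i then a i * ?De k j else 0) else 0)"
   by (intro sum.cong refl sum.swap)
  also have "... = (\<Sum>i\<in>K. \<Sum>j<2^N. \<Sum>k<d. if ka i = k then (if j < ta i then a i * ?De k j else 0) else 0)"
   by (rule sum.swap)
  also have "... = (\<Sum>i\<in>K. \<Sum>j<2^N. if j < ta i then a i * ?De (ka i) j else 0)"
   using d by (intro sum.cong refl) simp
  also have "... = (\<Sum>i\<in>K. a i * (inc (ka i) 0 (gp T N (ta i)) om))"
  proof (intro sum.cong refl)
   fix i assume "i \<in> K"
   then have "(\<Sum>j<2^N. if j < ta i then a i * ?De (ka i) j else 0) = (\<Sum>j<ta i. a i * ?De (ka i) j)"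
    using ta[of i] by (intro sum.mono_neutral_cong_right) auto
   then show "(\<Sum>j<2^N. if j < ta i then a i * ?De (ka i) j else 0) = a i * (inc (ka i) 0 (gp T N (ta i)) om)"
    by (simp only: sum_distrib_left[symmetric] sum_lessThan_telescope[of "\<lambda>j. w (ka i) (gp T N j) om"] gp_0)
  qed
  finally show ?thesis .
 qed
 have m[measurable]: "w (ka i) (gp T N (ta i)) \<in> borel_measurable M" if "i \<in> K" for i using wM[OF gp_in[OF ta[OF that]]] .
 have "(\<integral>\<^sup>+om. ennreal (exp (\<Sum>i\<in>K. a i * w (ka i) (gp T N (ta i)) om)) \<partial>M) = (\<integral>\<^sup>+om. ennreal (exp (?q / 2)) * ennreal (exp (LR N d c (2 ^ N) om)) \<partial>M)"
 proof (rule nn_integral_cong_AE)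
  show "AE om in M. ennreal (exp (\<Sum>i\<in>K. a i * w (ka i) (gp T N (ta i)) om)) = ennreal (exp (?q / 2)) * ennreal (exp (LR N d c (2 ^ N) om))"
   using AE_w0 by eventually_elim (simp add: LR_def SI SQ ennreal_mult[symmetric] exp_add[symmetric] del: ennreal_mult' ennreal_mult'')
 qed
 also have "... = ennreal (exp (?q / 2)) * (\<integral>\<^sup>+om. ennreal (exp (LR N d c (2 ^ N) om)) \<partial>M)"
  using LR_measurable_M[OF el] by (intro nn_integral_cmult) auto
 also have "... = ennreal (exp (?q / 2))" using exp_LR_1[OF el] by simp
 finally show ?thesis .
qed

end

text \<open>All exponential moments of finite combinations are given by the same deterministic
  formula, whatever probability space carries the motion.\<close>

lemma bm_system_grid_law:
 fixes ka lev ta :: "'i \<Rightarrow> nat"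
 assumes b1: "bm T M1 F1 w1" and b2: "bm T M2 F2 w2" and ta: "\<And>i. ta i \<le> 2 ^ lev i"
 shows "distr M1 (\<Pi>\<^sub>M i\<in>UNIV. borel) (\<lambda>om i. w1 (ka i) (gp T (lev i) (ta i)) om) = distr M2 (\<Pi>\<^sub>M i\<in>UNIV. borel) (\<lambda>om i. w2 (ka i) (gp T (lev i) (ta i)) om)"
proof (rule joint_law_eqI_exp_moments)
 interpret b1: bm T M1 F1 w1 by fact
 interpret b2: bm T M2 F2 w2 by fact
 show "prob_space M1" by unfold_locales
 show m: "w1 (ka i) (gp T (lev i) (ta i)) \<in> borel_measurable M1" "w2 (ka i) (gp T (lev i) (ta i)) \<in> borel_measurable M2" for i
  using b1.wM b2.wM b1.gp_in ta by auto
 fix K :: "'i set" and a :: "'i \<Rightarrow> real" assume K: "finite K"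
 \<comment> \<open>Sums over the finite index set are crude common upper bounds for the levels and
   directions involved.\<close>
 define N where "N = (\<Sum>i\<in>K. lev i)"
 define d where "d = Suc (\<Sum>i\<in>K. ka i)"
 let ?ta = "\<lambda>i. 2 ^ (N - lev i) * ta i"
 have lN: "lev i \<le> N" "ka i < d" if "i \<in> K" for i
  using member_le_sum[of i K lev] member_le_sum[of i K ka] that K by (auto simp: N_def d_def)
 have t2: "?ta i \<le> 2 ^ N" if "i \<in> K" for i
 proof -
  have "?ta i \<le> 2 ^ (N - lev i) * 2 ^ lev i" using ta[of i] by simp
  then show ?thesis using lN(1)[OF that] by (simp add: power_add[symmetric])
 qed
 have g: "gp T (lev i) (ta i) = gp T N (?ta i)" if "i \<in> K" for i using b1.gp_refine[OF lN(1)[OF that], of "ta i"] by simp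
 note ex = b1.exp_grid_combination[OF K lN(2) t2] b2.exp_grid_combination[OF K lN(2) t2]
 show "(\<integral>\<^sup>+om. ennreal (exp (\<Sum>i\<in>K. a i * w1 (ka i) (gp T (lev i) (ta i)) om)) \<partial>M1) < \<infinity>"
  "(\<integral>\<^sup>+om. ennreal (exp (\<Sum>i\<in>K. a i * w1 (ka i) (gp T (lev i) (ta i)) om)) \<partial>M1) = (\<integral>\<^sup>+om. ennreal (exp (\<Sum>i\<in>K. a i * w2 (ka i) (gp T (lev i) (ta i)) om)) \<partial>M2)"
  by (simp_all add: g ex less_top[symmetric] cong: sum.cong)
qed

text \<open>A combination of the coordinate motions is, by almost sure linearity, |u| times the real
  Brownian motion in the unit direction u / |u|. Its increments are independent of the past by
  definition, so joint independence needs no argument here; u = 0 and s = t are trivial.\<close>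

lemma bm_system_of_cylindrical:
 fixes e :: "nat \<Rightarrow> 'a::{real_inner, polish_space}"
 assumes M: "prob_space M" and F: "filtration_on {0..T} M F" and W: "cylindrical_bm {0..T} M F W" and e: "orthonormal_basis e"
 shows "bm_system T M F (\<lambda>k t. W t (e k))"
 unfolding bm_system_def
proof (intro conjI allI ballI)
 interpret prob_space M by fact
 have bmh: "brownian_motion {0..T} M F (\<lambda>t. W t h)" if "norm h = 1" for h using W that by (simp add: cylindrical_bm_def)
 have lin: "AE om in M. W t (a *\<^sub>R h + b *\<^sub>R k) om = a * W t h om + b * W t k om" if "t \<in> {0..T}" for t h k a b
  using W that by (simp add: cylindrical_bm_def)
 have n1: "norm (e k) = 1" for k using e by (simp add: orthonormal_basis_def norm_eq_sqrt_inner)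
 show "prob_space M" "filtration_on {0..T} M F" by fact+
 show "W t (e k) \<in> borel_measurable (F t)" if "t \<in> {0..T}" for k t using bmh[OF n1[of k]] that by (simp add: brownian_motion_def)
 show "AE om in M. W 0 (e k) om = 0" "AE om in M. continuous_on {0..T} (\<lambda>t. W t (e k) om)" for k
  using bmh[OF n1[of k]] by (simp_all add: brownian_motion_def)
 fix n and v :: "nat \<Rightarrow> real" and s t A assume s: "s \<in> {0..T}" and t: "t \<in> {s..T}" and A: "A \<in> sets (F s)"
 have t': "t \<in> {0..T}" using s t by auto
 have sub: "subalgebra M (F r)" if "r \<in> {0..T}" for r using F that by (simp add: filtration_on_def)
 define u where "u = (\<Sum>k<n. v k *\<^sub>R e k)"
 define q where "q = (\<Sum>k<n. (v k)\<^sup>2)"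
 have nu: "(norm u)\<^sup>2 = q" unfolding u_def q_def by (rule norm_lincomb[OF e])
 have W_sum: "AE om in M. W r (\<Sum>k<m. v k *\<^sub>R e k) om = (\<Sum>k<m. v k * W r (e k) om)" if r: "r \<in> {0..T}" for r m
 proof (induction m)
  case 0
  show ?case using lin[OF r, of 0 0 0 0] by simp
 next
  case (Suc m)
  show ?case using Suc lin[OF r, of 1 "\<Sum>k<m. v k *\<^sub>R e k" "v m" "e m"] by eventually_elim simp
 qed
 show "(\<integral>\<^sup>+om. indicator A om * ennreal (exp (\<Sum>k<n. v k * (W t (e k) om - W s (e k) om))) \<partial>M)
     = emeasure M A * ennreal (exp ((\<Sum>k<n. (v k)\<^sup>2) * (t - s) / 2))"
 proof (cases "s = t \<or> u = 0")
  case True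
  have AM[measurable]: "A \<in> events" using A sub[OF s] by (auto simp: subalgebra_def)
  have "v k = 0" if "u = 0" "k < n" for k
   using nu that by (auto simp: q_def sum_nonneg_eq_0_iff)
  then have "(\<Sum>k<n. v k * (W t (e k) om - W s (e k) om)) = 0" "(\<Sum>k<n. (v k)\<^sup>2) * (t - s) = 0" for om using True by auto
  then show ?thesis by (auto simp: q_def)
 next
  case False
  then have st: "s < t" using t by auto
  define h where "h = (1 / norm u) *\<^sub>R u"
  have h: "norm h = 1" "norm u *\<^sub>R h = u" using False by (auto simp: h_def)
  define De where "De om = W t h om - W s h om" for om
  have hm: "W r h \<in> borel_measurable M" if "r \<in> {0..T}" for r
   by (rule measurable_from_subalg[OF sub[OF that]]) (use bmh[OF h(1)] that in \<open>simp add: brownian_motion_def\<close>)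
  have [measurable]: "De \<in> borel_measurable M" unfolding De_def using hm[OF s] hm[OF t'] by measurable
  have D: "distributed M lborel De (normal_density 0 (sqrt (t - s)))" and I: "indep_set (sets (F s)) (sets (vimage_algebra (space M) De borel))"
   using bmh[OF h(1)] s t' st unfolding brownian_motion_def De_def by auto
  have "AE om in M. (\<Sum>k<n. v k * (W t (e k) om - W s (e k) om)) = norm u * De om"
   using W_sum[OF s, of n] W_sum[OF t', of n] lin[OF s, of "norm u" h 0 h] lin[OF t', of "norm u" h 0 h]
   by eventually_elim (simp add: u_def[symmetric] h(2) De_def right_diff_distrib sum_subtractf)
  then have "(\<integral>\<^sup>+om. indicator A om * ennreal (exp (\<Sum>k<n. v k * (W t (e k) om - W s (e k) om))) \<partial>M) = (\<integral>\<^sup>+om. indicator A om * ennreal (exp (norm u * De om)) \<partial>M)"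
   by (intro nn_integral_cong_AE) (auto elim!: AE_mp)
  also have "... = emeasure M A * (\<integral>\<^sup>+om. ennreal (exp (norm u * De om)) \<partial>M)"
   by (rule nn_integral_indep[OF prob_space_axioms sub[OF s] _ _ I A, where f="\<lambda>x. ennreal (exp (norm u * x))"]) measurable
  also have "(\<integral>\<^sup>+om. ennreal (exp (norm u * De om)) \<partial>M) = (\<integral>\<^sup>+x. ennreal (exp (norm u * x)) \<partial>distr M lborel De)"
   by (subst nn_integral_distr) auto
  also have "... = ennreal (exp (q * (t - s) / 2))"
   using D st nn_integral_exp_normal[of "sqrt (t - s)" "norm u"] nu by (simp add: distributed_def)
  finally show ?thesis by (simp add: q_def)
 qed
qed

text \<open>The index is capped so that every pair of naturals names a time in [0, T]. Codes can
  then be functions on a full countable type.\<close>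

definition pt :: "real \<Rightarrow> nat \<Rightarrow> nat \<Rightarrow> real" where "pt T n j = gp T n (min j (2 ^ n))"

definition idx :: "real \<Rightarrow> nat \<Rightarrow> real \<Rightarrow> nat" where "idx T n s = nat \<lfloor>clip T s * 2 ^ n / T\<rfloor>"

lemma pt_in: "0 < T \<Longrightarrow> pt T n j \<in> {0..T}"
proof -
 assume T: "0 < T"
 have "real (min j (2 ^ n)) \<le> 2 ^ n" by (metis min.cobounded2 of_nat_le_iff of_nat_numeral of_nat_power)
 then show ?thesis using T by (simp add: pt_def gp_def divide_le_eq)
qed

lemma pt_idx_tendsto: "0 < T \<Longrightarrow> (\<lambda>n. pt T n (idx T n s)) \<longlonglongrightarrow> clip T s"
proof -
 assume T: "0 < T"
 have "pt T n (idx T n s) = T * real_of_int \<lfloor>clip T s * 2 ^ n / T\<rfloor> / 2 ^ n" for n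
 proof -
  have c: "0 \<le> clip T s" "clip T s \<le> T" using clip_in[of T s] T by auto
  have "clip T s * 2 ^ n / T \<le> 2 ^ n" using c T by (simp add: divide_le_eq mult.commute)
  then have "\<lfloor>clip T s * 2 ^ n / T\<rfloor> \<le> 2 ^ n" by (simp add: floor_le_iff)
  then have "idx T n s \<le> 2 ^ n" by (simp add: idx_def nat_le_iff)
  moreover have "0 \<le> \<lfloor>clip T s * 2 ^ n / T\<rfloor>" using c T by simp
  ultimately show ?thesis by (simp add: pt_def gp_def idx_def min_def)
 qed
 then show ?thesis using grid_floor_tendsto[OF T] by simp
qed

text \<open>A path is coded by its values at the dyadic times, a point of a Polish space.\<close>

definition dec :: "real \<Rightarrow> (nat \<times> nat \<Rightarrow> 'a) \<Rightarrow> real \<Rightarrow> 'a::{real_inner, polish_space}" where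
 "dec T x s = (if Cauchy (\<lambda>n. x (n, idx T n s)) then lim (\<lambda>n. x (n, idx T n s)) else 0)"

definition code :: "real \<Rightarrow> (real \<Rightarrow> 'a) \<Rightarrow> nat \<times> nat \<Rightarrow> 'a::{real_inner, polish_space}" where
 "code T y = (\<lambda>(n, j). y (pt T n j))"

text \<open>Uniform continuity on the dyadic times, in countably many conditions so that the set is
  Borel. A time named by several pairs receives one value: distance 0 forces the distance of the
  values below every 1/(m+1).\<close>

definition unif :: "real \<Rightarrow> (nat \<times> nat \<Rightarrow> 'a::{real_inner, polish_space}) set" where
 "unif T = {x. \<forall>m. \<exists>p. \<forall>q q'. \<bar>pt T (fst q) (snd q) - pt T (fst q') (snd q')\<bar> < 1 / real (Suc p) \<longrightarrow> dist (x q) (x q') \<le> 1 / real (Suc m)}"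

lemma fun_coordinate_measurable: "(\<lambda>x. x i) \<in> borel_measurable (borel :: ('i::countable \<Rightarrow> 'b::second_countable_topology) measure)"
 using measurable_product_coordinates[of i] by simp

lemma dec_measurable[measurable]: "(\<lambda>p. dec T (fst p) (snd p)) \<in> borel_measurable (borel \<Otimes>\<^sub>M lborel)"
proof -
 have f[measurable]: "(\<lambda>p. (fst p :: nat \<times> nat \<Rightarrow> 'a::{real_inner, polish_space}) (n, idx T n (snd p))) \<in> borel_measurable (borel \<Otimes>\<^sub>M lborel)" for n
 proof (rule measurable_compose_countable[where f="\<lambda>i p. fst p (n, i)" and g="\<lambda>p. idx T n (snd p)"])
  show "(\<lambda>p. (fst p :: nat \<times> nat \<Rightarrow> 'a) (n, i)) \<in> borel_measurable (borel \<Otimes>\<^sub>M lborel)" for i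
   by (rule measurable_compose[OF measurable_fst fun_coordinate_measurable])
  show "(\<lambda>p. idx T n (snd p)) \<in> measurable (borel \<Otimes>\<^sub>M lborel) (count_space UNIV)"
   unfolding idx_def clip_def by measurable
 qed
 show ?thesis
 proof (rule borel_measurable_LIMSEQ_metric)
  show "(\<lambda>p. if Cauchy (\<lambda>n. (fst p :: nat \<times> nat \<Rightarrow> 'a) (n, idx T n (snd p))) then fst p (n, idx T n (snd p)) else 0) \<in> borel_measurable (borel \<Otimes>\<^sub>M lborel)" for n
   by measurable
  show "(\<lambda>n. if Cauchy (\<lambda>n. (fst p :: nat \<times> nat \<Rightarrow> 'a) (n, idx T n (snd p))) then fst p (n, idx T n (snd p)) else 0) \<longlonglongrightarrow> dec T (fst p) (snd p)" for p
  proof (cases "Cauchy (\<lambda>n. (fst p :: nat \<times> nat \<Rightarrow> 'a) (n, idx T n (snd p)))")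
   case True
   then show ?thesis using convergent_LIMSEQ_iff[THEN iffD1, OF Cauchy_convergent] by (simp add: dec_def)
  qed (simp add: dec_def)
 qed
qed

lemma dec_section_measurable[measurable]:
 fixes x :: "nat \<times> nat \<Rightarrow> 'a::{real_inner, polish_space}"
 shows "dec T x \<in> borel_measurable borel" "(\<lambda>x :: nat \<times> nat \<Rightarrow> 'a. dec T x s) \<in> borel_measurable borel"
proof -
 have "Pair x \<in> measurable lborel (borel \<Otimes>\<^sub>M lborel)" by simp
 from measurable_compose[OF this dec_measurable] show "dec T x \<in> borel_measurable borel" by simp
 have "(\<lambda>x :: nat \<times> nat \<Rightarrow> 'a. (x, s)) \<in> measurable borel (borel \<Otimes>\<^sub>M lborel)" by simp
 from measurable_compose[OF this dec_measurable] show "(\<lambda>x :: nat \<times> nat \<Rightarrow> 'a. dec T x s) \<in> borel_measurable borel" by simp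
qed

lemma unif_measurable[measurable]: "unif T \<in> sets borel"
proof -
 have "closed {x :: nat \<times> nat \<Rightarrow> 'a::{real_inner, polish_space}. dist (x q) (x q') \<le> c}" for q q' c
  by (intro closed_Collect_le continuous_on_dist continuous_on_product_coordinates continuous_on_const)
 then have "{x :: nat \<times> nat \<Rightarrow> 'a::{real_inner, polish_space}. dist (x q) (x q') \<le> c} \<in> sets borel" for q q' c by simp
 note [measurable] = this
 have "unif T = {x \<in> space borel. \<forall>m. \<exists>p. \<forall>q q'. \<bar>pt T (fst q) (snd q) - pt T (fst q') (snd q')\<bar> < 1 / real (Suc p) \<longrightarrow> x \<in> {x :: nat \<times> nat \<Rightarrow> 'a. dist (x q) (x q') \<le> 1 / real (Suc m)}}"
  by (simp add: unif_def)
 also have "... \<in> sets borel" by measurable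
 finally show ?thesis .
qed

lemma code_unif:
 assumes T: "0 < T" and y: "continuous_on {0..T} y"
 shows "code T y \<in> unif T" "dec T (code T y) s = y (clip T s)"
proof -
 have u: "uniformly_continuous_on {0..T} y" by (intro compact_uniformly_continuous y compact_Icc)
 show "code T y \<in> unif T"
  unfolding unif_def
 proof (intro CollectI allI)
  fix m :: nat
  obtain d where d: "d > 0" "\<And>r r'. r \<in> {0..T} \<Longrightarrow> r' \<in> {0..T} \<Longrightarrow> dist r' r < d \<Longrightarrow> dist (y r') (y r) < 1 / real (Suc m)"
   using u unfolding uniformly_continuous_on_def by (metis of_nat_0_less_iff zero_less_Suc zero_less_divide_1_iff)
  obtain p where p: "1 / real (Suc p) < d" using d(1) nat_approx_posE by blast
  show "\<exists>p. \<forall>q q'. \<bar>pt T (fst q) (snd q) - pt T (fst q') (snd q')\<bar> < 1 / real (Suc p) \<longrightarrow> dist (code T y q) (code T y q') \<le> 1 / real (Suc m)"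
  proof (intro exI[of _ p] allI impI)
   fix q q' assume "\<bar>pt T (fst q) (snd q) - pt T (fst q') (snd q')\<bar> < 1 / real (Suc p)"
   then show "dist (code T y q) (code T y q') \<le> 1 / real (Suc m)"
    using d(2)[OF pt_in pt_in, OF T T, of "fst q'" "snd q'" "fst q" "snd q"] p by (simp add: code_def case_prod_beta dist_real_def dist_commute abs_minus_commute)
  qed
 qed
 have "(\<lambda>n. y (pt T n (idx T n s))) \<longlonglongrightarrow> y (clip T s)"
  by (rule continuous_on_tendsto_compose[OF y pt_idx_tendsto[OF T]]) (use T clip_in pt_in in auto)
 then show "dec T (code T y) s = y (clip T s)"
  unfolding dec_def code_def by (simp add: limI LIMSEQ_imp_Cauchy)
qed

text \<open>Extension of a uniformly continuous function from the dyadic times to the interval. It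
  shows that on \<open>unif\<close> a code is recovered from its path, so distinct codes give
  distinct paths.\<close>

lemma unif_dec:
 fixes x :: "nat \<times> nat \<Rightarrow> 'a::{real_inner, polish_space}"
 assumes T: "0 < T" and x: "x \<in> unif T"
 shows "dec T x (pt T n j) = x (n, j)" "continuous_on UNIV (dec T x)"
proof -
 have un: "\<exists>p. \<forall>q q'. \<bar>pt T (fst q) (snd q) - pt T (fst q') (snd q')\<bar> < 1 / real (Suc p) \<longrightarrow> dist (x q) (x q') \<le> 1 / real (Suc m)" for m
  using x by (simp add: unif_def)
 have C: "Cauchy (\<lambda>n. x (n, idx T n s))" for s
 proof (rule metric_CauchyI)
  fix r :: real assume "0 < r"
  then obtain m where m: "1 / real (Suc m) < r" using nat_approx_posE by blast
  obtain p where p: "\<And>q q'. \<bar>pt T (fst q) (snd q) - pt T (fst q') (snd q')\<bar> < 1 / real (Suc p) \<Longrightarrow> dist (x q) (x q') \<le> 1 / real (Suc m)" using un by blast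
  have "Cauchy (\<lambda>n. pt T n (idx T n s))" using pt_idx_tendsto[OF T] by (rule LIMSEQ_imp_Cauchy)
  from metric_CauchyD[OF this, of "1 / real (Suc p)"] obtain N where
   N: "\<And>a b. N \<le> a \<Longrightarrow> N \<le> b \<Longrightarrow> dist (pt T a (idx T a s)) (pt T b (idx T b s)) < 1 / real (Suc p)" by auto
  show "\<exists>N. \<forall>a\<ge>N. \<forall>b\<ge>N. dist (x (a, idx T a s)) (x (b, idx T b s)) < r"
  proof (intro exI[of _ N] allI impI)
   fix a b assume "N \<le> a" "N \<le> b"
   then show "dist (x (a, idx T a s)) (x (b, idx T b s)) < r"
    using p[of "(a, idx T a s)" "(b, idx T b s)"] N[of a b] m by (simp add: dist_real_def)
  qed
 qed
 then have lim: "(\<lambda>n. x (n, idx T n s)) \<longlonglongrightarrow> dec T x s" for s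
  unfolding dec_def using convergent_LIMSEQ_iff[THEN iffD1, OF Cauchy_convergent[OF C[of s]]] by simp
 show "dec T x (pt T n j) = x (n, j)"
 proof (rule LIMSEQ_unique[OF lim])
  have c: "clip T (pt T n j) = pt T n j" by (rule clip_id[OF pt_in[OF T]])
  show "(\<lambda>a. x (a, idx T a (pt T n j))) \<longlonglongrightarrow> x (n, j)"
  proof (rule metric_LIMSEQ_I)
   fix r :: real assume "0 < r"
   then obtain m where m: "1 / real (Suc m) < r" using nat_approx_posE by blast
   obtain p where p: "\<And>q q'. \<bar>pt T (fst q) (snd q) - pt T (fst q') (snd q')\<bar> < 1 / real (Suc p) \<Longrightarrow> dist (x q) (x q') \<le> 1 / real (Suc m)" using un by blast
   obtain N where N: "\<And>a. N \<le> a \<Longrightarrow> dist (pt T a (idx T a (pt T n j))) (pt T n j) < 1 / real (Suc p)"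
    using metric_LIMSEQ_D[OF pt_idx_tendsto[OF T, of "pt T n j"], of "1 / real (Suc p)"] unfolding c by auto
   show "\<exists>N. \<forall>a\<ge>N. dist (x (a, idx T a (pt T n j))) (x (n, j)) < r"
   proof (intro exI[of _ N] allI impI)
    fix a assume "N \<le> a"
    then show "dist (x (a, idx T a (pt T n j))) (x (n, j)) < r"
     using p[of "(a, idx T a (pt T n j))" "(n, j)"] N[of a] m by (simp add: dist_real_def)
   qed
  qed
 qed
 show "continuous_on UNIV (dec T x)"
  unfolding continuous_on_iff
 proof (intro ballI allI impI)
  fix s r :: real assume "0 < r"
  then obtain m where m: "1 / real (Suc m) < r" using nat_approx_posE by blast
  obtain p where p: "\<And>q q'. \<bar>pt T (fst q) (snd q) - pt T (fst q') (snd q')\<bar> < 1 / real (Suc p) \<Longrightarrow> dist (x q) (x q') \<le> 1 / real (Suc m)" using un by blast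
  show "\<exists>d>0. \<forall>s'\<in>UNIV. dist s' s < d \<longrightarrow> dist (dec T x s') (dec T x s) < r"
  proof (intro exI[of _ "1 / real (Suc p)"] conjI ballI impI)
   fix s' assume "dist s' s < 1 / real (Suc p)"
   then have "\<bar>clip T s' - clip T s\<bar> < 1 / real (Suc p)" by (auto simp: clip_def dist_real_def)
   moreover have "(\<lambda>n. \<bar>pt T n (idx T n s') - pt T n (idx T n s)\<bar>) \<longlonglongrightarrow> \<bar>clip T s' - clip T s\<bar>"
    by (intro tendsto_intros pt_idx_tendsto[OF T])
   ultimately have "\<forall>\<^sub>F n in sequentially. \<bar>pt T n (idx T n s') - pt T n (idx T n s)\<bar> < 1 / real (Suc p)" by (rule order_tendstoD(2)[rotated])
   then have "\<forall>\<^sub>F n in sequentially. dist (x (n, idx T n s')) (x (n, idx T n s)) \<le> 1 / real (Suc m)"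
    by eventually_elim (use p in simp)
   then have "dist (dec T x s') (dec T x s) \<le> 1 / real (Suc m)"
    by (intro tendsto_upperbound[OF tendsto_dist[OF lim lim]]) auto
   then show "dist (dec T x s') (dec T x s) < r" using m by simp
  qed simp
 qed
qed

section \<open>Admissible codes and injectivity of the noise\<close>

context convex_sde
begin

text \<open>Conditions along the path under which \<open>path_gradV_integrable\<close> applies to
  the decoded path, written as integrals so that they are Borel in the code.\<close>

definition good :: "(nat \<times> nat \<Rightarrow> 'a) set" where
 "good = {x \<in> unif T. (\<integral>\<^sup>+s\<in>{0..T}. indicator (- diff_dom V) (dec T x s) \<partial>lborel) = 0 \<and>
   (\<forall>k. (\<integral>\<^sup>+s\<in>{0..T}. ennreal \<bar>gradV V (dec T x s) \<bullet> e k\<bar> \<partial>lborel) < \<infinity>)}"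

text \<open>The driving noise, at dyadic times, of the equation with \<open>B = 0\<close> whose solution has code \<open>x\<close>.\<close>

definition noise :: "'a \<Rightarrow> (nat \<times> nat \<Rightarrow> 'a) \<Rightarrow> nat \<times> nat \<times> nat \<Rightarrow> real" where
 "noise z x = (\<lambda>(k, n, j). x (n, j) \<bullet> e k - z \<bullet> e k - (LINT s:{0..pt T n j}|lborel. l k * (dec T x s \<bullet> e k) - gradV V (dec T x s) \<bullet> e k))"

lemma nn_integral_dec_measurable:
 assumes [measurable]: "f \<in> borel_measurable borel"
 shows "(\<lambda>x. \<integral>\<^sup>+s\<in>{0..T}. f (dec T x s) \<partial>lborel) \<in> borel_measurable borel"
 by (rule lborel.borel_measurable_nn_integral) (unfold case_prod_beta, measurable)

lemma integral_dec_measurable: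
 fixes f :: "'a \<Rightarrow> real"
 assumes [measurable]: "f \<in> borel_measurable borel"
 shows "(\<lambda>x. LINT s:{0..t}|lborel. f (dec T x s)) \<in> borel_measurable borel"
 unfolding set_lebesgue_integral_def
 by (rule lborel.borel_measurable_lebesgue_integral) (unfold case_prod_beta, measurable)

lemma good_measurable[measurable]: "good \<in> sets borel"
proof -
 note [measurable] = nn_integral_dec_measurable
 have "good = unif T \<inter> {x \<in> space borel. (\<integral>\<^sup>+s\<in>{0..T}. indicator (- diff_dom V) (dec T x s) \<partial>lborel) = 0} \<inter>
   (\<Inter>k. {x \<in> space borel. (\<integral>\<^sup>+s\<in>{0..T}. ennreal \<bar>gradV V (dec T x s) \<bullet> e k\<bar> \<partial>lborel) < \<infinity>})"
  by (auto simp: good_def)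
 also have "... \<in> sets borel"
  by (intro sets.Int sets.countable_INT' borel_measurable_pred_less nn_integral_dec_measurable)
    (auto intro!: nn_integral_dec_measurable measurable_sets_Collect)
 finally show ?thesis .
qed

lemma noise_measurable[measurable]: "noise z \<in> borel_measurable borel"
proof (rule measurable_coordinatewise_then_product)
 fix i :: "nat \<times> nat \<times> nat"
 obtain k n j where i: "i = (k, n, j)" by (cases i)
 have [measurable]: "(\<lambda>x. LINT s:{0..pt T n j}|lborel. l k * (dec T x s \<bullet> e k) - gradV V (dec T x s) \<bullet> e k) \<in> borel_measurable borel"
  by (rule integral_dec_measurable[where f="\<lambda>y. l k * (y \<bullet> e k) - gradV V y \<bullet> e k"]) measurable
 have [measurable]: "(\<lambda>x :: nat \<times> nat \<Rightarrow> 'a. x (n, j)) \<in> borel_measurable borel" by (rule fun_coordinate_measurable)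
 show "(\<lambda>x. noise z x i) \<in> borel_measurable borel" unfolding noise_def i by simp
qed

lemma goodD:
 assumes "x \<in> good"
 shows "AE s in lborel. s \<in> {0..T} \<longrightarrow> dec T x s \<in> diff_dom V" "set_integrable lborel {0..T} (\<lambda>s. norm (gradV V (dec T x s)))"
  "continuous_on UNIV (dec T x)" "dec T x (pt T n j) = x (n, j)"
proof -
 have u: "x \<in> unif T" using assms by (simp add: good_def)
 show c: "continuous_on UNIV (dec T x)" and "dec T x (pt T n j) = x (n, j)" using unif_dec[OF T u] by auto
 have "(\<integral>\<^sup>+s. indicator (- diff_dom V) (dec T x s) * indicator {0..T} s \<partial>lborel) = 0" using assms by (simp add: good_def)
 then have "AE s in lborel. indicator (- diff_dom V) (dec T x s) * indicator {0..T} s = (0 :: ennreal)"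
  by (subst (asm) nn_integral_0_iff_AE) measurable
 then show d: "AE s in lborel. s \<in> {0..T} \<longrightarrow> dec T x s \<in> diff_dom V" by eventually_elim (auto split: split_indicator_asm)
 show "set_integrable lborel {0..T} (\<lambda>s. norm (gradV V (dec T x s)))"
  by (rule path_gradV_integrable[OF V dom ne e c d]) (use assms in \<open>auto simp: good_def\<close>)
qed

text \<open>Subtracting the two equations cancels the noise. The difference of the paths then
  satisfies the coordinate equations of \<open>monotone_flow_unique\<close>, with the difference of
  the gradients as the monotone term.\<close>

lemma noise_inj: "inj_on (noise z) good"
proof (rule inj_onI)
 fix x x' assume x: "x \<in> good" and x': "x' \<in> good" and eq: "noise z x = noise z x'"
 let ?y = "dec T x" and ?y' = "dec T x'"
 define d where "d s = ?y s - ?y' s" for s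
 define g where "g s = gradV V (?y s) - gradV V (?y' s)" for s
 have [measurable]: "d \<in> borel_measurable borel" "g \<in> borel_measurable borel" unfolding d_def g_def by measurable
 have dc: "continuous_on S d" for S unfolding d_def using goodD(3)[OF x] goodD(3)[OF x'] by (intro continuous_intros) (auto intro: continuous_on_subset)
 have gi: "set_integrable lborel {0..T} (\<lambda>s. norm (g s))"
  unfolding set_integrable_def
 proof (rule Bochner_Integration.integrable_bound[OF set_integral_add(1)[OF goodD(2)[OF x] goodD(2)[OF x'], unfolded set_integrable_def]])
  show "AE s in lborel. norm (indicat_real {0..T} s *\<^sub>R norm (g s)) \<le> norm (indicat_real {0..T} s *\<^sub>R (norm (gradV V (?y s)) + norm (gradV V (?y' s))))"
   by (intro AE_I2) (auto simp: g_def norm_triangle_ineq4 split: split_indicator)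
 qed measurable
 have ii: "set_integrable lborel {0..T} (\<lambda>s. l k * (u s \<bullet> e k) - h s \<bullet> e k)"
  if "set_integrable lborel {0..T} (\<lambda>s. norm (h s))" "h \<in> borel_measurable borel" "continuous_on {0..T} u" for u h :: "real \<Rightarrow> 'a" and k
 proof -
  have "set_integrable lborel {0..T} (\<lambda>s. u s \<bullet> e k)"
   by (intro borel_integrable_atLeastAtMost' continuous_on_inner that(3) continuous_on_const)
  then have "set_integrable lborel {0..T} (\<lambda>s. l k * (u s \<bullet> e k))" by simp
  then show ?thesis by (intro set_integral_diff(1) set_integrable_inner that(1,2))
 qed
 have i0: "set_integrable lborel {0..T} (\<lambda>s. l k * (d s \<bullet> e k) - g s \<bullet> e k)" for k by (rule ii[OF gi _ dc]) measurable
 have grid: "d t \<bullet> e k = (LINT s:{0..t}|lborel. l k * (d s \<bullet> e k) - g s \<bullet> e k)" if t: "t = pt T n j" for t n j k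
 proof -
  have tT: "{0..t} \<subseteq> {0..T}" using pt_in[OF T, of n j] t by auto
  have "(LINT s:{0..t}|lborel. l k * (d s \<bullet> e k) - g s \<bullet> e k) = (LINT s:{0..t}|lborel. (l k * (?y s \<bullet> e k) - gradV V (?y s) \<bullet> e k) - (l k * (?y' s \<bullet> e k) - gradV V (?y' s) \<bullet> e k))"
   by (simp add: d_def g_def inner_diff_left algebra_simps)
  also have "... = (LINT s:{0..t}|lborel. l k * (?y s \<bullet> e k) - gradV V (?y s) \<bullet> e k) - (LINT s:{0..t}|lborel. l k * (?y' s \<bullet> e k) - gradV V (?y' s) \<bullet> e k)"
   using goodD(3)[OF x] goodD(3)[OF x']
   by (intro set_integral_diff(2) set_integrable_subset[OF ii _ tT] goodD(2)[OF x] goodD(2)[OF x']) (auto intro: continuous_on_subset)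
  also have "... = d t \<bullet> e k" using fun_cong[OF eq, of "(k, n, j)"] goodD(4)[OF x, of n j] goodD(4)[OF x', of n j]
   by (simp add: noise_def t d_def inner_diff_left)
  finally show ?thesis by simp
 qed
 \<comment> \<open>Equality of the noises is known at dyadic times; both sides are continuous in t,
   which gives the identity at all times.\<close>
 have all: "d t \<bullet> e k = (LINT s:{0..t}|lborel. l k * (d s \<bullet> e k) - g s \<bullet> e k)" if t: "t \<in> {0..T}" for t k
 proof (rule LIMSEQ_unique)
  have "continuous_on {0..T} (\<lambda>t. integral {0..t} (\<lambda>s. l k * (d s \<bullet> e k) - g s \<bullet> e k))"
   using set_borel_integral_eq_integral(1)[OF i0] by (rule indefinite_integral_continuous_1)
  moreover have "integral {0..t} (\<lambda>s. l k * (d s \<bullet> e k) - g s \<bullet> e k) = (LINT s:{0..t}|lborel. l k * (d s \<bullet> e k) - g s \<bullet> e k)" if "t \<in> {0..T}" for t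
   by (rule set_borel_integral_eq_integral(2)[symmetric]) (use that in \<open>auto intro: set_integrable_subset[OF i0]\<close>)
  ultimately have c: "continuous_on {0..T} (\<lambda>t. LINT s:{0..t}|lborel. l k * (d s \<bullet> e k) - g s \<bullet> e k)"
   by (subst (asm) continuous_on_cong[OF refl]) auto
  let ?t = "\<lambda>n. pt T n (idx T n t)"
  have t': "?t \<longlonglongrightarrow> t" using pt_idx_tendsto[OF T, of t] clip_id[OF t] by simp
  have "\<forall>\<^sub>F n in sequentially. ?t n \<in> {0..T}" using pt_in[OF T] by (intro always_eventually allI)
  then show "(\<lambda>n. LINT s:{0..?t n}|lborel. l k * (d s \<bullet> e k) - g s \<bullet> e k) \<longlonglongrightarrow> (LINT s:{0..t}|lborel. l k * (d s \<bullet> e k) - g s \<bullet> e k)"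
   by (rule continuous_on_tendsto_compose[OF c t' t])
  have "isCont d t" using dc[of UNIV] by (simp add: continuous_on_eq_continuous_at)
  then show "(\<lambda>n. LINT s:{0..?t n}|lborel. l k * (d s \<bullet> e k) - g s \<bullet> e k) \<longlonglongrightarrow> d t \<bullet> e k"
   unfolding grid[OF refl, symmetric] by (intro tendsto_inner tendsto_const isCont_tendsto_compose[OF _ t'])
 qed
 have mono: "AE s in lborel. s \<in> {0..T} \<longrightarrow> 0 \<le> d s \<bullet> g s"
  using goodD(1)[OF x] goodD(1)[OF x']
  by eventually_elim (simp add: d_def g_def gradV_monotone[OF V] inner_commute[of "dec T x _ - dec T x' _"])
 have "d t = 0" if "t \<in> {0..T}" for t
  by (rule monotone_flow_unique[OF e dc l(1) gi _ mono all that]) (simp add: set_borel_measurable_def)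
 then have "x (n, j) = x' (n, j)" for n j
  using pt_in[OF T, of n j] goodD(4)[OF x, of n j] goodD(4)[OF x', of n j] by (auto simp: d_def)
 then show "x = x'" by (intro ext) auto
qed

end

section \<open>Densities and path laws in terms of codes\<close>

context convex_sde
begin

definition noiseB :: "'a \<Rightarrow> (nat \<times> nat \<Rightarrow> 'a) \<Rightarrow> nat \<Rightarrow> nat \<Rightarrow> nat \<Rightarrow> real" where
 "noiseB z x k n j = noise z x (k, n, j) - (LINT s:{0..pt T n j}|lborel. B (dec T x s) \<bullet> e k)"

text \<open>The limit of the step densities, with every motion and path value replaced by its
  expression in the code. It depends on the solution only through the approximating data, which two
  solutions can share.\<close>

definition rho_of_code :: "'a \<Rightarrow> (nat \<Rightarrow> nat) \<Rightarrow> (nat \<Rightarrow> nat) \<Rightarrow> (nat \<Rightarrow> nat \<Rightarrow> 'a \<Rightarrow> real) \<Rightarrow> (nat \<times> nat \<Rightarrow> 'a) \<Rightarrow> real" where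
 "rho_of_code z Nf dm \<beta> x = lim (\<lambda>n. exp ((\<Sum>j<2^Nf n. \<Sum>k<dm n. \<beta> n k (x (Nf n, j)) * (noiseB z x k (Nf n) (Suc j) - noiseB z x k (Nf n) j))
   - (\<Sum>j<2^Nf n. (\<Sum>k<dm n. \<beta> n k (x (Nf n, j)) * \<beta> n k (x (Nf n, j))) * (T / 2 ^ Nf n)) / 2))"

lemma noiseB_measurable: "(\<lambda>x. noiseB z x k n j) \<in> borel_measurable borel"
proof -
 have [measurable]: "(\<lambda>x. noise z x (k, n, j)) \<in> borel_measurable borel"
  by (rule measurable_compose[OF noise_measurable fun_coordinate_measurable])
 have [measurable]: "(\<lambda>x. LINT s:{0..pt T n j}|lborel. B (dec T x s) \<bullet> e k) \<in> borel_measurable borel"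
  by (rule integral_dec_measurable[where f="\<lambda>y. B y \<bullet> e k"]) measurable
 show ?thesis unfolding noiseB_def by measurable
qed

lemma rho_of_code_measurable:
 assumes "\<And>n k. \<beta> n k \<in> borel_measurable borel"
 shows "rho_of_code z Nf dm \<beta> \<in> borel_measurable borel"
proof -
 have "(\<lambda>x. \<beta> n k (x (m, j))) \<in> borel_measurable borel" for n k and m j :: nat
  by (rule measurable_compose[OF fun_coordinate_measurable[of "(m, j)"] assms[of n k]])
 note [measurable] = this noiseB_measurable
 show ?thesis unfolding rho_of_code_def[abs_def] by measurable
qed

text \<open>What has to be retained of a solution after the drift is removed: the law
  \<open>L\<close> of its code, the Brownian origin of the noise law, and the weight
  \<open>1 / r\<close> that recovers the original path law.\<close>

definition coded :: "'a \<Rightarrow> ((nat \<times> nat \<Rightarrow> 'a) \<Rightarrow> real) \<Rightarrow> (real \<Rightarrow> 'a) measure \<Rightarrow> 'w measure \<Rightarrow> (nat \<Rightarrow> real \<Rightarrow> 'w \<Rightarrow> real) \<Rightarrow> (nat \<times> nat \<Rightarrow> 'a) measure \<Rightarrow> bool" where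
 "coded z r P Q w L \<longleftrightarrow> (\<exists>F. bm T Q F w) \<and> prob_space L \<and> sets L = sets borel \<and> (AE x in L. x \<in> good) \<and>
  distr L (\<Pi>\<^sub>M i\<in>UNIV. borel) (noise z) = distr Q (\<Pi>\<^sub>M i\<in>UNIV. borel) (\<lambda>om i. w (fst i) (pt T (fst (snd i)) (snd (snd i))) om) \<and>
  (\<forall>C\<in>sets (\<Pi>\<^sub>M t\<in>{0..T}. borel). emeasure P C = (\<integral>\<^sup>+x. indicator C (restrict (dec T x) {0..T}) * ennreal (1 / r x) \<partial>L))"

text \<open>After the change of measure which removes \<open>B\<close>, the noise of the code is a Brownian motion,
 whose law is known; the density of the inverse change of measure is a function of the code.\<close>

lemma solution_code:
 fixes M :: "'w measure"
 assumes sol: "solution T D A V B z M F W Y" and \<beta>: "\<And>n k. \<beta> n k \<in> borel_measurable borel"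
  and gir: "girsanov T M F (\<lambda>k t. W t (e k)) Nf dm (\<lambda>n k s om. \<beta> n k (adapted_process.Yg T Y (Nf n) s om)) (\<lambda>k s om. (- B (Y (clip T s) om)) \<bullet> e k) ((R + 2)\<^sup>2) R"
  and ad: "adapted_process T M F (\<lambda>k t. W t (e k)) Y"
 shows "\<exists>(Q :: 'w measure) w L. coded z (rho_of_code z Nf dm \<beta>) (path_law T M Y) Q w L"
proof -
 interpret Y: adapted_process T M F "\<lambda>k t. W t (e k)" Y by fact
 interpret g: girsanov T M F "\<lambda>k t. W t (e k)" Nf dm "\<lambda>n k s om. \<beta> n k (Y.Yg (Nf n) s om)" "\<lambda>k s om. (- B (Y (clip T s) om)) \<bullet> e k" "(R + 2)\<^sup>2" R by fact
 obtain \<rho> where \<rho>: "\<rho> \<in> borel_measurable M" "\<And>om. 0 < \<rho> om" "AE om in M. (\<lambda>n. exp (g.L n om)) \<longlonglongrightarrow> \<rho> om"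
  using g.density_exists by blast
 note [measurable] = \<rho>(1) rho_of_code_measurable[OF \<beta>]
 define Q where "Q = density M (\<lambda>om. ennreal (\<rho> om))"
 define w where "w k t om = W t (e k) om - (LINT s:{0..t}|lborel. (- B (Y (clip T s) om)) \<bullet> e k)" for k t om
 have bmQ: "bm_system T Q F w" unfolding Q_def w_def[abs_def] by (rule g.girsanov[OF \<rho>])
 interpret q: bm T Q F w using T bmQ by unfold_locales
 have AEQ: "(AE om in Q. P om) \<longleftrightarrow> (AE om in M. P om)" for P unfolding Q_def by (rule g.AE_density_iff[OF \<rho>])
 have sQ[measurable_cong]: "sets Q = sets M" by (simp add: Q_def)
 define cd where "cd om = code T (\<lambda>t. Y t om)" for om
 have cdm[measurable]: "cd \<in> borel_measurable M"
 proof (rule measurable_coordinatewise_then_product)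
  show "(\<lambda>om. cd om i) \<in> borel_measurable M" for i
   using Y.YM[OF pt_in[OF T]] by (cases i) (simp add: cd_def code_def)
 qed
 have paths: "continuous_on {0..T} (\<lambda>t. Y t om)" if "om \<in> space M" for om using Y.Yc[OF that] .
 have dcd: "dec T (cd om) s = Y (clip T s) om" if "om \<in> space M" for om s
  unfolding cd_def by (rule code_unif(2)[OF T paths[OF that]])
 have eD': "e k \<in> D" for k by (rule eD)
 have "AE om in M. \<forall>k. (\<integral>\<^sup>+s\<in>{0..T}. ennreal \<bar>gradV V (Y s om) \<bullet> e k\<bar> \<partial>lborel) < \<infinity>"
  unfolding AE_all_countable using sol eD by (simp add: solution_def)
 moreover have "AE om in M. \<forall>k n j. Y (pt T n j) om \<bullet> e k = z \<bullet> e k + (LINT s:{0..pt T n j}|lborel. Y s om \<bullet> A (e k) + (B (Y s om) - gradV V (Y s om)) \<bullet> e k) + W (pt T n j) (e k) om"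
  unfolding AE_all_countable using sol eD pt_in[OF T] by (simp add: solution_def)
 moreover have "AE om in M. AE s in lborel. s \<in> {0..T} \<longrightarrow> Y s om \<in> diff_dom V"
  using sol Y.AE_paths_iff[OF dom] by (simp add: solution_def)
 ultimately have main: "AE om in M. cd om \<in> good \<and> (\<forall>k n j. noise z (cd om) (k, n, j) = w k (pt T n j) om)"
  using AE_space
 proof eventually_elim
  case (elim om)
  let ?y = "\<lambda>s. Y (clip T s) om"
  note c = paths[OF elim(4)]
  note [measurable] = Y.path_borel[OF elim(4)]
  have "(\<integral>\<^sup>+s. indicator (- diff_dom V) (?y s) * indicator {0..T} s \<partial>lborel) = 0"
  proof (subst nn_integral_0_iff_AE)
   show "AE s in lborel. indicator (- diff_dom V) (?y s) * indicator {0..T} s = (0::ennreal)"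
    using elim(3) by eventually_elim (auto simp: clip_id split: split_indicator)
  qed measurable
  moreover have "(\<integral>\<^sup>+s\<in>{0..T}. ennreal \<bar>gradV V (?y s) \<bullet> e k\<bar> \<partial>lborel) = (\<integral>\<^sup>+s\<in>{0..T}. ennreal \<bar>gradV V (Y s om) \<bullet> e k\<bar> \<partial>lborel)" for k
   by (intro nn_integral_cong) (auto simp: clip_id split: split_indicator)
  moreover have "cd om \<in> unif T" unfolding cd_def by (rule code_unif(1)[OF T c])
  ultimately have "cd om \<in> good" using elim(1) by (simp add: good_def dcd[OF elim(4)])
  moreover have "noise z (cd om) (k, n, j) = w k (pt T n j) om" for k n j
  proof -
   have "cd om (n, j) = Y (pt T n j) om" by (simp add: cd_def code_def)
   moreover have "(LINT s:{0..pt T n j}|lborel. (- B (?y s)) \<bullet> e k) = - (LINT s:{0..pt T n j}|lborel. B (?y s) \<bullet> e k)"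
    by (simp add: set_lebesgue_integral_def)
   ultimately show ?thesis
    using elim(2) drift_split[OF c elim(3) elim(1)[rule_format] pt_in[OF T], of n j k] unfolding noise_def w_def by (simp add: dcd[OF elim(4)])
  qed
  ultimately show ?case by blast
 qed
 have rho: "AE om in M. \<rho> om = rho_of_code z Nf dm \<beta> (cd om)"
  using main \<rho>(3) AE_space
 proof eventually_elim
  case (elim om)
  \<comment> \<open>The original driving motion is also determined by the code: it is the noise of
    the equation without B minus the integral of B. Hence each step density, and with it the limit,
    is a function of the code.\<close>
  have Wn: "W (pt T n j) (e k) om = noiseB z (cd om) k n j" for k n j
   using elim(1) by (simp add: noiseB_def w_def dcd[OF elim(3)] set_lebesgue_integral_def)
  have pg: "gp T n j = pt T n j" if "j \<le> 2 ^ n" for n j using that by (simp add: pt_def)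
  have "g.L n om = (\<Sum>j<2^Nf n. \<Sum>k<dm n. \<beta> n k (cd om (Nf n, j)) * (noiseB z (cd om) k (Nf n) (Suc j) - noiseB z (cd om) k (Nf n) j))
   - (\<Sum>j<2^Nf n. (\<Sum>k<dm n. \<beta> n k (cd om (Nf n, j)) * \<beta> n k (cd om (Nf n, j))) * (T / 2 ^ Nf n)) / 2" for n
  proof -
   have "Y.Yg (Nf n) (gp T (Nf n) j) om = cd om (Nf n, j)" if "j < 2 ^ Nf n" for j
    using Y.Yg_gp[OF that] that by (simp add: cd_def code_def pg)
   then show ?thesis unfolding g.L_def Y.LR_def Y.SI_def Y.SQ_def Wn[symmetric]
    by (intro arg_cong2[where f="(-)"] arg_cong2[where f="(/)"] sum.cong refl) (simp_all add: pg)
  qed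
  then show ?case using elim(2) unfolding rho_of_code_def by (simp add: limI)
 qed
 define L where "L = distr Q borel cd"
 have mQ[measurable]: "cd \<in> borel_measurable Q" by measurable
 have wm: "(\<lambda>om i. w (fst i) (pt T (fst (snd i)) (snd (snd i))) om) \<in> measurable Q (\<Pi>\<^sub>M i\<in>UNIV. borel)"
  using q.wM[OF pt_in[OF T]] by (intro measurable_PiM_single') auto
 have nP: "noise z \<in> measurable borel (\<Pi>\<^sub>M i\<in>UNIV. borel)"
  using noise_measurable measurable_cong_sets[OF refl sets_PiM_equal_borel] by blast
 have "prob_space L" unfolding L_def by (rule q.prob_space_distr[OF mQ])
 moreover have "sets L = sets borel" by (simp add: L_def)
 moreover have "AE x in L. x \<in> good" unfolding L_def
  by (subst AE_distr_iff[OF mQ]) (use main in \<open>auto simp: AEQ elim: AE_mp\<close>)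
 moreover have "distr L (\<Pi>\<^sub>M i\<in>UNIV. borel) (noise z) = distr Q (\<Pi>\<^sub>M i\<in>UNIV. borel) (\<lambda>om i. w (fst i) (pt T (fst (snd i)) (snd (snd i))) om)"
 proof -
  have "distr L (\<Pi>\<^sub>M i\<in>UNIV. borel) (noise z) = distr Q (\<Pi>\<^sub>M i\<in>UNIV. borel) (noise z \<circ> cd)"
   unfolding L_def by (rule distr_distr[OF nP mQ])
  also have "... = distr Q (\<Pi>\<^sub>M i\<in>UNIV. borel) (\<lambda>om i. w (fst i) (pt T (fst (snd i)) (snd (snd i))) om)"
  proof (rule distr_cong_AE[OF refl refl _ measurable_comp[OF mQ nP] wm])
   show "AE om in Q. (noise z \<circ> cd) om = (\<lambda>i. w (fst i) (pt T (fst (snd i)) (snd (snd i))) om)"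
    unfolding AEQ using main by eventually_elim (auto simp: fun_eq_iff)
  qed
  finally show ?thesis .
 qed
 moreover have "emeasure (path_law T M Y) C = (\<integral>\<^sup>+x. indicator C (restrict (dec T x) {0..T}) * ennreal (1 / rho_of_code z Nf dm \<beta> x) \<partial>L)"
  if C[measurable]: "C \<in> sets (\<Pi>\<^sub>M t\<in>{0..T}. borel)" for C
 proof -
  have rm[measurable]: "(\<lambda>om. restrict (\<lambda>t. Y t om) {0..T}) \<in> measurable M (\<Pi>\<^sub>M t\<in>{0..T}. borel)"
   using Y.YM by (intro measurable_restrict) auto
  have dm'[measurable]: "(\<lambda>x. restrict (dec T x) {0..T}) \<in> measurable borel (\<Pi>\<^sub>M t\<in>{0..T}. (borel :: 'a measure))"
   by (intro measurable_restrict) measurable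
  let ?H = "\<lambda>x. indicator C (restrict (dec T x) {0..T}) * ennreal (1 / rho_of_code z Nf dm \<beta> x)"
  have "(\<integral>\<^sup>+x. ?H x \<partial>L) = (\<integral>\<^sup>+om. ?H (cd om) \<partial>Q)" unfolding L_def by (intro nn_integral_distr mQ) measurable
  also have "... = (\<integral>\<^sup>+om. ennreal (\<rho> om) * ?H (cd om) \<partial>M)" unfolding Q_def by (intro nn_integral_density) measurable
  also have "... = (\<integral>\<^sup>+om. indicator C (restrict (\<lambda>t. Y t om) {0..T}) \<partial>M)"
  proof (rule nn_integral_cong_AE)
   show "AE om in M. ennreal (\<rho> om) * ?H (cd om) = indicator C (restrict (\<lambda>t. Y t om) {0..T})"
    using rho AE_space
   proof eventually_elim
    case (elim om)
    have a: "restrict (dec T (cd om)) {0..T} = restrict (\<lambda>t. Y t om) {0..T}" by (auto simp: dcd[OF elim(2)] clip_id)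
    have b: "ennreal (\<rho> om) * ennreal (1 / \<rho> om) = 1" using \<rho>(2)[of om] by (simp add: ennreal_mult[symmetric] del: ennreal_mult')
    show ?case unfolding elim(1)[symmetric] by (simp only: a b mult.left_commute[of "ennreal (\<rho> om)"] mult_1_right)
   qed
  qed
  also have "... = (\<integral>\<^sup>+x. indicator C x \<partial>path_law T M Y)" unfolding path_law_def by (subst nn_integral_distr) auto
  finally show ?thesis by (simp add: path_law_def)
 qed
 ultimately show ?thesis using q.bm_axioms unfolding coded_def by blast
qed

lemma adapted_of_solution:
 assumes sol: "solution T D A V B z M F W Y"
 shows "adapted_process T M F (\<lambda>k t. W t (e k)) Y"
proof (unfold_locales, rule T)
 show "bm_system T M F (\<lambda>k t. W t (e k))"
  by (rule bm_system_of_cylindrical[OF _ _ _ e]) (use sol in \<open>auto simp: solution_def normal_filtration_def\<close>)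
qed (use sol in \<open>auto simp: solution_def\<close>)

theorem weak_uniqueness:
 fixes M1 :: "'p measure" and M2 :: "'q measure"
 assumes sol1: "solution T D A V B z M1 F1 W1 Y1" and sol2: "solution T D A V B z M2 F2 W2 Y2"
 shows "path_law T M1 Y1 = path_law T M2 Y2"
proof -
 note ad1 = adapted_of_solution[OF sol1] and ad2 = adapted_of_solution[OF sol2]
 have mB: "(\<lambda>x. - B x) \<in> borel_measurable borel" "\<And>x. norm (- B x) \<le> R" using BR by auto
 obtain Nf dm \<beta> where \<beta>: "\<And>n k. \<beta> n k \<in> borel_measurable borel"
  and g1: "girsanov T M1 F1 (\<lambda>k t. W1 t (e k)) Nf dm (\<lambda>n k s om. \<beta> n k (adapted_process.Yg T Y1 (Nf n) s om)) (\<lambda>k s om. (- B (Y1 (clip T s) om)) \<bullet> e k) ((R + 2)\<^sup>2) R"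
  and g2: "girsanov T M2 F2 (\<lambda>k t. W2 t (e k)) Nf dm (\<lambda>n k s om. \<beta> n k (adapted_process.Yg T Y2 (Nf n) s om)) (\<lambda>k s om. (- B (Y2 (clip T s) om)) \<bullet> e k) ((R + 2)\<^sup>2) R"
  using girsanov_pair[OF ad1 ad2 mB e] by blast
 obtain Q1 :: "'p measure" and w1 L1 and Q2 :: "'q measure" and w2 L2 where "coded z (rho_of_code z Nf dm \<beta>) (path_law T M1 Y1) Q1 w1 L1" "coded z (rho_of_code z Nf dm \<beta>) (path_law T M2 Y2) Q2 w2 L2"
  using solution_code[OF sol1 \<beta> g1 ad1] solution_code[OF sol2 \<beta> g2 ad2] by blast
 note 1 = this(1)[unfolded coded_def] and 2 = this(2)[unfolded coded_def]
 obtain F1' F2' where bm: "bm T Q1 F1' w1" "bm T Q2 F2' w2" using 1 2 by blast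
 have "distr L1 (\<Pi>\<^sub>M i\<in>UNIV. borel) (noise z) = distr L2 (\<Pi>\<^sub>M i\<in>UNIV. borel) (noise z)"
  using 1 2 bm_system_grid_law[OF bm, of "\<lambda>i. min (snd (snd i)) (2 ^ fst (snd i))" "\<lambda>i. fst (snd i)" fst] by (simp add: pt_def)
 \<comment> \<open>The Borel sets of a countable product of lines are those of the product
   \<sigma>-algebra, so the two readings of the noise law agree.\<close>
 moreover have "distr L borel (noise z) = distr L (\<Pi>\<^sub>M i\<in>UNIV. borel) (noise z)" for L
  by (rule distr_cong) (simp_all add: sets_PiM_equal_borel)
 ultimately have "L1 = L2"
  using 1 2 by (intro prob_eqI_of_injective_image[OF _ _ _ _ noise_measurable[of z] good_measurable noise_inj]) simp_all
 then have "emeasure (path_law T M1 Y1) C = emeasure (path_law T M2 Y2) C" if "C \<in> sets (\<Pi>\<^sub>M t\<in>{0..T}. borel)" for C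
  using 1 2 that by simp
 then show ?thesis by (intro measure_eqI) (simp_all add: path_law_def)
qed

end

text \<open>The process given under \<open>P z\<close> is turned into a solution with drift B by an
  equivalent measure. Its paths stay the same, so the exit times from the compact sets and the
  finiteness of the energy are inherited.\<close>

theorem theorem2p12:
  fixes D :: "'a::{real_inner, polish_space} set" and A B :: "'a \<Rightarrow> 'a" and V :: "'a \<Rightarrow> ereal"
    and e :: "nat \<Rightarrow> 'a" and \<gamma> \<nu> :: "'a measure" and \<omega>\<^sub>0 T :: real
    and j :: "'e::{banach, second_countable_topology} \<Rightarrow> 'a"
    and K :: "nat \<Rightarrow> 'a set" and S :: "'a set"
    and N :: "'w measure" and \<F> :: "real \<Rightarrow> 'w measure" and X :: "real \<Rightarrow> 'w \<Rightarrow> 'a"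
    and P :: "'a \<Rightarrow> 'w measure"
  assumes "self_adjoint_on D A"
    and "\<omega>\<^sub>0 > 0" and "\<And>x. x \<in> D \<Longrightarrow> A x \<bullet> x \<le> - \<omega>\<^sub>0 * (norm x)\<^sup>2"
    and "trace_class (inv_into D A)"
    and "eigenbasis D A e"
    and "centered_gaussian (covariance_op D A) \<gamma>"
    and "convex_potential V"
    and "\<nu> = gibbs \<gamma> V"
    and "potential_integrable \<gamma> V"
    and "T > 0"
    and "D2V_integrable e \<nu> V \<or> E_regular TYPE('v) j T D A \<gamma> V"
    and "B \<in> borel_measurable borel" and "bounded (range B)"
    and "compact_nest e \<nu> V K"
    and "associated_process D A e \<nu> V K S N \<F> X P"
    and "z \<in> S"
  shows "(\<exists>(M :: 'w measure) F W Y.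
            solution T D A V B z M F W Y \<and>
            (AE \<omega> in M. (\<lambda>n. hitting_time {0..T} (- K n) (\<lambda>t. Y t \<omega>)) \<longlonglongrightarrow> \<infinity>) \<and>
            (z \<in> HV V S X P T \<longrightarrow>
              (AE \<omega> in M. (\<integral>\<^sup>+s\<in>{0..T}. ennreal ((norm (gradV V (Y s \<omega>)))\<^sup>2) \<partial>lborel) < \<infinity>))) \<and>
         (\<forall>(M\<^sub>1 :: 'p measure) F\<^sub>1 W\<^sub>1 Y\<^sub>1 (M\<^sub>2 :: 'q measure) F\<^sub>2 W\<^sub>2 Y\<^sub>2.
            solution T D A V B z M\<^sub>1 F\<^sub>1 W\<^sub>1 Y\<^sub>1 \<longrightarrow>
            solution T D A V B z M\<^sub>2 F\<^sub>2 W\<^sub>2 Y\<^sub>2 \<longrightarrow>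
            path_law T M\<^sub>1 Y\<^sub>1 = path_law T M\<^sub>2 Y\<^sub>2)"
proof -
 note asm = assms
 have e: "orthonormal_basis e" by (rule eigenbasis_orthonormal[OF asm(5)])
 have eD: "e k \<in> D" for k using asm(5) by (simp add: eigenbasis_def)
 obtain l where l: "\<And>k. l k \<le> - \<omega>\<^sub>0" "\<And>k. A (e k) = l k *\<^sub>R e k" "\<And>h k. h \<in> D \<Longrightarrow> A h \<bullet> e k = l k * (h \<bullet> e k)"
  using self_adjoint_eigen[OF asm(1,5,3)] by blast
 have l0: "l k \<le> 0" for k using l(1)[of k] asm(2) by linarith
 have d1: "emeasure \<gamma> (diff_dom V) = 1" using asm(9) by (simp add: potential_integrable_def)
 then have ne: "diff_dom V \<noteq> {}" by auto
 \<comment> \<open>A set outside the \<sigma>-algebra has \<open>emeasure\<close> 0 by convention,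
   so measure 1 entails measurability.\<close>
 have "diff_dom V \<in> sets \<gamma>" using d1 emeasure_notin_sets[of "diff_dom V" \<gamma>] by fastforce
 then have dom: "diff_dom V \<in> sets borel" using asm(6) by (simp add: centered_gaussian_def)
 obtain R where R: "\<And>x. norm (B x) \<le> R" using asm(13) by (auto simp: bounded_iff)
 interpret convex_sde D A B V e l T R
  by unfold_locales (use asm(7,10,12) e eD l l0 dom ne R in auto)
 have ap: "markov_process S N \<F> X P" "\<And>t. 0 \<le> t \<Longrightarrow> (\<integral>\<^sup>+om. (\<integral>\<^sup>+s\<in>{0..t}. indicator (- diff_dom V) (X s om) \<partial>lborel) \<partial>P z) = 0"
  "solves_componentwise A e V \<F> X (P z) z"
  "\<And>h t. h \<in> D \<Longrightarrow> 0 \<le> t \<Longrightarrow> AE om in P z. (\<integral>\<^sup>+s\<in>{0..t}. ennreal \<bar>gradV V (X s om) \<bullet> h\<bar> \<partial>lborel) < \<infinity>"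
  "AE om in P z. (\<lambda>n. hitting_time {0..} (- K n) (\<lambda>t. X t om)) \<longlonglongrightarrow> \<infinity>"
  using asm(15,16) by (simp_all add: associated_process_def)
 have Pz: "prob_space (P z)" "sets (P z) = sets N" "AE om in P z. X 0 om = z"
  using ap(1) asm(16) by (simp_all add: markov_process_def)
 have spz: "space (P z) = space N" by (rule sets_eq_imp_space_eq[OF Pz(2)])
 have filt: "filtration_on {0..} (P z) \<F>" 
  using ap(1) Pz(2) spz by (simp add: markov_process_def filtration_on_def subalgebra_def)
 have XF: "X t \<in> borel_measurable (\<F> t)" if "0 \<le> t" for t using ap(1) that by (simp add: markov_process_def)
 have Xc: "continuous_on {0..T} (\<lambda>t. X t om)" if "om \<in> space (P z)" for om
 proof (rule continuous_on_subset)
  show "continuous_on {0..} (\<lambda>t. X t om)" using ap(1) that spz by (simp add: markov_process_def)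
 qed auto
 obtain W where W: "\<And>k. brownian_motion {0..} (P z) \<F> (W k)"
   "prob_space.indep_vars (P z) (\<lambda>_. \<Pi>\<^sub>M t\<in>{0..}. borel) (\<lambda>k om. restrict (\<lambda>t. W k t om) {0..}) UNIV"
   "AE om in P z. \<forall>t\<ge>0. \<forall>k. set_integrable lborel {0..t} (\<lambda>s. A (e k) \<bullet> X s om - e k \<bullet> gradV V (X s om)) \<and>
      e k \<bullet> X t om = e k \<bullet> z + (LINT s:{0..t}|lborel. A (e k) \<bullet> X s om - e k \<bullet> gradV V (X s om)) + W k t om"
  using ap(3) unfolding solves_componentwise_def by blast
 interpret prob_space "P z" by (rule Pz(1))
 interpret indep_bms "P z" \<F> W T by unfold_locales (rule filt W)+
 have bm: "bm_system T (P z) \<F> W" by (rule bm_system_of_indep)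
 interpret X: adapted_process T "P z" \<F> W X using T bm XF Xc by unfold_locales auto
 have eq: "AE om in P z. \<forall>t\<in>{0..T}. \<forall>k. X t om \<bullet> e k = z \<bullet> e k + (LINT s:{0..t}|lborel. l k * (X s om \<bullet> e k) - gradV V (X s om) \<bullet> e k) + W k t om"
  using W(3) by eventually_elim (auto simp: Ae inner_commute[of "e _"])
 obtain \<rho> F' W' where \<rho>: "\<rho> \<in> borel_measurable (P z)" "\<And>om. 0 < \<rho> om"
  and sol: "solution T D A V B z (density (P z) (\<lambda>om. ennreal (\<rho> om))) F' W' X"
  using weak_existence[OF bm _ Xc Pz(3) X.AE_paths_of_nn_integral[OF dom ap(2)] ap(4) eq] XF T by fastforce
 have AEQ: "(AE om in density (P z) (\<lambda>om. ennreal (\<rho> om)). Q om) \<longleftrightarrow> (AE om in P z. Q om)" for Q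
  using \<rho> by (simp add: AE_density)
 \<comment> \<open>On the shorter time set the infimum runs over fewer times, so the hitting times
   can only increase.\<close>
 have hit: "AE om in P z. (\<lambda>n. hitting_time {0..T} (- K n) (\<lambda>t. X t om)) \<longlonglongrightarrow> \<infinity>"
  using ap(5)
 proof eventually_elim
  case (elim om)
  show ?case unfolding tendsto_PInfty
  proof
   fix r
   have "\<forall>\<^sub>F n in sequentially. ereal r < hitting_time {0..} (- K n) (\<lambda>t. X t om)" using elim unfolding tendsto_PInfty by blast
   then show "\<forall>\<^sub>F n in sequentially. ereal r < hitting_time {0..T} (- K n) (\<lambda>t. X t om)"
    by eventually_elim (rule less_le_trans[OF _ hitting_time_mono_time])
  qed
 qed
 have en: "AE om in P z. (\<integral>\<^sup>+s\<in>{0..T}. ennreal ((norm (gradV V (X s om)))\<^sup>2) \<partial>lborel) < \<infinity>" if "z \<in> HV V S X P T"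
 proof -
  have "(\<integral>\<^sup>+om. (\<integral>\<^sup>+s\<in>{0..T}. ennreal ((norm (gradV V (X s om)))\<^sup>2) \<partial>lborel) \<partial>P z) < \<infinity>" using that by (simp add: HV_def energy_def)
  then have fin: "(\<integral>\<^sup>+om. (\<integral>\<^sup>+s\<in>{0..T}. ennreal ((norm (gradV V (X s om)))\<^sup>2) \<partial>lborel) \<partial>P z) \<noteq> \<infinity>" by simp
  have "(\<lambda>om. \<integral>\<^sup>+s\<in>{0..T}. ennreal ((norm (gradV V (X s om)))\<^sup>2) \<partial>lborel) \<in> borel_measurable (P z)"
   by (rule X.nn_integral_path_measurable[where f="\<lambda>x. ennreal ((norm (gradV V x))\<^sup>2)"]) measurable
  from nn_integral_noteq_infinite[OF this fin] show ?thesis by (simp add: less_top)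
 qed
 show ?thesis
  using sol hit en weak_uniqueness unfolding AEQ[symmetric] by blast
qed

end
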